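(* Let $\Gamma$ be a finite group and $p$ a prime with $p\nmid|\Gamma|$. Let $V_1,\dots,V_c$ be the non-trivial irreducible representations of $\Gamma$ over $\mathbb{F}_p$ (one from each isomorphism class). Let $\kappa_i=\operatorname{End}_\Gamma(V_i)$, $q_i=|\kappa_i|$ and $n_i=\dim_{\kappa_i}V_i$. Let $\epsilon_i=-1$ if $(\wedge^2_{\kappa_i}V_i)^\Gamma\neq 0$; let $\epsilon_i=1$ if $(\wedge^2_{\kappa_i}V_i)^\Gamma=0$ but $(V_i\otimes_{\kappa_i}V_i)^\Gamma\neq 0$; and let $\epsilon_i=0$ if $(V_i\otimes_{\kappa_i}V_i)^\Gamma=0$. Let $u$ be a positive integer. Let $R_\Gamma$ be the set of isomorphism classes of finite dimensional representations $V$ of $\Gamma$ over $\mathbb{F}_p$ with $V^\Gamma=0$, with the discrete topology and $\sigma$-algebra. Then there is a unique measure $\nu$ on $R_\Gamma$ such that $$\int_{X\in R_\Gamma}|\operatorname{Sur}(X,V)|\,d\nu=\frac{|(\wedge^2_{\mathbb{F}_p}V)^\Gamma|}{|V|^u}$$ for every $V\in R_\Gamma$. Moreover, for all non-negative integers $f_1,\dots,f_c$, writing $V=\prod_iV_i^{f_i}$, we have $$\nu(\{V\})=\frac{|(\wedge^2_{\mathbb{F}_p}V)^\Gamma|}{|V|^u|\operatorname{Aut}(V)|}\prod_{\substack{i\\ V_i\text{ self-dual}}}\ \prod_{\ell\ge 0}\bigl(1+q_i^{-un_i-\frac{\epsilon_i+1}{2}-\ell}\bigr)^{-1}\prod_{\substack{i<j\\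 V_i,V_j\text{ dual}}}\frac{\prod_{\ell=1}^\infty(1-q_i^{-\ell})\prod_{\ell=1}^{2un_i}(1-q_i^{-\ell})}{\prod_{\ell=1}^{un_i-f_i+f_j}(1-q_i^{-\ell})\prod_{\ell=1}^{un_i+f_i-f_j}(1-q_i^{-\ell})}$$ if $|f_i-f_j|\le un_i$ for all pairs of dual representations $V_i,V_j$, and $\nu(\{V\})=0$ otherwise.
   Context: $\operatorname{Sur}(X,V)$ is the set of surjective $\Gamma$-equivariant $\mathbb{F}_p$-linear maps $X\to V$, and $\operatorname{Aut}(V)$ is the group of automorphisms of $V$ as a representation of $\Gamma$. For a commutative ring $A$ and $A$-module $M$, $\wedge^2_AM$ is the quotient of $M\otimes_AM$ by the elements $m\otimes m$; $\Gamma$ acts diagonally on tensor and exterior squares, and superscript $\Gamma$ denotes $\Gamma$-invariants. $V_i$ is self-dual if it is isomorphic to its $\mathbb{F}_p$-dual representation; $V_i,V_j$ are dual if each is isomorphic to the $\mathbb{F}_p$-dual of the other. Empty products equal $1$. *)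

theory Defs
  imports
    "HOL-Analysis.Analysis"
    "HOL-Algebra.Algebra"
    "HOL-Number_Theory.Residues"
    "Jordan_Normal_Form.Missing_VectorSpace"
begin

section \<open>Representations of a group over a commutative ring\<close>

text \<open>A representation is an HOL-Algebra module record together with an action. The fields
  \<open>mult\<close> and \<open>one\<close>, which module records inherit from rings, play no role and are left
  unspecified in the constructions below.\<close>

record ('a, 'b, 'g) rep = "('a, 'b) module" +
  act :: "'g \<Rightarrow> 'b \<Rightarrow> 'b"

abbreviation Fp :: "nat \<Rightarrow> int ring" where
  "Fp p \<equiv> residue_ring (int p)"

definition representation ::
    "('g, 'z) monoid_scheme \<Rightarrow> ('a, 'y) ring_scheme \<Rightarrow> ('a, 'b, 'g) rep \<Rightarrow> bool" where
  "representation G R V \<longleftrightarrow>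
     Module.module R V \<and> group_action G (carrier V) (act V) \<and>
     (\<forall>g\<in>carrier G. act V g \<in> module_hom R V V)"

text \<open>Homomorphisms are taken to be extensional, so that sets of them may be counted.\<close>

definition rep_hom ::
    "('g, 'z) monoid_scheme \<Rightarrow> ('a, 'y) ring_scheme \<Rightarrow> ('a, 'b, 'g) rep \<Rightarrow> ('a, 'c, 'g) rep
      \<Rightarrow> ('b \<Rightarrow> 'c) set" where
  "rep_hom G R V W =
     {f \<in> module_hom R V W \<inter> extensional (carrier V).
        \<forall>g\<in>carrier G. \<forall>v\<in>carrier V. f (act V g v) = act W g (f v)}"

definition rep_Sur ::
    "('g, 'z) monoid_scheme \<Rightarrow> ('a, 'y) ring_scheme \<Rightarrow> ('a, 'b, 'g) rep \<Rightarrow> ('a, 'c, 'g) rep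
      \<Rightarrow> ('b \<Rightarrow> 'c) set" where
  "rep_Sur G R V W = {f \<in> rep_hom G R V W. f ` carrier V = carrier W}"

definition rep_Aut ::
    "('g, 'z) monoid_scheme \<Rightarrow> ('a, 'y) ring_scheme \<Rightarrow> ('a, 'b, 'g) rep \<Rightarrow> ('b \<Rightarrow> 'b) set" where
  "rep_Aut G R V = {f \<in> rep_hom G R V V. bij_betw f (carrier V) (carrier V)}"

definition rep_iso ::
    "('g, 'z) monoid_scheme \<Rightarrow> ('a, 'y) ring_scheme \<Rightarrow> ('a, 'b, 'g) rep \<Rightarrow> ('a, 'c, 'g) rep
      \<Rightarrow> bool" where
  "rep_iso G R V W \<longleftrightarrow> (\<exists>f\<in>rep_hom G R V W. bij_betw f (carrier V) (carrier W))"

definition rep_invariants :: "('g, 'z) monoid_scheme \<Rightarrow> ('a, 'b, 'g) rep \<Rightarrow> 'b set" where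
  "rep_invariants G V = {v \<in> carrier V. \<forall>g\<in>carrier G. act V g v = v}"

definition irreducible_rep ::
    "('g, 'z) monoid_scheme \<Rightarrow> ('a, 'y) ring_scheme \<Rightarrow> ('a, 'b, 'g) rep \<Rightarrow> bool" where
  "irreducible_rep G R V \<longleftrightarrow>
     representation G R V \<and> carrier V \<noteq> {\<zero>\<^bsub>V\<^esub>} \<and>
     (\<forall>N. Module.submodule N R V \<and> (\<forall>g\<in>carrier G. act V g ` N \<subseteq> N) \<longrightarrow>
          N = {\<zero>\<^bsub>V\<^esub>} \<or> N = carrier V)"

definition trivial_action :: "('g, 'z) monoid_scheme \<Rightarrow> ('a, 'b, 'g) rep \<Rightarrow> bool" where
  "trivial_action G V \<longleftrightarrow> (\<forall>g\<in>carrier G. \<forall>v\<in>carrier V. act V g v = v)"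

definition rep_prod :: "'i set \<Rightarrow> ('i \<Rightarrow> ('a, 'b, 'g) rep) \<Rightarrow> ('a, 'i \<Rightarrow> 'b, 'g) rep" where
  "rep_prod I V =
     \<lparr>carrier = (\<Pi>\<^sub>E i\<in>I. carrier (V i)), monoid.mult = undefined, monoid.one = undefined,
      ring.zero = (\<lambda>i\<in>I. \<zero>\<^bsub>V i\<^esub>),
      ring.add = (\<lambda>x y. \<lambda>i\<in>I. x i \<oplus>\<^bsub>V i\<^esub> y i),
      module.smult = (\<lambda>a x. \<lambda>i\<in>I. a \<odot>\<^bsub>V i\<^esub> x i),
      act = (\<lambda>g. \<lambda>x\<in>(\<Pi>\<^sub>E i\<in>I. carrier (V i)). \<lambda>i\<in>I. act (V i) g (x i))\<rparr>"

subsection \<open>Dual representations\<close>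

definition self_module :: "('a, 'y) ring_scheme \<Rightarrow> ('a, 'a) module" where
  "self_module R =
     \<lparr>carrier = carrier R, monoid.mult = monoid.mult R, monoid.one = \<one>\<^bsub>R\<^esub>,
      ring.zero = \<zero>\<^bsub>R\<^esub>,
      ring.add = ring.add R,
      module.smult = monoid.mult R\<rparr>"

definition rep_dual ::
    "('g, 'z) monoid_scheme \<Rightarrow> ('a, 'y) ring_scheme \<Rightarrow> ('a, 'b, 'g) rep
      \<Rightarrow> ('a, 'b \<Rightarrow> 'a, 'g) rep" where
  "rep_dual G R V =
     (let D = module_hom R V (self_module R) \<inter> extensional (carrier V) in
     \<lparr>carrier = D, monoid.mult = undefined, monoid.one = undefined,
      ring.zero = (\<lambda>v\<in>carrier V. \<zero>\<^bsub>R\<^esub>),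
      ring.add = (\<lambda>f h. \<lambda>v\<in>carrier V. f v \<oplus>\<^bsub>R\<^esub> h v),
      module.smult = (\<lambda>a f. \<lambda>v\<in>carrier V. a \<otimes>\<^bsub>R\<^esub> f v),
      act = (\<lambda>g. \<lambda>f\<in>D. \<lambda>v\<in>carrier V. f (act V (inv\<^bsub>G\<^esub> g) v))\<rparr>)"

definition self_dual ::
    "('g, 'z) monoid_scheme \<Rightarrow> ('a, 'y) ring_scheme \<Rightarrow> ('a, 'b, 'g) rep \<Rightarrow> bool" where
  "self_dual G R V \<longleftrightarrow> rep_iso G R V (rep_dual G R V)"

definition dual_pair ::
    "('g, 'z) monoid_scheme \<Rightarrow> ('a, 'y) ring_scheme \<Rightarrow> ('a, 'b, 'g) rep \<Rightarrow> ('a, 'c, 'g) rep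
      \<Rightarrow> bool" where
  "dual_pair G R V W \<longleftrightarrow> rep_iso G R V (rep_dual G R W) \<and> rep_iso G R W (rep_dual G R V)"

section \<open>The endomorphism ring of a representation\<close>

definition End_rep ::
    "('g, 'z) monoid_scheme \<Rightarrow> ('a, 'y) ring_scheme \<Rightarrow> ('a, 'b, 'g) rep \<Rightarrow> ('b \<Rightarrow> 'b) ring" where
  "End_rep G R V =
     \<lparr>carrier = rep_hom G R V V,
      monoid.mult = (\<lambda>f h. compose (carrier V) f h), monoid.one = (\<lambda>v\<in>carrier V. v),
      ring.zero = (\<lambda>v\<in>carrier V. \<zero>\<^bsub>V\<^esub>),
      ring.add = (\<lambda>f h. \<lambda>v\<in>carrier V. f v \<oplus>\<^bsub>V\<^esub> h v)\<rparr>"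

text \<open>The same abelian group with the same action, regarded as a module over its
  endomorphism ring.\<close>

definition rep_over_End :: "('a, 'b, 'g) rep \<Rightarrow> ('b \<Rightarrow> 'b, 'b, 'g) rep" where
  "rep_over_End V =
     \<lparr>carrier = carrier V, monoid.mult = undefined, monoid.one = undefined,
      ring.zero = \<zero>\<^bsub>V\<^esub>, ring.add = ring.add V,
      module.smult = (\<lambda>f v. f v), act = act V\<rparr>"

section \<open>Tensor and exterior squares\<close>

text \<open>The tensor square of an \<open>A\<close>-module is the free abelian group on pairs modulo the subgroup
  generated by the bilinearity and balancing relators. Scalars and group elements act on cosets:
  since the induced maps on the free abelian group preserve the relator subgroup \<open>N\<close>, the image
  of a coset \<open>C\<close> is contained in a single coset, namely \<open>N\<close> plus the image of \<open>C\<close>.\<close>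

definition tensor_relators :: "('a, 'y) ring_scheme \<Rightarrow> ('a, 'b, 'g) rep \<Rightarrow> ('b \<times> 'b \<Rightarrow>\<^sub>0 int) set" where
  "tensor_relators A M =
     {frag_of (x \<oplus>\<^bsub>M\<^esub> y, z) - frag_of (x, z) - frag_of (y, z) | x y z.
        x \<in> carrier M \<and> y \<in> carrier M \<and> z \<in> carrier M} \<union>
     {frag_of (x, y \<oplus>\<^bsub>M\<^esub> z) - frag_of (x, y) - frag_of (x, z) | x y z.
        x \<in> carrier M \<and> y \<in> carrier M \<and> z \<in> carrier M} \<union>
     {frag_of (a \<odot>\<^bsub>M\<^esub> x, y) - frag_of (x, a \<odot>\<^bsub>M\<^esub> y) | a x y.
        a \<in> carrier A \<and> x \<in> carrier M \<and> y \<in> carrier M}"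

abbreviation free_on_pairs :: "('a, 'b, 'g) rep \<Rightarrow> ('b \<times> 'b \<Rightarrow>\<^sub>0 int) monoid" where
  "free_on_pairs M \<equiv> free_Abelian_group (carrier M \<times> carrier M)"

definition tensor_kernel :: "('a, 'y) ring_scheme \<Rightarrow> ('a, 'b, 'g) rep \<Rightarrow> ('b \<times> 'b \<Rightarrow>\<^sub>0 int) set" where
  "tensor_kernel A M = generate (free_on_pairs M) (tensor_relators A M)"

definition tensor_map ::
    "('a, 'y) ring_scheme \<Rightarrow> ('a, 'b, 'g) rep \<Rightarrow> ('b \<Rightarrow> 'b) \<Rightarrow> ('b \<Rightarrow> 'b)
      \<Rightarrow> ('b \<times> 'b \<Rightarrow>\<^sub>0 int) set \<Rightarrow> ('b \<times> 'b \<Rightarrow>\<^sub>0 int) set" where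
  "tensor_map A M f h C =
     set_mult (free_on_pairs M) (tensor_kernel A M)
       (frag_extend (\<lambda>(x, y). frag_of (f x, h y)) ` C)"

definition tensor_square ::
    "('a, 'y) ring_scheme \<Rightarrow> ('a, 'b, 'g) rep \<Rightarrow> ('a, ('b \<times> 'b \<Rightarrow>\<^sub>0 int) set, 'g) rep" where
  "tensor_square A M =
     (let T = free_on_pairs M Mod tensor_kernel A M in
     \<lparr>carrier = carrier T, monoid.mult = undefined, monoid.one = undefined,
      ring.zero = \<one>\<^bsub>T\<^esub>,
      ring.add = monoid.mult T,
      module.smult = (\<lambda>a. tensor_map A M (\<lambda>x. a \<odot>\<^bsub>M\<^esub> x) (\<lambda>y. y)),
      act = (\<lambda>g. \<lambda>C\<in>carrier T. tensor_map A M (act M g) (act M g) C)\<rparr>)"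

definition pure_tensor ::
    "('a, 'y) ring_scheme \<Rightarrow> ('a, 'b, 'g) rep \<Rightarrow> 'b \<Rightarrow> 'b \<Rightarrow> ('b \<times> 'b \<Rightarrow>\<^sub>0 int) set" where
  "pure_tensor A M x y = r_coset (free_on_pairs M) (tensor_kernel A M) (frag_of (x, y))"

text \<open>Over a general commutative ring the squares \<open>x \<otimes> x\<close> generate a larger submodule than additive
  subgroup; it is the submodule that is factored out.\<close>

definition alternating_submodule ::
    "('a, 'y) ring_scheme \<Rightarrow> ('a, 'b, 'g) rep \<Rightarrow> ('b \<times> 'b \<Rightarrow>\<^sub>0 int) set set" where
  "alternating_submodule A M =
     \<Inter>{N. Module.submodule N A (tensor_square A M) \<and> (\<forall>x\<in>carrier M. pure_tensor A M x x \<in> N)}"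

definition exterior_square ::
    "('a, 'y) ring_scheme \<Rightarrow> ('a, 'b, 'g) rep \<Rightarrow> ('a, ('b \<times> 'b \<Rightarrow>\<^sub>0 int) set set, 'g) rep" where
  "exterior_square A M =
     (let T = tensor_square A M; N = alternating_submodule A M; E = T A_Mod N in
     \<lparr>carrier = carrier E, monoid.mult = undefined, monoid.one = undefined,
      ring.zero = \<one>\<^bsub>E\<^esub>,
      ring.add = monoid.mult E,
      module.smult = (\<lambda>a C. set_add T N ((\<lambda>t. a \<odot>\<^bsub>T\<^esub> t) ` C)),
      act = (\<lambda>g. \<lambda>C\<in>carrier E. set_add T N (act T g ` C))\<rparr>)"

text \<open>The sign is \<open>-1\<close>, \<open>1\<close>, \<open>0\<close> in the symplectic, symmetric and remaining case. Both squares
  are taken over the endomorphism ring; for irreducible \<open>V\<close> over a finite field this is a finite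
  division ring, hence a field.\<close>

definition rep_sign ::
    "('g, 'z) monoid_scheme \<Rightarrow> ('a, 'y) ring_scheme \<Rightarrow> ('a, 'b, 'g) rep \<Rightarrow> int" where
  "rep_sign G R V =
     (let \<kappa> = End_rep G R V; W = rep_over_End V;
          T = tensor_square \<kappa> W; E = exterior_square \<kappa> W in
      if rep_invariants G E \<noteq> {\<zero>\<^bsub>E\<^esub>} then - 1
      else if rep_invariants G T \<noteq> {\<zero>\<^bsub>T\<^esub>} then 1
      else 0)"

section \<open>Isomorphism classes and moments\<close>

text \<open>Finite-dimensional representations over \<open>Fp p\<close> have finite carriers, so up to isomorphism
  every one of them has a carrier consisting of natural numbers. An isomorphism class is
  represented by the set of its members on natural numbers; the representation that determines
  it may live on any type.\<close>

definition reps_no_invariants :: "('g, 'z) monoid_scheme \<Rightarrow> nat \<Rightarrow> (int, nat, 'g) rep set" where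
  "reps_no_invariants G p =
     {V. representation G (Fp p) V \<and> vectorspace.fin_dim (Fp p) V \<and> rep_invariants G V = {\<zero>\<^bsub>V\<^esub>}}"

definition iso_class ::
    "('g, 'z) monoid_scheme \<Rightarrow> nat \<Rightarrow> (int, 'b, 'g) rep \<Rightarrow> (int, nat, 'g) rep set" where
  "iso_class G p V = {U. representation G (Fp p) U \<and> rep_iso G (Fp p) U V}"

definition R_classes :: "('g, 'z) monoid_scheme \<Rightarrow> nat \<Rightarrow> (int, nat, 'g) rep set set" where
  "R_classes G p = iso_class G p ` reps_no_invariants G p"

text \<open>The number of surjections depends only on isomorphism classes, so it may be computed on
  any member of a class.\<close>

definition Sur_count ::
    "('g, 'z) monoid_scheme \<Rightarrow> nat \<Rightarrow> (int, nat, 'g) rep set \<Rightarrow> (int, 'b, 'g) rep \<Rightarrow> nat" where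
  "Sur_count G p cls V = card (rep_Sur G (Fp p) (SOME U. U \<in> cls) V)"

definition has_moments ::
    "('g, 'z) monoid_scheme \<Rightarrow> nat \<Rightarrow> nat \<Rightarrow> (int, nat, 'g) rep set measure \<Rightarrow> bool" where
  "has_moments G p u \<nu> \<longleftrightarrow>
     space \<nu> = R_classes G p \<and> sets \<nu> = Pow (R_classes G p) \<and>
     (\<forall>V\<in>reps_no_invariants G p.
        (\<integral>\<^sup>+ cls. of_nat (Sur_count G p cls V) \<partial>\<nu>) =
        ennreal (real (card (rep_invariants G (exterior_square (Fp p) V)))
                 / real (card (carrier V)) ^ u))"

end

theory Submission
 imports Defs "Jordan_Normal_Form.Char_Poly" "HOL-Computational_Algebra.Computational_Algebra"
begin

text \<open>Write \<open>W_f\<close> for the product of the \<open>V_i\<close> with multiplicities \<open>f_i\<close>. Since \<open>p\<close> does not divide the order of the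
group, representations over the prime field are semisimple (\<open>maschke\<close>), so the \<open>W_f\<close> represent all
isomorphism classes without invariants (\<open>classification\<close>), and by Schur's lemma the number of
surjections from \<open>W_e\<close> to \<open>W_f\<close> is the product over \<open>i\<close> and \<open>k < f_i\<close> of \<open>q_i^e_i - q_i^k\<close>
(\<open>card_sur_W\<close>). A measure is therefore a family of masses solving a linear system that is triangular
in \<open>f\<close>.

The right-hand sides factor. Averaging over the group identifies the size of the space of invariants
with that of the space of invariant functionals, so the invariants of the exterior square are counted
by invariant alternating forms (\<open>card_invariants_exterior_square\<close>). Forms pair \<open>V_i\<close> only with its dual
\<open>V_j\<close>, hence the count is a product over blocks, a block being a self-dual \<open>V_i\<close> or a pair of
distinct mutually dual ones (\<open>card_alt_W\<close>). A block of the second kind contributes \<open>q_i^(f_i f_j)\<close>, one of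
the first kind \<open>q_i^(f_i choose 2) a^f_i\<close>, where \<open>a\<close> is the number of alternating forms on \<open>V_i\<close>. That
\<open>a\<close> is \<open>q_i^((1 - \<epsilon>_i)/2)\<close> is \<open>card_alternating_sign\<close>: the endomorphism ring is a field
(\<open>wedderburn\<close>), every form is \<open>b(d x, y)\<close> for a fixed \<open>b\<close> and a unique endomorphism \<open>d\<close>, and taking adjoints is
an involution of the field. If it is trivial, all forms are balanced over the field, and either
all of them or only zero are alternating; if it is not, the alternating forms are
an eigenspace of the transposition and number \<open>sqrt q_i\<close>.

Existence. The proposed masses are products over blocks, and so are the numbers of surjections, so
the moments can be verified block by block. For a self-dual block this is Euler's product
expansion (\<open>single_block\<close>); for a dual pair it is the q-Vandermonde identity followed by its limiting
case (\<open>pair_block\<close>). All terms are nonnegative, so sums may be computed in any order.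

Uniqueness. The triangular system is inverted by q-analogues of binomial coefficients with alternating
signs. The inversion is legitimate for infinitely many unknowns because the inverse
coefficients are summable against the moments: Gaussian factors cancel and a geometric series
remains, which converges as \<open>u\<close> and the dimensions are positive (\<open>moments_unique\<close>).\<close>

section \<open>Wedderburn's theorem on finite division rings\<close>

lemma exists_prime_factor_with_root:
 fixes A :: "int poly" and z :: complex
 assumes "A \<noteq> 0" "poly (map_poly of_int A) z = 0"
 obtains P where "prime_elem P" "P dvd A" "poly (map_poly of_int P) z = 0"
proof -
 have "A = 0 \<or> poly (map_poly of_int A) z \<noteq> 0 \<or> (\<exists>P. prime_elem P \<and> P dvd A \<and> poly (map_poly of_int P) z = 0)"
 proof (induct A rule: prime_divisors_induct)
  case (unit x)
  then obtain y where "x * y = 1" by (metis dvdE)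
  hence "poly (map_poly of_int (x * y)) z = (1 :: complex)" by simp
  hence "poly (map_poly of_int x) z * poly (map_poly of_int y) z = (1 :: complex)" by (simp add: of_int_poly_hom.hom_mult)
  thus ?case by auto
 next
  case (factor P x)
  show ?case
  proof (cases "poly (map_poly of_int P) z = (0 :: complex)")
   case True thus ?thesis using factor by (auto simp: Factorial_Ring.prime_def)
  next
   case False
   thus ?thesis using factor by (auto simp: of_int_poly_hom.hom_mult intro: dvd_mult)
  qed
 qed simp
 thus ?thesis using assms that by blast
qed

text \<open>The divisor is the value at \<open>q\<close> of the minimal polynomial of a primitive root of unity of
 order \<open>n\<close>: it divides the cofactor polynomials, and it is large because every root of unity other
 than 1 has distance more than \<open>q - 1\<close> from \<open>q\<close>.\<close>

lemma witt_divisor: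
 fixes q n :: nat
 assumes q: "q \<ge> 2" and n: "n \<ge> 2"
 obtains a :: int where "\<And>d m. d dvd n \<Longrightarrow> d < n \<Longrightarrow> m * (int q ^ d - 1) = int q ^ n - 1 \<Longrightarrow> a dvd m"
  "\<not> a dvd int q - 1"
proof -
 define z where "z = cis (2 * pi / real n)"
 define c :: "int poly \<Rightarrow> complex poly" where "c = map_poly of_int"
 have cm: "c (A * B) = c A * c B" for A B by (simp add: c_def of_int_poly_hom.hom_mult)
 have zd: "z ^ d \<noteq> 1" if d: "0 < d" "d < n" for d
 proof
  assume "z ^ d = 1"
  hence "cis (real d * (2 * pi / real n)) = 1" unfolding z_def Complex.DeMoivre .
  hence "cos (real d * (2 * pi / real n)) = 1" by (metis Re_complex_of_real cis.simps(1) one_complex.simps(1))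
  then obtain k :: int where "real d * (2 * pi / real n) = real_of_int k * 2 * pi" using cos_one_2pi_int by auto
  hence "real d = real_of_int k * real n" using n by (simp add: field_simps)
  hence "int d = k * int n" by (metis of_int_eq_iff of_int_mult of_int_of_nat_eq)
  thus False using d by (metis dvd_triv_right nat_dvd_not_less of_nat_dvd_iff)
 qed
 have zn: "z ^ n = 1" unfolding z_def Complex.DeMoivre using n by simp
 \<comment> \<open>\<open>Y d\<close> is the polynomial whose roots are the \<open>d\<close>-th roots of unity, \<open>S d m\<close> the cofactor of \<open>Y d\<close> in \<open>Y (d * m)\<close>.\<close>
 define Y :: "nat \<Rightarrow> int poly" where "Y d = Polynomial.monom 1 d - 1" for d
 have cY: "c (Y d) = Polynomial.monom 1 d - 1" for d
  by (simp add: c_def Y_def of_int_poly_hom.hom_minus map_poly_monom)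
 have Yn0: "Y n \<noteq> 0"
 proof
  assume "Y n = 0"
  hence "poly (Y n) 0 = 0" by simp
  thus False using n by (cases n) (auto simp: Y_def poly_monom)
 qed
 have "poly (c (Y n)) z = 0" using zn by (simp add: cY poly_monom)
 then obtain P where P: "prime_elem P" "P dvd Y n" "poly (c P) z = 0"
  using exists_prime_factor_with_root[OF Yn0] unfolding c_def by blast
 define S :: "nat \<Rightarrow> nat \<Rightarrow> int poly" where "S d m = (\<Sum>i<m. Polynomial.monom 1 d ^ i)" for d m
 have YS: "Y (d * m) = Y d * S d m" for d m
 proof -
  have "Polynomial.monom (1::int) d ^ m - 1 = (Polynomial.monom 1 d - 1) * (\<Sum>i<m. Polynomial.monom 1 d ^ i)"
   by (rule power_diff_1_eq)
  thus ?thesis by (simp add: Y_def S_def monom_power)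
 qed
 have PS: "P dvd S d m" if d: "d * m = n" "d < n" for d m
 proof -
  have d0: "0 < d" using d n by (cases d) auto
  have "P dvd Y d * S d m" using P(2) YS[of d m] d by simp
  moreover have "\<not> P dvd Y d"
  proof
   assume "P dvd Y d"
   then obtain R where "Y d = P * R" by (rule dvdE)
   hence "poly (c (Y d)) z = poly (c P) z * poly (c R) z" by (simp add: cm)
   hence "z ^ d = 1" using P(3) by (simp add: cY poly_monom)
   thus False using zd[OF d0 d(2)] by simp
  qed
  ultimately show ?thesis using P(1) prime_elem_dvd_multD by blast
 qed
 define a where "a = poly P (int q)"
 have "a dvd m" if d: "d dvd n" "d < n" and m: "m * (int q ^ d - 1) = int q ^ n - 1" for d m
 proof -
  obtain k where k: "n = d * k" using d(1) by (rule dvdE)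
  have d0: "0 < d" using k n by (cases d) auto
  have "a dvd poly (S d k) (int q)" unfolding a_def using PS[of d k] d k by (auto simp: dvd_def)
  moreover have "poly (S d k) (int q) = m"
  proof -
   have "poly (Y n) (int q) = poly (Y d) (int q) * poly (S d k) (int q)" using YS[of d k] k by simp
   hence "int q ^ n - 1 = (int q ^ d - 1) * poly (S d k) (int q)" by (simp add: Y_def poly_monom)
   hence "(int q ^ d - 1) * poly (S d k) (int q) = (int q ^ d - 1) * m" using m by (metis mult.commute)
   moreover have "int q ^ d > 1" using q d0 by (simp add: one_less_power)
   ultimately show ?thesis by auto
  qed
  ultimately show ?thesis by simp
 qed
 moreover have "\<not> a dvd int q - 1"
 proof
  assume dv: "a dvd int q - 1"
  define C where "C = c P"
  obtain R where R: "Y n = P * R" using P(2) by (rule dvdE)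
  have "Polynomial.lead_coeff (Y n) = 1"
  proof -
   have "Polynomial.degree (Y n) = n"
    unfolding Y_def diff_conv_add_uminus using n
    by (subst degree_add_eq_left) (auto simp: degree_monom_eq)
   thus ?thesis using n by (simp add: Y_def coeff_eq_0)
  qed
  hence "Polynomial.lead_coeff P * Polynomial.lead_coeff R = 1" unfolding R by (simp add: Polynomial.lead_coeff_mult)
  hence "\<bar>Polynomial.lead_coeff P\<bar> = 1" by (metis abs_zmult_eq_1 abs_one)
  moreover have lcC: "Polynomial.lead_coeff C = of_int (Polynomial.lead_coeff P)" unfolding C_def c_def by simp
  ultimately have lc: "cmod (Polynomial.lead_coeff C) = 1" by (simp add: norm_of_int)
  have C0: "C \<noteq> 0" using lc by auto
  have roots: "w ^ n = 1 \<and> w \<noteq> 1" if w: "poly C w = 0" for w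
  proof
   have "poly (c (Y n)) w = poly C w * poly (c R) w" by (simp add: R cm C_def)
   thus "w ^ n = 1" using w by (simp add: cY poly_monom)
   show "w \<noteq> 1"
   proof
    assume w1: "w = 1"
    obtain R' where "S 1 n = P * R'" using PS[of 1 n] n by (auto elim: dvdE)
    hence "poly (c (S 1 n)) 1 = 0" using w w1 by (simp add: cm C_def)
    moreover have "c (S 1 n) = (\<Sum>i<n. Polynomial.monom 1 i)"
     by (simp add: S_def c_def of_int_poly_hom.hom_sum monom_power map_poly_monom)
    ultimately show False using n by (simp add: poly_sum poly_monom)
   qed
  qed
  have big: "cmod (complex_of_real (real q) - w) > real q - 1" if w: "poly C w = 0" for w
  proof -
   have wn: "cmod w = 1" using roots[OF w] n by (metis norm_power norm_one norm_ge_zero power_eq_1_iff zero_neq_numeral not_numeral_le_zero)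
   have "Re w < 1"
   proof (rule ccontr)
    assume "\<not> Re w < 1"
    moreover have "Re w \<le> 1" using complex_Re_le_cmod[of w] wn by simp
    ultimately have "Re w = 1" by simp
    moreover from this have "Im w = 0" using wn by (simp add: cmod_def)
    ultimately have "w = 1" by (simp add: complex_eq_iff)
    thus False using roots[OF w] by simp
   qed
   moreover have "Re (complex_of_real (real q) - w) \<le> cmod (complex_of_real (real q) - w)" by (rule complex_Re_le_cmod)
   ultimately show ?thesis by simp
  qed
  let ?q = "complex_of_real (real q)"
  have fin: "finite {w. poly C w = 0}" by (rule poly_roots_finite[OF C0])
  have zr: "poly C z = 0" using P(3) by (simp add: C_def)
  have "poly C ?q = Polynomial.lead_coeff C * (\<Prod>w | poly C w = 0. (?q - w) ^ Polynomial.order w C)"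
   by (subst complex_poly_decompose[of C, symmetric]) (simp add: poly_prod)
  hence "cmod (poly C ?q) = (\<Prod>w | poly C w = 0. cmod (?q - w) ^ Polynomial.order w C)"
   using lc by (simp add: norm_mult norm_power flip: prod_norm)
  also have "\<dots> = cmod (?q - z) ^ Polynomial.order z C * (\<Prod>w\<in>{w. poly C w = 0} - {z}. cmod (?q - w) ^ Polynomial.order w C)"
   using fin zr by (subst prod.remove[of _ z]) auto
  also have "\<dots> \<ge> cmod (?q - z) * 1"
  proof (rule mult_mono)
   have "Polynomial.order z C > 0" using zr C0 by (simp add: order_root)
   moreover have "cmod (?q - z) \<ge> 1" using big[OF zr] q by simp
   ultimately show "cmod (?q - z) \<le> cmod (?q - z) ^ Polynomial.order z C"
    by (metis Suc_leI power_increasing power_one_right One_nat_def)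
   show "1 \<le> (\<Prod>w\<in>{w. poly C w = 0} - {z}. cmod (?q - w) ^ Polynomial.order w C)"
   proof (rule prod_ge_1)
    fix w assume "w \<in> {w. poly C w = 0} - {z}"
    hence "cmod (?q - w) \<ge> 1" using big[of w] q by simp
    thus "1 \<le> cmod (?q - w) ^ Polynomial.order w C" by (rule one_le_power)
   qed
  qed auto
  finally have "cmod (poly C ?q) > real q - 1" using big[OF zr] by simp
  moreover have "poly C ?q = of_int a" unfolding C_def c_def a_def
   by (metis of_int_hom.poly_map_poly of_int_of_nat_eq of_real_of_nat_eq)
  ultimately have "real_of_int \<bar>a\<bar> > real q - 1" by (simp add: norm_of_int)
  hence "\<bar>a\<bar> > int q - 1" by linarith
  thus False using dv q zdvd_imp_le[of a "int q - 1"] by (metis abs_dvd_iff diff_gt_0_iff_gt linorder_not_less of_nat_1 of_nat_less_iff one_less_numeral_iff order_less_le_trans semiring_norm(76) zdvd_imp_le)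
 qed
 ultimately show ?thesis using that by blast
qed

text \<open>Witt's proof: the sizes of \<open>D\<close>, of its center and of all centralizers are powers of the size \<open>q\<close> of the
center, so the number supplied by \<open>witt_divisor\<close> divides the size of every noncentral conjugacy class and
of \<open>D\<close> minus zero, but not \<open>q - 1\<close>.\<close>

locale finite_division_ring = ring D for D (structure) +
 assumes finite_D: "finite (carrier D)" and nontrivial: "\<one> \<noteq> \<zero>"
  and inverse_exists: "x \<in> carrier D \<Longrightarrow> x \<noteq> \<zero> \<Longrightarrow> \<exists>y\<in>carrier D. y \<otimes> x = \<one> \<and> x \<otimes> y = \<one>"
begin

lemma no_zero_divisors:
 assumes "x \<in> carrier D" "y \<in> carrier D" "x \<otimes> y = \<zero>"
 shows "x = \<zero> \<or> y = \<zero>"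
proof (rule ccontr)
 assume nz: "\<not> ?thesis"
 then obtain z where z: "z \<in> carrier D" "z \<otimes> x = \<one>" using inverse_exists assms by blast
 have "y = z \<otimes> (x \<otimes> y)" using z assms(1,2) by (simp add: m_assoc[symmetric])
 hence "y = \<zero>" unfolding assms(3) using z by simp
 thus False using nz by simp
qed

text \<open>Division subrings and left subspaces over them. The size of \<open>D\<close> is compared both with that of the
center and with those of centralizers, so scalars are taken from division rings.\<close>

definition sdiv :: "'a set \<Rightarrow> bool" where
 "sdiv K \<longleftrightarrow> K \<subseteq> carrier D \<and> \<zero> \<in> K \<and> \<one> \<in> K \<and> (\<forall>x\<in>K. \<forall>y\<in>K. x \<oplus> y \<in> K) \<and> (\<forall>x\<in>K. \<ominus> x \<in> K) \<and>
   (\<forall>x\<in>K. \<forall>y\<in>K. x \<otimes> y \<in> K) \<and> (\<forall>x\<in>K. x \<noteq> \<zero> \<longrightarrow> (\<exists>y\<in>K. y \<otimes> x = \<one>))"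

definition lsub :: "'a set \<Rightarrow> 'a set \<Rightarrow> bool" where
 "lsub K S \<longleftrightarrow> S \<subseteq> carrier D \<and> \<zero> \<in> S \<and> (\<forall>x\<in>S. \<forall>y\<in>S. x \<oplus> y \<in> S) \<and> (\<forall>x\<in>S. \<ominus> x \<in> S) \<and> (\<forall>k\<in>K. \<forall>x\<in>S. k \<otimes> x \<in> S)"

text \<open>A set of maximal size among the subspaces whose size is a power of \<open>|K|\<close> is everything, since
 adjoining one vector multiplies the size by \<open>|K|\<close>.\<close>

lemma card_lsub_power:
 assumes K: "sdiv K" and M: "lsub K M"
 obtains k :: nat where "card M = card K ^ k"
proof -
 have Kc: "K \<subseteq> carrier D" and Mc: "M \<subseteq> carrier D" using K M by (auto simp: sdiv_def lsub_def)
 have finM: "finite M" and finK: "finite K" using finite_subset[OF Mc finite_D] finite_subset[OF Kc finite_D] .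
 have K2: "card K \<ge> 2"
 proof -
  have "{\<zero>, \<one>} \<subseteq> K" using K by (auto simp: sdiv_def)
  moreover have "card {\<zero>, \<one>} = 2" using nontrivial by auto
  ultimately show ?thesis using card_mono[OF finK] by metis
 qed
 define P where "P S \<longleftrightarrow> lsub K S \<and> S \<subseteq> M \<and> (\<exists>k. card S = card K ^ k)" for S
 have "P {\<zero>}" using K M by (auto simp: P_def lsub_def sdiv_def subset_iff intro!: exI[of _ 0])
 moreover have "\<forall>S. P S \<longrightarrow> card S < Suc (card M)" using card_mono[OF finM] by (auto simp: P_def less_Suc_eq_le)
 ultimately obtain S where S: "P S" and max: "\<And>S'. P S' \<Longrightarrow> card S' \<le> card S"
  using ex_has_greatest_nat[of P "{\<zero>}" card "Suc (card M)"] by blast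
 have Sc: "S \<subseteq> carrier D" "\<zero> \<in> S" and Sa: "\<And>x y. x \<in> S \<Longrightarrow> y \<in> S \<Longrightarrow> x \<oplus> y \<in> S" and Sn: "\<And>x. x \<in> S \<Longrightarrow> \<ominus> x \<in> S"
  and Sk: "\<And>k x. k \<in> K \<Longrightarrow> x \<in> S \<Longrightarrow> k \<otimes> x \<in> S" and SM: "S \<subseteq> M"
  using S by (auto simp: P_def lsub_def)
 have Ka: "\<And>x y. x \<in> K \<Longrightarrow> y \<in> K \<Longrightarrow> x \<oplus> y \<in> K" and Kn: "\<And>x. x \<in> K \<Longrightarrow> \<ominus> x \<in> K"
  and Km: "\<And>x y. x \<in> K \<Longrightarrow> y \<in> K \<Longrightarrow> x \<otimes> y \<in> K" and Ki: "\<And>x. x \<in> K \<Longrightarrow> x \<noteq> \<zero> \<Longrightarrow> \<exists>y\<in>K. y \<otimes> x = \<one>"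
  and K0: "\<zero> \<in> K"
  using K by (auto simp: sdiv_def)
 have "S = M"
 proof (rule ccontr)
  assume "S \<noteq> M"
  then obtain x where x: "x \<in> M" "x \<notin> S" using SM by blast
  have xc: "x \<in> carrier D" using x Mc by auto
  define S' where "S' = (\<lambda>(s, k). s \<oplus> k \<otimes> x) ` (S \<times> K)"
  have inj: "inj_on (\<lambda>(s, k). s \<oplus> k \<otimes> x) (S \<times> K)"
  proof (rule inj_onI, clarify)
   fix s k t l assume *: "s \<in> S" "k \<in> K" "t \<in> S" "l \<in> K" "s \<oplus> k \<otimes> x = t \<oplus> l \<otimes> x"
   have cc: "s \<in> carrier D" "t \<in> carrier D" "k \<in> carrier D" "l \<in> carrier D" using * Sc Kc by auto
   have e: "(k \<ominus> l) \<otimes> x = t \<oplus> \<ominus> s"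
   proof -
    have "(k \<ominus> l) \<otimes> x = (s \<oplus> k \<otimes> x) \<oplus> (\<ominus> s \<oplus> \<ominus> (l \<otimes> x))"
     using cc xc by (simp add: a_minus_def l_distr l_minus a_assoc r_neg2 a_lcomm[of "k \<otimes> x"] r_neg1)
    also have "\<dots> = t \<oplus> \<ominus> s" unfolding *(5) using cc xc by (simp add: a_assoc a_lcomm[of "l \<otimes> x"] r_neg)
    finally show ?thesis .
   qed
   have kl: "k \<ominus> l \<in> K" using * Ka Kn by (auto simp: a_minus_def)
   have "k \<ominus> l = \<zero>"
   proof (rule ccontr)
    assume "k \<ominus> l \<noteq> \<zero>"
    then obtain y where y: "y \<in> K" "y \<otimes> (k \<ominus> l) = \<one>" using Ki[OF kl] by blast
    have "y \<otimes> ((k \<ominus> l) \<otimes> x) = (y \<otimes> (k \<ominus> l)) \<otimes> x"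
     using m_assoc[OF subsetD[OF Kc y(1)] subsetD[OF Kc kl] xc] by simp
    hence "x = y \<otimes> ((k \<ominus> l) \<otimes> x)" unfolding y(2) l_one[OF xc] by (rule sym)
    also have "\<dots> \<in> S" unfolding e using y * Sk Sa Sn by auto
    finally show False using x by simp
   qed
   hence kl': "k = l" using cc(3,4) by simp
   hence "s = t" using *(5) cc(1,2,4) xc by (simp only: add.r_cancel m_closed)
   with kl' show "s = t \<and> k = l" by simp
  qed
  have cS': "card S' = card S * card K" unfolding S'_def by (simp add: card_image[OF inj] card_cartesian_product)
  have "lsub K S'" unfolding lsub_def
  proof (intro conjI ballI)
   show "S' \<subseteq> carrier D" using Sc Kc xc by (auto simp: S'_def)
   show "\<zero> \<in> S'" using Sc K0 xc by (auto simp: S'_def intro!: image_eqI[of _ _ "(\<zero>, \<zero>)"])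
   fix u assume "u \<in> S'"
   then obtain s k where u: "s \<in> S" "k \<in> K" "u = s \<oplus> k \<otimes> x" by (auto simp: S'_def)
   have uc: "s \<in> carrier D" "k \<in> carrier D" using u Sc Kc by auto
   have "\<ominus> u = \<ominus> s \<oplus> (\<ominus> k) \<otimes> x" using u uc xc by (simp add: minus_add l_minus)
   thus "\<ominus> u \<in> S'" using u Sn Kn by (auto simp: S'_def intro!: image_eqI[of _ _ "(\<ominus> s, \<ominus> k)"])
   show "u \<oplus> v \<in> S'" if v': "v \<in> S'" for v
   proof -
    obtain t l where v: "t \<in> S" "l \<in> K" "v = t \<oplus> l \<otimes> x" using v' by (auto simp: S'_def)
    have vc: "t \<in> carrier D" "l \<in> carrier D" using v Sc Kc by auto
    have "u \<oplus> v = (s \<oplus> t) \<oplus> (k \<oplus> l) \<otimes> x" using u v uc vc xc by (simp add: l_distr a_ac)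
    thus ?thesis using u v Sa Ka by (auto simp: S'_def intro!: image_eqI[of _ _ "(s \<oplus> t, k \<oplus> l)"])
   qed
   show "l \<otimes> u \<in> S'" if "l \<in> K" for l
   proof -
    have "l \<otimes> u = l \<otimes> s \<oplus> (l \<otimes> k) \<otimes> x" using u uc xc that Kc by (auto simp: r_distr m_assoc subset_iff)
    thus ?thesis using u that Sk Km by (auto simp: S'_def intro!: image_eqI[of _ _ "(l \<otimes> s, l \<otimes> k)"])
   qed
  qed
  moreover have "S' \<subseteq> M"
  proof
   fix u assume "u \<in> S'"
   then obtain s k where u: "s \<in> S" "k \<in> K" "u = s \<oplus> k \<otimes> x" by (auto simp: S'_def)
   thus "u \<in> M" using M SM x by (auto simp: lsub_def)
  qed
  moreover obtain j where "card S = card K ^ j" using S by (auto simp: P_def)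
  hence "card S' = card K ^ Suc j" using cS' by simp
  ultimately have "P S'" unfolding P_def by blast
  hence "card S * card K \<le> card S" using max cS' by metis
  moreover have "card S > 0" using Sc finite_subset[OF Sc(1) finite_D] by (auto simp: card_gt_0_iff)
  ultimately show False using K2 by (metis One_nat_def mult_le_cancel1 mult.right_neutral not_less_eq_eq numeral_2_eq_2)
 qed
 thus ?thesis using S that by (auto simp: P_def)
qed

definition cent :: "'a \<Rightarrow> 'a set" where "cent x = {y \<in> carrier D. x \<otimes> y = y \<otimes> x}"
definition ctr :: "'a set" where "ctr = {y \<in> carrier D. \<forall>x\<in>carrier D. x \<otimes> y = y \<otimes> x}"

lemma inv_commutes:
 assumes "x \<in> carrier D" "y \<in> carrier D" "z \<in> carrier D" "x \<otimes> y = y \<otimes> x" "z \<otimes> y = \<one>" "y \<otimes> z = \<one>"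
 shows "x \<otimes> z = z \<otimes> x"
proof -
 have "x \<otimes> z = (z \<otimes> y) \<otimes> (x \<otimes> z)" using assms by simp
 also have "\<dots> = z \<otimes> (y \<otimes> x) \<otimes> z" using assms(1-3) by (simp add: m_assoc)
 also have "\<dots> = z \<otimes> x \<otimes> (y \<otimes> z)" unfolding assms(4)[symmetric] using assms(1-3) by (simp add: m_assoc)
 finally show ?thesis using assms(1,3,6) by simp
qed

lemma
 assumes "x \<in> carrier D" "y \<in> carrier D" "z \<in> carrier D" "x \<otimes> y = y \<otimes> x" "x \<otimes> z = z \<otimes> x"
 shows add_commutes: "x \<otimes> (y \<oplus> z) = (y \<oplus> z) \<otimes> x"
  and mult_commutes: "x \<otimes> (y \<otimes> z) = (y \<otimes> z) \<otimes> x"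
proof -
 show "x \<otimes> (y \<oplus> z) = (y \<oplus> z) \<otimes> x"
  unfolding r_distr[OF assms(2,3,1)] l_distr[OF assms(2,3,1)] assms(4,5) ..
 have "x \<otimes> (y \<otimes> z) = (x \<otimes> y) \<otimes> z" using assms(1-3) by (simp only: m_assoc)
 also have "\<dots> = y \<otimes> (x \<otimes> z)" unfolding assms(4) using assms(1-3) by (simp only: m_assoc)
 also have "\<dots> = (y \<otimes> z) \<otimes> x" unfolding assms(5) using assms(1-3) by (simp only: m_assoc)
 finally show "x \<otimes> (y \<otimes> z) = (y \<otimes> z) \<otimes> x" .
qed

lemma minus_commutes:
 assumes "x \<in> carrier D" "y \<in> carrier D" "x \<otimes> y = y \<otimes> x"
 shows "x \<otimes> (\<ominus> y) = (\<ominus> y) \<otimes> x"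
 unfolding r_minus[OF assms(1,2)] l_minus[OF assms(2,1)] assms(3) ..

lemma sdiv_cent: assumes "x \<in> carrier D" shows "sdiv (cent x)"
 unfolding sdiv_def
proof (intro conjI ballI impI)
 fix y assume y: "y \<in> cent x" "y \<noteq> \<zero>"
 then obtain z where z: "z \<in> carrier D" "z \<otimes> y = \<one>" "y \<otimes> z = \<one>" using inverse_exists[of y] by (auto simp: cent_def)
 thus "\<exists>z\<in>cent x. z \<otimes> y = \<one>" using inv_commutes[OF assms _ z(1)] y by (auto simp: cent_def)
qed (use assms in \<open>auto simp: cent_def intro: add_commutes mult_commutes minus_commutes\<close>)

lemma sdiv_ctr: "sdiv ctr"
 unfolding sdiv_def
proof (intro conjI ballI impI)
 fix y assume y: "y \<in> ctr" "y \<noteq> \<zero>"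
 hence c: "y \<in> carrier D" "\<And>x. x \<in> carrier D \<Longrightarrow> x \<otimes> y = y \<otimes> x" unfolding ctr_def by blast+
 obtain z where z: "z \<in> carrier D" "z \<otimes> y = \<one>" "y \<otimes> z = \<one>" using inverse_exists[OF c(1) y(2)] by blast
 have "z \<in> ctr" unfolding ctr_def using inv_commutes[OF _ c(1) z(1) c(2) z(2,3)] z(1) by blast
 thus "\<exists>z\<in>ctr. z \<otimes> y = \<one>" using z(2) by blast
next
 fix y z assume yz: "y \<in> ctr" "z \<in> ctr"
 hence c: "y \<in> carrier D" "z \<in> carrier D" "\<And>x. x \<in> carrier D \<Longrightarrow> x \<otimes> y = y \<otimes> x" "\<And>x. x \<in> carrier D \<Longrightarrow> x \<otimes> z = z \<otimes> x"
  unfolding ctr_def by blast+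
 show "y \<oplus> z \<in> ctr" unfolding ctr_def using add_commutes[OF _ c(1,2) c(3,4)] a_closed[OF c(1,2)] by blast
 show "y \<otimes> z \<in> ctr" unfolding ctr_def using mult_commutes[OF _ c(1,2) c(3,4)] m_closed[OF c(1,2)] by blast
next
 fix y assume y: "y \<in> ctr"
 hence c: "y \<in> carrier D" "\<And>x. x \<in> carrier D \<Longrightarrow> x \<otimes> y = y \<otimes> x" unfolding ctr_def by blast+
 show "\<ominus> y \<in> ctr" unfolding ctr_def using minus_commutes[OF _ c(1) c(2)] a_inv_closed[OF c(1)] by blast
qed (auto simp: ctr_def)

text \<open>Orbit and stabilizer: the nonzero \<open>g\<close> that conjugate \<open>x\<close> to a given \<open>y\<close> form a coset of the centralizer.
Conjugacy is written as \<open>g \<otimes> x = y \<otimes> g\<close>, which avoids inverses.\<close>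

lemma conj_class_card:
 assumes x: "x \<in> carrier D"
 defines "U \<equiv> carrier D - {\<zero>}"
 defines "cl \<equiv> {y \<in> carrier D. \<exists>g\<in>U. g \<otimes> x = y \<otimes> g}"
 shows "card cl * (card (cent x) - 1) = card (carrier D) - 1"
proof -
 have finU: "finite U" using finite_D by (simp add: U_def)
 have ex: "\<exists>y. y \<in> carrier D \<and> g \<otimes> x = y \<otimes> g" if g: "g \<in> U" for g
 proof -
  obtain h where h: "h \<in> carrier D" "h \<otimes> g = \<one>" using inverse_exists[of g] g by (auto simp: U_def)
  have "g \<otimes> x = (g \<otimes> x \<otimes> h) \<otimes> g" using g h x by (simp add: U_def m_assoc)
  thus ?thesis using g h x by (intro exI[of _ "g \<otimes> x \<otimes> h"]) (auto simp: U_def)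
 qed
 define c where "c g = (SOME y. y \<in> carrier D \<and> g \<otimes> x = y \<otimes> g)" for g
 have c: "c g \<in> carrier D" "g \<otimes> x = c g \<otimes> g" if "g \<in> U" for g
  using someI_ex[OF ex[OF that]] unfolding c_def by auto
 have cu: "c g = y" if "g \<in> U" "y \<in> carrier D" "g \<otimes> x = y \<otimes> g" for g y
 proof -
  have gc: "g \<in> carrier D" using that by (simp add: U_def)
  have "(c g \<ominus> y) \<otimes> g = \<zero>" using c[OF that(1)] that gc by (simp add: a_minus_def l_distr l_minus r_neg)
  moreover have "g \<noteq> \<zero>" using that by (simp add: U_def)
  ultimately have "c g \<ominus> y = \<zero>" using no_zero_divisors[of "c g \<ominus> y" g] c[OF that(1)] that gc by auto
  thus ?thesis using c[OF that(1)] that by simp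
 qed
 have cl: "cl = c ` U" using c cu unfolding cl_def by blast
 have fib: "card {g \<in> U. c g = y} = card (cent x - {\<zero>})" if y: "y \<in> cl" for y
 proof -
  obtain g0 where g0: "g0 \<in> U" "c g0 = y" using y unfolding cl by blast
  obtain h0 where h0: "h0 \<in> carrier D" "h0 \<otimes> g0 = \<one>" "g0 \<otimes> h0 = \<one>" using inverse_exists[of g0] g0 by (auto simp: U_def)
  have g0c: "g0 \<in> carrier D" and yc: "y \<in> carrier D" and y0: "g0 \<otimes> x = y \<otimes> g0" using g0 c[OF g0(1)] by (auto simp: U_def)
  have "bij_betw (\<lambda>z. g0 \<otimes> z) (cent x - {\<zero>}) {g \<in> U. c g = y}"
  proof (rule bij_betw_byWitness[where f' = "\<lambda>g. h0 \<otimes> g"])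
   show "\<forall>z\<in>cent x - {\<zero>}. h0 \<otimes> (g0 \<otimes> z) = z" using g0c h0 by (auto simp: cent_def m_assoc[symmetric])
   show "\<forall>g\<in>{g \<in> U. c g = y}. g0 \<otimes> (h0 \<otimes> g) = g" using g0c h0 by (auto simp: U_def m_assoc[symmetric])
   show "(\<lambda>z. g0 \<otimes> z) ` (cent x - {\<zero>}) \<subseteq> {g \<in> U. c g = y}"
   proof (rule image_subsetI)
    fix z assume z: "z \<in> cent x - {\<zero>}"
    hence zc: "z \<in> carrier D" "z \<noteq> \<zero>" "x \<otimes> z = z \<otimes> x" by (auto simp: cent_def)
    have "g0 \<otimes> z \<in> U" using zc g0 g0c no_zero_divisors[of g0 z] by (auto simp: U_def)
    moreover have "g0 \<otimes> z \<otimes> x = y \<otimes> (g0 \<otimes> z)"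
    proof -
     have "g0 \<otimes> z \<otimes> x = g0 \<otimes> x \<otimes> z" using zc g0c x by (simp add: m_assoc)
     thus ?thesis using y0 zc g0c yc by (simp add: m_assoc)
    qed
    ultimately show "g0 \<otimes> z \<in> {g \<in> U. c g = y}" using cu[OF _ yc] by blast
   qed
   show "(\<lambda>g. h0 \<otimes> g) ` {g \<in> U. c g = y} \<subseteq> cent x - {\<zero>}"
   proof (rule image_subsetI)
    fix g assume "g \<in> {g \<in> U. c g = y}"
    hence g: "g \<in> U" "g \<in> carrier D" "g \<otimes> x = y \<otimes> g" using c by (auto simp: U_def)
    have "h0 \<otimes> y = x \<otimes> h0"
    proof -
     have "h0 \<otimes> y = h0 \<otimes> (y \<otimes> g0) \<otimes> h0" using h0 g0c yc by (simp add: m_assoc)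
     also have "\<dots> = (h0 \<otimes> g0) \<otimes> x \<otimes> h0" using y0[symmetric] h0(1) g0c x by (simp add: m_assoc)
     finally show ?thesis using h0 x by simp
    qed
    hence "(x \<otimes> h0) \<otimes> g = (h0 \<otimes> y) \<otimes> g" by simp
    hence "x \<otimes> (h0 \<otimes> g) = h0 \<otimes> (y \<otimes> g)" using g(2) h0(1) x yc by (simp only: m_assoc)
    hence "x \<otimes> (h0 \<otimes> g) = h0 \<otimes> g \<otimes> x" unfolding g(3)[symmetric] using g(2) h0(1) x by (simp only: m_assoc)
    moreover have "h0 \<otimes> g \<noteq> \<zero>" using no_zero_divisors[OF h0(1) g(2)] g(1) h0 nontrivial g0c by (auto simp: U_def)
    ultimately show "h0 \<otimes> g \<in> cent x - {\<zero>}" using g h0 by (auto simp: cent_def)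
   qed
  qed
  thus ?thesis by (simp add: bij_betw_same_card)
 qed
 have "card U = (\<Sum>y\<in>c ` U. card {g \<in> U. c g = y})"
  using sum.image_gen[OF finU, of "\<lambda>_. 1::nat" c] by simp
 also have "\<dots> = card cl * card (cent x - {\<zero>})" using fib by (simp add: cl)
 finally have "card U = card cl * card (cent x - {\<zero>})" .
 moreover have "card (cent x - {\<zero>}) = card (cent x) - 1" using x by (subst card_Diff_singleton) (auto simp: cent_def)
 moreover have "card U = card (carrier D) - 1" unfolding U_def by (subst card_Diff_singleton) auto
 ultimately show ?thesis by simp
qed

theorem wedderburn: "field D"
proof -
 have comm: "x \<otimes> y = y \<otimes> x" if xy: "x \<in> carrier D" "y \<in> carrier D" for x y
 proof (rule ccontr)
  assume nc: "x \<otimes> y \<noteq> y \<otimes> x"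
  define q where "q = card ctr"
  have ctr_c: "ctr \<subseteq> carrier D" by (auto simp: ctr_def)
  have fin: "finite ctr" by (rule finite_subset[OF ctr_c finite_D])
  have q2: "q \<ge> 2"
  proof -
   have "{\<zero>, \<one>} \<subseteq> ctr" by (auto simp: ctr_def)
   moreover have "card {\<zero>, \<one>} = 2" using nontrivial by auto
   ultimately show ?thesis unfolding q_def using card_mono[OF fin] by metis
  qed
  have qpow: "q ^ i = q ^ j \<Longrightarrow> i = j" for i j using q2 power_inject_exp[of q i j] by simp
  have "lsub ctr (carrier D)" using ctr_c by (auto simp: lsub_def)
  then obtain n where n: "card (carrier D) = q ^ n" using card_lsub_power[OF sdiv_ctr] unfolding q_def by metis
  have n2: "n \<ge> 2"
  proof (rule ccontr)
   assume "\<not> n \<ge> 2"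
   hence "n = 0 \<or> n = 1" by auto
   hence "card (carrier D) \<le> card ctr" using n q2 by (auto simp: q_def)
   hence "ctr = carrier D" using card_seteq[OF finite_D ctr_c] by simp
   thus False using nc xy by (auto simp: ctr_def)
  qed
  obtain a :: int where a: "\<And>d m. d dvd n \<Longrightarrow> d < n \<Longrightarrow> m * (int q ^ d - 1) = int q ^ n - 1 \<Longrightarrow> a dvd m"
   "\<not> a dvd int q - 1" using witt_divisor[OF q2 n2] by metis
  define U where "U = carrier D - {\<zero>}"
  define cl where "cl x = {y \<in> carrier D. \<exists>g\<in>U. g \<otimes> x = y \<otimes> g}" for x
  have acl: "a dvd int (card (cl x))" if x: "x \<in> carrier D - ctr" for x
  proof -
   have xc: "x \<in> carrier D" using x by simp
   note sc = sdiv_cent[OF xc]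
   have "lsub ctr (cent x)" using sc ctr_c unfolding sdiv_def lsub_def
   proof (intro conjI ballI)
    fix k y assume k: "k \<in> ctr" and y: "y \<in> cent x"
    hence "k \<in> cent x" using xc by (auto simp: cent_def ctr_def)
    thus "k \<otimes> y \<in> cent x" using sc y by (auto simp: sdiv_def)
   qed auto
   then obtain d where d: "card (cent x) = q ^ d" using card_lsub_power[OF sdiv_ctr] unfolding q_def by metis
   have "lsub (cent x) (carrier D)" by (auto simp: lsub_def cent_def)
   then obtain m where "card (carrier D) = card (cent x) ^ m" using card_lsub_power[OF sc] by metis
   hence "q ^ n = q ^ (d * m)" using n d by (simp add: power_mult)
   hence dn: "d dvd n" using qpow by (metis dvd_triv_left)
   have "cent x \<noteq> carrier D" using x by (force simp: cent_def ctr_def)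
   hence "card (cent x) < card (carrier D)" using finite_D by (intro psubset_card_mono) (auto simp: cent_def)
   hence dn': "d < n" using n d q2 power_less_imp_less_exp[of q d n] by simp
   have "card (cl x) * (card (cent x) - 1) = card (carrier D) - 1"
    unfolding cl_def U_def by (rule conj_class_card[OF xc])
   hence "card (cl x) * (q ^ d - 1) = q ^ n - 1" using n d by simp
   hence "int (card (cl x)) * int (q ^ d - 1) = int (q ^ n - 1)" by (metis of_nat_mult)
   moreover have "int (q ^ k - 1) = int q ^ k - 1" for k using q2 by (subst of_nat_diff) auto
   ultimately show ?thesis using a(1)[OF dn dn'] by simp
  qed
  have cl_refl: "x \<in> cl x" if "x \<in> carrier D" for x
   using that nontrivial by (auto simp: cl_def U_def intro!: bexI[of _ \<one>])
  have cl_sym: "x \<in> cl y" if xy: "x \<in> carrier D" "y \<in> cl x" for x y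
  proof -
   obtain g where g: "g \<in> carrier D" "g \<noteq> \<zero>" "g \<otimes> x = y \<otimes> g" "y \<in> carrier D" using xy by (auto simp: cl_def U_def)
   obtain h where h: "h \<in> carrier D" "h \<otimes> g = \<one>" "g \<otimes> h = \<one>" using inverse_exists g by blast
   have "h \<otimes> y = h \<otimes> (y \<otimes> g) \<otimes> h" using g h by (simp add: m_assoc)
   also have "\<dots> = (h \<otimes> g) \<otimes> x \<otimes> h" unfolding g(3)[symmetric] using g(1) h(1) xy(1) by (simp only: m_assoc m_closed)
   finally have "h \<otimes> y = x \<otimes> h" using h xy by simp
   moreover have "h \<noteq> \<zero>" using h g nontrivial by auto
   ultimately show ?thesis using h xy g by (auto simp: cl_def U_def)
  qed
  have cl_trans: "z \<in> cl x" if x: "x \<in> carrier D" "y \<in> cl x" "z \<in> cl y" for x y z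
  proof -
   obtain g where g: "g \<in> carrier D" "g \<noteq> \<zero>" "g \<otimes> x = y \<otimes> g" "y \<in> carrier D" using x by (auto simp: cl_def U_def)
   obtain h where h: "h \<in> carrier D" "h \<noteq> \<zero>" "h \<otimes> y = z \<otimes> h" "z \<in> carrier D" using x by (auto simp: cl_def U_def)
   have "(h \<otimes> g) \<otimes> x = h \<otimes> (g \<otimes> x)" using g(1) h(1) x(1) by (simp only: m_assoc)
   also have "\<dots> = h \<otimes> y \<otimes> g" unfolding g(3) using g(1,4) h(1) by (simp only: m_assoc)
   also have "\<dots> = z \<otimes> (h \<otimes> g)" unfolding h(3) using g(1) h(1,4) by (simp only: m_assoc)
   finally have "(h \<otimes> g) \<otimes> x = z \<otimes> (h \<otimes> g)" .
   moreover have "h \<otimes> g \<noteq> \<zero>" using no_zero_divisors g h by blast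
   ultimately show ?thesis using g h by (auto simp: cl_def U_def intro!: bexI[of _ "h \<otimes> g"])
  qed
  have cl_nc: "y \<in> carrier D - ctr" if x: "x \<in> carrier D - ctr" "y \<in> cl x" for x y
  proof (rule ccontr)
   assume "y \<notin> carrier D - ctr"
   hence y: "y \<in> ctr" using x by (auto simp: cl_def)
   obtain g where g: "g \<in> carrier D" "g \<noteq> \<zero>" "g \<otimes> x = y \<otimes> g" "y \<in> carrier D" using x by (auto simp: cl_def U_def)
   have "g \<otimes> (x \<ominus> y) = \<zero>" using g y x by (simp add: ctr_def a_minus_def r_distr r_minus r_neg)
   hence "x \<ominus> y = \<zero>" using no_zero_divisors[of g "x \<ominus> y"] g x by auto
   hence "x = y" using g x by simp
   thus False using x y by simp
  qed
  define r where "r = {(x, y). x \<in> carrier D - ctr \<and> y \<in> cl x}"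
  have "equiv (carrier D - ctr) r"
  proof (rule equivI)
   show "r \<subseteq> (carrier D - ctr) \<times> (carrier D - ctr)"
   proof (rule subrelI)
    fix x y assume "(x, y) \<in> r"
    hence "x \<in> carrier D - ctr" "y \<in> cl x" by (simp_all add: r_def)
    thus "(x, y) \<in> (carrier D - ctr) \<times> (carrier D - ctr)" using cl_nc[of x y] by blast
   qed
   show "refl_on (carrier D - ctr) r" using cl_refl by (auto simp: r_def refl_on_def)
   show "sym r"
   proof (rule symI)
    fix x y assume "(x, y) \<in> r"
    hence "x \<in> carrier D - ctr" "x \<in> carrier D" "y \<in> cl x" by (simp_all add: r_def)
    thus "(y, x) \<in> r" using cl_sym[of x y] cl_nc[of x y] by (simp add: r_def)
   qed
   show "trans r"
   proof (rule transI)
    fix x y z assume "(x, y) \<in> r" "(y, z) \<in> r"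
    hence "x \<in> carrier D - ctr" "x \<in> carrier D" "y \<in> cl x" "z \<in> cl y" by (simp_all add: r_def)
    thus "(x, z) \<in> r" using cl_trans[of x y z] by (simp add: r_def)
   qed
  qed
  hence "nat \<bar>a\<bar> dvd card (carrier D - ctr)"
  proof (rule equiv_imp_dvd_card[rotated])
   fix C assume "C \<in> (carrier D - ctr) // r"
   then obtain x where "x \<in> carrier D - ctr" "C = cl x" by (auto simp: quotient_def r_def)
   thus "nat \<bar>a\<bar> dvd card C" using acl[of x] by (simp add: nat_dvd_iff nat_abs_dvd_iff)
  qed (use finite_D in simp)
  hence "a dvd int (card (carrier D) - card ctr)" using card_Diff_subset[OF fin ctr_c] by (simp add: nat_abs_dvd_iff)
  moreover have "card ctr \<le> card (carrier D)" by (rule card_mono[OF finite_D ctr_c])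
  ultimately have 1: "a dvd int q ^ n - int q" using n by (simp add: of_nat_diff q_def)
  have "a dvd (\<Sum>i<n. int q ^ i)"
   by (rule a(1)[of 1]) (use n2 power_diff_1_eq[of "int q" n] in \<open>auto simp: mult.commute\<close>)
  hence "a dvd int q ^ n - 1" unfolding power_diff_1_eq[of "int q" n] by (rule dvd_mult)
  hence "a dvd (int q ^ n - 1) - (int q ^ n - int q)" using 1 by (rule dvd_diff)
  thus False using a(2) by simp
 qed
 have "cring D" by (intro cring.intro comm_monoid.intro comm_monoid_axioms.intro ring_axioms monoid_axioms comm)
 moreover have "Units D = carrier D - {\<zero>}"
 proof
  show "Units D \<subseteq> carrier D - {\<zero>}" using nontrivial by (auto simp: Units_def)
  show "carrier D - {\<zero>} \<subseteq> Units D" using inverse_exists by (auto simp: Units_def)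
 qed
 ultimately show ?thesis by (rule cring.cring_fieldI)
qed

end

section \<open>Identities for q-series\<close>

text \<open>\<open>qp n\<close> is the q-Pochhammer symbol in the variable \<open>x = 1/q\<close> and \<open>rp\<close> its reciprocal, continued by zero to
negative integers. With this convention \<open>rp_rec\<close> holds for all integers, sums over shifted ranges need
no boundary terms, and summands outside the range \<open>\<bar>f_i - f_j\<bar> \<le> u n_i\<close> vanish by themselves.\<close>

locale qseries =
 fixes q :: real and x :: real
 assumes q1: "q > 1" and xdef: "x = 1 / q"
begin

definition qp :: "nat \<Rightarrow> real" where "qp n = (\<Prod>i<n. 1 - x ^ Suc i)"

definition rp :: "int \<Rightarrow> real" where "rp n = (if n < 0 then 0 else 1 / qp (nat n))"

definition qinf :: real where "qinf = prodinf (\<lambda>l. 1 - x ^ Suc l)"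

definition inj_count :: "nat \<Rightarrow> nat \<Rightarrow> real" where
 "inj_count e f = (\<Prod>k<f. q ^ e - q ^ k)"

lemma x_bounds: "0 < x" "x < 1" "q * x = 1" "x \<noteq> 0" "q \<noteq> 0" "0 < q"
 using q1 by (auto simp: xdef)

lemma qx_cancel: "q ^ n * x ^ n = 1" "q ^ n * (x ^ n * z) = z" "x ^ n * q ^ n = 1"
proof -
 show 1: "q ^ n * x ^ n = 1" by (simp only: power_mult_distrib[symmetric] x_bounds(3) power_one)
 thus "q ^ n * (x ^ n * z) = z" "x ^ n * q ^ n = 1"
  by (simp_all only: mult.assoc[symmetric] mult.commute[of "x ^ n" "q ^ n"] mult_1 refl)
qed

lemma qp_pos: "qp n > 0"
 unfolding qp_def using x_bounds by (intro prod_pos) (auto simp: power_less_one_iff simp del: power_Suc)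

lemma qp_Suc: "qp (Suc n) = qp n * (1 - x ^ Suc n)" "qp 0 = 1"
 by (auto simp: qp_def)

lemma rp_nonneg: "rp n \<ge> 0"
 using qp_pos[of "nat n"] by (simp add: rp_def less_imp_le)

lemma rp_nat: "rp (int n) = 1 / qp n"
 by (simp add: rp_def)

lemma rp_neg: "n < 0 \<Longrightarrow> rp n = 0"
 by (simp add: rp_def)

lemma rp_rec: "rp (n - 1) = (1 - x powi n) * rp n"
proof (cases "n > 0")
 case True
 then obtain m where m: "n = int (Suc m)" by (metis gr0_implies_Suc zero_less_imp_eq_int)
 have nm: "n - 1 = int m" using m by simp
 have "1 - x ^ Suc m \<noteq> 0" using qp_pos[of "Suc m"] by (auto simp: qp_Suc simp del: power_Suc)
 thus ?thesis using qp_pos[of m] unfolding nm unfolding m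
  by (simp add: rp_nat qp_Suc del: power_Suc of_nat_Suc)
next
 case False
 thus ?thesis by (cases "n = 0") (auto simp: rp_def)
qed

lemma x_powi_add: "x powi (m + n) = x powi m * x powi n"
 using x_bounds by (simp add: power_int_add)

lemma pascal:
 assumes "r + s = n"
 shows "(1 - x powi n) * (rp r * rp s) = rp r * rp (s - 1) + x powi s * (rp (r - 1) * rp s)"
 using assms[symmetric] by (simp add: rp_rec x_powi_add algebra_simps)

text \<open>Passing from \<open>n\<close> to \<open>n + 1\<close> multiplies both sides by the same factor, by \<open>pascal\<close>. At \<open>t = - 1\<close> the identity
gives the orthogonality relation behind Moebius inversion, and its limit is Euler's expansion.\<close>

lemma q_binomial:
 "(\<Prod>l<n. 1 + t * x ^ l) * rp (int n)
  = (\<Sum>j<Suc n. x ^ (j choose 2) * t ^ j * (rp (int j) * rp (int n - int j)))"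
proof (induction n)
 case 0 thus ?case by (simp add: rp_def qp_Suc numeral_2_eq_2)
next
 case (Suc n)
 let ?w = "\<lambda>j. x ^ (j choose 2) * t ^ j"
 define P where "P m = (\<Sum>j<Suc m. ?w j * (rp (int j) * rp (int m - int j)))" for m
 have c2: "Suc j choose 2 = (j choose 2) + j" for j by (simp add: numeral_2_eq_2)
 have ne: "1 - x ^ Suc n \<noteq> 0" using qp_pos[of "Suc n"] by (auto simp: qp_Suc simp del: power_Suc)
 have "(1 - x ^ Suc n) * P (Suc n)
   = (\<Sum>j<Suc (Suc n). ?w j * ((1 - x powi (int (Suc n))) * (rp (int j) * rp (int (Suc n) - int j))))"
  unfolding P_def sum_distrib_left by (intro sum.cong refl) (simp only: power_int_of_nat mult_ac)
 also have "\<dots> = (\<Sum>j<Suc (Suc n). ?w j * (rp (int j) * rp (int n - int j)))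
   + (\<Sum>j<Suc (Suc n). ?w j * (x powi (int (Suc n) - int j) * (rp (int j - 1) * rp (int (Suc n) - int j))))"
  unfolding sum.distrib[symmetric] by (intro sum.cong refl, subst pascal) (simp_all add: algebra_simps)
 also have "(\<Sum>j<Suc (Suc n). ?w j * (rp (int j) * rp (int n - int j))) = P n"
  by (simp add: P_def rp_neg)
 also have "(\<Sum>j<Suc (Suc n). ?w j * (x powi (int (Suc n) - int j) * (rp (int j - 1) * rp (int (Suc n) - int j))))
   = (\<Sum>j<Suc n. t * x ^ n * (?w j * (rp (int j) * rp (int n - int j))))"
 proof (subst sum.lessThan_Suc_shift, simp add: rp_neg del: sum.lessThan_Suc, intro sum.cong refl)
  fix j assume "j \<in> {..<Suc n}"
  hence "x ^ j * x powi (int n - int j) = x ^ n"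
   by (metis x_bounds(4) add_diff_cancel_left' diff_add_cancel power_int_of_nat x_powi_add add.commute)
  thus "x ^ (Suc j choose 2) * (t * t ^ j) * (x powi (int n - int j) * (rp (int j) * rp (int n - int j)))
    = t * x ^ n * (?w j * (rp (int j) * rp (int n - int j)))"
   by (simp add: c2 power_add mult_ac)
 qed
 also have "P n + \<dots> = (1 + t * x ^ n) * P n"
  unfolding sum_distrib_left[symmetric] by (simp add: P_def algebra_simps del: sum.lessThan_Suc)
 finally have "(1 - x ^ Suc n) * P (Suc n) = (1 + t * x ^ n) * ((\<Prod>l<n. 1 + t * x ^ l) * rp (int n))"
  using Suc by (simp add: P_def)
 also have "rp (int n) = (1 - x ^ Suc n) * rp (int (Suc n))"
 proof -
  have "int (Suc n) - 1 = int n" by simp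
  thus ?thesis using rp_rec[of "int (Suc n)"] by (simp only: power_int_of_nat)
 qed
 finally have "(1 - x ^ Suc n) * P (Suc n)
   = (1 - x ^ Suc n) * ((\<Prod>l<Suc n. 1 + t * x ^ l) * rp (int (Suc n)))"
  by (simp only: prod.lessThan_Suc mult_ac)
 with ne have "P (Suc n) = (\<Prod>l<Suc n. 1 + t * x ^ l) * rp (int (Suc n))"
  unfolding mult_cancel_left by blast
 thus ?case by (simp add: P_def)
qed

text \<open>The q-Vandermonde identity for an infinite upper argument, in a form symmetric enough for induction on
\<open>P + R\<close> with \<open>R\<close> fixed: \<open>pascal\<close> splits each term, and shifting the index in one half
recombines the two halves by \<open>rp_rec\<close>.\<close>

lemma vandermonde:
 assumes "P + R = int m" "R < int M"
 shows "(\<Sum>a<M. x powi (int a * (int a + P)) * (rp (int a) * rp (P + int a) * rp (R - int a)))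
  = rp (int m) * rp R"
 using assms(1)
proof (induction m arbitrary: P)
 case 0
 have P: "P = - R" using 0 by simp
 show ?case
 proof (cases "R < 0")
  case True
  thus ?thesis by (simp add: rp_neg)
 next
  case False
  then obtain r where r: "R = int r" by (metis not_less zero_le_imp_eq_int)
  have "(\<Sum>a<M. x powi (int a * (int a + P)) * (rp (int a) * rp (P + int a) * rp (R - int a)))
    = (\<Sum>a<M. if a = r then rp (int r) else 0)"
   by (intro sum.cong) (auto simp: P r rp_def qp_Suc)
  thus ?thesis using assms(2) by (simp add: r) (simp add: rp_def qp_Suc)
 qed
next
 case (Suc m)
 define P' where "P' = P - 1"
 have P: "P = P' + 1" "P' + R = int m" using Suc.prems by (auto simp: P'_def)
 let ?t = "\<lambda>P a. x powi (int a * (int a + P)) * (rp (int a) * rp (P + int a) * rp (R - int a))"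
 let ?s = "\<lambda>a. x powi (int a * (int a + P')) * (rp (int a - 1) * rp (P' + int a) * rp (R - int a))"
 have "(1 - x powi int (Suc m)) * (\<Sum>a<M. ?t P a)
   = (\<Sum>a<M. x powi (int a * (int a + P)) * (rp (int a) * ((1 - x powi int (Suc m)) * (rp (R - int a) * rp (P + int a)))))"
  unfolding sum_distrib_left by (intro sum.cong) (simp_all add: algebra_simps)
 also have "\<dots> = (\<Sum>a<M. x powi int a * (?t P' a)) + (\<Sum>a<M. ?s (Suc a))"
  unfolding sum.distrib[symmetric]
 proof (intro sum.cong refl)
  fix a
  have e1: "int a * (int a + P) = int a + int a * (int a + P')"
   and e2: "int (Suc a) * (int (Suc a) + P') = int a * (int a + P) + (P + int a)"
   and e3: "P + int a - 1 = P' + int a" "R - int a - 1 = R - int (Suc a)" "P' + int (Suc a) = P + int a" "int (Suc a) - 1 = int a"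
   using P by (simp_all add: algebra_simps)
  have alg: "Y = z * Y' \<Longrightarrow> L = r2 * p' + w * (r3 * s) \<Longrightarrow>
    Y * (r * L) = z * (Y' * (r * p' * r2)) + (Y * w) * (r * s * r3)"
   for Y z Y' L r2 p' w r3 s r :: real
   by (simp add: algebra_simps)
  have Y: "x powi (int a * (int a + P)) = x powi int a * x powi (int a * (int a + P'))"
   unfolding e1 x_powi_add ..
  have F: "(1 - x powi int (Suc m)) * (rp (R - int a) * rp (P + int a))
    = rp (R - int a) * rp (P' + int a) + x powi (P + int a) * (rp (R - int (Suc a)) * rp (P + int a))"
   using pascal[of "R - int a" "P + int a" "int (Suc m)"] Suc.prems unfolding e3 by simp
  show "x powi (int a * (int a + P)) * (rp (int a) * ((1 - x powi int (Suc m)) * (rp (R - int a) * rp (P + int a))))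
    = x powi int a * (?t P' a) + ?s (Suc a)"
   unfolding e2 e3 x_powi_add[of "int a * (int a + P)"] by (rule alg[OF Y F])
 qed
 also have "(\<Sum>a<M. ?s (Suc a)) = (\<Sum>a<Suc M. ?s a)"
  by (subst sum.lessThan_Suc_shift) (simp add: rp_neg)
 also have "\<dots> = (\<Sum>a<M. (1 - x powi int a) * ?t P' a)"
  using assms(2) by (simp add: rp_neg) (intro sum.cong, simp_all add: rp_rec mult_ac)
 also have "(\<Sum>a<M. x powi int a * (?t P' a)) + \<dots> = (\<Sum>a<M. ?t P' a)"
  unfolding sum.distrib[symmetric] by (intro sum.cong) (simp_all add: algebra_simps)
 also have "\<dots> = rp (int m) * rp R" using Suc.IH[OF P(2)] .
 also have "rp (int m) = (1 - x powi int (Suc m)) * rp (int (Suc m))"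
  using rp_rec[of "int (Suc m)"] by simp
 finally have "(1 - x ^ Suc m) * (\<Sum>a<M. ?t P a) = (1 - x ^ Suc m) * (rp (int (Suc m)) * rp R)"
  by (simp only: power_int_of_nat mult.assoc)
 moreover have "1 - x ^ Suc m \<noteq> 0" using qp_pos[of "Suc m"] by (auto simp: qp_Suc simp del: power_Suc)
 ultimately show ?case unfolding mult_cancel_left by blast
qed

lemma conv_prod: "convergent_prod (\<lambda>l. 1 + t * x ^ l)"
proof (rule abs_convergent_prod_imp_convergent_prod, unfold abs_convergent_prod_conv_summable)
 show "summable (\<lambda>l. norm (1 + t * x ^ l - 1))"
  using x_bounds by (simp add: abs_mult summable_mult summable_geometric)
qed

lemma prod_LIMSEQ: "(\<lambda>n. \<Prod>l<n. 1 + t * x ^ l) \<longlonglongrightarrow> prodinf (\<lambda>l. 1 + t * x ^ l)"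
proof -
 have "(\<lambda>n. \<Prod>l\<le>n. 1 + t * x ^ l) \<longlonglongrightarrow> prodinf (\<lambda>l. 1 + t * x ^ l)"
  by (rule convergent_prod_LIMSEQ[OF conv_prod])
 thus ?thesis by (rule LIMSEQ_lessThan_iff_atMost[THEN iffD2])
qed

lemma qinf_eq: "qinf = prodinf (\<lambda>l. 1 + (- x) * x ^ l)" "qp = (\<lambda>n. \<Prod>l<n. 1 + (- x) * x ^ l)"
 by (auto simp: qinf_def qp_def)

lemma qp_LIMSEQ: "qp \<longlonglongrightarrow> qinf"
 unfolding qinf_eq by (rule prod_LIMSEQ)

lemma qinf_pos: "qinf > 0"
proof -
 have "1 + (- x) * x ^ l \<noteq> 0" for l
  using qp_pos[of "Suc l"] by (auto simp: qp_Suc)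
 hence "qinf \<noteq> 0" unfolding qinf_eq by (intro prodinf_nonzero conv_prod)
 moreover have "qinf \<ge> 0"
  using qp_LIMSEQ by (rule LIMSEQ_le_const) (auto intro: less_imp_le qp_pos)
 ultimately show ?thesis by simp
qed

lemma qinf_le_qp: "qinf \<le> qp n"
proof (rule LIMSEQ_le_const2[OF qp_LIMSEQ], intro exI allI impI)
 fix m assume "n \<le> m"
 thus "qp m \<le> qp n"
 proof (induction rule: dec_induct)
  case (step m)
  have "qp m * (1 - x ^ Suc m) \<le> qp m * 1"
   using qp_pos[of m] x_bounds by (intro mult_left_mono) auto
  thus ?case using step.IH by (simp add: qp_Suc del: power_Suc)
 qed simp
qed

lemma rp_le: "rp n \<le> 1 / qinf"
 using qinf_le_qp[of "nat n"] qinf_pos qp_pos[of "nat n"] by (auto simp: rp_def intro!: divide_left_mono)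

lemma rp_LIMSEQ: "(\<lambda>n. rp (int n - int j)) \<longlonglongrightarrow> 1 / qinf"
proof -
 have "(\<lambda>n. 1 / qp n) \<longlonglongrightarrow> 1 / qinf"
  using qinf_pos by (intro tendsto_divide qp_LIMSEQ) auto
 hence "(\<lambda>n. rp (int (n + j) - int j)) \<longlonglongrightarrow> 1 / qinf" by (simp add: rp_nat)
 thus ?thesis by (rule LIMSEQ_offset)
qed

text \<open>The numbers \<open>rp (n - j)\<close> increase to \<open>1 / qinf\<close>, so the finite sums squeeze the partial sums of \<open>w\<close>. This turns
finite q-identities into statements about infinite series without a separate convergence argument.\<close>

lemma convolution_limit:
 assumes w: "\<And>j. w j \<ge> 0" and r: "\<And>n. (\<Sum>j<Suc n. w j * rp (int n - int j)) = r n"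
  and lim: "r \<longlonglongrightarrow> L"
 shows "w sums (L * qinf)"
proof -
 have up: "(\<Sum>j<J. w j) \<le> L * qinf" for J
 proof -
  have "(\<lambda>n. \<Sum>j<J. w j * rp (int n - int j)) \<longlonglongrightarrow> (\<Sum>j<J. w j * (1 / qinf))"
   by (intro tendsto_intros rp_LIMSEQ)
  moreover have "(\<Sum>j<J. w j * rp (int n - int j)) \<le> r n" if "n \<ge> J" for n
   unfolding r[symmetric] using that w rp_nonneg by (intro sum_mono2) auto
  ultimately have "(\<Sum>j<J. w j * (1 / qinf)) \<le> L"
   by (intro LIMSEQ_le[OF _ lim]) auto
  thus ?thesis using qinf_pos by (simp add: sum_divide_distrib[symmetric] field_simps)
 qed
 have sm: "summable w"
  by (rule summableI_nonneg_bounded[of _ "L * qinf"]) (use w up in auto)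
 hence "suminf w \<le> L * qinf" by (rule suminf_le_const) (rule up)
 moreover have "L \<le> suminf w / qinf"
 proof (rule LIMSEQ_le_const2[OF lim], intro exI allI impI)
  fix n
  have "r n \<le> (\<Sum>j<Suc n. w j * (1 / qinf))"
   unfolding r[symmetric] using w rp_le by (intro sum_mono mult_left_mono) auto
  also have "\<dots> = (\<Sum>j<Suc n. w j) / qinf" by (simp add: sum_divide_distrib add_divide_distrib)
  also have "\<dots> \<le> suminf w / qinf"
   using qinf_pos sm w by (intro divide_right_mono sum_le_suminf) auto
  finally show "r n \<le> suminf w / qinf" .
 qed
 hence "L * qinf \<le> suminf w" using qinf_pos by (simp add: field_simps)
 ultimately show ?thesis using sm by (simp add: sums_iff)
qed

lemma euler:
 assumes "t \<ge> 0"
 shows "(\<lambda>j. x ^ (j choose 2) * t ^ j * rp (int j)) sums prodinf (\<lambda>l. 1 + t * x ^ l)"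
proof -
 have "(\<lambda>j. x ^ (j choose 2) * t ^ j * rp (int j)) sums (prodinf (\<lambda>l. 1 + t * x ^ l) * (1 / qinf) * qinf)"
 proof (rule convolution_limit)
  show "(\<lambda>n. (\<Prod>l<n. 1 + t * x ^ l) * rp (int n)) \<longlonglongrightarrow> prodinf (\<lambda>l. 1 + t * x ^ l) * (1 / qinf)"
   using rp_LIMSEQ[of 0] by (intro tendsto_mult prod_LIMSEQ) simp
 qed (use assms x_bounds rp_nonneg q_binomial in \<open>auto simp: mult_ac\<close>)
 thus ?thesis using qinf_pos by simp
qed

text \<open>The limit of \<open>vandermonde\<close> for \<open>R\<close> tending to infinity. Combinatorially this is the dissection of
partitions by their Durfee rectangles.\<close>

lemma durfee: "(\<lambda>b. x powi (int b * (int b + B)) * (rp (int b) * rp (B + int b))) sums (1 / qinf)"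
proof -
 let ?w = "\<lambda>b. x powi (int b * (int b + B)) * (rp (int b) * rp (B + int b))"
 have "?w sums (1 / qinf * (1 / qinf) * qinf)"
 proof (rule convolution_limit)
  fix n
  show "(\<Sum>j<Suc n. ?w j * rp (int n - int j)) = rp (int n + B) * rp (int n)"
  proof (cases "int n + B < 0")
   case True
   thus ?thesis by (subst sum.neutral) (auto simp: rp_neg)
  next
   case False
   then obtain m where m: "int n + B = int m" by (metis not_less zero_le_imp_eq_int)
   thus ?thesis using vandermonde[of B "int n" m "Suc n"] by (simp add: mult_ac add.commute)
  qed
 next
  have 1: "rp (int n + B) = rp (int (n + nat (B + \<bar>B\<bar>)) - int (nat (\<bar>B\<bar>)))" for n
  proof -
   have "0 \<le> B + \<bar>B\<bar>" by linarith
   thus ?thesis by simp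
  qed
  have "(\<lambda>n. rp (int n + B)) \<longlonglongrightarrow> 1 / qinf"
   unfolding 1 by (rule LIMSEQ_ignore_initial_segment[of "\<lambda>n. rp (int n - int (nat (\<bar>B\<bar>)))"]) (rule rp_LIMSEQ)
  thus "(\<lambda>n. rp (int n + B) * rp (int n)) \<longlonglongrightarrow> 1 / qinf * (1 / qinf)"
   using rp_LIMSEQ[of 0] by (intro tendsto_mult) simp_all
 qed (use x_bounds rp_nonneg in \<open>auto intro!: mult_nonneg_nonneg\<close>)
 thus ?thesis using qinf_pos by simp
qed

lemma inj_count_eq: "inj_count e f = q ^ (e * f) * qp e * rp (int e - int f)"
proof (cases "f \<le> e")
 case True
 have ef: "int e - int f = int (e - f)" using True by simp
 have "inj_count e f * qp (e - f) = q ^ (e * f) * qp e" using True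
 proof (induction f)
  case (Suc f)
  have q: "qp (e - f) = qp (e - Suc f) * (1 - x ^ (e - f))"
   using Suc.prems qp_Suc(1)[of "e - Suc f"] by (simp add: Suc_diff_Suc del: power_Suc)
  have "q ^ e * (1 - x ^ (e - f)) = q ^ e - q ^ f"
   using Suc.prems qx_cancel(1)[of "e - f"] power_add[of q f "e - f"] by (simp add: right_diff_distrib mult.assoc)
  hence "inj_count e (Suc f) * qp (e - Suc f) = inj_count e f * qp (e - f) * q ^ e"
   unfolding q inj_count_def by (simp add: mult_ac)
  thus ?case using Suc by (simp add: power_add)
 qed (simp add: inj_count_def)
 thus ?thesis using qp_pos[of "e - f"] unfolding ef rp_nat by (simp add: field_simps)
next
 case False
 hence "inj_count e f = 0" unfolding inj_count_def by (intro prod_zero) auto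
 thus ?thesis using False by (simp add: rp_neg)
qed

lemma inj_count_self_pos: "inj_count e e > 0"
 using qp_pos[of e] qp_pos[of 0] x_bounds by (auto simp: inj_count_eq rp_def intro!: mult_pos_pos)

lemma inj_count_nonneg: "inj_count e f \<ge> 0"
 unfolding inj_count_eq using qp_pos[of e] x_bounds rp_nonneg by (intro mult_nonneg_nonneg) (auto intro: less_imp_le)

lemma inj_count_less: "e < f \<Longrightarrow> inj_count e f = 0"
 by (simp add: inj_count_eq rp_neg)

text \<open>The ratio of surjections onto the \<open>f\<close>-th power to automorphisms: all that enters the moments of a block.\<close>

lemma inj_ratio: "inj_count (f + a) f / inj_count (f + a) (f + a) = x ^ ((f + a) * a) * rp (int a)"
proof -
 have "q ^ ((f + a) * (f + a)) * x ^ ((f + a) * a) = q ^ ((f + a) * f)"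
  unfolding add_mult_distrib2[of "f + a"] power_add using qx_cancel by (simp add: mult.assoc)
 note key = this[symmetric]
 have "inj_count (f + a) f = q ^ ((f + a) * f) * qp (f + a) * rp (int a)"
  "inj_count (f + a) (f + a) = q ^ ((f + a) * (f + a)) * qp (f + a)"
  unfolding inj_count_eq by (simp_all add: rp_def qp_Suc)
 thus ?thesis unfolding key using qp_pos[of "f + a"] x_bounds by simp
qed

lemma choose_two: "(f + a) choose 2 = (f choose 2) + (a choose 2) + f * a"
 "a * a = 2 * (a choose 2) + a" for f a :: nat
proof -
 show "a * a = 2 * (a choose 2) + a" for a :: nat
  by (induction a) (auto simp: numeral_2_eq_2)
 from this[of a] this[of f] this[of "f + a"]
 show "(f + a) choose 2 = (f choose 2) + (a choose 2) + f * a" by (simp add: algebra_simps)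
qed

text \<open>After the shift \<open>k = f + a\<close> the quadratic exponents combine to \<open>a choose 2\<close>, and Euler's expansion applies.\<close>

lemma single_block:
 assumes "s > 0"
 shows "(\<lambda>k. q ^ (k choose 2) * s ^ k * x ^ (N * k) / inj_count k k * inj_count k f)
   sums (q ^ (f choose 2) * s ^ f * x ^ (N * f) * prodinf (\<lambda>l. 1 + (s * x ^ (N + 1)) * x ^ l))"
proof -
 let ?g = "\<lambda>k. q ^ (k choose 2) * s ^ k * x ^ (N * k) / inj_count k k * inj_count k f"
 let ?t = "s * x ^ (N + 1)"
 let ?P = "prodinf (\<lambda>l. 1 + ?t * x ^ l)"
 have 1: "?g (a + f) = q ^ (f choose 2) * s ^ f * x ^ (N * f) * (x ^ (a choose 2) * ?t ^ a * rp (int a))" for a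
 proof -
  have e: "q ^ ((f + a) choose 2) * x ^ ((f + a) * a) = q ^ (f choose 2) * (x ^ (a choose 2) * x ^ a)"
  proof -
   have "(f + a) * a = f * a + (a choose 2) + (a choose 2) + a"
    using choose_two(2)[of a] by (simp add: algebra_simps)
   thus ?thesis unfolding choose_two(1) by (simp add: power_add mult_ac qx_cancel(2))
  qed
  have "?g (a + f) = q ^ ((f + a) choose 2) * s ^ (f + a) * x ^ (N * (f + a)) * (x ^ ((f + a) * a) * rp (int a))"
   unfolding inj_ratio[symmetric] by (simp add: add.commute)
  also have "\<dots> = (q ^ ((f + a) choose 2) * x ^ ((f + a) * a)) * s ^ (f + a) * x ^ (N * (f + a)) * rp (int a)"
   by (simp only: mult_ac)
  also have "\<dots> = q ^ (f choose 2) * s ^ f * x ^ (N * f) * (x ^ (a choose 2) * ?t ^ a * rp (int a))"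
   unfolding e by (simp add: power_add power_mult_distrib distrib_left power_mult mult_ac)
  finally show ?thesis .
 qed
 have "(\<lambda>a. ?g (a + f)) sums (q ^ (f choose 2) * s ^ f * x ^ (N * f) * ?P)"
  unfolding 1 using assms x_bounds by (intro sums_mult euler) auto
 moreover have "(\<Sum>i<f. ?g i) = 0" by (intro sum.neutral) (simp add: inj_count_less)
 ultimately show ?thesis by (subst sums_iff_shift'[symmetric, where n = f]) simp
qed

text \<open>The same shift in both variables. The summation over \<open>a\<close> is a q-Vandermonde sum whose value depends on \<open>b\<close>
only through one factor, which leaves the series of \<open>durfee\<close>.\<close>

lemma pair_term:
 fixes N f g a b :: nat
 defines "A \<equiv> int N + int f - int g" and "B \<equiv> int N - int f + int g"
 defines "d \<equiv> int (a + f) - int (b + g)"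
 shows "q ^ ((a + f) * (b + g)) * x ^ (N * (a + f + (b + g))) * rp (int N - d) * rp (int N + d)
    / (inj_count (a + f) (a + f) * inj_count (b + g) (b + g)) * (inj_count (a + f) f * inj_count (b + g) g)
   = q ^ (f * g) * x ^ (N * (f + g)) * (x powi (int b * (int b + B)) * rp (int b) *
    (x powi (int a * (int a + (A - int b))) * (rp (int a) * rp ((A - int b) + int a) * rp ((B + int b) - int a))))"
proof -
 have d: "int N - d = B + int b - int a" "int N + d = A - int b + int a"
  by (simp_all add: d_def A_def B_def)
 have x: "q ^ n = x powi (- int n)" for n
  using x_bounds by (simp add: xdef power_int_minus power_divide)
 have "q ^ ((a + f) * (b + g)) * x ^ (N * (a + f + (b + g))) * (x ^ ((f + a) * a) * x ^ ((g + b) * b))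
   = q ^ (f * g) * x ^ (N * (f + g)) * (x powi (int b * (int b + B)) * x powi (int a * (int a + (A - int b))))"
  unfolding x unfolding power_int_of_nat[symmetric] x_powi_add[symmetric] A_def B_def
  by (rule arg_cong[of _ _ "\<lambda>n. x powi n"]) (simp add: algebra_simps)
 hence "q ^ ((a + f) * (b + g)) * x ^ (N * (a + f + (b + g))) * rp (int N - d) * rp (int N + d) *
   ((x ^ ((f + a) * a) * rp (int a)) * (x ^ ((g + b) * b) * rp (int b)))
   = q ^ (f * g) * x ^ (N * (f + g)) * (x powi (int b * (int b + B)) * x powi (int a * (int a + (A - int b)))) *
    rp (int N - d) * rp (int N + d) * rp (int a) * rp (int b)"
  by (simp only: mult_ac)
 thus ?thesis unfolding inj_ratio[symmetric] unfolding d
  by (simp add: add.commute mult_ac)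
qed

lemma pair_block:
 fixes f g N :: nat
 defines "w \<equiv> \<lambda>k l. q ^ (k * l) * x ^ (N * (k + l)) * rp (int N - (int k - int l)) * rp (int N + (int k - int l))
    / (inj_count k k * inj_count l l) * (inj_count k f * inj_count l g)"
 shows "\<exists>v. (\<forall>l. (\<lambda>k. w k l) sums v l) \<and> v sums (q ^ (f * g) * x ^ (N * (f + g)) * (rp (2 * int N) / qinf))"
proof -
 define A where "A = int N + int f - int g"
 define B where "B = int N - int f + int g"
 define v where "v b = q ^ (f * g) * x ^ (N * (f + g)) * (x powi (int b * (int b + B)) * rp (int b) *
   (rp (int (2 * N)) * rp (B + int b)))" for b
 have "(\<lambda>k. w k (b + g)) sums v b" for b
 proof -
  have "(\<lambda>a. w (a + f) (b + g)) sums v b"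
   unfolding w_def pair_term[of _ f b g N] A_def[symmetric] B_def[symmetric] v_def
  proof (intro sums_mult)
   have s: "(A - int b) + (B + int b) = int (2 * N)" by (simp add: A_def B_def)
   have M: "B + int b < int (nat (B + int b) + 1)" by linarith
   show "(\<lambda>a. x powi (int a * (int a + (A - int b))) * (rp (int a) * rp ((A - int b) + int a) * rp ((B + int b) - int a)))
    sums (rp (int (2 * N)) * rp (B + int b))"
    unfolding vandermonde[OF s M, symmetric] by (rule sums_finite) (auto simp: rp_neg)
  qed
  moreover have "(\<Sum>i<f. w i (b + g)) = 0" by (intro sum.neutral) (simp add: inj_count_less w_def)
  ultimately show ?thesis by (subst sums_iff_shift'[symmetric, where n = f]) simp
 qed
 hence "(\<lambda>k. w k l) sums (if l < g then 0 else v (l - g))" for l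
  using le_add_diff_inverse2[of g l] by (cases "l < g") (simp add: w_def inj_count_less, metis not_less)
 moreover have "(\<lambda>l. if l < g then 0 else v (l - g)) sums (q ^ (f * g) * x ^ (N * (f + g)) * (rp (2 * int N) / qinf))"
 proof (subst sums_iff_shift'[symmetric, where n = g])
  have "v sums (q ^ (f * g) * x ^ (N * (f + g)) * rp (int (2 * N)) * (1 / qinf))"
   using sums_mult[OF durfee[of B], of "q ^ (f * g) * x ^ (N * (f + g)) * rp (int (2 * N))"]
   by (simp add: v_def[abs_def] mult_ac)
  thus "(\<lambda>i. if i + g < g then 0 else v (i + g - g)) sums
   (q ^ (f * g) * x ^ (N * (f + g)) * (rp (2 * int N) / qinf) - (\<Sum>i<g. if i < g then 0 else v (i - g)))" by simp
 qed
 ultimately show ?thesis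
  by (intro exI[of _ "\<lambda>l. if l < g then 0 else v (l - g)"]) blast
qed

text \<open>The inverse of the triangular matrix \<open>inj_count\<close>.\<close>

definition moeb :: "nat \<Rightarrow> nat \<Rightarrow> real" where
 "moeb k f = (if f < k then 0 else (- 1) ^ (f - k) * q ^ ((f - k) choose 2)
   * (inj_count f k / (inj_count f f * inj_count k k)))"

lemma moeb_inverse:
 assumes "F \<ge> e"
 shows "(\<Sum>f\<le>F. inj_count e f * moeb k f) = (if e = k then 1 else 0)"
proof (cases "e < k")
 case True
 hence "inj_count e f * moeb k f = 0" for f
  by (cases "f < k") (simp_all add: moeb_def inj_count_less)
 thus ?thesis using True by (simp only: sum.neutral_const) simp
next
 case False
 define n where "n = e - k"
 have e: "e = k + n" using False by (simp add: n_def)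
 have m: "moeb k (k + a) = (- 1) ^ a * q ^ (a choose 2) * x ^ ((k + a) * a) * rp (int a) / inj_count k k" for a
  using inj_ratio[of k a] inj_count_self_pos[of "k + a"] inj_count_self_pos[of k]
  by (auto simp add: moeb_def divide_simps)
 define c where "c = q ^ (e * k) * qp e * q ^ (n choose 2) / inj_count k k"
 have t: "inj_count e (k + (n - j)) * moeb k (k + (n - j))
   = c * (- 1) ^ n * (x ^ (j choose 2) * (- 1) ^ j * (rp (int j) * rp (int n - int j)))" if "j \<le> n" for j
 proof -
  define a where "a = n - j"
  have n: "n = j + a" using that by (simp add: a_def)
  have "e * (k + a) = e * k + (k + a) * a + j * a" by (simp add: e n algebra_simps)
  hence "q ^ (e * (k + a)) * q ^ (a choose 2) * x ^ ((k + a) * a)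
    = q ^ (e * k) * (q ^ (j * a) * q ^ (a choose 2)) * (q ^ ((k + a) * a) * x ^ ((k + a) * a))"
   by (simp only: power_add mult_ac)
  also have "q ^ (j * a) * q ^ (a choose 2) = q ^ (n choose 2) * x ^ (j choose 2)"
  proof -
   have "q ^ (n choose 2) * x ^ (j choose 2)
     = q ^ (j * a) * q ^ (a choose 2) * (q ^ (j choose 2) * x ^ (j choose 2))"
    unfolding n choose_two(1)[of j a] power_add by (simp only: mult_ac)
   thus ?thesis by (simp only: qx_cancel mult_1_right)
  qed
  finally have p: "q ^ (e * (k + a)) * q ^ (a choose 2) * x ^ ((k + a) * a)
    = q ^ (e * k) * (q ^ (n choose 2) * x ^ (j choose 2))" by (simp only: qx_cancel mult_1_right)
  have s: "(- 1 :: real) ^ a = (- 1) ^ n * (- 1) ^ j" unfolding n power_add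
   by (simp add: mult_ac flip: power_mult_distrib)
  have "inj_count e (k + a) * moeb k (k + a)
    = (q ^ (e * (k + a)) * q ^ (a choose 2) * x ^ ((k + a) * a))
     * (qp e * rp (int j) * (- 1) ^ a * rp (int a) / inj_count k k)"
   unfolding m unfolding inj_count_eq[of e] by (simp add: e n)
  also have "\<dots> = c * (- 1) ^ n * (x ^ (j choose 2) * (- 1) ^ j * (rp (int j) * rp (int n - int j)))"
   unfolding p s c_def by (simp add: n)
  finally show ?thesis by (simp add: a_def)
 qed
 have "(\<Sum>f\<le>F. inj_count e f * moeb k f) = (\<Sum>f\<in>{k..e}. inj_count e f * moeb k f)"
  using assms by (intro sum.mono_neutral_right) (auto simp: moeb_def inj_count_less)
 also have "\<dots> = (\<Sum>j<Suc n. inj_count e (k + (n - j)) * moeb k (k + (n - j)))"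
  by (rule sum.reindex_bij_witness[of _ "\<lambda>j. k + (n - j)" "\<lambda>f. e - f"]) (auto simp: e)
 also have "\<dots> = c * (- 1) ^ n * ((\<Prod>l<n. 1 + (- 1) * x ^ l) * rp (int n))"
  unfolding q_binomial sum_distrib_left by (intro sum.cong refl t) auto
 also have "\<dots> = (if e = k then 1 else 0)"
 proof (cases n)
  case 0
  thus ?thesis using inj_count_self_pos[of k]
   by (simp add: e c_def numeral_2_eq_2 rp_def qp_Suc) (simp add: inj_count_eq rp_def qp_Suc)
 next
  case (Suc n')
  hence "(\<Prod>l<n. 1 + (- 1) * x ^ l) = 0" by (intro prod_zero bexI[of _ 0]) auto
  thus ?thesis using Suc by (simp add: e)
 qed
 finally show ?thesis .
qed

text \<open>The power \<open>Suc f choose 2\<close> of \<open>q\<close> is an upper bound for the growth of the moments. It is exactly cancelled by the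
quadratic exponents of the inverse matrix, so a geometric series remains.\<close>

lemma moeb_summable:
 assumes "N \<ge> 1"
 shows "summable (\<lambda>f. \<bar>moeb k f\<bar> * (q ^ (Suc f choose 2) * x ^ (N * f)))"
proof -
 let ?g = "\<lambda>f. \<bar>moeb k f\<bar> * (q ^ (Suc f choose 2) * x ^ (N * f))"
 have b: "norm (?g (a + k)) \<le> q ^ (Suc k choose 2) / inj_count k k / qinf * x ^ a" for a
 proof -
  have "(Suc k + a) choose 2 = (Suc k choose 2) + (a choose 2) + (k * a + a)"
   unfolding choose_two(1) by simp
  hence "((Suc k + a) choose 2) + (a choose 2) = (Suc k choose 2) + (k + a) * a"
   unfolding add_mult_distrib choose_two(2) by simp
  hence p: "q ^ (a choose 2) * q ^ (Suc (a + k) choose 2) = q ^ (Suc k choose 2) * q ^ ((k + a) * a)"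
   by (simp add: add.commute flip: power_add)
  have "\<bar>moeb k (a + k)\<bar> = q ^ (a choose 2) * (x ^ ((k + a) * a) * rp (int a) / inj_count k k)"
   unfolding moeb_def using inj_count_self_pos[of k] inj_count_self_pos[of "a + k"] x_bounds
    inj_count_nonneg[of "a + k" k]
   unfolding inj_ratio[of k a, symmetric] by (simp add: abs_mult power_abs add.commute)
  hence "?g (a + k) = (q ^ (a choose 2) * q ^ (Suc (a + k) choose 2))
    * (x ^ ((k + a) * a) * rp (int a) / inj_count k k) * x ^ (N * (a + k))"
   by (simp only: mult_ac)
  also have "\<dots> = (q ^ (Suc k choose 2) / inj_count k k) * (rp (int a) * x ^ (N * (a + k))) *
    (q ^ ((k + a) * a) * x ^ ((k + a) * a))"
   unfolding p by (simp add: mult_ac)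
  also have "\<dots> = (q ^ (Suc k choose 2) / inj_count k k) * (rp (int a) * x ^ (N * (a + k)))"
   unfolding qx_cancel by simp
  also have "\<dots> \<le> (q ^ (Suc k choose 2) / inj_count k k) * (1 / qinf * x ^ a)"
  proof (intro mult_left_mono mult_mono rp_le power_decreasing)
   have "1 * a \<le> N * (a + k)" using assms by (intro mult_le_mono) auto
   thus "a \<le> N * (a + k)" by simp
  qed (use x_bounds inj_count_self_pos[of k] qinf_pos in \<open>auto intro: less_imp_le divide_nonneg_pos\<close>)
  finally show ?thesis using x_bounds by (simp add: abs_mult)
 qed
 have "summable (\<lambda>a. ?g (a + k))"
  by (rule summable_comparison_test'[of "\<lambda>a. q ^ (Suc k choose 2) / inj_count k k / qinf * x ^ a" 0])
   (use x_bounds b in \<open>auto intro!: summable_mult summable_geometric\<close>)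
 thus ?thesis by (rule summable_iff_shift[THEN iffD1])
qed

end

section \<open>Sums over multiplicities\<close>

text \<open>Multiplicity vectors on an index set \<open>I\<close> are extensional functions; sums over them are integrals of
extended nonnegative functions against the counting measure.\<close>

abbreviation multi :: "'i set \<Rightarrow> ('i \<Rightarrow> nat) set" where
 "multi I \<equiv> \<Pi>\<^sub>E i\<in>I. UNIV"

lemma countable_multi: "finite I \<Longrightarrow> countable (multi I)"
 by (intro countable_PiE) auto

lemma count_space_multi: "finite I \<Longrightarrow> count_space (multi I) = Pi\<^sub>M I (\<lambda>_. count_space UNIV)"
 using count_space_PiM_finite[of I "\<lambda>_. UNIV :: nat set"] by (simp add: o_def)

lemma nn_integral_multi_insert:
 assumes "finite I" "i \<notin> I"
 shows "(\<integral>\<^sup>+e. h e \<partial>count_space (multi (insert i I)))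
  = (\<integral>\<^sup>+k. \<integral>\<^sup>+e. h (e(i := k)) \<partial>count_space (multi I) \<partial>count_space UNIV)"
proof -
 interpret product_sigma_finite "\<lambda>_ :: 'a. count_space (UNIV :: nat set)"
  by (intro product_sigma_finite.intro sigma_finite_measure_count_space_countable) simp
 have "finite (insert i I)" using assms by simp
 thus ?thesis
  unfolding count_space_multi[OF assms(1)]
  by (subst count_space_multi, simp, intro product_nn_integral_insert_rev assms)
   (simp add: count_space_multi[symmetric])
qed

lemma nn_integral_swap:
 assumes "countable A" "countable B"
 shows "(\<integral>\<^sup>+a. \<integral>\<^sup>+b. h a b \<partial>count_space B \<partial>count_space A)
  = (\<integral>\<^sup>+b. \<integral>\<^sup>+a. h a b \<partial>count_space A \<partial>count_space B)"
proof -
 interpret pair_sigma_finite "count_space A" "count_space B"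
  by (intro pair_sigma_finite.intro sigma_finite_measure_count_space_countable assms)
 show ?thesis using Fubini'[of h] by (simp add: pair_measure_countable assms)
qed

text \<open>\<open>S\<close> and \<open>P\<close> index the blocks of one and of two coordinates; \<open>st\<close> sends the first coordinate of a block in \<open>P\<close> to
the second one.\<close>

lemma nn_integral_blocks:
 fixes a :: "'i \<Rightarrow> nat \<Rightarrow> ennreal" and b :: "'i \<Rightarrow> nat \<Rightarrow> nat \<Rightarrow> ennreal"
 assumes "finite P" "finite S" "inj_on st P" "S \<inter> P = {}" "S \<inter> st ` P = {}" "P \<inter> st ` P = {}"
 shows "(\<integral>\<^sup>+e. (\<Prod>i\<in>S. a i (e i)) * (\<Prod>i\<in>P. b i (e i) (e (st i))) \<partial>count_space (multi (S \<union> P \<union> st ` P)))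
  = (\<Prod>i\<in>S. \<integral>\<^sup>+k. a i k \<partial>count_space UNIV)
   * (\<Prod>i\<in>P. \<integral>\<^sup>+l. \<integral>\<^sup>+k. b i k l \<partial>count_space UNIV \<partial>count_space UNIV)"
 using assms
proof (induction P rule: finite_induct)
 case empty
 from empty(1) show ?case
 proof (induction S rule: finite_induct)
  case empty
  thus ?case by (subst nn_integral_count_space_finite) simp_all
 next
  case (insert i S)
  have "(\<integral>\<^sup>+e. (\<Prod>j\<in>insert i S. a j (e j)) \<partial>count_space (multi (insert i S)))
    = (\<integral>\<^sup>+k. \<integral>\<^sup>+e. a i k * (\<Prod>j\<in>S. a j (e j)) \<partial>count_space (multi S) \<partial>count_space UNIV)"
   unfolding nn_integral_multi_insert[OF insert(1,2)] prod.insert[OF insert(1,2)] fun_upd_same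
   by (intro nn_integral_cong arg_cong2[of _ _ _ _ "(*)"] prod.cong) (use insert in auto)
  with insert show ?case by (simp add: nn_integral_cmult nn_integral_multc)
 qed
next
 case (insert i P)
 let ?I = "S \<union> P \<union> st ` P"
 have ne: "st i \<noteq> i" "st i \<notin> ?I" "i \<notin> insert (st i) ?I" using insert.prems insert.hyps by (auto simp: inj_on_def)
 have ne': "st x \<noteq> st i" "st x \<noteq> i" if "x \<in> P" for x
  using insert.prems insert.hyps that by (auto simp: inj_on_def)
 have I: "S \<union> insert i P \<union> st ` insert i P = insert (st i) (insert i ?I)" by auto
 have fin: "finite ?I" using insert by simp
 define H where "H e = (\<Prod>i\<in>S. a i (e i)) * (\<Prod>i\<in>P. b i (e i) (e (st i)))" for e
 have H: "H (e(j := k)) = H e" if "j = i \<or> j = st i" for e j k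
  using that ne ne' unfolding H_def by (intro arg_cong2[of _ _ _ _ "(*)"] prod.cong) auto
 have F: "(\<Prod>i\<in>S. a i (e i)) * (\<Prod>i\<in>insert i P. b i (e i) (e (st i))) = b i (e i) (e (st i)) * H e" for e
  using insert.hyps by (simp add: H_def mult_ac)
 have G: "b i ((e(i := k, st i := l)) i) ((e(i := k, st i := l)) (st i)) * H (e(i := k, st i := l)) = b i k l * H e"
  for e k l using ne by (simp add: H)
 have "(\<integral>\<^sup>+e. (\<Prod>i\<in>S. a i (e i)) * (\<Prod>i\<in>insert i P. b i (e i) (e (st i)))
    \<partial>count_space (multi (S \<union> insert i P \<union> st ` insert i P)))
   = (\<integral>\<^sup>+l. \<integral>\<^sup>+k. \<integral>\<^sup>+e. b i k l * H e \<partial>count_space (multi ?I) \<partial>count_space UNIV \<partial>count_space UNIV)"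
  unfolding I F using ne fin
  by (subst nn_integral_multi_insert, simp, simp, subst nn_integral_multi_insert, simp, simp) (simp only: G)
 also have "\<dots> = (\<integral>\<^sup>+l. \<integral>\<^sup>+k. b i k l \<partial>count_space UNIV \<partial>count_space UNIV) * (\<integral>\<^sup>+e. H e \<partial>count_space (multi ?I))"
  by (simp add: nn_integral_cmult nn_integral_multc)
 also have "(\<integral>\<^sup>+e. H e \<partial>count_space (multi ?I)) = (\<Prod>i\<in>S. \<integral>\<^sup>+k. a i k \<partial>count_space UNIV)
   * (\<Prod>i\<in>P. \<integral>\<^sup>+l. \<integral>\<^sup>+k. b i k l \<partial>count_space UNIV \<partial>count_space UNIV)"
  unfolding H_def using insert by auto
 finally show ?case using insert.hyps by (simp add: mult_ac)
qed

lemma nn_integral_sums: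
 assumes "\<And>k. g k \<ge> 0" "g sums v"
 shows "(\<integral>\<^sup>+k. ennreal (g k) \<partial>count_space UNIV) = ennreal v"
 unfolding nn_integral_count_space_nat by (rule suminf_ennreal_eq[OF assms])

text \<open>The inverse matrix has entries of both signs. Splitting it into positive and negative part gives
two nonnegative sums, for which the order of summation may be changed; they differ by the mass of
\<open>k\<close> and are finite by \<open>moeb_summable\<close>, so the mass is determined.\<close>

lemma moments_unique:
 fixes q :: "'i \<Rightarrow> real" and N :: "'i \<Rightarrow> nat" and M :: "('i \<Rightarrow> nat) \<Rightarrow> real"
  and \<nu> \<nu>' :: "('i \<Rightarrow> nat) \<Rightarrow> ennreal"
 assumes I: "finite I" and q: "\<And>i. i \<in> I \<Longrightarrow> q i > 1" and N: "\<And>i. i \<in> I \<Longrightarrow> N i \<ge> 1"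
  and M: "\<And>f. f \<in> multi I \<Longrightarrow> 0 \<le> M f"
   "\<And>f. f \<in> multi I \<Longrightarrow> M f \<le> (\<Prod>i\<in>I. q i ^ (Suc (f i) choose 2) * (1 / q i) ^ (N i * f i))"
  and mom: "\<And>f. f \<in> multi I \<Longrightarrow>
    (\<integral>\<^sup>+e. \<nu> e * ennreal (\<Prod>i\<in>I. qseries.inj_count (q i) (e i) (f i)) \<partial>count_space (multi I)) = ennreal (M f)"
   "\<And>f. f \<in> multi I \<Longrightarrow>
    (\<integral>\<^sup>+e. \<nu>' e * ennreal (\<Prod>i\<in>I. qseries.inj_count (q i) (e i) (f i)) \<partial>count_space (multi I)) = ennreal (M f)"
  and k: "k \<in> multi I"
 shows "\<nu> k = \<nu>' k"
proof -
 have qs: "qseries (q i) (1 / q i)" if "i \<in> I" for i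
  using q[OF that] by unfold_locales auto
 have q0: "0 \<le> q i" if "i \<in> I" for i using q[OF that] by simp
 define \<mu> where "\<mu> f = (\<Prod>i\<in>I. qseries.moeb (q i) (k i) (f i))" for f
 define K where "K e f = (\<Prod>i\<in>I. qseries.inj_count (q i) (e i) (f i))" for e f
 have K0: "K e f \<ge> 0" for e f unfolding K_def by (intro prod_nonneg) (auto intro: qseries.inj_count_nonneg[OF qs])
 let ?J = "count_space (multi I)"
 have orth: "(\<integral>\<^sup>+f. ennreal (K e f * max 0 (\<mu> f)) \<partial>?J)
   = (\<integral>\<^sup>+f. ennreal (K e f * max 0 (- \<mu> f)) \<partial>?J) + (if e = k then 1 else 0)" if e: "e \<in> multi I" for e
 proof -
  let ?F = "\<Pi>\<^sub>E i\<in>I. {..e i}"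
  have F: "finite ?F" "?F \<subseteq> multi I" using I by (auto intro: finite_PiE)
  have out: "K e f = 0" if f: "f \<in> multi I" "f \<notin> ?F" for f
  proof -
   obtain i where "i \<in> I" "f i > e i" using f by (auto simp: PiE_iff)
   thus ?thesis unfolding K_def using I qseries.inj_count_less[OF qs] by (intro prod_zero) auto
  qed
  have fin: "(\<integral>\<^sup>+f. ennreal (K e f * g f) \<partial>?J) = ennreal (\<Sum>f\<in>?F. K e f * g f)" if "\<And>f. g f \<ge> 0" for g
   using that K0 out by (subst nn_integral_count_space'[OF F(1) _ F(2)]) (auto simp: sum_ennreal)
  have "(\<Sum>f\<in>?F. K e f * \<mu> f) = (\<Sum>f\<in>?F. \<Prod>i\<in>I. qseries.inj_count (q i) (e i) (f i) * qseries.moeb (q i) (k i) (f i))"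
   by (simp add: K_def \<mu>_def prod.distrib)
  also have "\<dots> = (\<Prod>i\<in>I. \<Sum>j\<le>e i. qseries.inj_count (q i) (e i) j * qseries.moeb (q i) (k i) j)"
   by (subst prod_sum_PiE) (use I in auto)
  also have "\<dots> = (\<Prod>i\<in>I. if e i = k i then 1 else 0)"
   by (intro prod.cong refl qseries.moeb_inverse[OF qs]) auto
  also have "\<dots> = (if e = k then 1 else 0)"
  proof (cases "e = k")
   case False
   then obtain i where "i \<in> I" "e i \<noteq> k i" using e k by (metis PiE_ext)
   hence "(\<Prod>i\<in>I. if e i = k i then 1 else 0 :: real) = 0" using I by (intro prod_zero) auto
   thus ?thesis using False by simp
  qed simp
  finally have s: "(\<Sum>f\<in>?F. K e f * \<mu> f) = (if e = k then 1 else 0)" .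
  have "(\<Sum>f\<in>?F. K e f * max 0 (\<mu> f)) = (\<Sum>f\<in>?F. K e f * max 0 (- \<mu> f)) + (\<Sum>f\<in>?F. K e f * \<mu> f)"
   unfolding sum.distrib[symmetric] by (intro sum.cong) (auto simp: max_def algebra_simps)
  moreover have "(\<integral>\<^sup>+f. ennreal (K e f * max 0 (- \<mu> f)) \<partial>?J) + (if e = k then 1 else 0)
    = ennreal ((\<Sum>f\<in>?F. K e f * max 0 (- \<mu> f)) + (if e = k then 1 else 0))"
   using K0 by (subst fin, simp, subst ennreal_plus) (auto intro!: sum_nonneg)
  ultimately show ?thesis unfolding s by (simp add: fin)
 qed
 have inv: "(\<integral>\<^sup>+f. ennreal (M f * max 0 (\<mu> f)) \<partial>?J) = (\<integral>\<^sup>+f. ennreal (M f * max 0 (- \<mu> f)) \<partial>?J) + \<rho> k"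
  if mom: "\<And>f. f \<in> multi I \<Longrightarrow> (\<integral>\<^sup>+e. \<rho> e * ennreal (K e f) \<partial>?J) = ennreal (M f)" for \<rho>
 proof -
  have 1: "(\<integral>\<^sup>+f. ennreal (M f * g f) \<partial>?J) = (\<integral>\<^sup>+e. \<rho> e * (\<integral>\<^sup>+f. ennreal (K e f * g f) \<partial>?J) \<partial>?J)"
   if g: "\<And>f. g f \<ge> 0" for g
  proof -
   have "(\<integral>\<^sup>+f. ennreal (M f * g f) \<partial>?J) = (\<integral>\<^sup>+f. \<integral>\<^sup>+e. \<rho> e * ennreal (K e f * g f) \<partial>?J \<partial>?J)"
   proof (intro nn_integral_cong, unfold space_count_space)
    fix f assume f: "f \<in> multi I"
    have "ennreal (M f * g f) = (\<integral>\<^sup>+e. \<rho> e * ennreal (K e f) \<partial>?J) * ennreal (g f)"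
     using M(1)[OF f] g by (simp add: ennreal_mult mom[OF f])
    also have "\<dots> = (\<integral>\<^sup>+e. \<rho> e * ennreal (K e f) * ennreal (g f) \<partial>?J)"
     by (rule nn_integral_multc[symmetric]) simp
    finally show "ennreal (M f * g f) = (\<integral>\<^sup>+e. \<rho> e * ennreal (K e f * g f) \<partial>?J)"
     using K0 g by (simp add: ennreal_mult mult.assoc)
   qed
   also have "\<dots> = (\<integral>\<^sup>+e. \<integral>\<^sup>+f. \<rho> e * ennreal (K e f * g f) \<partial>?J \<partial>?J)"
    by (intro nn_integral_swap countable_multi I)
   finally show ?thesis by (simp add: nn_integral_cmult)
  qed
  have "(\<integral>\<^sup>+f. ennreal (M f * max 0 (\<mu> f)) \<partial>?J)
    = (\<integral>\<^sup>+e. \<rho> e * (\<integral>\<^sup>+f. ennreal (K e f * max 0 (- \<mu> f)) \<partial>?J) + \<rho> e * (if e = k then 1 else 0) \<partial>?J)"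
   by (subst 1) (auto simp: orth distrib_left intro!: nn_integral_cong)
  also have "\<dots> = (\<integral>\<^sup>+f. ennreal (M f * max 0 (- \<mu> f)) \<partial>?J) + (\<integral>\<^sup>+e. \<rho> e * (if e = k then 1 else 0) \<partial>?J)"
   by (subst nn_integral_add) (auto simp: 1)
  also have "(\<integral>\<^sup>+e. \<rho> e * (if e = k then 1 else 0) \<partial>?J) = \<rho> k"
   using k by (subst nn_integral_count_space'[of "{k}"]) auto
  finally show ?thesis .
 qed
 have "(\<integral>\<^sup>+f. ennreal (M f * max 0 (- \<mu> f)) \<partial>?J)
   \<le> (\<integral>\<^sup>+f. (\<Prod>i\<in>I. ennreal (\<bar>qseries.moeb (q i) (k i) (f i)\<bar> * (q i ^ (Suc (f i) choose 2) * (1 / q i) ^ (N i * f i)))) \<partial>?J)"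
 proof (intro nn_integral_mono, unfold space_count_space)
  fix f assume f: "f \<in> multi I"
  have "M f * max 0 (- \<mu> f) \<le> (\<Prod>i\<in>I. q i ^ (Suc (f i) choose 2) * (1 / q i) ^ (N i * f i)) * \<bar>\<mu> f\<bar>"
   using M[OF f] by (intro mult_mono) auto
  also have "\<dots> = (\<Prod>i\<in>I. \<bar>qseries.moeb (q i) (k i) (f i)\<bar> * (q i ^ (Suc (f i) choose 2) * (1 / q i) ^ (N i * f i)))"
   by (simp add: \<mu>_def abs_prod prod.distrib mult_ac)
  finally show "ennreal (M f * max 0 (- \<mu> f)) \<le> (\<Prod>i\<in>I. ennreal (\<bar>qseries.moeb (q i) (k i) (f i)\<bar> * (q i ^ (Suc (f i) choose 2) * (1 / q i) ^ (N i * f i))))"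
   using q0 by (subst prod_ennreal) (auto intro!: ennreal_leI mult_nonneg_nonneg zero_le_power)
 qed
 also have "\<dots> = (\<Prod>i\<in>I. \<integral>\<^sup>+j. ennreal (\<bar>qseries.moeb (q i) (k i) j\<bar> * (q i ^ (Suc j choose 2) * (1 / q i) ^ (N i * j))) \<partial>count_space UNIV)"
  using nn_integral_blocks[of "{}" I id "\<lambda>i j. ennreal (\<bar>qseries.moeb (q i) (k i) j\<bar> * (q i ^ (Suc j choose 2) * (1 / q i) ^ (N i * j)))"] I
  by simp
 also have "\<dots> < \<infinity>"
 proof -
  have "(\<integral>\<^sup>+j. ennreal (\<bar>qseries.moeb (q i) (k i) j\<bar> * (q i ^ (Suc j choose 2) * (1 / q i) ^ (N i * j))) \<partial>count_space UNIV) \<noteq> \<infinity>"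
   if i: "i \<in> I" for i
   using q[OF i] by (subst nn_integral_sums[OF _ summable_sums[OF qseries.moeb_summable[OF qs[OF i] N[OF i]]]]) auto
  thus ?thesis by (simp add: ennreal_prod_eq_top infinity_ennreal_def less_top[symmetric])
 qed
 finally have "(\<integral>\<^sup>+f. ennreal (M f * max 0 (- \<mu> f)) \<partial>?J) \<noteq> \<infinity>" by simp
 thus ?thesis
  using inv[of \<nu>] inv[of \<nu>'] mom unfolding K_def[symmetric] by (simp add: ennreal_add_left_cancel)
qed

section \<open>Finite p-torsion groups with a linear action\<close>

text \<open>A representation over the prime field is the same as a group killed by \<open>p\<close> on which \<open>G\<close> acts
additively, and equivariant linear maps are equivariant additive maps. Working without scalars makes the
tensor squares over endomorphism rings, the trivial representation and subrepresentations instances of one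
notion. The passage from and to representations in the sense of modules is \<open>representation_arep\<close> and
\<open>arep_representation\<close>.\<close>

locale arep = G: group G + V: abelian_group V
 for G :: "('g, 'm) monoid_scheme" and p :: nat and V :: "('a, 'b, 'g) rep" (structure) +
 assumes prime_p: "Factorial_Ring.prime p"
  and finite_carrier [simp]: "finite (carrier V)"
  and torsion: "x \<in> carrier V \<Longrightarrow> add_pow V p x = \<zero>"
  and act_closed [simp]: "g \<in> carrier G \<Longrightarrow> x \<in> carrier V \<Longrightarrow> act V g x \<in> carrier V"
  and act_add [simp]: "g \<in> carrier G \<Longrightarrow> x \<in> carrier V \<Longrightarrow> y \<in> carrier V
     \<Longrightarrow> act V g (x \<oplus> y) = act V g x \<oplus> act V g y"
  and act_one [simp]: "x \<in> carrier V \<Longrightarrow> act V \<one>\<^bsub>G\<^esub> x = x"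
  and act_mult: "g \<in> carrier G \<Longrightarrow> h \<in> carrier G \<Longrightarrow> x \<in> carrier V
     \<Longrightarrow> act V (g \<otimes>\<^bsub>G\<^esub> h) x = act V g (act V h x)"
begin

lemma act_zero [simp]:
 assumes "g \<in> carrier G" shows "act V g \<zero> = \<zero>"
proof -
 have "act V g \<zero> \<oplus> act V g \<zero> = act V g \<zero> \<oplus> \<zero>"
  using act_add[OF assms, of "\<zero>" "\<zero>"] assms by simp
 thus ?thesis using assms by (simp only: V.add.l_cancel V.zero_closed act_closed)
qed

lemma diff_zero_iff:
 assumes "x \<in> carrier V" "y \<in> carrier V"
 shows "x \<ominus> y = \<zero> \<longleftrightarrow> x = y"
proof
 assume "x \<ominus> y = \<zero>"
 hence "x \<oplus> (\<ominus> y) = y \<oplus> (\<ominus> y)"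
  using assms by (simp add: a_minus_def V.r_neg)
 thus "x = y" using assms by (simp only: V.add.r_cancel V.a_inv_closed)
qed (use assms in \<open>simp add: a_minus_def V.r_neg\<close>)

lemma act_inv_cancel [simp]:
 assumes "g \<in> carrier G" "x \<in> carrier V"
 shows "act V g (act V (inv\<^bsub>G\<^esub> g) x) = x" "act V (inv\<^bsub>G\<^esub> g) (act V g x) = x"
 using assms act_mult[of g "inv\<^bsub>G\<^esub> g" x] act_mult[of "inv\<^bsub>G\<^esub> g" g x] by auto

end

definition ahom :: "('g, 'm) monoid_scheme \<Rightarrow> ('a, 'b, 'g) rep \<Rightarrow> ('c, 'd, 'g) rep \<Rightarrow> ('b \<Rightarrow> 'd) set"
 where "ahom G U V = {f \<in> carrier U \<rightarrow>\<^sub>E carrier V.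
  (\<forall>x\<in>carrier U. \<forall>y\<in>carrier U. f (x \<oplus>\<^bsub>U\<^esub> y) = f x \<oplus>\<^bsub>V\<^esub> f y) \<and>
  (\<forall>g\<in>carrier G. \<forall>x\<in>carrier U. f (act U g x) = act V g (f x))}"

definition aiso :: "('g, 'm) monoid_scheme \<Rightarrow> ('a, 'b, 'g) rep \<Rightarrow> ('c, 'd, 'g) rep \<Rightarrow> bool"
 where "aiso G U V \<longleftrightarrow> (\<exists>f\<in>ahom G U V. bij_betw f (carrier U) (carrier V))"

definition asub :: "('g, 'm) monoid_scheme \<Rightarrow> ('a, 'b, 'g) rep \<Rightarrow> 'b set \<Rightarrow> bool"
 where "asub G V N \<longleftrightarrow> N \<subseteq> carrier V \<and> \<zero>\<^bsub>V\<^esub> \<in> N \<and> (\<forall>x\<in>N. \<forall>y\<in>N. x \<oplus>\<^bsub>V\<^esub> y \<in> N)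
   \<and> (\<forall>g\<in>carrier G. \<forall>x\<in>N. act V g x \<in> N)"

definition airr :: "('g, 'm) monoid_scheme \<Rightarrow> nat \<Rightarrow> ('a, 'b, 'g) rep \<Rightarrow> bool"
 where "airr G p V \<longleftrightarrow> arep G p V \<and> carrier V \<noteq> {\<zero>\<^bsub>V\<^esub>} \<and>
   (\<forall>N. asub G V N \<longrightarrow> N = {\<zero>\<^bsub>V\<^esub>} \<or> N = carrier V)"

lemma ahomI:
 assumes "f \<in> extensional (carrier U)" "\<And>x. x \<in> carrier U \<Longrightarrow> f x \<in> carrier V"
  "\<And>x y. x \<in> carrier U \<Longrightarrow> y \<in> carrier U \<Longrightarrow> f (x \<oplus>\<^bsub>U\<^esub> y) = f x \<oplus>\<^bsub>V\<^esub> f y"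
  "\<And>g x. g \<in> carrier G \<Longrightarrow> x \<in> carrier U \<Longrightarrow> f (act U g x) = act V g (f x)"
 shows "f \<in> ahom G U V"
 using assms by (auto simp: ahom_def PiE_def)

lemma
 assumes "f \<in> ahom G U V"
 shows ahom_ext: "f \<in> extensional (carrier U)"
  and ahom_closed: "x \<in> carrier U \<Longrightarrow> f x \<in> carrier V"
  and ahom_add: "x \<in> carrier U \<Longrightarrow> y \<in> carrier U \<Longrightarrow> f (x \<oplus>\<^bsub>U\<^esub> y) = f x \<oplus>\<^bsub>V\<^esub> f y"
  and ahom_act: "g \<in> carrier G \<Longrightarrow> x \<in> carrier U \<Longrightarrow> f (act U g x) = act V g (f x)"
 using assms by (auto simp: ahom_def PiE_def Pi_def)

lemma ahom_zero:
 assumes "arep G p U" "arep G p V" "f \<in> ahom G U V"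
 shows "f \<zero>\<^bsub>U\<^esub> = \<zero>\<^bsub>V\<^esub>"
proof -
 interpret U: arep G p U by fact
 interpret V: arep G p V by fact
 have c: "f \<zero>\<^bsub>U\<^esub> \<in> carrier V" using assms(3) by (auto intro: ahom_closed)
 have "f \<zero>\<^bsub>U\<^esub> \<oplus>\<^bsub>V\<^esub> f \<zero>\<^bsub>U\<^esub> = f \<zero>\<^bsub>U\<^esub> \<oplus>\<^bsub>V\<^esub> \<zero>\<^bsub>V\<^esub>"
  using ahom_add[OF assms(3), of "\<zero>\<^bsub>U\<^esub>" "\<zero>\<^bsub>U\<^esub>"] c by simp
 thus ?thesis using c by (simp only: V.V.add.l_cancel V.V.zero_closed)
qed

lemma ahom_neg:
 assumes "arep G p U" "arep G p V" "f \<in> ahom G U V" "x \<in> carrier U"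
 shows "f (\<ominus>\<^bsub>U\<^esub> x) = \<ominus>\<^bsub>V\<^esub> f x"
proof -
 interpret U: arep G p U by fact
 interpret V: arep G p V by fact
 have "f (\<ominus>\<^bsub>U\<^esub> x) \<oplus>\<^bsub>V\<^esub> f x = \<zero>\<^bsub>V\<^esub>"
  using ahom_add[OF assms(3), of "\<ominus>\<^bsub>U\<^esub> x" x] assms ahom_zero[OF assms(1-3)]
  by (simp add: U.V.l_neg)
 thus ?thesis using assms by (intro V.V.minus_equality[symmetric]) (auto intro: ahom_closed)
qed

lemma ahom_diff:
 assumes "arep G p U" "arep G p V" "f \<in> ahom G U V" "x \<in> carrier U" "y \<in> carrier U"
 shows "f (x \<ominus>\<^bsub>U\<^esub> y) = f x \<ominus>\<^bsub>V\<^esub> f y"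
proof -
 interpret U: arep G p U by fact
 show ?thesis using assms by (simp add: a_minus_def ahom_add ahom_neg)
qed

lemma ahom_diff_zero:
 assumes "arep G p U" "arep G p V" "f \<in> ahom G U V" "x \<in> carrier U" "y \<in> carrier U"
 shows "f (x \<ominus>\<^bsub>U\<^esub> y) = \<zero>\<^bsub>V\<^esub> \<longleftrightarrow> f x = f y"
proof -
 interpret V: arep G p V by fact
 show ?thesis unfolding ahom_diff[OF assms]
  by (rule V.diff_zero_iff) (use assms in \<open>auto intro: ahom_closed\<close>)
qed

lemma ahom_finite:
 assumes "arep G p U" "arep G p V"
 shows "finite (ahom G U V)"
proof -
 interpret U: arep G p U by fact
 interpret V: arep G p V by fact
 have "ahom G U V \<subseteq> carrier U \<rightarrow>\<^sub>E carrier V" by (auto simp: ahom_def)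
 thus ?thesis by (rule finite_subset) (simp add: finite_PiE)
qed

lemma ahom_zero_map:
 assumes "arep G p U" "arep G p V"
 shows "(\<lambda>x\<in>carrier U. \<zero>\<^bsub>V\<^esub>) \<in> ahom G U V"
proof -
 interpret U: arep G p U by fact
 interpret V: arep G p V by fact
 show ?thesis by (intro ahomI) auto
qed

lemma ahom_compose:
 assumes "arep G p U" "f \<in> ahom G U V" "h \<in> ahom G V W"
 shows "compose (carrier U) h f \<in> ahom G U W"
proof -
 interpret U: arep G p U by fact
 show ?thesis using assms(2,3)
  by (intro ahomI) (auto simp: compose_def ahom_closed ahom_add ahom_act)
qed

lemma ahom_id:
 assumes "arep G p U" shows "(\<lambda>x\<in>carrier U. x) \<in> ahom G U U"
proof -
 interpret U: arep G p U by fact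
 show ?thesis by (intro ahomI) auto
qed

lemma ahom_eqI:
 assumes "f \<in> ahom G U V" "h \<in> ahom G U V" "\<And>x. x \<in> carrier U \<Longrightarrow> f x = h x"
 shows "f = h"
 using assms by (metis ahom_ext extensionalityI)

lemma ahom_inverse:
 assumes "arep G p U" "arep G p V" "f \<in> ahom G U V" "bij_betw f (carrier U) (carrier V)"
 shows "(\<lambda>y\<in>carrier V. inv_into (carrier U) f y) \<in> ahom G V U"
proof -
 interpret U: arep G p U by fact
 interpret V: arep G p V by fact
 let ?h = "inv_into (carrier U) f"
 have h: "?h y \<in> carrier U" "f (?h y) = y" if "y \<in> carrier V" for y
  using assms(4) that by (auto simp: bij_betw_def inv_into_into f_inv_into_f)
 have hf: "?h (f x) = x" if "x \<in> carrier U" for x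
  using assms(4) that by (simp add: bij_betw_inv_into_left)
 show ?thesis
 proof (intro ahomI)
  fix x y assume xy: "x \<in> carrier V" "y \<in> carrier V"
  have "?h (x \<oplus>\<^bsub>V\<^esub> y) = ?h (f (?h x \<oplus>\<^bsub>U\<^esub> ?h y))" using xy h assms(3) by (simp add: ahom_add)
  also have "\<dots> = ?h x \<oplus>\<^bsub>U\<^esub> ?h y" using xy h by (simp add: hf)
  finally show "(\<lambda>y\<in>carrier V. ?h y) (x \<oplus>\<^bsub>V\<^esub> y) = (\<lambda>y\<in>carrier V. ?h y) x \<oplus>\<^bsub>U\<^esub> (\<lambda>y\<in>carrier V. ?h y) y"
   using xy by simp
 next
  fix g y assume gy: "g \<in> carrier G" "y \<in> carrier V"
  have "?h (act V g y) = ?h (f (act U g (?h y)))" using gy h assms(3) by (simp add: ahom_act)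
  also have "\<dots> = act U g (?h y)" using gy h by (simp add: hf)
  finally show "(\<lambda>y\<in>carrier V. ?h y) (act V g y) = act U g ((\<lambda>y\<in>carrier V. ?h y) y)"
   using gy by simp
 qed (use h in auto)
qed

lemma aiso_refl: "arep G p U \<Longrightarrow> aiso G U U"
 unfolding aiso_def by (rule bexI[OF _ ahom_id]) (auto simp: bij_betw_def inj_on_def)

lemma aiso_sym:
 assumes "arep G p U" "arep G p V" "aiso G U V" shows "aiso G V U"
proof -
 obtain f where f: "f \<in> ahom G U V" "bij_betw f (carrier U) (carrier V)"
  using assms(3) by (auto simp: aiso_def)
 have "bij_betw (\<lambda>y\<in>carrier V. inv_into (carrier U) f y) (carrier V) (carrier U)"
  using bij_betw_inv_into[OF f(2)] by simp
 thus ?thesis using ahom_inverse[OF assms(1,2) f] unfolding aiso_def by blast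
qed

lemma aiso_trans:
 assumes "arep G p U" "aiso G U V" "aiso G V W" shows "aiso G U W"
proof -
 obtain f where f: "f \<in> ahom G U V" "bij_betw f (carrier U) (carrier V)"
  using assms(2) by (auto simp: aiso_def)
 obtain h where h: "h \<in> ahom G V W" "bij_betw h (carrier V) (carrier W)"
  using assms(3) by (auto simp: aiso_def)
 have "bij_betw (compose (carrier U) h f) (carrier U) (carrier W)"
  by (rule bij_betw_compose[OF f(2) h(2)])
 thus ?thesis using ahom_compose[OF assms(1) f(1) h(1)] by (auto simp: aiso_def)
qed

lemma aiso_card: "aiso G U V \<Longrightarrow> card (carrier U) = card (carrier V)"
 unfolding aiso_def using bij_betw_same_card by blast

text \<open>Composing with an isomorphism on either side is a bijection on homomorphisms that
 keeps the image, hence surjectivity.\<close>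

lemma aiso_hom_bij:
 assumes U: "arep G p U" and U': "arep G p U'" and V: "arep G p V" and V': "arep G p V'"
  and iU: "aiso G U U'" and iV: "aiso G V V'"
 shows "\<exists>\<Phi>. bij_betw \<Phi> (ahom G U' V) (ahom G U V') \<and>
  (\<forall>f\<in>ahom G U' V. \<Phi> f ` carrier U = carrier V' \<longleftrightarrow> f ` carrier U' = carrier V)"
proof -
 obtain a where a: "a \<in> ahom G U U'" "bij_betw a (carrier U) (carrier U')"
  using iU by (auto simp: aiso_def)
 obtain b where b: "b \<in> ahom G V V'" "bij_betw b (carrier V) (carrier V')"
  using iV by (auto simp: aiso_def)
 define a' where "a' = (\<lambda>y\<in>carrier U'. inv_into (carrier U) a y)"
 define b' where "b' = (\<lambda>y\<in>carrier V'. inv_into (carrier V) b y)"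
 have a': "a' \<in> ahom G U' U" unfolding a'_def by (rule ahom_inverse[OF U U' a])
 have b': "b' \<in> ahom G V' V" unfolding b'_def by (rule ahom_inverse[OF V V' b])
 have aa: "a (a' y) = y" if "y \<in> carrier U'" for y
  using that a(2) by (simp add: a'_def bij_betw_inv_into_right)
 have aa': "a' (a y) = y" if "y \<in> carrier U" for y
  using that a ahom_closed[OF a(1)] by (simp add: a'_def bij_betw_inv_into_left)
 have bb: "b (b' y) = y" if "y \<in> carrier V'" for y
  using that b(2) by (simp add: b'_def bij_betw_inv_into_right)
 have bb': "b' (b y) = y" if "y \<in> carrier V" for y
  using that b ahom_closed[OF b(1)] by (simp add: b'_def bij_betw_inv_into_left)
 define \<Phi> where "\<Phi> f = compose (carrier U) (compose (carrier U') b f) a" for f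
 define \<Psi> where "\<Psi> f = compose (carrier U') (compose (carrier U) b' f) a'" for f
 have \<Phi>: "\<Phi> f \<in> ahom G U V'" if "f \<in> ahom G U' V" for f
  unfolding \<Phi>_def using U U' a b that ahom_compose by metis
 have \<Psi>: "\<Psi> f \<in> ahom G U' V" if "f \<in> ahom G U V'" for f
  unfolding \<Psi>_def using U U' a' b' that ahom_compose by metis
 have "bij_betw \<Phi> (ahom G U' V) (ahom G U V')"
 proof (rule bij_betw_byWitness[where f' = \<Psi>])
  show "\<forall>f\<in>ahom G U' V. \<Psi> (\<Phi> f) = f"
  proof
   fix f assume f: "f \<in> ahom G U' V"
   show "\<Psi> (\<Phi> f) = f"
    by (rule ahom_eqI[OF \<Psi>[OF \<Phi>[OF f]] f])
     (simp add: \<Phi>_def \<Psi>_def compose_def aa bb' ahom_closed[OF a'] ahom_closed[OF f])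
  qed
  show "\<forall>f\<in>ahom G U V'. \<Phi> (\<Psi> f) = f"
  proof
   fix f assume f: "f \<in> ahom G U V'"
   show "\<Phi> (\<Psi> f) = f"
    by (rule ahom_eqI[OF \<Phi>[OF \<Psi>[OF f]] f])
     (simp add: \<Phi>_def \<Psi>_def compose_def aa' bb ahom_closed[OF a(1)] ahom_closed[OF f])
  qed
 qed (use \<Phi> \<Psi> in auto)
 moreover have "(\<Phi> f ` carrier U = carrier V') \<longleftrightarrow> f ` carrier U' = carrier V" if f: "f \<in> ahom G U' V" for f
 proof -
  have "\<Phi> f ` carrier U = b ` f ` a ` carrier U"
   using ahom_closed[OF a(1)] by (auto simp: \<Phi>_def compose_def image_iff)
  also have "\<dots> = b ` f ` carrier U'" using a(2) by (simp add: bij_betw_def)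
  finally have e: "\<Phi> f ` carrier U = b ` f ` carrier U'" .
  have "f ` carrier U' \<subseteq> carrier V" using ahom_closed[OF f] by auto
  thus ?thesis unfolding e using b(2) by (metis bij_betw_def inj_on_image_eq_iff order_refl)
 qed
 ultimately show ?thesis by blast
qed

lemma aiso_card_hom:
 assumes "arep G p U" "arep G p U'" "arep G p V" "arep G p V'" "aiso G U U'" "aiso G V V'"
 shows "card (ahom G U V) = card (ahom G U' V')"
proof -
 have s: "aiso G V' V" using assms aiso_sym by blast
 obtain \<Phi> where "bij_betw \<Phi> (ahom G U' V') (ahom G U V)"
  using aiso_hom_bij[OF assms(1,2,4,3) assms(5) s] by blast
 thus ?thesis by (simp add: bij_betw_same_card)
qed

definition asur :: "('g, 'm) monoid_scheme \<Rightarrow> ('a, 'b, 'g) rep \<Rightarrow> ('c, 'd, 'g) rep \<Rightarrow> ('b \<Rightarrow> 'd) set"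
 where "asur G U V = {f \<in> ahom G U V. f ` carrier U = carrier V}"

lemma aiso_card_sur:
 assumes "arep G p U" "arep G p U'" "arep G p V" "arep G p V'" "aiso G U U'" "aiso G V V'"
 shows "card (asur G U V) = card (asur G U' V')"
proof -
 have s: "aiso G V' V" using assms aiso_sym by blast
 obtain \<Phi> where P: "bij_betw \<Phi> (ahom G U' V') (ahom G U V)"
   "\<forall>f\<in>ahom G U' V'. \<Phi> f ` carrier U = carrier V \<longleftrightarrow> f ` carrier U' = carrier V'"
  using aiso_hom_bij[OF assms(1,2,4,3) assms(5) s] by blast
 have "\<Phi> ` asur G U' V' = asur G U V"
 proof
  show "asur G U V \<subseteq> \<Phi> ` asur G U' V'"
  proof
   fix x assume x: "x \<in> asur G U V"
   hence "x \<in> \<Phi> ` ahom G U' V'" using P(1) by (simp add: asur_def bij_betw_def)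
   then obtain f where f: "f \<in> ahom G U' V'" "x = \<Phi> f" by blast
   thus "x \<in> \<Phi> ` asur G U' V'" using x bspec[OF P(2) f(1)] by (auto simp: asur_def)
  qed
 qed (use P in \<open>auto simp: asur_def bij_betw_def\<close>)
 hence "bij_betw \<Phi> (asur G U' V') (asur G U V)"
  using P(1) unfolding bij_betw_def by (auto simp: asur_def intro: inj_on_subset)
 thus ?thesis by (simp add: bij_betw_same_card)
qed

subsection \<open>Kernels, subrepresentations and Schur's lemma\<close>

lemma asub_kernel:
 assumes "arep G p U" "arep G p V" "f \<in> ahom G U V"
 shows "asub G U {x \<in> carrier U. f x = \<zero>\<^bsub>V\<^esub>}"
proof -
 interpret U: arep G p U by fact
 interpret V: arep G p V by fact
 show ?thesis using assms ahom_zero[OF assms]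
  by (auto simp: asub_def ahom_add ahom_act)
qed

lemma asub_image:
 assumes "arep G p U" "arep G p V" "f \<in> ahom G U V"
 shows "asub G V (f ` carrier U)"
proof -
 interpret U: arep G p U by fact
 interpret V: arep G p V by fact
 show ?thesis unfolding asub_def
 proof (intro conjI ballI)
  show "\<zero>\<^bsub>V\<^esub> \<in> f ` carrier U" using ahom_zero[OF assms] by (metis U.V.zero_closed imageI)
  show "x \<oplus>\<^bsub>V\<^esub> y \<in> f ` carrier U" if "x \<in> f ` carrier U" "y \<in> f ` carrier U" for x y
   using that assms(3) by (auto simp: ahom_add[symmetric])
  show "act V g x \<in> f ` carrier U" if "x \<in> f ` carrier U" "g \<in> carrier G" for x g
   using that assms(3) by (auto simp: ahom_act[symmetric])
 qed (use ahom_closed[OF assms(3)] in auto)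
qed

lemma ahom_inj_iff:
 assumes "arep G p U" "arep G p V" "f \<in> ahom G U V"
 shows "inj_on f (carrier U) \<longleftrightarrow> {x \<in> carrier U. f x = \<zero>\<^bsub>V\<^esub>} = {\<zero>\<^bsub>U\<^esub>}"
proof -
 interpret U: arep G p U by fact
 interpret V: arep G p V by fact
 show ?thesis
 proof
  assume "inj_on f (carrier U)"
  thus "{x \<in> carrier U. f x = \<zero>\<^bsub>V\<^esub>} = {\<zero>\<^bsub>U\<^esub>}"
   using ahom_zero[OF assms] by (auto dest: inj_onD[where y = "\<zero>\<^bsub>U\<^esub>"])
 next
  assume k: "{x \<in> carrier U. f x = \<zero>\<^bsub>V\<^esub>} = {\<zero>\<^bsub>U\<^esub>}"
  show "inj_on f (carrier U)"
  proof (rule inj_onI)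
   fix x y assume xy: "x \<in> carrier U" "y \<in> carrier U" "f x = f y"
   have "f (x \<ominus>\<^bsub>U\<^esub> y) = \<zero>\<^bsub>V\<^esub>"
    using xy ahom_diff_zero[OF assms] by blast
   hence "x \<ominus>\<^bsub>U\<^esub> y = \<zero>\<^bsub>U\<^esub>" using k xy by (blast intro: U.V.minus_closed)
   thus "x = y" using xy U.diff_zero_iff by blast
  qed
 qed
qed

lemma arep_sub:
 assumes "arep G p V" "asub G V N"
 shows "arep G p (V\<lparr>carrier := N\<rparr>)"
proof -
 interpret V: arep G p V by fact
 have sub: "N \<subseteq> carrier V" and z: "\<zero>\<^bsub>V\<^esub> \<in> N" and cl: "\<And>x y. x \<in> N \<Longrightarrow> y \<in> N \<Longrightarrow> x \<oplus>\<^bsub>V\<^esub> y \<in> N"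
  and ac: "\<And>g x. g \<in> carrier G \<Longrightarrow> x \<in> N \<Longrightarrow> act V g x \<in> N"
  using assms(2) by (auto simp: asub_def)
 have pw: "add_pow V (n::nat) x \<in> N" if "x \<in> N" for n x
  by (induct n) (use that z cl in \<open>auto simp: add_pow_def\<close>)
 have fin: "finite N" using sub finite_subset V.finite_carrier by blast
 have inv: "\<exists>y\<in>N. y \<oplus>\<^bsub>V\<^esub> x = \<zero>\<^bsub>V\<^esub>" if x: "x \<in> N" for x
 proof -
  obtain m where m: "p = Suc m"
   using V.prime_p not0_implies_Suc by (metis not_prime_0)
  have "add_pow V m x \<oplus>\<^bsub>V\<^esub> x = \<zero>\<^bsub>V\<^esub>"
   using V.torsion[of x] x sub m by (auto simp: add_pow_def)
  thus ?thesis using pw[OF x] by blast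
 qed
 have ab: "abelian_group (V\<lparr>carrier := N\<rparr>)"
  by (rule abelian_groupI) (use sub z cl inv in \<open>auto simp: V.V.a_ac subset_iff\<close>)
 have pw_eq: "add_pow (V\<lparr>carrier := N\<rparr>) (n::nat) x = add_pow V n x" for n x
  by (simp add: add_pow_def nat_pow_def)
 show ?thesis
  by (intro arep.intro arep_axioms.intro ab V.G.group_axioms V.prime_p)
   (use sub fin ac V.torsion V.act_mult in \<open>auto simp: pw_eq subset_iff\<close>)
qed

lemma schur_inj:
 assumes "airr G p U" "arep G p V" "f \<in> ahom G U V" "f \<noteq> (\<lambda>x\<in>carrier U. \<zero>\<^bsub>V\<^esub>)"
 shows "inj_on f (carrier U)"
proof -
 have U: "arep G p U" using assms(1) by (simp add: airr_def)
 let ?K = "{x \<in> carrier U. f x = \<zero>\<^bsub>V\<^esub>}"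
 have "?K = {\<zero>\<^bsub>U\<^esub>} \<or> ?K = carrier U"
  using asub_kernel[OF U assms(2,3)] assms(1) by (auto simp: airr_def)
 moreover have "?K \<noteq> carrier U"
 proof
  assume "?K = carrier U"
  hence "f = (\<lambda>x\<in>carrier U. \<zero>\<^bsub>V\<^esub>)"
   using ahom_ext[OF assms(3)] by (intro extensionalityI[where A = "carrier U"]) auto
  thus False using assms by simp
 qed
 ultimately show ?thesis using ahom_inj_iff[OF U assms(2,3)] by blast
qed

lemma schur_surj:
 assumes "arep G p U" "airr G p V" "f \<in> ahom G U V" "f \<noteq> (\<lambda>x\<in>carrier U. \<zero>\<^bsub>V\<^esub>)"
 shows "f ` carrier U = carrier V"
proof -
 have V: "arep G p V" using assms(2) by (simp add: airr_def)
 have "f ` carrier U = {\<zero>\<^bsub>V\<^esub>} \<or> f ` carrier U = carrier V"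
  using asub_image[OF assms(1) V assms(3)] assms(2) by (auto simp: airr_def)
 moreover have "f ` carrier U \<noteq> {\<zero>\<^bsub>V\<^esub>}"
 proof
  assume "f ` carrier U = {\<zero>\<^bsub>V\<^esub>}"
  hence "f = (\<lambda>x\<in>carrier U. \<zero>\<^bsub>V\<^esub>)"
   using ahom_ext[OF assms(3)] by (intro extensionalityI[where A = "carrier U"]) auto
  thus False using assms by simp
 qed
 ultimately show ?thesis by blast
qed

lemma schur_bij:
 assumes "airr G p U" "airr G p V" "f \<in> ahom G U V" "f \<noteq> (\<lambda>x\<in>carrier U. \<zero>\<^bsub>V\<^esub>)"
 shows "bij_betw f (carrier U) (carrier V)"
 using schur_inj[OF assms(1) _ assms(3,4)] schur_surj[OF _ assms(2-4)] assms(1,2)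
 by (auto simp: bij_betw_def airr_def)

lemma card_hom_noniso:
 assumes "airr G p U" "airr G p V" "\<not> aiso G U V"
 shows "card (ahom G U V) = 1"
proof -
 have "ahom G U V = {\<lambda>x\<in>carrier U. \<zero>\<^bsub>V\<^esub>}"
  using schur_bij[OF assms(1,2)] assms ahom_zero_map[of G p U V] by (auto simp: aiso_def airr_def)
 thus ?thesis by simp
qed

subsection \<open>Biproducts\<close>

text \<open>Direct sums are handled through injections and projections, so that the same lemmas serve internal
decompositions and products.\<close>

definition biprod where
 "biprod G U A B i1 i2 p1 p2 \<longleftrightarrow>
   i1 \<in> ahom G A U \<and> i2 \<in> ahom G B U \<and> p1 \<in> ahom G U A \<and> p2 \<in> ahom G U B \<and>
   (\<forall>a\<in>carrier A. p1 (i1 a) = a \<and> p2 (i1 a) = \<zero>\<^bsub>B\<^esub>) \<and>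
   (\<forall>b\<in>carrier B. p2 (i2 b) = b \<and> p1 (i2 b) = \<zero>\<^bsub>A\<^esub>) \<and>
   (\<forall>u\<in>carrier U. i1 (p1 u) \<oplus>\<^bsub>U\<^esub> i2 (p2 u) = u)"

locale biprod_rep = U: arep G p U + A: arep G p A + B: arep G p B
 for G :: "('g, 'm) monoid_scheme" and p :: nat
  and U :: "('u, 'v, 'g) rep" and A :: "('a, 'b, 'g) rep" and B :: "('c, 'd, 'g) rep" +
 fixes i1 i2 p1 p2
 assumes biprod: "biprod G U A B i1 i2 p1 p2"
begin

lemma i1: "i1 \<in> ahom G A U" and i2: "i2 \<in> ahom G B U"
 and p1: "p1 \<in> ahom G U A" and p2: "p2 \<in> ahom G U B"
 and p1i1 [simp]: "a \<in> carrier A \<Longrightarrow> p1 (i1 a) = a"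
 and p2i1 [simp]: "a \<in> carrier A \<Longrightarrow> p2 (i1 a) = \<zero>\<^bsub>B\<^esub>"
 and p2i2 [simp]: "b \<in> carrier B \<Longrightarrow> p2 (i2 b) = b"
 and p1i2 [simp]: "b \<in> carrier B \<Longrightarrow> p1 (i2 b) = \<zero>\<^bsub>A\<^esub>"
 and i1p1_i2p2: "u \<in> carrier U \<Longrightarrow> i1 (p1 u) \<oplus>\<^bsub>U\<^esub> i2 (p2 u) = u"
 using biprod by (auto simp: biprod_def)

lemmas cl [simp] = ahom_closed[OF i1] ahom_closed[OF i2] ahom_closed[OF p1] ahom_closed[OF p2]

lemma decomp_unique:
 assumes "a \<in> carrier A" "b \<in> carrier B"
 shows "p1 (i1 a \<oplus>\<^bsub>U\<^esub> i2 b) = a" "p2 (i1 a \<oplus>\<^bsub>U\<^esub> i2 b) = b"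
 using assms by (simp_all add: ahom_add[OF p1] ahom_add[OF p2])

lemma card_biprod: "card (carrier U) = card (carrier A) * card (carrier B)"
proof -
 have "bij_betw (\<lambda>u. (p1 u, p2 u)) (carrier U) (carrier A \<times> carrier B)"
  by (rule bij_betw_byWitness[where f' = "\<lambda>(a, b). i1 a \<oplus>\<^bsub>U\<^esub> i2 b"])
   (auto simp: i1p1_i2p2 decomp_unique)
 thus ?thesis by (simp add: bij_betw_same_card card_cartesian_product)
qed

lemma card_hom_from:
 assumes Z: "arep G p Z"
 shows "card (ahom G U Z) = card (ahom G A Z) * card (ahom G B Z)"
proof -
 interpret Z: arep G p Z by fact
 let ?F = "\<lambda>f. (compose (carrier A) f i1, compose (carrier B) f i2)"
 let ?H = "\<lambda>(f, h). \<lambda>u\<in>carrier U. f (p1 u) \<oplus>\<^bsub>Z\<^esub> h (p2 u)"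
 have H: "?H (f, h) \<in> ahom G U Z" if fh: "f \<in> ahom G A Z" "h \<in> ahom G B Z" for f h
 proof -
  have *: "f (p1 u) \<in> carrier Z" "h (p2 u) \<in> carrier Z" if "u \<in> carrier U" for u
   using that fh by (auto intro: ahom_closed)
  show ?thesis
   by (intro ahomI) (use * fh in \<open>auto simp: ahom_add[OF p1] ahom_add[OF p2] ahom_add
    ahom_act[OF p1] ahom_act[OF p2] ahom_act Z.V.a_ac\<close>)
 qed
 have "bij_betw ?F (ahom G U Z) (ahom G A Z \<times> ahom G B Z)"
 proof (rule bij_betw_byWitness[where f' = ?H])
  show "\<forall>f\<in>ahom G U Z. ?H (?F f) = f"
  proof
   fix f assume f: "f \<in> ahom G U Z"
   have "?H (?F f) \<in> ahom G U Z"
    using H ahom_compose[OF A.arep_axioms i1 f] ahom_compose[OF B.arep_axioms i2 f] by auto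
   thus "?H (?F f) = f"
    by (rule ahom_eqI[OF _ f]) (auto simp: compose_def ahom_add[OF f, symmetric] i1p1_i2p2)
  qed
  show "\<forall>fh\<in>ahom G A Z \<times> ahom G B Z. ?F (?H fh) = fh"
  proof
   fix fh assume "fh \<in> ahom G A Z \<times> ahom G B Z"
   then obtain f h where fh_eq: "fh = (f, h)" and fh: "f \<in> ahom G A Z" "h \<in> ahom G B Z" by blast
   have z: "f \<zero>\<^bsub>A\<^esub> = \<zero>\<^bsub>Z\<^esub>" "h \<zero>\<^bsub>B\<^esub> = \<zero>\<^bsub>Z\<^esub>"
    using ahom_zero[OF A.arep_axioms Z fh(1)] ahom_zero[OF B.arep_axioms Z fh(2)] .
   have "compose (carrier A) (?H (f, h)) i1 = f"
    using ahom_compose[OF A.arep_axioms i1 H[OF fh]] fh(1)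
    by (rule ahom_eqI) (use fh z in \<open>auto simp: compose_def ahom_closed\<close>)
   moreover have "compose (carrier B) (?H (f, h)) i2 = h"
    using ahom_compose[OF B.arep_axioms i2 H[OF fh]] fh(2)
    by (rule ahom_eqI) (use fh z in \<open>auto simp: compose_def ahom_closed\<close>)
   ultimately show "?F (?H fh) = fh" by (simp add: fh_eq)
  qed
  show "?F ` ahom G U Z \<subseteq> ahom G A Z \<times> ahom G B Z"
   using ahom_compose[OF A.arep_axioms i1] ahom_compose[OF B.arep_axioms i2] by auto
  show "?H ` (ahom G A Z \<times> ahom G B Z) \<subseteq> ahom G U Z" using H by auto
 qed
 thus ?thesis by (simp add: bij_betw_same_card card_cartesian_product)
qed

text \<open>For irreducible \<open>B\<close> a pair \<open>(f, h)\<close> with \<open>f\<close> surjective onto \<open>A\<close> is surjective onto the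
 biproduct iff \<open>h\<close> does not vanish on the kernel of \<open>f\<close>, that is, iff \<open>h\<close> does not factor
 through \<open>f\<close>.\<close>

lemma card_sur_to:
 assumes Z: "arep G p Z" and irr: "airr G p B"
 shows "card (asur G Z U) = card (asur G Z A) * (card (ahom G Z B) - card (ahom G A B))"
proof -
 interpret Z: arep G p Z by fact
 define K where "K f = {x \<in> carrier Z. f x = \<zero>\<^bsub>A\<^esub>}" for f
 define Fac where "Fac f = (\<lambda>c. compose (carrier Z) c f) ` ahom G A B" for f
 have Fac_sub: "Fac f \<subseteq> ahom G Z B" if "f \<in> ahom G Z A" for f
  unfolding Fac_def using ahom_compose[OF Z that] by auto
 have Fac_iff: "h \<in> Fac f \<longleftrightarrow> (\<forall>x\<in>K f. h x = \<zero>\<^bsub>B\<^esub>)" if f: "f \<in> asur G Z A" and h: "h \<in> ahom G Z B" for f h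
 proof
  have fh: "f \<in> ahom G Z A" and fs: "f ` carrier Z = carrier A" using f by (auto simp: asur_def)
  assume "h \<in> Fac f"
  then obtain c where c: "c \<in> ahom G A B" "h = compose (carrier Z) c f" by (auto simp: Fac_def)
  show "\<forall>x\<in>K f. h x = \<zero>\<^bsub>B\<^esub>"
   using c ahom_zero[OF A.arep_axioms B.arep_axioms c(1)] by (auto simp: K_def compose_def)
 next
  have fh: "f \<in> ahom G Z A" and fs: "f ` carrier Z = carrier A" using f by (auto simp: asur_def)
  assume z: "\<forall>x\<in>K f. h x = \<zero>\<^bsub>B\<^esub>"
  define s where "s = inv_into (carrier Z) f"
  have s: "s a \<in> carrier Z" "f (s a) = a" if "a \<in> carrier A" for a
   using that fs by (auto simp: s_def inv_into_into f_inv_into_f)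
  have key: "h x = h y" if "x \<in> carrier Z" "y \<in> carrier Z" "f x = f y" for x y
  proof -
   have "f (x \<ominus>\<^bsub>Z\<^esub> y) = \<zero>\<^bsub>A\<^esub>"
    using that ahom_diff_zero[OF Z A.arep_axioms fh] by blast
   hence "h (x \<ominus>\<^bsub>Z\<^esub> y) = \<zero>\<^bsub>B\<^esub>" using z that by (auto simp: K_def)
   thus ?thesis using that ahom_diff_zero[OF Z B.arep_axioms h] by blast
  qed
  define c where "c = (\<lambda>a\<in>carrier A. h (s a))"
  have "c \<in> ahom G A B"
  proof (intro ahomI)
   fix a b assume ab: "a \<in> carrier A" "b \<in> carrier A"
   have "h (s (a \<oplus>\<^bsub>A\<^esub> b)) = h (s a \<oplus>\<^bsub>Z\<^esub> s b)"
    by (rule key) (use ab s fh in \<open>auto simp: ahom_add\<close>)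
   thus "c (a \<oplus>\<^bsub>A\<^esub> b) = c a \<oplus>\<^bsub>B\<^esub> c b" using ab s h by (simp add: c_def ahom_add)
  next
   fix g a assume ga: "g \<in> carrier G" "a \<in> carrier A"
   have "h (s (act A g a)) = h (act Z g (s a))"
    by (rule key) (use ga s fh in \<open>auto simp: ahom_act\<close>)
   thus "c (act A g a) = act B g (c a)" using ga s h by (simp add: c_def ahom_act)
  qed (use s h in \<open>auto simp: c_def intro: ahom_closed\<close>)
  moreover have "h = compose (carrier Z) c f"
  proof (rule extensionalityI[where A = "carrier Z"])
   fix x assume x: "x \<in> carrier Z"
   have "h x = h (s (f x))" by (rule key) (use x s fh in \<open>auto simp: ahom_closed\<close>)
   thus "h x = compose (carrier Z) c f x" using x fh by (simp add: c_def compose_def ahom_closed)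
  qed (use h ahom_ext in auto)
  ultimately show "h \<in> Fac f" unfolding Fac_def by blast
 qed
 have card_Fac: "card (Fac f) = card (ahom G A B)" if f: "f \<in> asur G Z A" for f
 proof -
  have fh: "f \<in> ahom G Z A" and fs: "f ` carrier Z = carrier A" using f by (auto simp: asur_def)
  have "inj_on (\<lambda>c. compose (carrier Z) c f) (ahom G A B)"
  proof (rule inj_onI)
   fix c d assume cd: "c \<in> ahom G A B" "d \<in> ahom G A B" "compose (carrier Z) c f = compose (carrier Z) d f"
   show "c = d"
   proof (rule ahom_eqI[OF cd(1,2)])
    fix a assume "a \<in> carrier A"
    then obtain x where x: "x \<in> carrier Z" "a = f x" using fs by blast
    show "c a = d a" using fun_cong[OF cd(3), of x] x by (simp add: compose_def)
   qed
  qed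
  thus ?thesis by (simp add: Fac_def card_image)
 qed
 define S where "S = (SIGMA f:asur G Z A. ahom G Z B - Fac f)"
 let ?F = "\<lambda>f. (compose (carrier Z) p1 f, compose (carrier Z) p2 f)"
 let ?H = "\<lambda>(f, h). \<lambda>x\<in>carrier Z. i1 (f x) \<oplus>\<^bsub>U\<^esub> i2 (h x)"
 have H: "?H (f, h) \<in> ahom G Z U" if fh: "f \<in> ahom G Z A" "h \<in> ahom G Z B" for f h
 proof -
  have *: "f u \<in> carrier A" "h u \<in> carrier B" if "u \<in> carrier Z" for u
   using that fh by (auto intro: ahom_closed)
  show ?thesis
   by (intro ahomI) (use * fh in \<open>auto simp: ahom_add[OF i1] ahom_add[OF i2] ahom_add
    ahom_act[OF i1] ahom_act[OF i2] ahom_act U.V.a_ac\<close>)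
 qed
 have "bij_betw ?F (asur G Z U) S"
 proof (rule bij_betw_byWitness[where f' = ?H])
  show "\<forall>f\<in>asur G Z U. ?H (?F f) = f"
  proof
   fix f assume "f \<in> asur G Z U"
   hence f: "f \<in> ahom G Z U" by (simp add: asur_def)
   have "?H (?F f) \<in> ahom G Z U"
    using H ahom_compose[OF Z f p1] ahom_compose[OF Z f p2] by auto
   thus "?H (?F f) = f"
    by (rule ahom_eqI[OF _ f]) (use f in \<open>auto simp: compose_def i1p1_i2p2 ahom_closed\<close>)
  qed
  show "\<forall>fh\<in>S. ?F (?H fh) = fh"
  proof
   fix fh assume "fh \<in> S"
   then obtain f h where fh_eq: "fh = (f, h)" and fh: "f \<in> ahom G Z A" "h \<in> ahom G Z B"
    by (auto simp: S_def asur_def)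
   have "compose (carrier Z) p1 (?H (f, h)) = f"
    using ahom_compose[OF Z H[OF fh] p1] fh(1)
    by (rule ahom_eqI) (use fh in \<open>auto simp: compose_def ahom_closed decomp_unique\<close>)
   moreover have "compose (carrier Z) p2 (?H (f, h)) = h"
    using ahom_compose[OF Z H[OF fh] p2] fh(2)
    by (rule ahom_eqI) (use fh in \<open>auto simp: compose_def ahom_closed decomp_unique\<close>)
   ultimately show "?F (?H fh) = fh" by (simp add: fh_eq)
  qed
  show "?F ` asur G Z U \<subseteq> S"
  proof (rule image_subsetI)
   fix f assume "f \<in> asur G Z U"
   hence f: "f \<in> ahom G Z U" and fs: "f ` carrier Z = carrier U" by (auto simp: asur_def)
   define f1 where "f1 = compose (carrier Z) p1 f"
   define f2 where "f2 = compose (carrier Z) p2 f"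
   have f1: "f1 \<in> ahom G Z A" unfolding f1_def by (rule ahom_compose[OF Z f p1])
   have f2: "f2 \<in> ahom G Z B" unfolding f2_def by (rule ahom_compose[OF Z f p2])
   have "a \<in> f1 ` carrier Z" if a: "a \<in> carrier A" for a
   proof -
    obtain x where "x \<in> carrier Z" "f x = i1 a" using a fs cl(1) by (metis imageE)
    thus ?thesis using a by (auto simp: f1_def compose_def intro!: image_eqI[of _ _ x])
   qed
   hence f1s: "f1 \<in> asur G Z A" using f1 by (auto simp: asur_def ahom_closed)
   have "\<not> (\<forall>x\<in>K f1. f2 x = \<zero>\<^bsub>B\<^esub>)"
   proof -
    obtain b where b: "b \<in> carrier B" "b \<noteq> \<zero>\<^bsub>B\<^esub>" using irr B.V.zero_closed by (force simp: airr_def)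
    obtain x where "x \<in> carrier Z" "f x = i2 b" using b fs cl(2) by (metis imageE)
    hence "x \<in> K f1" "f2 x \<noteq> \<zero>\<^bsub>B\<^esub>"
     using b by (simp_all add: K_def f1_def f2_def compose_def)
    thus ?thesis by blast
   qed
   hence "f2 \<notin> Fac f1" using Fac_iff[OF f1s f2] by simp
   thus "(compose (carrier Z) p1 f, compose (carrier Z) p2 f) \<in> S"
    unfolding f1_def[symmetric] f2_def[symmetric] S_def using f1s f2 by blast
  qed
  show "?H ` S \<subseteq> asur G Z U"
  proof (rule image_subsetI)
   fix fh assume "fh \<in> S"
   then obtain f h where fh_eq: "fh = (f, h)" and "(f, h) \<in> S" by (cases fh) auto
   hence fs: "f \<in> asur G Z A" and h: "h \<in> ahom G Z B" and nf: "h \<notin> Fac f" by (auto simp: S_def)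
   have f: "f \<in> ahom G Z A" and fi: "f ` carrier Z = carrier A" using fs by (auto simp: asur_def)
   have nz: "\<exists>x\<in>K f. h x \<noteq> \<zero>\<^bsub>B\<^esub>" using Fac_iff[OF fs h] nf by simp
   have subK: "asub G Z (K f)" unfolding K_def by (rule asub_kernel[OF Z A.arep_axioms f])
   define Z' where "Z' = Z\<lparr>carrier := K f\<rparr>"
   have Z': "arep G p Z'" unfolding Z'_def by (rule arep_sub[OF Z subK])
   have Ksub: "K f \<subseteq> carrier Z" by (auto simp: K_def)
   define h' where "h' = restrict h (K f)"
   have "h' \<in> ahom G Z' B"
    using h Ksub subK by (intro ahomI) (auto simp: h'_def Z'_def ahom_add ahom_act ahom_closed subset_iff asub_def)
   moreover have "h' \<noteq> (\<lambda>x\<in>carrier Z'. \<zero>\<^bsub>B\<^esub>)"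
    using nz by (auto simp: h'_def Z'_def fun_eq_iff restrict_def)
   ultimately have "h' ` carrier Z' = carrier B" using schur_surj[OF Z' irr] by blast
   hence hK: "h ` K f = carrier B" by (auto simp: Z'_def h'_def image_def restrict_def)
   have "u \<in> ?H (f, h) ` carrier Z" if u: "u \<in> carrier U" for u
   proof -
    obtain x where x: "x \<in> carrier Z" "f x = p1 u" using fi u cl(3) by (metis imageE)
    have "p2 u \<ominus>\<^bsub>B\<^esub> h x \<in> carrier B" using u x h by (auto intro: ahom_closed)
    then obtain k where k: "k \<in> K f" "h k = p2 u \<ominus>\<^bsub>B\<^esub> h x" using hK by (metis imageE)
    have kX: "k \<in> carrier Z" "f k = \<zero>\<^bsub>A\<^esub>" using k by (auto simp: K_def)
    have 1: "f (k \<oplus>\<^bsub>Z\<^esub> x) = p1 u" using kX x u f by (simp add: ahom_add)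
    have 2: "h (k \<oplus>\<^bsub>Z\<^esub> x) = p2 u"
     using kX x u h k by (simp add: ahom_add a_minus_def B.V.a_assoc B.V.l_neg ahom_closed)
    have "u = ?H (f, h) (k \<oplus>\<^bsub>Z\<^esub> x)" using kX x u 1 2 by (simp add: i1p1_i2p2)
    thus ?thesis by (rule image_eqI) (use kX x in simp)
   qed
   moreover have "?H (f, h) ` carrier Z \<subseteq> carrier U"
    by (rule image_subsetI) (rule ahom_closed[OF H[OF f h]])
   ultimately show "?H fh \<in> asur G Z U" using H[OF f h] unfolding asur_def fh_eq by blast
  qed
 qed
 hence "card (asur G Z U) = card S" by (rule bij_betw_same_card)
 also have "\<dots> = (\<Sum>f\<in>asur G Z A. card (ahom G Z B - Fac f))"
  unfolding S_def using ahom_finite[OF Z A.arep_axioms] ahom_finite[OF Z B.arep_axioms]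
  by (intro card_SigmaI) (auto simp: asur_def)
 also have "\<dots> = (\<Sum>f\<in>asur G Z A. card (ahom G Z B) - card (ahom G A B))"
 proof (rule sum.cong[OF refl])
  fix f assume f: "f \<in> asur G Z A"
  hence "Fac f \<subseteq> ahom G Z B" using Fac_sub[of f] unfolding asur_def by blast
  thus "card (ahom G Z B - Fac f) = card (ahom G Z B) - card (ahom G A B)"
   using card_Fac[OF f] ahom_finite[OF Z B.arep_axioms]
   by (subst card_Diff_subset) (auto dest: finite_subset)
 qed
 finally show ?thesis by simp
qed

end

subsection \<open>Maschke's theorem\<close>

context arep
begin

lemma pow_closed [simp]: "x \<in> carrier V \<Longrightarrow> add_pow V (n::nat) x \<in> carrier V"
 by (rule V.add.nat_pow_closed)

lemma pow_0 [simp]: "add_pow V (0::nat) x = \<zero>" by (simp add: add_pow_def)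

lemma pow_Suc: "add_pow V (Suc n) x = add_pow V n x \<oplus> x" by (simp add: add_pow_def)

lemma pow_add: "x \<in> carrier V \<Longrightarrow> add_pow V ((m::nat) + n) x = add_pow V m x \<oplus> add_pow V n x"
 by (simp add: V.add.nat_pow_mult)

lemma pow_pow: "x \<in> carrier V \<Longrightarrow> add_pow V (m::nat) (add_pow V (n::nat) x) = add_pow V (n * m) x"
 by (simp add: V.add.nat_pow_pow)

lemma pow_distrib: "x \<in> carrier V \<Longrightarrow> y \<in> carrier V
  \<Longrightarrow> add_pow V (n::nat) (x \<oplus> y) = add_pow V n x \<oplus> add_pow V n y"
 by (rule V.add.nat_pow_distrib)

lemma pow_mod:
 assumes "x \<in> carrier V" shows "add_pow V (n mod p) x = add_pow V n x"
proof -
 have "add_pow V (p * (n div p)) x = \<zero>"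
  using assms torsion[OF assms] pow_pow[OF assms, of "n div p" p] by simp
 hence "add_pow V (p * (n div p) + n mod p) x = add_pow V (n mod p) x"
  using assms by (simp only: pow_add) simp
 thus ?thesis by simp
qed

text \<open>Multiplication by a number prime to \<open>p\<close> is invertible, and the inverse does not depend on the vector.\<close>

lemma pow_inverse:
 assumes "x \<in> carrier V" "\<not> p dvd k"
 obtains m :: nat where "\<And>x. x \<in> carrier V \<Longrightarrow> add_pow V m (add_pow V k x) = x"
proof -
 have "coprime k p" using prime_p assms(2) by (metis coprime_commute prime_imp_coprime)
 then obtain m where m: "[k * m = 1] (mod p)" using cong_solve_coprime_nat[of k p] by auto
 have "add_pow V m (add_pow V k x) = x" if x: "x \<in> carrier V" for x
 proof -
  have "add_pow V m (add_pow V k x) = add_pow V ((k * m) mod p) x"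
   using x by (simp add: pow_pow pow_mod)
  also have "(k * m) mod p = 1"
   using m prime_gt_1_nat[OF prime_p] by (simp add: cong_def)
  finally show ?thesis using x by (simp add: add_pow_def)
 qed
 thus ?thesis using that by blast
qed

lemma act_pow:
 assumes "g \<in> carrier G" "x \<in> carrier V"
 shows "act V g (add_pow V (n::nat) x) = add_pow V n (act V g x)"
 by (induct n) (use assms in \<open>auto simp: pow_Suc\<close>)

lemma asub_pow: "asub H V N \<Longrightarrow> x \<in> N \<Longrightarrow> add_pow V (n::nat) x \<in> N"
 by (induct n) (auto simp: pow_Suc asub_def)

lemma asub_neg:
 assumes "asub H V N" "x \<in> N" shows "\<ominus> x \<in> N"
proof -
 have x: "x \<in> carrier V" using assms by (auto simp: asub_def)
 have "add_pow V (p - 1) x \<oplus> x = \<zero>"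
  using pow_Suc[of "p - 1" x] torsion[OF x] prime_gt_0_nat[OF prime_p] by simp
 hence "\<ominus> x = add_pow V (p - 1) x" using x by (simp add: V.minus_equality)
 thus ?thesis using asub_pow[OF assms] by simp
qed

lemma act_finsum:
 assumes "finite S" "g \<in> carrier G" "f \<in> S \<rightarrow> carrier V"
 shows "act V g (finsum V f S) = finsum V (\<lambda>s. act V g (f s)) S"
 using assms
proof (induct S)
 case (insert s S)
 have f: "f \<in> S \<rightarrow> carrier V" "f s \<in> carrier V" using insert by auto
 hence f': "(\<lambda>s. act V g (f s)) \<in> S \<rightarrow> carrier V" using insert.prems by (simp add: Pi_iff)
 show ?case using insert f f' by (simp add: V.finsum_insert V.finsum_closed)
qed auto

lemma asub_finsum:
 assumes "finite S" "asub H V N" "f \<in> S \<rightarrow> N"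
 shows "finsum V f S \<in> N"
 using assms
proof (induct S)
 case (insert s S)
 have "f \<in> S \<rightarrow> carrier V" "f s \<in> carrier V" using insert by (auto simp: asub_def)
 thus ?case using insert by (auto simp: V.finsum_insert asub_def)
qed (auto simp: asub_def)

lemma finsum_const_pow:
 assumes "finite S" "x \<in> carrier V"
 shows "finsum V (\<lambda>_. x) S = add_pow V (card S) x"
 using assms by (induct S) (auto simp: V.finsum_insert pow_Suc V.a_comm)

text \<open>A complement of \<open>N\<close> is a subgroup that is maximal among those meeting \<open>N\<close> trivially: if it
 and \<open>N\<close> did not span, then adjoining a further element would keep the intersection trivial,
 because nonzero multiples modulo \<open>p\<close> can be divided out.\<close>

lemma linear_retraction:
 assumes N: "asub G V N"
 obtains r where "\<And>x. x \<in> carrier V \<Longrightarrow> r x \<in> N" "\<And>x. x \<in> N \<Longrightarrow> r x = x"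
  "\<And>x y. x \<in> carrier V \<Longrightarrow> y \<in> carrier V \<Longrightarrow> r (x \<oplus> y) = r x \<oplus> r y"
proof -
 have Nc: "N \<subseteq> carrier V" "\<zero> \<in> N" and Na: "\<And>x y. x \<in> N \<Longrightarrow> y \<in> N \<Longrightarrow> x \<oplus> y \<in> N"
  using N by (auto simp: asub_def)
 define P where "P C \<longleftrightarrow> C \<subseteq> carrier V \<and> \<zero> \<in> C \<and> (\<forall>x\<in>C. \<forall>y\<in>C. x \<oplus> y \<in> C) \<and> C \<inter> N = {\<zero>}" for C
 have "P {\<zero>}" using Nc by (auto simp: P_def)
 moreover have "\<And>C. P C \<Longrightarrow> card C < Suc (card (carrier V))"
  by (auto simp: P_def less_Suc_eq_le intro: card_mono)
 ultimately obtain C where C: "P C" and max: "\<And>D. P D \<Longrightarrow> card D \<le> card C"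
  using ex_has_greatest_nat[of P "{\<zero>}" card "Suc (card (carrier V))"] by (metis less_imp_le)
 have Cc: "C \<subseteq> carrier V" "\<zero> \<in> C" "C \<inter> N = {\<zero>}" and Ca: "\<And>x y. x \<in> C \<Longrightarrow> y \<in> C \<Longrightarrow> x \<oplus> y \<in> C"
  using C by (auto simp: P_def)
 \<comment> \<open>Only closure of \<open>C\<close> under addition matters, so it is regarded as stable under the trivial group.\<close>
 define G1 :: "('g, 'm) monoid_scheme" where "G1 = G\<lparr>carrier := {}\<rparr>"
 have sC: "asub G1 V C" using Cc Ca by (auto simp: asub_def G1_def)
 have Cneg: "\<And>x. x \<in> C \<Longrightarrow> \<ominus> x \<in> C" using asub_neg[OF sC] .
 have Nneg: "\<And>x. x \<in> N \<Longrightarrow> \<ominus> x \<in> N" using asub_neg[OF N] .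
 have span: "\<exists>c\<in>C. \<exists>n\<in>N. x = n \<oplus> c" if x: "x \<in> carrier V" for x
 proof (rule ccontr)
  assume no: "\<not> ?thesis"
  define D where "D = {c \<oplus> add_pow V k x | c (k::nat). c \<in> C}"
  have "P D" unfolding P_def
  proof (intro conjI ballI equalityI subsetI)
   show "\<And>y. y \<in> D \<Longrightarrow> y \<in> carrier V" using Cc x by (auto simp: D_def)
   have "\<zero> \<oplus> add_pow V (0::nat) x \<in> D" unfolding D_def using Cc by blast
   thus z: "\<zero> \<in> D" by simp
   fix y z assume "y \<in> D" "z \<in> D"
   then obtain c k d l where *: "y = c \<oplus> add_pow V (k::nat) x" "z = d \<oplus> add_pow V (l::nat) x" "c \<in> C" "d \<in> C"
    by (auto simp: D_def)
   hence "y \<oplus> z = (c \<oplus> d) \<oplus> add_pow V (k + l) x"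
    using Cc x by (simp add: subset_iff pow_add V.a_ac)
   thus "y \<oplus> z \<in> D" using Ca[OF *(3,4)] unfolding D_def by blast
  next
   fix y assume "y \<in> D \<inter> N"
   then obtain c k where *: "y = c \<oplus> add_pow V (k::nat) x" "c \<in> C" "y \<in> N" by (auto simp: D_def)
   have cV: "c \<in> carrier V" "y \<in> carrier V" using * Cc Nc by auto
   show "y \<in> {\<zero>}"
   proof (cases "p dvd k")
    case True
    hence "add_pow V k x = \<zero>" using pow_mod[OF x, of k] by (simp add: dvd_eq_mod_eq_0)
    hence "y = c" using * cV by simp
    thus ?thesis using * Cc by auto
   next
    case False
    obtain m :: nat where m: "\<And>x. x \<in> carrier V \<Longrightarrow> add_pow V m (add_pow V k x) = x"
     using pow_inverse[OF x False] by blast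
    have "add_pow V k x = y \<oplus> \<ominus> c"
     using * cV x by (simp add: V.a_ac V.r_neg2 V.r_neg1)
    hence "x = add_pow V m y \<oplus> add_pow V m (\<ominus> c)"
     using m[OF x] cV by (simp add: pow_distrib)
    moreover have "add_pow V m y \<in> N" "add_pow V m (\<ominus> c) \<in> C"
     using asub_pow[OF N *(3)] asub_pow[OF sC Cneg[OF *(2)]] .
    ultimately show ?thesis using no by blast
   qed
  next
   fix y assume "y \<in> {\<zero>}"
   moreover have "\<zero> \<oplus> add_pow V (0::nat) x \<in> D" unfolding D_def using Cc by blast
   ultimately show "y \<in> D \<inter> N" using Nc by simp
  qed
  moreover have "C \<subset> D"
  proof
   have "c \<oplus> add_pow V (0::nat) x \<in> D" if "c \<in> C" for c unfolding D_def using that by blast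
   thus "C \<subseteq> D" using Cc by force
   have "\<zero> \<oplus> add_pow V (1::nat) x \<in> D" unfolding D_def using Cc by blast
   moreover have "add_pow V (1::nat) x = x" using x by (simp add: add_pow_def)
   ultimately have "x \<in> D" using x by simp
   moreover have "x \<notin> C" using no Nc x by (metis V.l_zero)
   ultimately show "C \<noteq> D" by blast
  qed
  ultimately show False
   using max[of D] psubset_card_mono[of D C] finite_subset[OF _ finite_carrier, of D]
   by (auto simp: P_def)
 qed
 have uniq: "n = n'" if h: "c \<in> C" "c' \<in> C" "n \<in> N" "n' \<in> N" "n \<oplus> c = n' \<oplus> c'" for c c' n n'
 proof -
  have V: "c \<in> carrier V" "c' \<in> carrier V" "n \<in> carrier V" "n' \<in> carrier V" using h Cc Nc by auto
  have "n \<oplus> \<ominus> n' = c' \<oplus> \<ominus> c"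
  proof -
   have "(n \<oplus> \<ominus> n') \<oplus> (n' \<oplus> c) = (n \<oplus> c) \<oplus> (\<ominus> n' \<oplus> n')"
    using V by (simp only: V.a_ac V.a_closed V.a_inv_closed)
   also have "\<dots> = (n' \<oplus> c') \<oplus> (\<ominus> c \<oplus> c)" using V h(5) by (simp add: V.l_neg)
   also have "\<dots> = (c' \<oplus> \<ominus> c) \<oplus> (n' \<oplus> c)"
    using V by (simp only: V.a_ac V.a_closed V.a_inv_closed)
   finally show ?thesis using V by (simp only: V.add.r_cancel V.a_closed V.a_inv_closed)
  qed
  moreover have "n \<oplus> \<ominus> n' \<in> N" "c' \<oplus> \<ominus> c \<in> C" using h Na Ca Nneg Cneg by auto
  ultimately have "n \<ominus> n' = \<zero>" using Cc by (auto simp: a_minus_def)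
  thus ?thesis using diff_zero_iff V by blast
 qed
 define r where "r x = (SOME n. n \<in> N \<and> (\<exists>c\<in>C. x = n \<oplus> c))" for x
 have r: "r x \<in> N" "\<exists>c\<in>C. x = r x \<oplus> c" if "x \<in> carrier V" for x
  using someI_ex[of "\<lambda>n. n \<in> N \<and> (\<exists>c\<in>C. x = n \<oplus> c)"] span[OF that] unfolding r_def by blast+
 have req: "r (n \<oplus> c) = n" if nc: "n \<in> N" "c \<in> C" for n c
 proof -
  have "n \<oplus> c \<in> carrier V" using nc Nc Cc by auto
  from r[OF this] obtain c' where "r (n \<oplus> c) \<in> N" "c' \<in> C" "n \<oplus> c = r (n \<oplus> c) \<oplus> c'" by blast
  thus ?thesis using uniq[OF nc(2) _ nc(1)] by metis
 qed
 show ?thesis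
 proof (rule that)
  show "r x \<in> N" if "x \<in> carrier V" for x using r that by blast
  show "r x = x" if "x \<in> N" for x using req[OF that Cc(2)] that Nc by auto
  show "r (x \<oplus> y) = r x \<oplus> r y" if xy: "x \<in> carrier V" "y \<in> carrier V" for x y
  proof -
   obtain c where c: "c \<in> C" "x = r x \<oplus> c" using r[OF xy(1)] by blast
   obtain d where d: "d \<in> C" "y = r y \<oplus> d" using r[OF xy(2)] by blast
   have cd: "c \<in> carrier V" "d \<in> carrier V" "r x \<in> carrier V" "r y \<in> carrier V" using c d Cc r xy Nc by auto
   have "x \<oplus> y = (r x \<oplus> c) \<oplus> (r y \<oplus> d)" using c(2) d(2) by simp
   also have "\<dots> = (r x \<oplus> r y) \<oplus> (c \<oplus> d)" using cd by (simp add: V.a_ac)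
   finally show ?thesis using req Na Ca c d r xy by metis
  qed
 qed
qed

text \<open>Averaging a linear retraction over the group makes it equivariant; its kernel is the
 complement.\<close>

lemma maschke:
 assumes N: "asub G V N" and fin: "finite (carrier G)" and cop: "\<not> p dvd card (carrier G)"
 obtains K i1 i2 p1 p2 where "asub G V K"
  "biprod G V (V\<lparr>carrier := N\<rparr>) (V\<lparr>carrier := K\<rparr>) i1 i2 p1 p2"
proof -
 have Nc: "N \<subseteq> carrier V" "\<zero> \<in> N" and Na: "\<And>x y. x \<in> N \<Longrightarrow> y \<in> N \<Longrightarrow> x \<oplus> y \<in> N"
  and Nact: "\<And>g x. g \<in> carrier G \<Longrightarrow> x \<in> N \<Longrightarrow> act V g x \<in> N"
  using N by (auto simp: asub_def)
 obtain r where r: "\<And>x. x \<in> carrier V \<Longrightarrow> r x \<in> N" "\<And>x. x \<in> N \<Longrightarrow> r x = x"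
  "\<And>x y. x \<in> carrier V \<Longrightarrow> y \<in> carrier V \<Longrightarrow> r (x \<oplus> y) = r x \<oplus> r y"
  using linear_retraction[OF N] by blast
 obtain m :: nat where m: "\<And>x. x \<in> carrier V \<Longrightarrow> add_pow V m (add_pow V (card (carrier G)) x) = x"
  using pow_inverse[OF V.zero_closed cop] by blast
 \<comment> \<open>The summands of the average of \<open>r\<close> over the group; \<open>m\<close> inverts the group order modulo \<open>p\<close>.\<close>
 define t where "t x g = act V g (r (act V (inv\<^bsub>G\<^esub> g) x))" for x g
 have tN: "t x \<in> carrier G \<rightarrow> N" if "x \<in> carrier V" for x using that r Nact by (auto simp: t_def)
 have tV: "t x \<in> carrier G \<rightarrow> carrier V" if "x \<in> carrier V" for x using tN[OF that] Nc by auto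
 define s where "s x = finsum V (t x) (carrier G)" for x
 have sN: "s x \<in> N" if "x \<in> carrier V" for x unfolding s_def by (rule asub_finsum[OF fin N tN[OF that]])
 have sV: "s x \<in> carrier V" if "x \<in> carrier V" for x using sN[OF that] Nc by auto
 have s_add: "s (x \<oplus> y) = s x \<oplus> s y" if xy: "x \<in> carrier V" "y \<in> carrier V" for x y
 proof -
  have "s (x \<oplus> y) = finsum V (\<lambda>g. t x g \<oplus> t y g) (carrier G)"
   unfolding s_def
  proof (rule V.finsum_cong'[OF refl])
   show "(\<lambda>g. t x g \<oplus> t y g) \<in> carrier G \<rightarrow> carrier V" using tV[OF xy(1)] tV[OF xy(2)] by auto
   fix g assume g: "g \<in> carrier G"
   have "r (act V (inv\<^bsub>G\<^esub> g) x) \<in> carrier V" "r (act V (inv\<^bsub>G\<^esub> g) y) \<in> carrier V"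
    using g xy r(1) Nc by (meson G.inv_closed act_closed subsetD)+
   thus "t (x \<oplus> y) g = t x g \<oplus> t y g" using g xy r by (simp add: t_def)
  qed
  also have "\<dots> = s x \<oplus> s y" unfolding s_def using V.finsum_addf[OF tV[OF xy(1)] tV[OF xy(2)]] .
  finally show ?thesis .
 qed
 have s_act: "s (act V h x) = act V h (s x)" if hx: "h \<in> carrier G" "x \<in> carrier V" for h x
 proof -
  have "act V h (s x) = finsum V (\<lambda>g. act V h (t x g)) (carrier G)"
   unfolding s_def by (rule act_finsum[OF fin hx(1) tV[OF hx(2)]])
  also have "\<dots> = finsum V (\<lambda>g. t (act V h x) (h \<otimes>\<^bsub>G\<^esub> g)) (carrier G)"
  proof (rule V.finsum_cong'[OF refl])
   show "(\<lambda>g. t (act V h x) (h \<otimes>\<^bsub>G\<^esub> g)) \<in> carrier G \<rightarrow> carrier V"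
    using tV[of "act V h x"] hx by auto
   fix g assume g: "g \<in> carrier G"
   have "act V (inv\<^bsub>G\<^esub> (h \<otimes>\<^bsub>G\<^esub> g)) (act V h x) = act V (inv\<^bsub>G\<^esub> g) x"
    using g hx by (simp add: G.inv_mult_group act_mult)
   thus "act V h (t x g) = t (act V h x) (h \<otimes>\<^bsub>G\<^esub> g)"
    using g hx r(1)[of "act V (inv\<^bsub>G\<^esub> g) x"] Nc by (simp add: t_def act_mult subset_iff)
  qed
  also have "\<dots> = finsum V (t (act V h x)) ((\<lambda>g. h \<otimes>\<^bsub>G\<^esub> g) ` carrier G)"
   by (rule V.finsum_reindex[symmetric]) (use tV[of "act V h x"] hx in \<open>auto simp: inj_on_def\<close>)
  also have "(\<lambda>g. h \<otimes>\<^bsub>G\<^esub> g) ` carrier G = carrier G" using hx by (simp add: G.surj_const_mult)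
  finally show ?thesis by (simp add: s_def)
 qed
 have s_N: "s x = add_pow V (card (carrier G)) x" if x: "x \<in> N" for x
 proof -
  have xV: "x \<in> carrier V" using x Nc by auto
  have "s x = finsum V (\<lambda>_. x) (carrier G)" unfolding s_def
  proof (rule V.finsum_cong'[OF refl])
   fix g assume g: "g \<in> carrier G"
   have "r (act V (inv\<^bsub>G\<^esub> g) x) = act V (inv\<^bsub>G\<^esub> g) x" using g x Nact r(2) by auto
   thus "t x g = x" using g xV by (simp add: t_def)
  qed (use xV in auto)
  also have "\<dots> = add_pow V (card (carrier G)) x" by (rule finsum_const_pow[OF fin xV])
  finally show ?thesis .
 qed
 define q where "q x = add_pow V m (s x)" for x
 have qN: "q x \<in> N" if "x \<in> carrier V" for x unfolding q_def by (rule asub_pow[OF N sN[OF that]])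
 have qV: "q x \<in> carrier V" if "x \<in> carrier V" for x using qN[OF that] Nc by auto
 have q_add: "q (x \<oplus> y) = q x \<oplus> q y" if "x \<in> carrier V" "y \<in> carrier V" for x y
  using that by (simp add: q_def s_add pow_distrib sV)
 have q_act: "q (act V h x) = act V h (q x)" if "h \<in> carrier G" "x \<in> carrier V" for h x
  using that by (simp add: q_def s_act act_pow sV)
 have q_N: "q x = x" if "x \<in> N" for x using that s_N m Nc by (auto simp: q_def)
 have hom: "(\<lambda>x\<in>carrier V. q x) \<in> ahom G V V"
  by (intro ahomI) (auto simp: q_add q_act qV)
 define K where "K = {x \<in> carrier V. q x = \<zero>}"
 have K: "asub G V K"
 proof -
  have "{x \<in> carrier V. (\<lambda>x\<in>carrier V. q x) x = \<zero>} = K" unfolding K_def by auto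
  thus ?thesis using asub_kernel[OF arep_axioms arep_axioms hom] by simp
 qed
 have Kc: "K \<subseteq> carrier V" by (auto simp: K_def)
 have Kact: "\<And>g x. g \<in> carrier G \<Longrightarrow> x \<in> K \<Longrightarrow> act V g x \<in> K" and K0: "\<zero> \<in> K"
  and Kadd: "\<And>x y. x \<in> K \<Longrightarrow> y \<in> K \<Longrightarrow> x \<oplus> y \<in> K"
  using K by (auto simp: asub_def)
 have q_neg: "q (\<ominus> x) = \<ominus> q x" if "x \<in> carrier V" for x
  using ahom_neg[OF arep_axioms arep_axioms hom that] that by simp
 have xq: "\<ominus> q x \<oplus> x \<in> K" if "x \<in> carrier V" for x
  using that by (simp add: K_def q_add q_neg qV q_N qN V.l_neg)
 hence xq': "x \<oplus> \<ominus> q x \<in> K" if "x \<in> carrier V" for x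
  using that by (simp add: V.a_comm qV)
 define i1 where "i1 = (\<lambda>x\<in>N. x)"
 define i2 where "i2 = (\<lambda>x\<in>K. x)"
 define p1 where "p1 = (\<lambda>x\<in>carrier V. q x)"
 define p2 where "p2 = (\<lambda>x\<in>carrier V. \<ominus> q x \<oplus> x)"
 have act_neg: "act V g (\<ominus> x) = \<ominus> act V g x" if "g \<in> carrier G" "x \<in> carrier V" for g x
 proof -
  have "act V g (\<ominus> x) \<oplus> act V g x = \<zero>"
   using that by (simp add: act_add[symmetric] V.l_neg del: act_add)
  thus ?thesis using that by (metis V.a_inv_closed V.minus_equality act_closed)
 qed
 have "biprod G V (V\<lparr>carrier := N\<rparr>) (V\<lparr>carrier := K\<rparr>) i1 i2 p1 p2"
  unfolding biprod_def
 proof (intro conjI ballI)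
  show "i1 \<in> ahom G (V\<lparr>carrier := N\<rparr>) V" unfolding i1_def
   by (intro ahomI) (use Nc Na Nact in auto)
  show "i2 \<in> ahom G (V\<lparr>carrier := K\<rparr>) V" unfolding i2_def
   by (intro ahomI) (use Kc Kadd Kact in auto)
  show "p1 \<in> ahom G V (V\<lparr>carrier := N\<rparr>)" unfolding p1_def
   by (intro ahomI) (auto simp: q_add q_act qN)
  show "p2 \<in> ahom G V (V\<lparr>carrier := K\<rparr>)" unfolding p2_def
   by (intro ahomI) (auto simp: xq xq' q_add q_act qV V.minus_add V.a_ac act_neg)
  fix x assume "x \<in> carrier (V\<lparr>carrier := N\<rparr>)"
  hence x: "x \<in> N" "x \<in> carrier V" using Nc by auto
  show "p1 (i1 x) = x" "p2 (i1 x) = \<zero>\<^bsub>V\<lparr>carrier := K\<rparr>\<^esub>"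
   using x by (simp_all add: p1_def p2_def i1_def q_N V.l_neg)
 next
  fix x assume "x \<in> carrier (V\<lparr>carrier := K\<rparr>)"
  hence x: "x \<in> K" "x \<in> carrier V" "q x = \<zero>" by (auto simp: K_def)
  show "p2 (i2 x) = x" "p1 (i2 x) = \<zero>\<^bsub>V\<lparr>carrier := N\<rparr>\<^esub>"
   using x by (simp_all add: p1_def p2_def i2_def)
 next
  fix x assume x: "x \<in> carrier V"
  show "i1 (p1 x) \<oplus> i2 (p2 x) = x"
   using x xq qN qV by (simp add: p1_def p2_def i1_def i2_def V.r_neg2 V.r_neg1)
 qed
 thus ?thesis using that K by blast
qed

text \<open>A nonzero subrepresentation of minimal size.\<close>

lemma exists_irreducible_sub:
 assumes "carrier V \<noteq> {\<zero>}"
 obtains N where "asub G V N" "airr G p (V\<lparr>carrier := N\<rparr>)"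
proof -
 define P where "P N \<longleftrightarrow> asub G V N \<and> N \<noteq> {\<zero>}" for N
 have "P (carrier V)" using assms by (auto simp: P_def asub_def)
 then obtain N where N: "P N" and min: "\<And>M. P M \<Longrightarrow> card N \<le> card M"
  using ex_has_least_nat[of P "carrier V" card] by blast
 have fN: "finite N" using N finite_subset[OF _ finite_carrier] by (auto simp: P_def asub_def)
 have "airr G p (V\<lparr>carrier := N\<rparr>)" unfolding airr_def
 proof (intro conjI allI impI)
  show "arep G p (V\<lparr>carrier := N\<rparr>)" using N arep_sub[OF arep_axioms] by (auto simp: P_def)
  show "carrier (V\<lparr>carrier := N\<rparr>) \<noteq> {\<zero>\<^bsub>V\<lparr>carrier := N\<rparr>\<^esub>}" using N by (auto simp: P_def)
  fix M assume M: "asub G (V\<lparr>carrier := N\<rparr>) M"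
  hence MN: "M \<subseteq> N" by (auto simp: asub_def)
  show "M = {\<zero>\<^bsub>V\<lparr>carrier := N\<rparr>\<^esub>} \<or> M = carrier (V\<lparr>carrier := N\<rparr>)"
  proof (cases "M = {\<zero>}")
   case False
   hence "P M" using M N MN by (auto simp: P_def asub_def)
   hence "M = N" using min MN fN card_seteq by blast
   thus ?thesis by simp
  qed simp
 qed
 thus ?thesis using that N by (auto simp: P_def)
qed

end

lemma (in biprod_rep) card_hom_to:
 assumes Z: "arep G p Z"
 shows "card (ahom G Z U) = card (ahom G Z A) * card (ahom G Z B)"
proof -
 interpret Z: arep G p Z by fact
 let ?F = "\<lambda>f. (compose (carrier Z) p1 f, compose (carrier Z) p2 f)"
 let ?H = "\<lambda>(f, h). \<lambda>x\<in>carrier Z. i1 (f x) \<oplus>\<^bsub>U\<^esub> i2 (h x)"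
 have H: "?H (f, h) \<in> ahom G Z U" if fh: "f \<in> ahom G Z A" "h \<in> ahom G Z B" for f h
 proof -
  have *: "f u \<in> carrier A" "h u \<in> carrier B" if "u \<in> carrier Z" for u
   using that fh by (auto intro: ahom_closed)
  show ?thesis
   by (intro ahomI) (use * fh in \<open>auto simp: ahom_add[OF i1] ahom_add[OF i2] ahom_add
    ahom_act[OF i1] ahom_act[OF i2] ahom_act U.V.a_ac\<close>)
 qed
 have "bij_betw ?F (ahom G Z U) (ahom G Z A \<times> ahom G Z B)"
 proof (rule bij_betw_byWitness[where f' = ?H])
  show "\<forall>f\<in>ahom G Z U. ?H (?F f) = f"
  proof
   fix f assume f: "f \<in> ahom G Z U"
   have "?H (?F f) \<in> ahom G Z U"
    using H ahom_compose[OF Z f p1] ahom_compose[OF Z f p2] by auto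
   thus "?H (?F f) = f"
    by (rule ahom_eqI[OF _ f]) (use f in \<open>auto simp: compose_def i1p1_i2p2 ahom_closed\<close>)
  qed
  show "\<forall>fh\<in>ahom G Z A \<times> ahom G Z B. ?F (?H fh) = fh"
  proof
   fix fh assume "fh \<in> ahom G Z A \<times> ahom G Z B"
   then obtain f h where fh_eq: "fh = (f, h)" and fh: "f \<in> ahom G Z A" "h \<in> ahom G Z B"
    by blast
   have "compose (carrier Z) p1 (?H (f, h)) = f"
    using ahom_compose[OF Z H[OF fh] p1] fh(1)
    by (rule ahom_eqI) (use fh in \<open>auto simp: compose_def ahom_closed decomp_unique\<close>)
   moreover have "compose (carrier Z) p2 (?H (f, h)) = h"
    using ahom_compose[OF Z H[OF fh] p2] fh(2)
    by (rule ahom_eqI) (use fh in \<open>auto simp: compose_def ahom_closed decomp_unique\<close>)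
   ultimately show "?F (?H fh) = fh" by (simp add: fh_eq)
  qed
  show "?F ` ahom G Z U \<subseteq> ahom G Z A \<times> ahom G Z B"
   using ahom_compose[OF Z _ p1] ahom_compose[OF Z _ p2] by auto
  show "?H ` (ahom G Z A \<times> ahom G Z B) \<subseteq> ahom G Z U" using H by auto
 qed
 thus ?thesis by (simp add: bij_betw_same_card card_cartesian_product)
qed

lemma biprod_iso:
 assumes "biprod_rep G p U A B i1 i2 p1 p2" "biprod_rep G p U' A' B' i1' i2' p1' p2'"
  and "aiso G A A'" "aiso G B B'"
 shows "aiso G U U'"
proof -
 interpret S: biprod_rep G p U A B i1 i2 p1 p2 by fact
 interpret T: biprod_rep G p U' A' B' i1' i2' p1' p2' by fact
 obtain a where a: "a \<in> ahom G A A'" "bij_betw a (carrier A) (carrier A')" using assms(3) by (auto simp: aiso_def)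
 obtain b where b: "b \<in> ahom G B B'" "bij_betw b (carrier B) (carrier B')" using assms(4) by (auto simp: aiso_def)
 define f where "f = (\<lambda>u\<in>carrier U. i1' (a (p1 u)) \<oplus>\<^bsub>U'\<^esub> i2' (b (p2 u)))"
 have ab: "a (p1 u) \<in> carrier A'" "b (p2 u) \<in> carrier B'" if "u \<in> carrier U" for u
  using that a b by (auto intro: ahom_closed)
 have f: "f \<in> ahom G U U'" unfolding f_def
  by (intro ahomI) (use ab in \<open>auto simp: ahom_add[OF T.i1] ahom_add[OF T.i2] ahom_add[OF S.p1] ahom_add[OF S.p2]
   ahom_add[OF a(1)] ahom_add[OF b(1)] ahom_act[OF T.i1] ahom_act[OF T.i2] ahom_act[OF S.p1] ahom_act[OF S.p2]
   ahom_act[OF a(1)] ahom_act[OF b(1)] T.U.V.a_ac ahom_closed[OF a(1)] ahom_closed[OF b(1)]\<close>)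
 have fi: "p1' (f u) = a (p1 u)" "p2' (f u) = b (p2 u)" if "u \<in> carrier U" for u
  using that ab by (simp_all add: f_def T.decomp_unique)
 have "bij_betw f (carrier U) (carrier U')"
 proof (rule bij_betw_imageI)
  show "inj_on f (carrier U)"
  proof (rule inj_onI)
   fix u v assume uv: "u \<in> carrier U" "v \<in> carrier U" "f u = f v"
   have "a (p1 u) = a (p1 v)" "b (p2 u) = b (p2 v)" using fi uv by metis+
   hence "p1 u = p1 v" "p2 u = p2 v"
    using a(2) b(2) uv by (auto simp: bij_betw_def dest: inj_onD)
   thus "u = v" using S.i1p1_i2p2 uv by metis
  qed
  show "f ` carrier U = carrier U'"
  proof
   show "f ` carrier U \<subseteq> carrier U'" using f by (auto intro: ahom_closed)
   show "carrier U' \<subseteq> f ` carrier U"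
   proof
    fix w assume w: "w \<in> carrier U'"
    obtain x where x: "x \<in> carrier A" "a x = p1' w" using a(2) T.cl(3)[OF w] by (metis bij_betw_def imageE)
    obtain y where y: "y \<in> carrier B" "b y = p2' w" using b(2) T.cl(4)[OF w] by (metis bij_betw_def imageE)
    let ?u = "i1 x \<oplus>\<^bsub>U\<^esub> i2 y"
    have u: "?u \<in> carrier U" using x y by simp
    have "f ?u = w" using u x y w by (simp add: f_def S.decomp_unique T.i1p1_i2p2)
    thus "w \<in> f ` carrier U" using u by blast
   qed
  qed
 qed
 thus ?thesis using f by (auto simp: aiso_def)
qed

subsection \<open>Products\<close>

lemma rep_prod_simps [simp]:
 "carrier (rep_prod I V) = (\<Pi>\<^sub>E i\<in>I. carrier (V i))"
 "\<zero>\<^bsub>rep_prod I V\<^esub> = (\<lambda>i\<in>I. \<zero>\<^bsub>V i\<^esub>)"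
 "x \<oplus>\<^bsub>rep_prod I V\<^esub> y = (\<lambda>i\<in>I. x i \<oplus>\<^bsub>V i\<^esub> y i)"
 "a \<odot>\<^bsub>rep_prod I V\<^esub> x = (\<lambda>i\<in>I. a \<odot>\<^bsub>V i\<^esub> x i)"
 "x \<in> (\<Pi>\<^sub>E i\<in>I. carrier (V i)) \<Longrightarrow> act (rep_prod I V) g x = (\<lambda>i\<in>I. act (V i) g (x i))"
 by (auto simp: rep_prod_def)

lemma arep_prod:
 assumes "finite I" "\<And>i. i \<in> I \<Longrightarrow> arep G p (V i)" "group G" "Factorial_Ring.prime p"
 shows "arep G p (rep_prod I V)"
proof -
 let ?W = "rep_prod I V"
 interpret G: group G by fact
 have ab: "abelian_group (?W)"
 proof (rule abelian_groupI)
  fix x assume x: "x \<in> carrier (?W)"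
  have "(\<lambda>i\<in>I. \<ominus>\<^bsub>V i\<^esub> x i) \<in> carrier (?W)"
  proof -
   have "\<ominus>\<^bsub>V i\<^esub> x i \<in> carrier (V i)" if "i \<in> I" for i
   proof -
    interpret arep G p "V i" using assms(2) that .
    show ?thesis using x that by auto
   qed
   thus ?thesis by auto
  qed
  moreover have "(\<lambda>i\<in>I. \<ominus>\<^bsub>V i\<^esub> x i) \<oplus>\<^bsub>?W\<^esub> x = \<zero>\<^bsub>?W\<^esub>"
  proof -
   have "\<ominus>\<^bsub>V i\<^esub> x i \<oplus>\<^bsub>V i\<^esub> x i = \<zero>\<^bsub>V i\<^esub>" if "i \<in> I" for i
   proof -
    interpret arep G p "V i" using assms(2) that .
    show ?thesis using x that by (auto intro: V.l_neg)
   qed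
   thus ?thesis by (auto simp: restrict_def)
  qed
  ultimately show "\<exists>y\<in>carrier (?W). y \<oplus>\<^bsub>?W\<^esub> x = \<zero>\<^bsub>?W\<^esub>" by blast
 next
  fix x y assume xy: "x \<in> carrier (?W)" "y \<in> carrier (?W)"
  have *: "x i \<oplus>\<^bsub>V i\<^esub> y i \<in> carrier (V i)" "x i \<oplus>\<^bsub>V i\<^esub> y i = y i \<oplus>\<^bsub>V i\<^esub> x i" if "i \<in> I" for i
  proof -
   interpret arep G p "V i" using assms(2) that .
   show "x i \<oplus>\<^bsub>V i\<^esub> y i \<in> carrier (V i)" "x i \<oplus>\<^bsub>V i\<^esub> y i = y i \<oplus>\<^bsub>V i\<^esub> x i"
    using xy that by (auto intro: V.a_comm)
  qed
  show "x \<oplus>\<^bsub>?W\<^esub> y \<in> carrier (?W)" using * by auto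
  show "x \<oplus>\<^bsub>?W\<^esub> y = y \<oplus>\<^bsub>?W\<^esub> x" using * by (auto simp: restrict_def)
  fix z assume z: "z \<in> carrier (?W)"
  have "x i \<oplus>\<^bsub>V i\<^esub> y i \<oplus>\<^bsub>V i\<^esub> z i = x i \<oplus>\<^bsub>V i\<^esub> (y i \<oplus>\<^bsub>V i\<^esub> z i)" if "i \<in> I" for i
  proof -
   interpret arep G p "V i" using assms(2) that .
   show ?thesis using xy z that by (auto intro!: V.a_assoc)
  qed
  thus "x \<oplus>\<^bsub>?W\<^esub> y \<oplus>\<^bsub>?W\<^esub> z = x \<oplus>\<^bsub>?W\<^esub> (y \<oplus>\<^bsub>?W\<^esub> z)"
   by (auto simp: restrict_def)
 next
  show "\<zero>\<^bsub>?W\<^esub> \<in> carrier (?W)"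
  proof -
   have "\<zero>\<^bsub>V i\<^esub> \<in> carrier (V i)" if "i \<in> I" for i
   proof -
    interpret arep G p "V i" using assms(2) that .
    show ?thesis by simp
   qed
   thus ?thesis by auto
  qed
  fix x assume x: "x \<in> carrier (?W)"
  have "\<zero>\<^bsub>V i\<^esub> \<oplus>\<^bsub>V i\<^esub> x i = x i" if "i \<in> I" for i
  proof -
   interpret arep G p "V i" using assms(2) that .
   show ?thesis by (rule V.l_zero) (use x that in auto)
  qed
  hence "\<zero>\<^bsub>?W\<^esub> \<oplus>\<^bsub>?W\<^esub> x = restrict x I" by (auto simp: restrict_def)
  thus "\<zero>\<^bsub>?W\<^esub> \<oplus>\<^bsub>?W\<^esub> x = x" using x by (auto simp: PiE_def extensional_restrict)
 qed
 have pw: "add_pow (?W) (n::nat) x = (\<lambda>i\<in>I. add_pow (V i) n (x i))" for n x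
  by (induct n) (auto simp: add_pow_def restrict_def)
 show ?thesis
 proof (intro arep.intro arep_axioms.intro ab)
  show "finite (carrier (?W))" using assms(1,2) by (auto intro!: finite_PiE arep.finite_carrier)
  fix x assume x: "x \<in> carrier (?W)"
  have xi: "i \<in> I \<Longrightarrow> x i \<in> carrier (V i)" for i using x by auto
  show "[p] \<cdot>\<^bsub>?W\<^esub> x = \<zero>\<^bsub>?W\<^esub>"
   unfolding pw using arep.torsion[OF assms(2) xi] by (auto simp: restrict_def)
  have "act (?W) \<one>\<^bsub>G\<^esub> x = restrict x I"
   using x arep.act_one[OF assms(2) xi] by (auto simp: restrict_def)
  thus "act (?W) \<one>\<^bsub>G\<^esub> x = x" using x by (auto simp: PiE_def extensional_restrict)
  fix g assume g: "g \<in> carrier G"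
  show cl: "act (?W) g x \<in> carrier (?W)"
   using x arep.act_closed[OF assms(2) g xi] by auto
  show "act (?W) g (x \<oplus>\<^bsub>?W\<^esub> y) = act (?W) g x \<oplus>\<^bsub>?W\<^esub> act (?W) g y"
   if y: "y \<in> carrier (?W)" for y
  proof -
   have yi: "i \<in> I \<Longrightarrow> y i \<in> carrier (V i)" for i using y by auto
   have "(\<lambda>i\<in>I. x i \<oplus>\<^bsub>V i\<^esub> y i) \<in> (\<Pi>\<^sub>E i\<in>I. carrier (V i))"
    using abelian_monoid.a_closed[OF abelian_group.axioms(1)[OF ab] x y] by simp
   thus ?thesis using x y arep.act_add[OF assms(2) g xi yi] by (auto simp: restrict_def)
  qed
  fix h assume h: "h \<in> carrier G"
  have "(\<lambda>i\<in>I. act (V i) h (x i)) \<in> (\<Pi>\<^sub>E i\<in>I. carrier (V i))"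
   using x arep.act_closed[OF assms(2) h xi] by auto
  thus "act (?W) (g \<otimes>\<^bsub>G\<^esub> h) x = act (?W) g (act (?W) h x)"
   using x arep.act_mult[OF assms(2) g h xi] by (auto simp: restrict_def)
 qed (use assms in auto)
qed

lemma rep_prod_biprod:
 assumes "finite I" "a \<notin> I" "\<And>i. i \<in> insert a I \<Longrightarrow> arep G p (V i)" "group G" "Factorial_Ring.prime p"
 obtains i1 i2 p1 p2 where "biprod_rep G p (rep_prod (insert a I) V) (rep_prod I V) (V a) i1 i2 p1 p2"
proof -
 let ?A = "rep_prod I V" and ?U = "rep_prod (insert a I) V"
 let ?CA = "\<Pi>\<^sub>E i\<in>I. carrier (V i)" and ?CU = "\<Pi>\<^sub>E i\<in>insert a I. carrier (V i)"
 interpret A: arep G p ?A by (rule arep_prod) (use assms in auto)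
 interpret U: arep G p ?U by (rule arep_prod) (use assms in auto)
 interpret B: arep G p "V a" using assms by auto
 have z: "\<zero>\<^bsub>V i\<^esub> \<in> carrier (V i)" and zz: "\<zero>\<^bsub>V i\<^esub> \<oplus>\<^bsub>V i\<^esub> \<zero>\<^bsub>V i\<^esub> = \<zero>\<^bsub>V i\<^esub>"
  and az: "\<And>g. g \<in> carrier G \<Longrightarrow> act (V i) g \<zero>\<^bsub>V i\<^esub> = \<zero>\<^bsub>V i\<^esub>"
  and lz: "\<And>x. x \<in> carrier (V i) \<Longrightarrow> \<zero>\<^bsub>V i\<^esub> \<oplus>\<^bsub>V i\<^esub> x = x"
  and rz: "\<And>x. x \<in> carrier (V i) \<Longrightarrow> x \<oplus>\<^bsub>V i\<^esub> \<zero>\<^bsub>V i\<^esub> = x"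
  and ac: "\<And>g x. g \<in> carrier G \<Longrightarrow> x \<in> carrier (V i) \<Longrightarrow> act (V i) g x \<in> carrier (V i)"
  and ad: "\<And>x y. x \<in> carrier (V i) \<Longrightarrow> y \<in> carrier (V i) \<Longrightarrow> x \<oplus>\<^bsub>V i\<^esub> y \<in> carrier (V i)"
  if "i \<in> insert a I" for i
 proof -
  interpret arep G p "V i" using assms(3) that .
  show "\<zero>\<^bsub>V i\<^esub> \<in> carrier (V i)" "\<zero>\<^bsub>V i\<^esub> \<oplus>\<^bsub>V i\<^esub> \<zero>\<^bsub>V i\<^esub> = \<zero>\<^bsub>V i\<^esub>"
   "\<And>g. g \<in> carrier G \<Longrightarrow> act (V i) g \<zero>\<^bsub>V i\<^esub> = \<zero>\<^bsub>V i\<^esub>"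
   "\<And>x. x \<in> carrier (V i) \<Longrightarrow> \<zero>\<^bsub>V i\<^esub> \<oplus>\<^bsub>V i\<^esub> x = x" "\<And>x. x \<in> carrier (V i) \<Longrightarrow> x \<oplus>\<^bsub>V i\<^esub> \<zero>\<^bsub>V i\<^esub> = x"
   "\<And>g x. g \<in> carrier G \<Longrightarrow> x \<in> carrier (V i) \<Longrightarrow> act (V i) g x \<in> carrier (V i)"
   "\<And>x y. x \<in> carrier (V i) \<Longrightarrow> y \<in> carrier (V i) \<Longrightarrow> x \<oplus>\<^bsub>V i\<^esub> y \<in> carrier (V i)"
   by auto
 qed
 define i1 where "i1 = (\<lambda>f\<in>?CA. \<lambda>i\<in>insert a I. if i = a then \<zero>\<^bsub>V i\<^esub> else f i)"
 define i2 where "i2 = (\<lambda>b\<in>carrier (V a). \<lambda>i\<in>insert a I. if i = a then b else \<zero>\<^bsub>V i\<^esub>)"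
 define p1 where "p1 = (\<lambda>f\<in>?CU. restrict f I)"
 define p2 where "p2 = (\<lambda>f\<in>?CU. f a)"
 have c1: "i1 f \<in> ?CU" if "f \<in> ?CA" for f
  using that z by (auto simp: i1_def)
 have c2: "i2 b \<in> ?CU" if "b \<in> carrier (V a)" for b
  using that z by (auto simp: i2_def)
 have c3: "p1 f \<in> ?CA" if "f \<in> ?CU" for f
  using that by (auto simp: p1_def)
 have c4: "p2 f \<in> carrier (V a)" if "f \<in> ?CU" for f
  using that by (auto simp: p2_def)
 have cA: "(\<lambda>i\<in>I. x i \<oplus>\<^bsub>V i\<^esub> y i) \<in> ?CA"
   if "x \<in> ?CA" "y \<in> ?CA" for x y
  using A.V.a_closed that by simp
 have cU: "(\<lambda>i\<in>insert a I. x i \<oplus>\<^bsub>V i\<^esub> y i) \<in> ?CU"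
   if "x \<in> ?CU" "y \<in> ?CU" for x y
  using U.V.a_closed that by simp
 have aA: "(\<lambda>i\<in>I. act (V i) g (x i)) \<in> ?CA"
   if "g \<in> carrier G" "x \<in> ?CA" for g x
  using A.act_closed[of g x] that by simp
 have aU: "(\<lambda>i\<in>insert a I. act (V i) g (x i)) \<in> ?CU"
   if "g \<in> carrier G" "x \<in> ?CU" for g x
  using U.act_closed[of g x] that by simp
 have "biprod G ?U ?A (V a) i1 i2 p1 p2"
  unfolding biprod_def
 proof (intro conjI ballI)
  show "i1 \<in> ahom G ?A ?U"
  proof (rule ahomI)
   fix x y assume xy: "x \<in> carrier ?A" "y \<in> carrier ?A"
   show "i1 (x \<oplus>\<^bsub>?A\<^esub> y) = i1 x \<oplus>\<^bsub>?U\<^esub> i1 y"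
    using xy cA assms(2) zz by (auto simp: i1_def fun_eq_iff restrict_def)
  next
   fix g x assume g: "g \<in> carrier G" and x: "x \<in> carrier ?A"
   show "i1 (act ?A g x) = act ?U g (i1 x)"
    using g x aA[OF g, of x] c1[of x] assms(2) az[of a g] by (auto simp: i1_def fun_eq_iff restrict_def)
  qed (use c1 in \<open>auto simp: i1_def\<close>)
  show "i2 \<in> ahom G (V a) ?U"
  proof (rule ahomI)
   fix x y assume xy: "x \<in> carrier (V a)" "y \<in> carrier (V a)"
   show "i2 (x \<oplus>\<^bsub>V a\<^esub> y) = i2 x \<oplus>\<^bsub>?U\<^esub> i2 y"
    using xy zz by (auto simp: i2_def fun_eq_iff restrict_def)
  next
   fix g x assume g: "g \<in> carrier G" and x: "x \<in> carrier (V a)"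
   show "i2 (act (V a) g x) = act ?U g (i2 x)"
    using g x c2[of x] az[OF _ g] by (auto simp: i2_def fun_eq_iff restrict_def)
  qed (use c2 in \<open>auto simp: i2_def\<close>)
  show "p1 \<in> ahom G ?U ?A"
  proof (rule ahomI)
   fix x y assume xy: "x \<in> carrier ?U" "y \<in> carrier ?U"
   show "p1 (x \<oplus>\<^bsub>?U\<^esub> y) = p1 x \<oplus>\<^bsub>?A\<^esub> p1 y"
    using xy cU[of x y] by (auto simp: p1_def fun_eq_iff restrict_def)
  next
   fix g x assume g: "g \<in> carrier G" and x: "x \<in> carrier ?U"
   show "p1 (act ?U g x) = act ?A g (p1 x)"
    using g x aU[OF g, of x] c3[of x] by (auto simp: p1_def fun_eq_iff restrict_def)
  qed (use c3 in \<open>auto simp: p1_def\<close>)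
  show "p2 \<in> ahom G ?U (V a)"
  proof (rule ahomI)
   fix x y assume xy: "x \<in> carrier ?U" "y \<in> carrier ?U"
   show "p2 (x \<oplus>\<^bsub>?U\<^esub> y) = p2 x \<oplus>\<^bsub>V a\<^esub> p2 y"
    using xy cU[of x y] by (simp add: p2_def)
  next
   fix g x assume g: "g \<in> carrier G" and x: "x \<in> carrier ?U"
   show "p2 (act ?U g x) = act (V a) g (p2 x)"
    using g x aU[OF g, of x] by (simp add: p2_def)
  qed (use c4 in \<open>auto simp: p2_def\<close>)
  fix x assume "x \<in> carrier ?A"
  hence x: "x \<in> ?CA" by simp
  show "p1 (i1 x) = x" using x c1[OF x] assms(2) by (auto simp: p1_def i1_def fun_eq_iff restrict_def PiE_def extensional_def)
  show "p2 (i1 x) = \<zero>\<^bsub>V a\<^esub>" using x c1[OF x] by (auto simp: p2_def i1_def)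
 next
  fix x assume x: "x \<in> carrier (V a)"
  show "p2 (i2 x) = x" using x c2[OF x] by (auto simp: p2_def i2_def)
  show "p1 (i2 x) = \<zero>\<^bsub>?A\<^esub>" using x c2[OF x] assms(2) by (auto simp: p1_def i2_def fun_eq_iff restrict_def)
 next
  fix x assume "x \<in> carrier ?U"
  hence x: "x \<in> ?CU" by simp
  have "i1 (p1 x) \<oplus>\<^bsub>?U\<^esub> i2 (p2 x) = restrict x (insert a I)"
  proof -
   have "\<zero>\<^bsub>V a\<^esub> \<oplus>\<^bsub>V a\<^esub> x a = x a" "\<And>i. i \<in> I \<Longrightarrow> x i \<oplus>\<^bsub>V i\<^esub> \<zero>\<^bsub>V i\<^esub> = x i"
    using lz rz PiE_mem[OF x] by auto
   thus ?thesis using x c3[OF x] c4[OF x] by (auto simp: i1_def i2_def p1_def p2_def fun_eq_iff restrict_def)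
  qed
  thus "i1 (p1 x) \<oplus>\<^bsub>?U\<^esub> i2 (p2 x) = x" using x by (metis PiE_restrict)
 qed
 hence "biprod_rep G p ?U ?A (V a) i1 i2 p1 p2"
  by (intro biprod_rep.intro biprod_rep_axioms.intro A.arep_axioms U.arep_axioms B.arep_axioms)
 thus ?thesis by (rule that)
qed

subsection \<open>The trivial representation and functionals\<close>

text \<open>The prime field with trivial action; homomorphisms into it are the invariant functionals.\<close>

definition fp :: "nat \<Rightarrow> (int, int, 'g) rep" where
 "fp p = \<lparr>carrier = {0..<int p}, monoid.mult = undefined, monoid.one = undefined,
   ring.zero = 0, ring.add = (\<lambda>x y. (x + y) mod int p),
   module.smult = (\<lambda>a x. (a * x) mod int p), act = (\<lambda>g x. x)\<rparr>"

lemma fp_simps [simp]: "carrier (fp p) = {0..<int p}" "\<zero>\<^bsub>fp p\<^esub> = 0"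
 "x \<oplus>\<^bsub>fp p\<^esub> y = (x + y) mod int p" "act (fp p) g x = x"
 by (simp_all add: fp_def)

lemma fp_pow: "x \<in> {0..<int p} \<Longrightarrow> add_pow (fp p) (n::nat) x = (int n * x) mod int p"
 by (induct n) (auto simp: add_pow_def algebra_simps mod_simps)

lemma add_pow_zero: "add_pow V (0::nat) x = \<zero>\<^bsub>V\<^esub>"
 and add_pow_Suc: "add_pow V (Suc n) x = add_pow V n x \<oplus>\<^bsub>V\<^esub> x"
 by (simp_all add: add_pow_def)

lemma arep_fp:
 assumes "group G" "Factorial_Ring.prime p"
 shows "arep G p (fp p)"
proof -
 have p: "int p > 0" using assms(2) by (simp add: prime_gt_0_nat)
 have "abelian_group (fp p :: (int, int, 'a) rep)"
 proof (rule abelian_groupI)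
  fix x assume "x \<in> carrier (fp p :: (int, int, 'a) rep)"
  thus "\<exists>y\<in>carrier (fp p :: (int, int, 'a) rep). y \<oplus>\<^bsub>fp p\<^esub> x = \<zero>\<^bsub>fp p\<^esub>"
   using p by (intro bexI[of _ "(- x) mod int p"]) (simp_all add: mod_add_left_eq)
 next
  fix x y z :: int
  show "x \<oplus>\<^bsub>fp p :: (int, int, 'a) rep\<^esub> y \<oplus>\<^bsub>fp p :: (int, int, 'a) rep\<^esub> z =
   x \<oplus>\<^bsub>fp p :: (int, int, 'a) rep\<^esub> (y \<oplus>\<^bsub>fp p :: (int, int, 'a) rep\<^esub> z)"
   by (simp add: mod_simps add.assoc)
  show "x \<oplus>\<^bsub>fp p :: (int, int, 'a) rep\<^esub> y = y \<oplus>\<^bsub>fp p :: (int, int, 'a) rep\<^esub> x"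
   by (simp add: add.commute)
 qed (use p in auto)
 thus ?thesis using assms by (intro arep.intro arep_axioms.intro) (auto simp: fp_pow p)
qed

lemma airr_fp:
 assumes "group G" "Factorial_Ring.prime p"
 shows "airr G p (fp p)"
proof -
 interpret F: arep G p "fp p :: (int, int, 'a) rep" by (rule arep_fp[OF assms])
 have p1: "int p > 1" using assms(2) prime_gt_1_nat by auto
 show ?thesis unfolding airr_def
 proof (intro conjI allI impI F.arep_axioms)
  have "1 \<in> {0..<int p}" using p1 by simp
  thus "carrier (fp p :: (int, int, 'a) rep) \<noteq> {\<zero>\<^bsub>fp p :: (int, int, 'a) rep\<^esub>}"
   unfolding fp_simps by (metis singletonD zero_neq_one)
  fix N assume N: "asub G (fp p :: (int, int, 'a) rep) N"
  hence Nc: "N \<subseteq> {0..<int p}" and N0: "0 \<in> N" by (auto simp: asub_def)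
  show "N = {\<zero>\<^bsub>fp p :: (int, int, 'a) rep\<^esub>} \<or> N = carrier (fp p :: (int, int, 'a) rep)"
  proof (cases "N = {0}")
   case False
   then obtain k where k: "k \<in> N" "k \<noteq> 0" using N0 by blast
   hence k0: "0 < k" "k < int p" using Nc by force+
   have "coprime k (int p)"
    using assms(2) k0 by (metis coprime_commute prime_imp_coprime prime_nat_int_transfer zdvd_not_zless)
   then obtain m where m: "[k * m = 1] (mod int p)" using cong_solve_coprime_int by blast
   have "y \<in> N" if y: "y \<in> {0..<int p}" for y
   proof -
    define n where "n = nat ((m * y) mod int p)"
    have "add_pow (fp p :: (int, int, 'a) rep) n k \<in> N" using F.asub_pow[OF N k(1)] .
    moreover have "add_pow (fp p :: (int, int, 'a) rep) n k = (int n * k) mod int p" using k0 by (simp add: fp_pow)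
    moreover have "(int n * k) mod int p = ((k * m) * y) mod int p"
     using p1 by (simp add: n_def mod_simps mult_ac)
    moreover have "\<dots> = y" using m y p1 by (metis cong_def cong_scalar_right mod_pos_pos_trivial mult_1 atLeastLessThan_iff)
    ultimately show ?thesis by simp
   qed
   thus ?thesis using Nc by auto
  qed simp
 qed
qed

text \<open>A homomorphism from the prime field is determined by the image of 1, which is any invariant vector.\<close>

lemma card_hom_fp:
 assumes "arep G p V"
 shows "card (ahom G (fp p) V) = card (rep_invariants G V)"
proof -
 interpret V: arep G p V by fact
 interpret F: arep G p "fp p :: (int, int, 'a) rep" by (rule arep_fp[OF V.G.group_axioms V.prime_p])
 have p1: "int p > 1" using V.prime_p prime_gt_1_nat by auto
 have fn: "f (int n mod int p) = add_pow V n (f 1)" if f: "f \<in> ahom G (fp p) V" for f :: "int \<Rightarrow> 'c" and n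
 proof (induct n)
  case 0 show ?case using ahom_zero[OF F.arep_axioms V.arep_axioms f] by simp
 next
  case (Suc n)
  have "f (int (Suc n) mod int p) = f ((int n mod int p) \<oplus>\<^bsub>(fp p :: (int, int, 'a) rep)\<^esub> 1)" by (simp add: mod_simps add.commute)
  also have "\<dots> = f (int n mod int p) \<oplus>\<^bsub>V\<^esub> f 1" using p1 by (intro ahom_add[OF f]) auto
  finally show ?case using Suc by (simp add: V.pow_Suc)
 qed
 have "bij_betw (\<lambda>f. f 1) (ahom G (fp p) V) (rep_invariants G V)"
 proof (rule bij_betw_byWitness[where f' = "\<lambda>v. \<lambda>k\<in>{0..<int p}. add_pow V (nat k) v"])
  show "\<forall>f\<in>ahom G (fp p) V. (\<lambda>k\<in>{0..<int p}. add_pow V (nat k) (f 1)) = f"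
  proof
   fix f assume f: "f \<in> ahom G (fp p :: (int, int, 'a) rep) V"
   show "(\<lambda>k\<in>{0..<int p}. add_pow V (nat k) (f 1)) = f"
   proof (rule extensionalityI[where A = "{0..<int p}"])
    fix k assume "k \<in> {0..<int p}"
    thus "(\<lambda>k\<in>{0..<int p}. add_pow V (nat k) (f 1)) k = f k" using fn[OF f, of "nat k"] by simp
   qed (use ahom_ext[OF f] in auto)
  qed
  show "\<forall>v\<in>rep_invariants G V. (\<lambda>k\<in>{0..<int p}. add_pow V (nat k) v) 1 = v"
   using p1 by (auto simp: rep_invariants_def add_pow_def)
  show "(\<lambda>f. f 1) ` ahom G (fp p) V \<subseteq> rep_invariants G V"
   using p1 by (auto simp: rep_invariants_def ahom_closed ahom_act[symmetric])
  show "(\<lambda>v. \<lambda>k\<in>{0..<int p}. add_pow V (nat k) v) ` rep_invariants G V \<subseteq> ahom G (fp p) V"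
  proof (rule image_subsetI, rule ahomI)
   fix v x y assume v: "v \<in> rep_invariants G V" and "x \<in> carrier (fp p :: (int, int, 'a) rep)" "y \<in> carrier (fp p :: (int, int, 'a) rep)"
   hence vc: "v \<in> carrier V" and xy: "0 \<le> x" "0 \<le> y" "x < int p" "y < int p" by (auto simp: rep_invariants_def)
   have "nat ((x + y) mod int p) = (nat x + nat y) mod p" using xy p1 by (simp add: nat_mod_distrib nat_add_distrib)
   thus "(\<lambda>k\<in>{0..<int p}. add_pow V (nat k) v) (x \<oplus>\<^bsub>fp p :: (int, int, 'a) rep\<^esub> y) =
    (\<lambda>k\<in>{0..<int p}. add_pow V (nat k) v) x \<oplus>\<^bsub>V\<^esub> (\<lambda>k\<in>{0..<int p}. add_pow V (nat k) v) y"
    using xy p1 vc by (simp add: V.pow_mod V.pow_add)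
  qed (auto simp: rep_invariants_def V.act_pow)
 qed
 thus ?thesis by (rule bij_betw_same_card)
qed

lemma card_hom_from_zero:
 assumes "arep G p U" "arep G p V" "carrier U = {\<zero>\<^bsub>U\<^esub>}"
 shows "card (ahom G U V) = 1"
proof -
 have "ahom G U V = {\<lambda>x\<in>carrier U. \<zero>\<^bsub>V\<^esub>}"
 proof (intro equalityI subsetI)
  fix f assume f: "f \<in> ahom G U V"
  have "f = (\<lambda>x\<in>carrier U. \<zero>\<^bsub>V\<^esub>)"
   by (rule ahom_eqI[OF f ahom_zero_map[OF assms(1,2)]]) (use ahom_zero[OF assms(1,2) f] assms(3) in auto)
  thus "f \<in> {\<lambda>x\<in>carrier U. \<zero>\<^bsub>V\<^esub>}" by simp
 qed (use ahom_zero_map[OF assms(1,2)] in auto)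
 thus ?thesis by simp
qed

lemma card_hom_to_zero:
 assumes "arep G p U" "arep G p V" "carrier V = {\<zero>\<^bsub>V\<^esub>}"
 shows "card (ahom G U V) = 1"
proof -
 have "ahom G U V = {\<lambda>x\<in>carrier U. \<zero>\<^bsub>V\<^esub>}"
 proof (intro equalityI subsetI)
  fix f assume f: "f \<in> ahom G U V"
  have "f = (\<lambda>x\<in>carrier U. \<zero>\<^bsub>V\<^esub>)"
   by (rule ahom_eqI[OF f ahom_zero_map[OF assms(1,2)]]) (use ahom_closed[OF f] assms(3) in auto)
  thus "f \<in> {\<lambda>x\<in>carrier U. \<zero>\<^bsub>V\<^esub>}" by simp
 qed (use ahom_zero_map[OF assms(1,2)] in auto)
 thus ?thesis by simp
qed

text \<open>Splitting off an irreducible subrepresentation, which makes induction on the size possible.\<close>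

lemma split_irreducible:
 assumes U: "arep G p U" and fin: "finite (carrier G)" and cop: "\<not> p dvd card (carrier G)"
  and nz: "carrier U \<noteq> {\<zero>\<^bsub>U\<^esub>}"
 obtains N K i1 i2 p1 p2 where "asub G U N" "asub G U K" "airr G p (U\<lparr>carrier := N\<rparr>)"
  "biprod_rep G p U (U\<lparr>carrier := N\<rparr>) (U\<lparr>carrier := K\<rparr>) i1 i2 p1 p2" "card K < card (carrier U)"
proof -
 interpret U: arep G p U by fact
 obtain N where N: "asub G U N" "airr G p (U\<lparr>carrier := N\<rparr>)"
  using U.exists_irreducible_sub[OF nz] by blast
 obtain K i1 i2 p1 p2 where K: "asub G U K"
   "biprod G U (U\<lparr>carrier := N\<rparr>) (U\<lparr>carrier := K\<rparr>) i1 i2 p1 p2"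
  using U.maschke[OF N(1) fin cop] by metis
 have B: "biprod_rep G p U (U\<lparr>carrier := N\<rparr>) (U\<lparr>carrier := K\<rparr>) i1 i2 p1 p2"
  using K by (intro biprod_rep.intro biprod_rep_axioms.intro U arep_sub[OF U N(1)] arep_sub[OF U K(1)])
 have "card (carrier U) = card N * card K" using biprod_rep.card_biprod[OF B] by simp
 moreover have "card N > 1"
 proof -
  have "\<zero>\<^bsub>U\<^esub> \<in> N" "N \<noteq> {\<zero>\<^bsub>U\<^esub>}" using N by (auto simp: airr_def asub_def)
  moreover have "finite N" using N(1) finite_subset[OF _ U.finite_carrier] by (auto simp: asub_def)
  moreover from calculation obtain y where "y \<in> N" "y \<noteq> \<zero>\<^bsub>U\<^esub>" by blast
  ultimately show ?thesis using card_mono[of N "{\<zero>\<^bsub>U\<^esub>, y}"] by simp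
 qed
 moreover have "card K > 0"
  using K(1) finite_subset[OF _ U.finite_carrier, of K] by (auto simp: asub_def card_gt_0_iff)
 ultimately have "card K < card (carrier U)" by simp
 thus ?thesis using that N K(1) B by blast
qed

text \<open>Both sides are multiplicative over direct sums, and for an irreducible representation they
 are \<open>p\<close> or \<open>1\<close> according to whether it is trivial.\<close>

lemma card_invariants_eq_functionals:
 assumes "arep G p U" "finite (carrier G)" "\<not> p dvd card (carrier G)"
 shows "card (rep_invariants G U) = card (ahom G U (fp p))"
 using assms(1)
proof (induct "card (carrier U)" arbitrary: U rule: less_induct)
 case less
 interpret U: arep G p U by fact
 note F = airr_fp[OF U.G.group_axioms U.prime_p]
 have F': "arep G p (fp p)" using F by (simp add: airr_def)
 show ?case
 proof (cases "carrier U = {\<zero>\<^bsub>U\<^esub>}")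
  case True
  have "card (ahom G (fp p) U) = 1" by (rule card_hom_to_zero[OF F' less.prems True])
  moreover have "card (ahom G U (fp p)) = 1" by (rule card_hom_from_zero[OF less.prems F' True])
  ultimately show ?thesis using card_hom_fp[OF less.prems] by simp
 next
  case False
  obtain N K i1 i2 p1 p2 where NK: "asub G U N" "asub G U K" "airr G p (U\<lparr>carrier := N\<rparr>)"
   "biprod_rep G p U (U\<lparr>carrier := N\<rparr>) (U\<lparr>carrier := K\<rparr>) i1 i2 p1 p2" "card K < card (carrier U)"
   using split_irreducible[OF less.prems assms(2,3) False] by metis
  interpret B: biprod_rep G p U "U\<lparr>carrier := N\<rparr>" "U\<lparr>carrier := K\<rparr>" i1 i2 p1 p2 by fact
  have K: "card (ahom G (fp p) (U\<lparr>carrier := K\<rparr>)) = card (ahom G (U\<lparr>carrier := K\<rparr>) (fp p))"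
   using less.hyps[of "U\<lparr>carrier := K\<rparr>"] NK(5) B.B.arep_axioms card_hom_fp[OF B.B.arep_axioms] by simp
  have N: "card (ahom G (fp p) (U\<lparr>carrier := N\<rparr>)) = card (ahom G (U\<lparr>carrier := N\<rparr>) (fp p))"
  proof (cases "aiso G (U\<lparr>carrier := N\<rparr>) (fp p)")
   case True
   thus ?thesis using aiso_card_hom[OF F' B.A.arep_axioms B.A.arep_axioms F']
    by (simp add: aiso_sym[OF B.A.arep_axioms F'])
  next
   case False
   hence "\<not> aiso G (fp p) (U\<lparr>carrier := N\<rparr>)" using aiso_sym[OF F' B.A.arep_axioms] by blast
   thus ?thesis using card_hom_noniso[OF NK(3) F False] card_hom_noniso[OF F NK(3)] by simp
  qed
  show ?thesis
   using card_hom_fp[OF less.prems] B.card_hom_to[OF F'] B.card_hom_from[OF F'] K N by simp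
 qed
qed

text \<open>Forgetting the action is the same as letting the trivial group act, so results about representations
specialize to vector spaces.\<close>

abbreviation triv_grp :: "('g, 'm) monoid_scheme \<Rightarrow> ('g, 'm) monoid_scheme" where
 "triv_grp G \<equiv> G\<lparr>carrier := {\<one>\<^bsub>G\<^esub>}\<rparr>"

lemma (in arep) arep_triv: "arep (triv_grp G) p V"
proof -
 have "group (triv_grp G)" by (rule groupI) auto
 thus ?thesis
  by (intro arep.intro arep_axioms.intro V.abelian_group_axioms) (auto simp: prime_p torsion)
qed

text \<open>Without an action this says that a finite vector space and its dual have the same size.\<close>

lemma (in arep) card_functionals:
 "card (ahom (triv_grp G) V (fp p)) = card (carrier V)"
proof -
 have "card (rep_invariants (triv_grp G) V) = card (ahom (triv_grp G) V (fp p))"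
  by (rule card_invariants_eq_functionals[OF arep_triv]) (use prime_p in auto)
 moreover have "rep_invariants (triv_grp G) V = carrier V" by (auto simp: rep_invariants_def)
 ultimately show ?thesis by simp
qed

text \<open>A nonzero invariant functional would identify the representation with the trivial one, by Schur's lemma.\<close>

lemma functionals_nontrivial_irreducible:
 assumes V: "airr G p V" and nt: "\<not> trivial_action G V"
 shows "ahom G V (fp p) = {\<lambda>x\<in>carrier V. 0}"
proof -
 interpret V: arep G p V using V by (simp add: airr_def)
 note F = airr_fp[OF V.G.group_axioms V.prime_p]
 have F': "arep G p (fp p)" using F by (simp add: airr_def)
 have "\<not> aiso G V (fp p)"
 proof
  assume "aiso G V (fp p)"
  then obtain f where f: "f \<in> ahom G V (fp p)" "bij_betw f (carrier V) (carrier (fp p :: (int, int, 'a) rep))"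
   by (auto simp: aiso_def)
  have "act V g x = x" if "g \<in> carrier G" "x \<in> carrier V" for g x
  proof -
   have "f (act V g x) = f x" using ahom_act[OF f(1) that] by simp
   thus ?thesis using f(2) that by (auto simp: bij_betw_def dest: inj_onD)
  qed
  thus False using nt by (auto simp: trivial_action_def)
 qed
 hence "card (ahom G V (fp p)) = 1" by (rule card_hom_noniso[OF V F])
 moreover have "(\<lambda>x\<in>carrier V. 0) \<in> ahom G V (fp p)" using ahom_zero_map[OF V.arep_axioms F'] by simp
 ultimately show ?thesis by (metis card_1_singletonE singletonD)
qed

subsection \<open>Comparison with representations over the prime field\<close>

text \<open>Over the prime field scalar multiplication is repeated addition; records for which this holds are
determined by their additive structure.\<close>

definition smult_ok :: "nat \<Rightarrow> (int, 'b, 'g) rep \<Rightarrow> bool" where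
 "smult_ok p V \<longleftrightarrow> (\<forall>a\<in>{0..<int p}. \<forall>x\<in>carrier V. a \<odot>\<^bsub>V\<^esub> x = add_pow V (nat a) x)"

lemma Fp_simps [simp]: "carrier (Fp p) = {0..<int p}" "\<zero>\<^bsub>Fp p\<^esub> = 0" "\<one>\<^bsub>Fp p\<^esub> = 1"
 "x \<oplus>\<^bsub>Fp p\<^esub> y = (x + y) mod int p" "x \<otimes>\<^bsub>Fp p\<^esub> y = (x * y) mod int p"
 by (auto simp: residue_ring_def)

lemma representation_arep:
 assumes rep: "representation G (Fp p) V" and fin: "finite (carrier V)" and p: "Factorial_Ring.prime p"
 shows "arep G p V" "smult_ok p V"
proof -
 interpret module "Fp p" V using rep by (simp add: representation_def)
 have p1: "int p > 1" using p prime_gt_1_nat by auto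
 interpret GA: group_hom G "BijGroup (carrier V)" "act V"
  using rep by (simp add: representation_def group_action_def)
 have sm: "int n \<odot>\<^bsub>V\<^esub> x = add_pow V n x" if "n < p" "x \<in> carrier V" for n x
  using that(1)
 proof (induct n)
  case 0 show ?case using smult_l_null[OF that(2)] by (simp add: add_pow_def)
 next
  case (Suc n)
  have "int (Suc n) \<odot>\<^bsub>V\<^esub> x = (int n \<oplus>\<^bsub>Fp p\<^esub> 1) \<odot>\<^bsub>V\<^esub> x" using Suc(2) by (simp add: add.commute)
  also have "\<dots> = int n \<odot>\<^bsub>V\<^esub> x \<oplus>\<^bsub>V\<^esub> 1 \<odot>\<^bsub>V\<^esub> x" using Suc(2) that p1 by (intro smult_l_distr) auto
  also have "1 \<odot>\<^bsub>V\<^esub> x = x" using smult_one[OF that(2)] by simp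
  finally show ?case using Suc by (simp add: add_pow_def)
 qed
 thus "smult_ok p V" unfolding smult_ok_def by (metis atLeastLessThan_iff int_nat_eq nat_less_iff)
 have tors: "add_pow V p x = \<zero>\<^bsub>V\<^esub>" if x: "x \<in> carrier V" for x
 proof -
  obtain m where m: "p = Suc m" using p1 by (cases p) auto
  have mp: "m < p" using m by simp
  have o: "1 \<odot>\<^bsub>V\<^esub> x = x" using smult_one[OF x] by simp
  have "add_pow V p x = int m \<odot>\<^bsub>V\<^esub> x \<oplus>\<^bsub>V\<^esub> 1 \<odot>\<^bsub>V\<^esub> x"
   using sm[of m x] x by (simp add: m add_pow_Suc o)
  also have "\<dots> = (int m \<oplus>\<^bsub>Fp p\<^esub> 1) \<odot>\<^bsub>V\<^esub> x" using x p1 mp by (intro smult_l_distr[symmetric]) auto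
  also have "int m \<oplus>\<^bsub>Fp p\<^esub> 1 = 0" unfolding Fp_simps by (simp add: m add.commute)
  also have "0 \<odot>\<^bsub>V\<^esub> x = \<zero>\<^bsub>V\<^esub>" using smult_l_null[OF x] by simp
  finally show ?thesis .
 qed
 have ah: "act V g \<in> Bij (carrier V)" if "g \<in> carrier G" for g
  using GA.hom_closed[OF that] by (simp add: BijGroup_def)
 have one: "act V \<one>\<^bsub>G\<^esub> = (\<lambda>x\<in>carrier V. x)" using GA.hom_one by (simp add: BijGroup_def)
 have mult: "act V (g \<otimes>\<^bsub>G\<^esub> h) x = act V g (act V h x)"
  if "g \<in> carrier G" "h \<in> carrier G" "x \<in> carrier V" for g h x
  using GA.hom_mult[OF that(1,2)] ah that by (simp add: BijGroup_def compose_def)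
 have madd: "act V g (x \<oplus>\<^bsub>V\<^esub> y) = act V g x \<oplus>\<^bsub>V\<^esub> act V g y"
  if "g \<in> carrier G" "x \<in> carrier V" "y \<in> carrier V" for g x y
  using rep that by (auto simp: representation_def intro: module_hom_add)
 show "arep G p V"
  by (intro arep.intro arep_axioms.intro GA.G.group_axioms M.abelian_group_axioms p fin tors madd mult)
   (use ah one in \<open>auto simp: Bij_def bij_betw_def\<close>)
qed

lemma arep_representation:
 assumes V: "arep G p V" and sm: "smult_ok p V" and ext: "\<And>g. g \<in> carrier G \<Longrightarrow> act V g \<in> extensional (carrier V)"
 shows "representation G (Fp p) V"
proof -
 interpret V: arep G p V by fact
 have p1: "int p > 1" using V.prime_p prime_gt_1_nat by auto
 have s: "a \<odot>\<^bsub>V\<^esub> x = add_pow V (nat a) x" if "0 \<le> a" "a < int p" "x \<in> carrier V" for a x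
  using sm that by (auto simp: smult_ok_def)
 have md: "Module.module (Fp p) V"
 proof (rule moduleI)
  show "cring (Fp p)" by (rule residues.cring) (use p1 in \<open>simp add: residues_def\<close>)
 next
  fix a b x assume "a \<in> carrier (Fp p)" "b \<in> carrier (Fp p)" "x \<in> carrier V"
  hence ab: "0 \<le> a" "a < int p" "0 \<le> b" "b < int p" and x: "x \<in> carrier V" by auto
  have "nat ((a + b) mod int p) = (nat a + nat b) mod p" using ab p1 by (simp add: nat_mod_distrib nat_add_distrib)
  thus "(a \<oplus>\<^bsub>Fp p\<^esub> b) \<odot>\<^bsub>V\<^esub> x = a \<odot>\<^bsub>V\<^esub> x \<oplus>\<^bsub>V\<^esub> b \<odot>\<^bsub>V\<^esub> x"
   using ab x p1 by (simp add: s V.pow_mod V.pow_add)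
  have "nat ((a * b) mod int p) = (nat a * nat b) mod p" using ab p1 by (simp add: nat_mod_distrib nat_mult_distrib)
  thus "(a \<otimes>\<^bsub>Fp p\<^esub> b) \<odot>\<^bsub>V\<^esub> x = a \<odot>\<^bsub>V\<^esub> (b \<odot>\<^bsub>V\<^esub> x)"
   using ab x p1 by (simp add: s V.pow_mod V.pow_pow mult.commute)
 qed (use s p1 in \<open>auto simp: V.V.abelian_group_axioms V.pow_distrib add_pow_def[of _ "Suc 0"]\<close>)
 have bij: "act V g \<in> Bij (carrier V)" if g: "g \<in> carrier G" for g
 proof -
  have "bij_betw (act V g) (carrier V) (carrier V)"
   by (rule bij_betw_byWitness[where f' = "act V (inv\<^bsub>G\<^esub> g)"]) (use g in auto)
  thus ?thesis using ext[OF g] by (simp add: Bij_def)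
 qed
 have "group_hom G (BijGroup (carrier V)) (act V)"
 proof (intro group_hom.intro V.G.group_axioms group_BijGroup group_hom_axioms.intro homI)
  show "act V g \<in> carrier (BijGroup (carrier V))" if "g \<in> carrier G" for g
   using bij[OF that] by (simp add: BijGroup_def)
  fix g h assume gh: "g \<in> carrier G" "h \<in> carrier G"
  have "act V (g \<otimes>\<^bsub>G\<^esub> h) = compose (carrier V) (act V g) (act V h)"
   using ext[of "g \<otimes>\<^bsub>G\<^esub> h"] gh
   by (intro extensionalityI[where A = "carrier V"]) (auto simp: compose_def V.act_mult)
  thus "act V (g \<otimes>\<^bsub>G\<^esub> h) = act V g \<otimes>\<^bsub>BijGroup (carrier V)\<^esub> act V h"
   using bij gh by (simp add: BijGroup_def)
 qed
 moreover have "act V g \<in> module_hom (Fp p) V V" if "g \<in> carrier G" for g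
  using that by (auto simp: module_hom_def s V.act_pow)
 ultimately show ?thesis using md by (simp add: representation_def group_action_def)
qed

lemma ahom_pow:
 assumes "arep G p U" "arep G p V" "f \<in> ahom G U V" "x \<in> carrier U"
 shows "f (add_pow U (n::nat) x) = add_pow V n (f x)"
proof -
 interpret U: arep G p U by fact
 interpret V: arep G p V by fact
 show ?thesis
  by (induct n) (use assms ahom_zero[OF assms(1-3)] in \<open>auto simp: add_pow_Suc ahom_add\<close>)
qed

lemma rep_hom_eq_ahom:
 assumes "arep G p U" "arep G p V" "smult_ok p U" "smult_ok p V"
 shows "rep_hom G (Fp p) U V = ahom G U V"
proof -
 have "f \<in> rep_hom G (Fp p) U V \<longleftrightarrow> f \<in> ahom G U V" for f
 proof
  assume "f \<in> rep_hom G (Fp p) U V"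
  thus "f \<in> ahom G U V" by (auto simp: rep_hom_def ahom_def module_hom_def PiE_def)
 next
  assume f: "f \<in> ahom G U V"
  thus "f \<in> rep_hom G (Fp p) U V"
   using ahom_pow[OF assms(1,2) f] assms(3,4)
   by (auto simp: rep_hom_def module_hom_def smult_ok_def ahom_closed ahom_add ahom_act ahom_ext)
 qed
 thus ?thesis by blast
qed

lemma rep_iso_eq_aiso:
 assumes "arep G p U" "arep G p V" "smult_ok p U" "smult_ok p V"
 shows "rep_iso G (Fp p) U V \<longleftrightarrow> aiso G U V"
 by (simp add: rep_iso_def aiso_def rep_hom_eq_ahom[OF assms])

lemma smult_ok_prod:
 assumes "\<And>i. i \<in> I \<Longrightarrow> smult_ok p (V i)"
 shows "smult_ok p (rep_prod I V)"
proof -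
 have pw: "add_pow (rep_prod I V) (n::nat) x = (\<lambda>i\<in>I. add_pow (V i) n (x i))" for n x
  by (induct n) (auto simp: add_pow_def restrict_def)
 show ?thesis using assms by (auto simp: smult_ok_def pw restrict_def fun_eq_iff PiE_iff)
qed

lemma irreducible_rep_airr:
 assumes irr: "irreducible_rep G (Fp p) V" and fin: "finite (carrier V)" and p: "Factorial_Ring.prime p"
 shows "airr G p V"
proof -
 have rep: "representation G (Fp p) V" using irr by (simp add: irreducible_rep_def)
 note V = representation_arep[OF rep fin p]
 interpret V: arep G p V by (rule V(1))
 interpret M: module "Fp p" V using rep by (simp add: representation_def)
 show ?thesis unfolding airr_def
 proof (intro conjI allI impI V(1))
  show "carrier V \<noteq> {\<zero>\<^bsub>V\<^esub>}" using irr by (simp add: irreducible_rep_def)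
  fix N assume N: "asub G V N"
  have "Module.submodule N (Fp p) V"
   using N V(2) V.asub_pow[OF N] V.asub_neg[OF N]
   by (intro M.submoduleI) (auto simp: asub_def smult_ok_def subset_iff)
  thus "N = {\<zero>\<^bsub>V\<^esub>} \<or> N = carrier V" using irr N by (auto simp: irreducible_rep_def asub_def)
 qed
qed

lemma airr_irreducible_rep:
 assumes irr: "airr G p V" and rep: "representation G (Fp p) V"
 shows "irreducible_rep G (Fp p) V"
proof -
 interpret V: arep G p V using irr by (simp add: airr_def)
 show ?thesis unfolding irreducible_rep_def
 proof (intro conjI allI impI rep)
  show "carrier V \<noteq> {\<zero>\<^bsub>V\<^esub>}" using irr by (simp add: airr_def)
  fix N assume "Module.submodule N (Fp p) V \<and> (\<forall>g\<in>carrier G. act V g ` N \<subseteq> N)"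
  hence N: "subgroup N (add_monoid V)" "\<forall>g\<in>carrier G. act V g ` N \<subseteq> N" by (auto simp: Module.submodule_def)
  have "asub G V N" unfolding asub_def
   using subgroup.subset[OF N(1)] subgroup.one_closed[OF N(1)] subgroup.m_closed[OF N(1)] N(2)
   by (auto simp: image_subset_iff)
  thus "N = {\<zero>\<^bsub>V\<^esub>} \<or> N = carrier V" using irr by (auto simp: airr_def)
 qed
qed

text \<open>Every finite representation has a copy whose carrier consists of natural numbers.\<close>

lemma nat_copy_exists:
 assumes "arep G p V"
 obtains U :: "(int, nat, 'g) rep" where "arep G p U" "smult_ok p U" "representation G (Fp p) U"
  "aiso G U (V :: ('a, 'b, 'g) rep)"
proof -
 interpret V: arep G p V by fact
 obtain \<phi> :: "'b \<Rightarrow> nat" where \<phi>: "inj_on \<phi> (carrier V)"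
  using V.finite_carrier by (meson finite_imp_inj_to_nat_seg)
 define \<psi> where "\<psi> = inv_into (carrier V) \<phi>"
 have \<psi>\<phi> [simp]: "\<psi> (\<phi> x) = x" if "x \<in> carrier V" for x using \<phi> that by (simp add: \<psi>_def)
 have \<phi>i: "\<phi> x = \<phi> y \<longleftrightarrow> x = y" if "x \<in> carrier V" "y \<in> carrier V" for x y
  using inj_on_eq_iff[OF \<phi> that] .
 define U :: "(int, nat, 'g) rep" where "U = \<lparr>carrier = \<phi> ` carrier V, monoid.mult = undefined, monoid.one = undefined,
   ring.zero = \<phi> \<zero>\<^bsub>V\<^esub>, ring.add = (\<lambda>m n. \<phi> (\<psi> m \<oplus>\<^bsub>V\<^esub> \<psi> n)),
   module.smult = (\<lambda>a n. \<phi> (add_pow V (nat a) (\<psi> n))),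
   act = (\<lambda>g. \<lambda>n\<in>\<phi> ` carrier V. \<phi> (act V g (\<psi> n)))\<rparr>"
 have U [simp]: "carrier U = \<phi> ` carrier V" "\<zero>\<^bsub>U\<^esub> = \<phi> \<zero>\<^bsub>V\<^esub>" "m \<oplus>\<^bsub>U\<^esub> n = \<phi> (\<psi> m \<oplus>\<^bsub>V\<^esub> \<psi> n)"
  "a \<odot>\<^bsub>U\<^esub> n = \<phi> (add_pow V (nat a) (\<psi> n))" "act U g = (\<lambda>n\<in>\<phi> ` carrier V. \<phi> (act V g (\<psi> n)))"
  for m n a g by (simp_all add: U_def)
 have "abelian_group U"
 proof (rule abelian_groupI)
  fix x assume "x \<in> carrier U"
  then obtain y where y: "y \<in> carrier V" "x = \<phi> y" by auto
  show "\<exists>y\<in>carrier U. y \<oplus>\<^bsub>U\<^esub> x = \<zero>\<^bsub>U\<^esub>"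
   using y by (intro bexI[of _ "\<phi> (\<ominus>\<^bsub>V\<^esub> y)"]) (auto simp: V.V.l_neg)
 qed (auto simp: V.V.a_ac)
 moreover have pw: "add_pow U (n::nat) (\<phi> x) = \<phi> (add_pow V n x)" if "x \<in> carrier V" for n x
  by (induct n) (use that in \<open>simp_all add: add_pow_zero add_pow_Suc\<close>)
 ultimately have aU: "arep G p U"
  by (intro arep.intro arep_axioms.intro V.G.group_axioms V.prime_p) (auto simp: V.torsion V.act_mult \<phi>i)
 have sU: "smult_ok p U" by (auto simp: smult_ok_def pw)
 have "representation G (Fp p) U" by (rule arep_representation[OF aU sU]) simp
 moreover have "aiso G U V" unfolding aiso_def
 proof (rule bexI[of _ "restrict \<psi> (\<phi> ` carrier V)"])
  show "bij_betw (restrict \<psi> (\<phi> ` carrier V)) (carrier U) (carrier V)"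
   by (rule bij_betw_byWitness[where f' = \<phi>]) auto
  show "restrict \<psi> (\<phi> ` carrier V) \<in> ahom G U V"
   by (rule ahomI) (auto simp: \<phi>i dest: sym)
 qed
 ultimately show ?thesis using that aU sU by blast
qed

lemma aiso_trivial_action:
 assumes U: "arep G p U" and V: "arep G p V" and i: "aiso G U V" and t: "trivial_action G V"
 shows "trivial_action G U"
proof -
 interpret U: arep G p U by fact
 obtain f where f: "f \<in> ahom G U V" "bij_betw f (carrier U) (carrier V)" using i by (auto simp: aiso_def)
 show ?thesis unfolding trivial_action_def
 proof (intro ballI)
  fix g v assume gv: "g \<in> carrier G" "v \<in> carrier U"
  have "f (act U g v) = f v" using ahom_act[OF f(1) gv] t gv ahom_closed[OF f(1)] by (simp add: trivial_action_def)
  thus "act U g v = v" using f(2) gv by (auto simp: bij_betw_def dest: inj_onD)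
 qed
qed

lemma airr_aiso:
 assumes V: "airr G p V" and U: "arep G p U" and i: "aiso G U V"
 shows "airr G p U"
proof -
 interpret U: arep G p U by fact
 interpret V: arep G p V using V by (simp add: airr_def)
 obtain f where f: "f \<in> ahom G U V" "bij_betw f (carrier U) (carrier V)" using i by (auto simp: aiso_def)
 have inj: "inj_on f (carrier U)" and im: "f ` carrier U = carrier V" using f(2) by (auto simp: bij_betw_def)
 have f0: "f \<zero>\<^bsub>U\<^esub> = \<zero>\<^bsub>V\<^esub>" by (rule ahom_zero[OF U V.arep_axioms f(1)])
 show ?thesis unfolding airr_def
 proof (intro conjI allI impI U)
  show "carrier U \<noteq> {\<zero>\<^bsub>U\<^esub>}" using V im f0 by (auto simp: airr_def)
  fix N assume N: "asub G U N"
  have Nc: "N \<subseteq> carrier U" using N by (auto simp: asub_def)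
  have "asub G V (f ` N)" unfolding asub_def
  proof (intro conjI ballI)
   show "f ` N \<subseteq> carrier V" using Nc im by auto
   show "\<zero>\<^bsub>V\<^esub> \<in> f ` N" using N f0 by (force simp: asub_def)
   show "x \<oplus>\<^bsub>V\<^esub> y \<in> f ` N" if "x \<in> f ` N" "y \<in> f ` N" for x y
    using that N Nc by (auto simp: asub_def ahom_add[OF f(1), symmetric] subset_iff)
   show "act V g x \<in> f ` N" if "g \<in> carrier G" "x \<in> f ` N" for g x
    using that N Nc by (auto simp: asub_def ahom_act[OF f(1), symmetric] subset_iff)
  qed
  hence "f ` N = {\<zero>\<^bsub>V\<^esub>} \<or> f ` N = carrier V" using V by (auto simp: airr_def)
  moreover have "f ` {\<zero>\<^bsub>U\<^esub>} = {\<zero>\<^bsub>V\<^esub>}" using f0 by simp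
  ultimately show "N = {\<zero>\<^bsub>U\<^esub>} \<or> N = carrier U"
   using inj_on_image_eq_iff[OF inj Nc] im U.V.zero_closed by (metis empty_subsetI insert_subset order_refl)
 qed
qed

subsection \<open>Dual representations and invariant bilinear forms\<close>

lemma rep_dual_simps:
 "\<zero>\<^bsub>rep_dual G (Fp p) V\<^esub> = (\<lambda>v\<in>carrier V. 0)"
 "f \<oplus>\<^bsub>rep_dual G (Fp p) V\<^esub> h = (\<lambda>v\<in>carrier V. (f v + h v) mod int p)"
 "a \<odot>\<^bsub>rep_dual G (Fp p) V\<^esub> f = (\<lambda>v\<in>carrier V. (a * f v) mod int p)"
 "f \<in> carrier (rep_dual G (Fp p) V) \<Longrightarrow>
   act (rep_dual G (Fp p) V) g f = (\<lambda>v\<in>carrier V. f (act V (inv\<^bsub>G\<^esub> g) v))"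
 by (auto simp: rep_dual_def Let_def)

lemma rep_dual_carrier:
 assumes "arep G p V" "smult_ok p V"
 shows "carrier (rep_dual G (Fp p) V) = ahom (triv_grp G) V (fp p)"
proof -
 interpret V: arep G p V by fact
 interpret T: arep "triv_grp G" p V by (rule V.arep_triv)
 have F: "arep (triv_grp G) p (fp p)" by (rule arep_fp[OF T.G.group_axioms V.prime_p])
 have "f \<in> module_hom (Fp p) V (self_module (Fp p)) \<inter> extensional (carrier V) \<longleftrightarrow> f \<in> ahom (triv_grp G) V (fp p)" for f
 proof
  assume "f \<in> module_hom (Fp p) V (self_module (Fp p)) \<inter> extensional (carrier V)"
  thus "f \<in> ahom (triv_grp G) V (fp p)"
   by (intro ahomI) (auto simp: module_hom_def self_module_def Pi_def)
 next
  assume f: "f \<in> ahom (triv_grp G) V (fp p)"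
  have "f (r \<odot>\<^bsub>V\<^esub> m) = (r * f m) mod int p" if "0 \<le> r" "r < int p" "m \<in> carrier V" for r m
  proof -
   have "f (r \<odot>\<^bsub>V\<^esub> m) = f (add_pow V (nat r) m)" using assms(2) that by (simp add: smult_ok_def)
   also have "\<dots> = add_pow (fp p :: (int, int, 'a) rep) (nat r) (f m)"
    by (rule ahom_pow[OF T.arep_axioms F f that(3)])
   also have "\<dots> = (r * f m) mod int p" using that ahom_closed[OF f that(3)] by (simp add: fp_pow)
   finally show ?thesis .
  qed
  thus "f \<in> module_hom (Fp p) V (self_module (Fp p)) \<inter> extensional (carrier V)"
   using ahom_closed[OF f] ahom_add[OF f] ahom_ext[OF f] by (auto simp: module_hom_def self_module_def)
 qed
 thus ?thesis by (auto simp: rep_dual_def Let_def)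
qed

lemma
 assumes "arep G p V" "smult_ok p V"
 shows arep_dual: "arep G p (rep_dual G (Fp p) V)"
  and smult_ok_dual: "smult_ok p (rep_dual G (Fp p) V)"
  and card_dual: "card (carrier (rep_dual G (Fp p) V)) = card (carrier V)"
proof -
 interpret V: arep G p V by fact
 interpret T: arep "triv_grp G" p V by (rule V.arep_triv)
 have F: "arep (triv_grp G) p (fp p)" by (rule arep_fp[OF T.G.group_axioms V.prime_p])
 define D where "D = rep_dual G (Fp p) V"
 have Dc: "carrier D = ahom (triv_grp G) V (fp p)" unfolding D_def by (rule rep_dual_carrier[OF assms])
 note Ds = rep_dual_simps[where G = G and p = p and V = V, folded D_def]
 have p0: "int p > 0" using V.prime_p prime_gt_0_nat by auto
 have rng: "0 \<le> f v" "f v < int p" if "f \<in> carrier D" "v \<in> carrier V" for f v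
  using ahom_closed[of f "triv_grp G" V "fp p" v] that by (auto simp: Dc)
 have ad: "f (v \<oplus>\<^bsub>V\<^esub> w) = (f v + f w) mod int p" if "f \<in> carrier D" "v \<in> carrier V" "w \<in> carrier V" for f v w
  using ahom_add[of f "triv_grp G" V "fp p" v w] that by (auto simp: Dc)
 have ext: "f \<in> extensional (carrier V)" if "f \<in> carrier D" for f
  using ahom_ext[of f "triv_grp G" V "fp p"] that by (auto simp: Dc)
 have DI: "f \<in> carrier D" if "f \<in> extensional (carrier V)" "\<And>v. v \<in> carrier V \<Longrightarrow> 0 \<le> f v \<and> f v < int p"
  "\<And>v w. v \<in> carrier V \<Longrightarrow> w \<in> carrier V \<Longrightarrow> f (v \<oplus>\<^bsub>V\<^esub> w) = (f v + f w) mod int p" for f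
  unfolding Dc using that by (intro ahomI) auto
 have eqI: "f = h" if "f \<in> extensional (carrier V)" "h \<in> extensional (carrier V)" "\<And>v. v \<in> carrier V \<Longrightarrow> f v = h v" for f h :: "_ \<Rightarrow> int"
  using that by (metis extensionalityI)
 have addD: "f \<oplus>\<^bsub>D\<^esub> h \<in> carrier D" if fh: "f \<in> carrier D" "h \<in> carrier D" for f h
 proof (rule DI)
  fix v w assume vw: "v \<in> carrier V" "w \<in> carrier V"
  have "(f (v \<oplus>\<^bsub>V\<^esub> w) + h (v \<oplus>\<^bsub>V\<^esub> w)) mod int p = ((f v + f w) + (h v + h w)) mod int p"
   using vw fh by (simp add: ad mod_add_eq)
  also have "\<dots> = ((f v + h v) + (f w + h w)) mod int p" by (simp add: algebra_simps)
  also have "\<dots> = ((f v + h v) mod int p + (f w + h w) mod int p) mod int p" by (simp add: mod_add_eq)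
  finally show "(f \<oplus>\<^bsub>D\<^esub> h) (v \<oplus>\<^bsub>V\<^esub> w) = ((f \<oplus>\<^bsub>D\<^esub> h) v + (f \<oplus>\<^bsub>D\<^esub> h) w) mod int p"
   using vw by (simp add: Ds)
 qed (use p0 in \<open>auto simp: Ds\<close>)
 have zeroD: "\<zero>\<^bsub>D\<^esub> \<in> carrier D" by (rule DI) (use p0 in \<open>auto simp: Ds\<close>)
 have negD: "(\<lambda>v\<in>carrier V. (- f v) mod int p) \<in> carrier D" if f: "f \<in> carrier D" for f
 proof (rule DI)
  fix v w assume vw: "v \<in> carrier V" "w \<in> carrier V"
  have "(- f (v \<oplus>\<^bsub>V\<^esub> w)) mod int p = (- f v + - f w) mod int p" using vw f by (simp add: ad mod_minus_eq)
  also have "\<dots> = ((- f v) mod int p + (- f w) mod int p) mod int p" by (rule mod_add_eq[symmetric])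
  finally show "(\<lambda>v\<in>carrier V. (- f v) mod int p) (v \<oplus>\<^bsub>V\<^esub> w) =
   ((\<lambda>v\<in>carrier V. (- f v) mod int p) v + (\<lambda>v\<in>carrier V. (- f v) mod int p) w) mod int p"
   using vw by simp
 qed (use p0 in auto)
 have "abelian_group D"
 proof (rule abelian_groupI)
  fix f assume f: "f \<in> carrier D"
  show "\<exists>h\<in>carrier D. h \<oplus>\<^bsub>D\<^esub> f = \<zero>\<^bsub>D\<^esub>"
   by (rule bexI[OF _ negD[OF f]]) (auto simp: Ds fun_eq_iff restrict_def mod_add_left_eq)
  show "\<zero>\<^bsub>D\<^esub> \<oplus>\<^bsub>D\<^esub> f = f"
   by (rule eqI) (use f ext rng in \<open>auto simp: Ds\<close>)
  fix h assume "h \<in> carrier D"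
  show "f \<oplus>\<^bsub>D\<^esub> h = h \<oplus>\<^bsub>D\<^esub> f" by (simp add: Ds add.commute)
  fix k
  show "f \<oplus>\<^bsub>D\<^esub> h \<oplus>\<^bsub>D\<^esub> k = f \<oplus>\<^bsub>D\<^esub> (h \<oplus>\<^bsub>D\<^esub> k)"
   by (auto simp: Ds fun_eq_iff restrict_def mod_add_left_eq mod_add_right_eq add.assoc)
 qed (use addD zeroD in auto)
 moreover have pw: "add_pow D (n::nat) f = (\<lambda>v\<in>carrier V. (int n * f v) mod int p)" if "f \<in> carrier D" for n f
  by (induct n) (auto simp: add_pow_zero add_pow_Suc Ds fun_eq_iff restrict_def mod_add_left_eq mod_add_right_eq algebra_simps)
 moreover have actD: "act D g f \<in> carrier D" if gf: "g \<in> carrier G" "f \<in> carrier D" for g f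
  by (rule DI) (use gf ad rng in \<open>auto simp: Ds\<close>)
 moreover have "finite (carrier D)" unfolding Dc by (rule ahom_finite[OF T.arep_axioms F])
 moreover have "act D \<one>\<^bsub>G\<^esub> f = f" if f: "f \<in> carrier D" for f
  by (rule eqI) (use f ext in \<open>auto simp: Ds\<close>)
 moreover have "act D (g \<otimes>\<^bsub>G\<^esub> h) f = act D g (act D h f)" if gh: "g \<in> carrier G" "h \<in> carrier G" "f \<in> carrier D" for g h f
  using gh actD[OF gh(2,3)] by (auto simp: Ds fun_eq_iff restrict_def V.G.inv_mult_group V.act_mult)
 moreover have "act D g (f \<oplus>\<^bsub>D\<^esub> h) = act D g f \<oplus>\<^bsub>D\<^esub> act D g h" if "g \<in> carrier G" "f \<in> carrier D" "h \<in> carrier D" for g f h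
  using that addD by (auto simp: Ds fun_eq_iff restrict_def)
 ultimately show "arep G p (rep_dual G (Fp p) V)"
  unfolding D_def[symmetric]
  by (intro arep.intro arep_axioms.intro V.G.group_axioms V.prime_p) (auto simp: Ds(1))
 show "smult_ok p (rep_dual G (Fp p) V)"
  unfolding D_def[symmetric] smult_ok_def by (auto simp: pw Ds)
 show "card (carrier (rep_dual G (Fp p) V)) = card (carrier V)"
  unfolding D_def[symmetric] Dc by (rule V.card_functionals)
qed

text \<open>Invariant bilinear forms with values in the residues modulo \<open>p\<close>, as extensional functions on pairs so that they
can be counted.\<close>

definition forms :: "('g, 'm) monoid_scheme \<Rightarrow> nat \<Rightarrow> ('a, 'b, 'g) rep \<Rightarrow> ('c, 'd, 'g) rep \<Rightarrow> ('b \<times> 'd \<Rightarrow> int) set"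
 where "forms G p U V = {b \<in> (carrier U \<times> carrier V) \<rightarrow>\<^sub>E {0..<int p}.
  (\<forall>x\<in>carrier U. \<forall>x'\<in>carrier U. \<forall>y\<in>carrier V. b (x \<oplus>\<^bsub>U\<^esub> x', y) = (b (x, y) + b (x', y)) mod int p) \<and>
  (\<forall>x\<in>carrier U. \<forall>y\<in>carrier V. \<forall>y'\<in>carrier V. b (x, y \<oplus>\<^bsub>V\<^esub> y') = (b (x, y) + b (x, y')) mod int p) \<and>
  (\<forall>g\<in>carrier G. \<forall>x\<in>carrier U. \<forall>y\<in>carrier V. b (act U g x, act V g y) = b (x, y))}"

definition alt_forms where "alt_forms G p V = {b \<in> forms G p V V. \<forall>x\<in>carrier V. b (x, x) = 0}"

lemma formsI:
 assumes "b \<in> extensional (carrier U \<times> carrier V)"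
  "\<And>x y. x \<in> carrier U \<Longrightarrow> y \<in> carrier V \<Longrightarrow> 0 \<le> b (x, y) \<and> b (x, y) < int p"
  "\<And>x x' y. x \<in> carrier U \<Longrightarrow> x' \<in> carrier U \<Longrightarrow> y \<in> carrier V \<Longrightarrow> b (x \<oplus>\<^bsub>U\<^esub> x', y) = (b (x, y) + b (x', y)) mod int p"
  "\<And>x y y'. x \<in> carrier U \<Longrightarrow> y \<in> carrier V \<Longrightarrow> y' \<in> carrier V \<Longrightarrow> b (x, y \<oplus>\<^bsub>V\<^esub> y') = (b (x, y) + b (x, y')) mod int p"
  "\<And>g x y. g \<in> carrier G \<Longrightarrow> x \<in> carrier U \<Longrightarrow> y \<in> carrier V \<Longrightarrow> b (act U g x, act V g y) = b (x, y)"
 shows "b \<in> forms G p U V"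
 unfolding forms_def PiE_def Pi_def using assms by auto

lemma
 assumes "b \<in> forms G p U V"
 shows forms_ext: "b \<in> extensional (carrier U \<times> carrier V)"
  and forms_range: "x \<in> carrier U \<Longrightarrow> y \<in> carrier V \<Longrightarrow> 0 \<le> b (x, y) \<and> b (x, y) < int p"
  and forms_add1: "x \<in> carrier U \<Longrightarrow> x' \<in> carrier U \<Longrightarrow> y \<in> carrier V \<Longrightarrow> b (x \<oplus>\<^bsub>U\<^esub> x', y) = (b (x, y) + b (x', y)) mod int p"
  and forms_add2: "x \<in> carrier U \<Longrightarrow> y \<in> carrier V \<Longrightarrow> y' \<in> carrier V \<Longrightarrow> b (x, y \<oplus>\<^bsub>V\<^esub> y') = (b (x, y) + b (x, y')) mod int p"
  and forms_act: "g \<in> carrier G \<Longrightarrow> x \<in> carrier U \<Longrightarrow> y \<in> carrier V \<Longrightarrow> b (act U g x, act V g y) = b (x, y)"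
 using assms unfolding forms_def PiE_def Pi_def by auto

lemma alt_forms_forms: "b \<in> alt_forms G p V \<Longrightarrow> b \<in> forms G p V V"
 by (simp add: alt_forms_def)

lemma forms_eqI:
 assumes "b \<in> forms G p U V" "c \<in> forms G p U V" "\<And>x y. x \<in> carrier U \<Longrightarrow> y \<in> carrier V \<Longrightarrow> b (x, y) = c (x, y)"
 shows "b = c"
 by (rule extensionalityI[OF forms_ext[OF assms(1)] forms_ext[OF assms(2)]]) (use assms(3) in auto)

lemma forms_zero:
 assumes "b \<in> forms G p U V" "arep G p U" "arep G p V"
 shows "y \<in> carrier V \<Longrightarrow> b (\<zero>\<^bsub>U\<^esub>, y) = 0" "x \<in> carrier U \<Longrightarrow> b (x, \<zero>\<^bsub>V\<^esub>) = 0"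
proof -
 interpret U: arep G p U by fact
 interpret V: arep G p V by fact
 have *: "k = 0" if "k = (k + k) mod int p" "0 \<le> k" "k < int p" for k
 proof -
  have "int p dvd (k + k) - (k + k) mod int p" by (rule dvd_minus_mod)
  hence "int p dvd (k + k) - k" unfolding that(1)[symmetric] .
  hence "int p dvd k" by simp
  thus ?thesis using that zdvd_not_zless[of k "int p"] by (cases "k = 0") auto
 qed
 show "b (\<zero>\<^bsub>U\<^esub>, y) = 0" if y: "y \<in> carrier V"
 proof (rule *)
  show "b (\<zero>\<^bsub>U\<^esub>, y) = (b (\<zero>\<^bsub>U\<^esub>, y) + b (\<zero>\<^bsub>U\<^esub>, y)) mod int p"
   using forms_add1[OF assms(1) U.V.zero_closed U.V.zero_closed y] unfolding U.V.l_zero[OF U.V.zero_closed] .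
 qed (use forms_range[OF assms(1) U.V.zero_closed y] in auto)
 show "b (x, \<zero>\<^bsub>V\<^esub>) = 0" if x: "x \<in> carrier U"
 proof (rule *)
  show "b (x, \<zero>\<^bsub>V\<^esub>) = (b (x, \<zero>\<^bsub>V\<^esub>) + b (x, \<zero>\<^bsub>V\<^esub>)) mod int p"
   using forms_add2[OF assms(1) x V.V.zero_closed V.V.zero_closed] unfolding V.V.l_zero[OF V.V.zero_closed] .
 qed (use forms_range[OF assms(1) x V.V.zero_closed] in auto)
qed

lemma forms_finite:
 assumes "arep G p U" "arep G p V" shows "finite (forms G p U V)"
proof -
 interpret U: arep G p U by fact
 interpret V: arep G p V by fact
 have "forms G p U V \<subseteq> (carrier U \<times> carrier V) \<rightarrow>\<^sub>E {0..<int p}" by (auto simp: forms_def)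
 thus ?thesis by (rule finite_subset) (simp add: finite_PiE)
qed

lemma zero_form:
 assumes "arep G p U" "arep G p V" shows "(\<lambda>_\<in>carrier U \<times> carrier V. 0) \<in> forms G p U V"
proof -
 interpret U: arep G p U by fact
 interpret V: arep G p V by fact
 show ?thesis by (rule formsI) (use prime_gt_0_nat[OF U.prime_p] in auto)
qed

text \<open>Currying.\<close>

lemma forms_dual_bij:
 assumes U: "arep G p U" and V: "arep G p V" and sm: "smult_ok p V"
 shows "bij_betw (\<lambda>b. \<lambda>x\<in>carrier U. \<lambda>y\<in>carrier V. b (x, y)) (forms G p U V) (ahom G U (rep_dual G (Fp p) V))"
proof -
 interpret U: arep G p U by fact
 interpret V: arep G p V by fact
 interpret D: arep G p "rep_dual G (Fp p) V" by (rule arep_dual[OF V sm])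
 note Dc = rep_dual_carrier[OF V sm]
 have rng: "0 \<le> \<beta> x y \<and> \<beta> x y < int p" and adD: "\<And>y'. y' \<in> carrier V \<Longrightarrow> \<beta> x (y \<oplus>\<^bsub>V\<^esub> y') = (\<beta> x y + \<beta> x y') mod int p"
  if "\<beta> \<in> ahom G U (rep_dual G (Fp p) V)" "x \<in> carrier U" "y \<in> carrier V" for \<beta> x y
 proof -
  have "\<beta> x \<in> ahom (triv_grp G) V (fp p)" using ahom_closed[OF that(1,2)] by (simp add: Dc)
  from ahom_closed[OF this that(3)] ahom_add[OF this that(3)]
  show "0 \<le> \<beta> x y \<and> \<beta> x y < int p" "\<And>y'. y' \<in> carrier V \<Longrightarrow> \<beta> x (y \<oplus>\<^bsub>V\<^esub> y') = (\<beta> x y + \<beta> x y') mod int p" by auto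
 qed
 have Fin: "(\<lambda>x\<in>carrier U. \<lambda>y\<in>carrier V. b (x, y)) \<in> ahom G U (rep_dual G (Fp p) V)" if b: "b \<in> forms G p U V" for b
 proof -
  have c: "(\<lambda>y\<in>carrier V. b (x, y)) \<in> carrier (rep_dual G (Fp p) V)" if "x \<in> carrier U" for x
   unfolding Dc by (rule ahomI) (use that forms_range[OF b] forms_add2[OF b] in auto)
  show ?thesis
  proof (rule ahomI)
   fix x x' assume x: "x \<in> carrier U" "x' \<in> carrier U"
   show "(\<lambda>x\<in>carrier U. \<lambda>y\<in>carrier V. b (x, y)) (x \<oplus>\<^bsub>U\<^esub> x') =
    (\<lambda>x\<in>carrier U. \<lambda>y\<in>carrier V. b (x, y)) x \<oplus>\<^bsub>rep_dual G (Fp p) V\<^esub> (\<lambda>x\<in>carrier U. \<lambda>y\<in>carrier V. b (x, y)) x'"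
    using x forms_add1[OF b] by (auto simp: rep_dual_simps fun_eq_iff restrict_def)
  next
   fix g x assume g: "g \<in> carrier G" and x: "x \<in> carrier U"
   have "b (act U g x, y) = b (x, act V (inv\<^bsub>G\<^esub> g) y)" if y: "y \<in> carrier V" for y
    using forms_act[OF b g x, of "act V (inv\<^bsub>G\<^esub> g) y"] g y by simp
   thus "(\<lambda>x\<in>carrier U. \<lambda>y\<in>carrier V. b (x, y)) (act U g x) =
    act (rep_dual G (Fp p) V) g ((\<lambda>x\<in>carrier U. \<lambda>y\<in>carrier V. b (x, y)) x)"
    using g x c[OF x] by (auto simp: rep_dual_simps(4) fun_eq_iff restrict_def)
  qed (use c in auto)
 qed
 have Hin: "(\<lambda>(x, y)\<in>carrier U \<times> carrier V. \<beta> x y) \<in> forms G p U V" if \<beta>: "\<beta> \<in> ahom G U (rep_dual G (Fp p) V)" for \<beta>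
 proof (rule formsI)
  fix x x' y assume x: "x \<in> carrier U" "x' \<in> carrier U" "y \<in> carrier V"
  thus "(\<lambda>(x, y)\<in>carrier U \<times> carrier V. \<beta> x y) (x \<oplus>\<^bsub>U\<^esub> x', y) =
   ((\<lambda>(x, y)\<in>carrier U \<times> carrier V. \<beta> x y) (x, y) + (\<lambda>(x, y)\<in>carrier U \<times> carrier V. \<beta> x y) (x', y)) mod int p"
   using ahom_add[OF \<beta>, of x x'] by (simp add: rep_dual_simps)
 next
  fix g x y assume g: "g \<in> carrier G" and x: "x \<in> carrier U" and y: "y \<in> carrier V"
  thus "(\<lambda>(x, y)\<in>carrier U \<times> carrier V. \<beta> x y) (act U g x, act V g y) = (\<lambda>(x, y)\<in>carrier U \<times> carrier V. \<beta> x y) (x, y)"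
   using ahom_act[OF \<beta> g x] ahom_closed[OF \<beta> x] by (simp add: rep_dual_simps(4))
 qed (use rng[OF \<beta>] adD[OF \<beta>] in auto)
 show ?thesis
 proof (rule bij_betw_byWitness[where f' = "\<lambda>\<beta>. \<lambda>(x, y)\<in>carrier U \<times> carrier V. \<beta> x y"])
  show "\<forall>b\<in>forms G p U V. (\<lambda>(x, y)\<in>carrier U \<times> carrier V. (\<lambda>x\<in>carrier U. \<lambda>y\<in>carrier V. b (x, y)) x y) = b"
  proof
   fix b assume b: "b \<in> forms G p U V"
   show "(\<lambda>(x, y)\<in>carrier U \<times> carrier V. (\<lambda>x\<in>carrier U. \<lambda>y\<in>carrier V. b (x, y)) x y) = b"
    by (rule forms_eqI[OF Hin[OF Fin[OF b]] b]) auto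
  qed
  show "\<forall>\<beta>\<in>ahom G U (rep_dual G (Fp p) V). (\<lambda>x\<in>carrier U. \<lambda>y\<in>carrier V. (\<lambda>(x, y)\<in>carrier U \<times> carrier V. \<beta> x y) (x, y)) = \<beta>"
  proof
   fix \<beta> assume \<beta>: "\<beta> \<in> ahom G U (rep_dual G (Fp p) V)"
   show "(\<lambda>x\<in>carrier U. \<lambda>y\<in>carrier V. (\<lambda>(x, y)\<in>carrier U \<times> carrier V. \<beta> x y) (x, y)) = \<beta>"
   proof (rule ahom_eqI[OF Fin[OF Hin[OF \<beta>]] \<beta>])
    fix x assume x: "x \<in> carrier U"
    have "\<beta> x \<in> extensional (carrier V)" using ahom_closed[OF \<beta> x] by (auto simp: Dc dest: ahom_ext)
    thus "(\<lambda>x\<in>carrier U. \<lambda>y\<in>carrier V. (\<lambda>(x, y)\<in>carrier U \<times> carrier V. \<beta> x y) (x, y)) x = \<beta> x"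
     using x by (auto simp: fun_eq_iff restrict_def extensional_def)
   qed
  qed
 qed (use Fin Hin in auto)
qed

lemma card_forms:
 assumes "arep G p U" "arep G p V" "smult_ok p V"
 shows "card (forms G p U V) = card (ahom G U (rep_dual G (Fp p) V))"
 by (rule bij_betw_same_card[OF forms_dual_bij[OF assms]])

lemma card_forms_swap_le:
 assumes U: "arep G p U" and V: "arep G p V"
 shows "card (forms G p U V) \<le> card (forms G p V U)"
proof (rule card_inj_on_le[OF _ _ forms_finite[OF V U]])
 interpret U: arep G p U by fact
 interpret V: arep G p V by fact
 let ?F = "\<lambda>b. \<lambda>(y, x)\<in>carrier V \<times> carrier U. b (x, y)"
 show "?F ` forms G p U V \<subseteq> forms G p V U"
 proof (rule image_subsetI)
  fix b assume b: "b \<in> forms G p U V"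
  show "?F b \<in> forms G p V U"
   by (rule formsI) (use forms_range[OF b] forms_add1[OF b] forms_add2[OF b] forms_act[OF b] in auto)
 qed
 show "inj_on ?F (forms G p U V)"
 proof (rule inj_onI)
  fix b c assume bc: "b \<in> forms G p U V" "c \<in> forms G p U V" "?F b = ?F c"
  show "b = c"
  proof (rule forms_eqI[OF bc(1,2)])
   fix x y assume "x \<in> carrier U" "y \<in> carrier V"
   thus "b (x, y) = c (x, y)" using fun_cong[OF bc(3), of "(y, x)"] by simp
  qed
 qed
qed

lemma card_forms_swap:
 "arep G p U \<Longrightarrow> arep G p V \<Longrightarrow> card (forms G p U V) = card (forms G p V U)"
 by (rule antisym) (rule card_forms_swap_le; assumption)+

text \<open>A nonzero invariant form between irreducible representations embeds each of them into the
 dual of the other; since dual spaces have equal size, both embeddings are isomorphisms.\<close>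

lemma iso_dual_iff:
 assumes U: "airr G p U" "smult_ok p U" and V: "airr G p V" "smult_ok p V"
 shows "aiso G U (rep_dual G (Fp p) V) \<longleftrightarrow> card (forms G p U V) \<noteq> 1"
proof -
 interpret U: arep G p U using U by (simp add: airr_def)
 interpret V: arep G p V using V by (simp add: airr_def)
 note DV = arep_dual[OF V.arep_axioms V(2)] and DU = arep_dual[OF U.arep_axioms U(2)]
 have ne: "\<exists>f\<in>ahom G A B. f \<noteq> (\<lambda>x\<in>carrier A. \<zero>\<^bsub>B\<^esub>)" if "card (ahom G A B) \<noteq> 1" "arep G p A" "arep G p B"
  for A :: "('u, 'v, 'a) rep" and B :: "('w, 'x, 'a) rep"
 proof (rule ccontr)
  assume "\<not> ?thesis"
  hence "ahom G A B = {\<lambda>x\<in>carrier A. \<zero>\<^bsub>B\<^esub>}" using ahom_zero_map[OF that(2,3)] by blast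
  thus False using that(1) by simp
 qed
 show ?thesis
 proof
  assume "aiso G U (rep_dual G (Fp p) V)"
  then obtain f where f: "f \<in> ahom G U (rep_dual G (Fp p) V)" "bij_betw f (carrier U) (carrier (rep_dual G (Fp p) V))"
   by (auto simp: aiso_def)
  have "f \<noteq> (\<lambda>x\<in>carrier U. \<zero>\<^bsub>rep_dual G (Fp p) V\<^esub>)"
  proof
   assume z: "f = (\<lambda>x\<in>carrier U. \<zero>\<^bsub>rep_dual G (Fp p) V\<^esub>)"
   obtain x where x: "x \<in> carrier U" "x \<noteq> \<zero>\<^bsub>U\<^esub>" using U(1) U.V.zero_closed by (force simp: airr_def)
   have "f x = f \<zero>\<^bsub>U\<^esub>" using x by (simp add: z)
   thus False using f(2) x U.V.zero_closed by (auto simp: bij_betw_def dest: inj_onD)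
  qed
  moreover have "f = (\<lambda>x\<in>carrier U. \<zero>\<^bsub>rep_dual G (Fp p) V\<^esub>)" if "ahom G U (rep_dual G (Fp p) V) = {h}" for h
   using f(1) ahom_zero_map[OF U.arep_axioms DV] unfolding that by simp
  ultimately show "card (forms G p U V) \<noteq> 1"
   using card_forms[OF U.arep_axioms V.arep_axioms V(2)] by (metis card_1_singletonE)
 next
  assume n: "card (forms G p U V) \<noteq> 1"
  obtain f where f: "f \<in> ahom G U (rep_dual G (Fp p) V)" "f \<noteq> (\<lambda>x\<in>carrier U. \<zero>\<^bsub>rep_dual G (Fp p) V\<^esub>)"
   using ne[OF _ U.arep_axioms DV] n card_forms[OF U.arep_axioms V.arep_axioms V(2)] by metis
  obtain h where h: "h \<in> ahom G V (rep_dual G (Fp p) U)" "h \<noteq> (\<lambda>x\<in>carrier V. \<zero>\<^bsub>rep_dual G (Fp p) U\<^esub>)"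
   using ne[OF _ V.arep_axioms DU] n card_forms[OF V.arep_axioms U.arep_axioms U(2)]
    card_forms_swap[OF U.arep_axioms V.arep_axioms] by metis
  have fi: "inj_on f (carrier U)" by (rule schur_inj[OF U(1) DV f])
  have hi: "inj_on h (carrier V)" by (rule schur_inj[OF V(1) DU h])
  have fs: "f ` carrier U \<subseteq> carrier (rep_dual G (Fp p) V)" and hs: "h ` carrier V \<subseteq> carrier (rep_dual G (Fp p) U)"
   using ahom_closed[OF f(1)] ahom_closed[OF h(1)] by auto
  have "card (carrier V) \<le> card (carrier U)"
   using card_inj_on_le[OF hi hs] card_dual[OF U.arep_axioms U(2)] arep.finite_carrier[OF DU] by simp
  moreover have "card (f ` carrier U) = card (carrier U)" by (rule card_image[OF fi])
  ultimately have "f ` carrier U = carrier (rep_dual G (Fp p) V)"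
   using card_dual[OF V.arep_axioms V(2)] arep.finite_carrier[OF DV] fs by (metis card_seteq)
  thus "aiso G U (rep_dual G (Fp p) V)" using f(1) fi by (auto simp: aiso_def bij_betw_def)
 qed
qed

lemma alt_antisym:
 assumes "b \<in> alt_forms G p V" "x \<in> carrier V" "y \<in> carrier V" "arep G p V"
 shows "(b (x, y) + b (y, x)) mod int p = 0"
proof -
 interpret V: arep G p V by fact
 have b: "b \<in> forms G p V V" and z: "\<And>x. x \<in> carrier V \<Longrightarrow> b (x, x) = 0" using assms(1) by (auto simp: alt_forms_def)
 have "0 = b (x \<oplus>\<^bsub>V\<^esub> y, x \<oplus>\<^bsub>V\<^esub> y)" using z assms by simp
 also have "\<dots> = ((b (x, x) + b (y, x)) mod int p + (b (x, y) + b (y, y)) mod int p) mod int p"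
  using assms by (simp add: forms_add1[OF b] forms_add2[OF b])
 also have "\<dots> = (b (x, y) + b (y, x)) mod int p" using z assms by (simp add: mod_add_eq add.commute)
 finally show ?thesis by simp
qed

text \<open>An alternating form on a direct sum consists of alternating forms on the summands and an
 arbitrary form pairing one summand with the other.\<close>

lemma (in biprod_rep) card_alt_forms:
 "card (alt_forms G p U) = card (alt_forms G p A) * card (alt_forms G p B) * card (forms G p A B)"
proof -
 let ?F = "\<lambda>b. (\<lambda>(a, a')\<in>carrier A \<times> carrier A. b (i1 a, i1 a'),
         \<lambda>(d, d')\<in>carrier B \<times> carrier B. b (i2 d, i2 d'),
         \<lambda>(a, d)\<in>carrier A \<times> carrier B. b (i1 a, i2 d))"
 let ?H = "\<lambda>(s, t, c). \<lambda>(u, u')\<in>carrier U \<times> carrier U.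
   (s (p1 u, p1 u') + t (p2 u, p2 u') + c (p1 u, p2 u') - c (p1 u', p2 u)) mod int p"
 have pp: "int p > 0" using A.prime_p prime_gt_0_nat by auto
 have F: "?F b \<in> alt_forms G p A \<times> alt_forms G p B \<times> forms G p A B" if b: "b \<in> alt_forms G p U" for b
 proof -
  have bf: "b \<in> forms G p U U" and z: "\<And>x. x \<in> carrier U \<Longrightarrow> b (x, x) = 0" using b by (auto simp: alt_forms_def)
  note fs = forms_range[OF bf] forms_add1[OF bf] forms_add2[OF bf] forms_act[OF bf]
   ahom_add[OF i1] ahom_add[OF i2] ahom_act[OF i1] ahom_act[OF i2]
  have "(\<lambda>(a, a')\<in>carrier A \<times> carrier A. b (i1 a, i1 a')) \<in> forms G p A A"
   by (rule formsI) (use fs in auto)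
  moreover have "(\<lambda>(a, a')\<in>carrier B \<times> carrier B. b (i2 a, i2 a')) \<in> forms G p B B"
   by (rule formsI) (use fs in auto)
  moreover have "(\<lambda>(a, a')\<in>carrier A \<times> carrier B. b (i1 a, i2 a')) \<in> forms G p A B"
   by (rule formsI) (use fs in auto)
  ultimately show ?thesis using z by (auto simp: alt_forms_def)
 qed
 have H: "?H (s, t, c) \<in> alt_forms G p U" if s: "s \<in> alt_forms G p A" and t: "t \<in> alt_forms G p B" and c: "c \<in> forms G p A B" for s t c
 proof -
  have sf: "s \<in> forms G p A A" and tf: "t \<in> forms G p B B" using s t by (auto simp: alt_forms_def)
  have m: "((x mod int p) + (y mod int p) + (z mod int p) - (w mod int p)) mod int p = (x + y + z - w) mod int p" for x y z w
  proof -
   have "[(x mod int p) + (y mod int p) + (z mod int p) - (w mod int p) = x + y + z - w] (mod int p)"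
    by (intro cong_add cong_diff) (simp_all add: cong_def)
   thus ?thesis by (simp only: cong_def)
  qed
  have "?H (s, t, c) \<in> forms G p U U"
  proof (rule formsI)
   fix x x' y assume x: "x \<in> carrier U" "x' \<in> carrier U" "y \<in> carrier U"
   have "(s (p1 (x \<oplus>\<^bsub>U\<^esub> x'), p1 y) + t (p2 (x \<oplus>\<^bsub>U\<^esub> x'), p2 y) + c (p1 (x \<oplus>\<^bsub>U\<^esub> x'), p2 y) - c (p1 y, p2 (x \<oplus>\<^bsub>U\<^esub> x'))) mod int p
    = ((s (p1 x, p1 y) + s (p1 x', p1 y)) + (t (p2 x, p2 y) + t (p2 x', p2 y)) + (c (p1 x, p2 y) + c (p1 x', p2 y))
      - (c (p1 y, p2 x) + c (p1 y, p2 x'))) mod int p"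
    using x by (simp add: ahom_add[OF p1] ahom_add[OF p2] forms_add1[OF sf] forms_add1[OF tf] forms_add1[OF c] forms_add2[OF c] m)
   also have "\<dots> = ((s (p1 x, p1 y) + t (p2 x, p2 y) + c (p1 x, p2 y) - c (p1 y, p2 x)) mod int p
     + (s (p1 x', p1 y) + t (p2 x', p2 y) + c (p1 x', p2 y) - c (p1 y, p2 x')) mod int p) mod int p"
    unfolding mod_add_eq by (simp add: algebra_simps)
   finally show "?H (s, t, c) (x \<oplus>\<^bsub>U\<^esub> x', y) = (?H (s, t, c) (x, y) + ?H (s, t, c) (x', y)) mod int p"
    using x by simp
  next
   fix x y x' assume x: "y \<in> carrier U" "x \<in> carrier U" "x' \<in> carrier U"
   have "(s (p1 y, p1 (x \<oplus>\<^bsub>U\<^esub> x')) + t (p2 y, p2 (x \<oplus>\<^bsub>U\<^esub> x')) + c (p1 y, p2 (x \<oplus>\<^bsub>U\<^esub> x')) - c (p1 (x \<oplus>\<^bsub>U\<^esub> x'), p2 y)) mod int p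
    = ((s (p1 y, p1 x) + s (p1 y, p1 x')) + (t (p2 y, p2 x) + t (p2 y, p2 x')) + (c (p1 y, p2 x) + c (p1 y, p2 x'))
      - (c (p1 x, p2 y) + c (p1 x', p2 y))) mod int p"
    using x by (simp add: ahom_add[OF p1] ahom_add[OF p2] forms_add2[OF sf] forms_add2[OF tf] forms_add1[OF c] forms_add2[OF c] m)
   also have "\<dots> = ((s (p1 y, p1 x) + t (p2 y, p2 x) + c (p1 y, p2 x) - c (p1 x, p2 y)) mod int p
     + (s (p1 y, p1 x') + t (p2 y, p2 x') + c (p1 y, p2 x') - c (p1 x', p2 y)) mod int p) mod int p"
    unfolding mod_add_eq by (simp add: algebra_simps)
   finally show "?H (s, t, c) (y, x \<oplus>\<^bsub>U\<^esub> x') = (?H (s, t, c) (y, x) + ?H (s, t, c) (y, x')) mod int p"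
    using x by simp
  next
   fix g x y assume "g \<in> carrier G" "x \<in> carrier U" "y \<in> carrier U"
   thus "?H (s, t, c) (act U g x, act U g y) = ?H (s, t, c) (x, y)"
    by (simp add: ahom_act[OF p1] ahom_act[OF p2] forms_act[OF sf] forms_act[OF tf] forms_act[OF c])
  qed (use pp in auto)
  thus ?thesis using s t by (auto simp: alt_forms_def)
 qed
 have "bij_betw ?F (alt_forms G p U) (alt_forms G p A \<times> alt_forms G p B \<times> forms G p A B)"
 proof (rule bij_betw_byWitness[where f' = ?H])
  show "\<forall>b\<in>alt_forms G p U. ?H (?F b) = b"
  proof
   fix b assume b: "b \<in> alt_forms G p U"
   have bf: "b \<in> forms G p U U" using b by (auto simp: alt_forms_def)
   have "?F b \<in> alt_forms G p A \<times> alt_forms G p B \<times> forms G p A B" by (rule F[OF b])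
   hence "?H (?F b) \<in> alt_forms G p U" using H by blast
   hence hf: "?H (?F b) \<in> forms G p U U" by (rule alt_forms_forms)
   show "?H (?F b) = b"
   proof (rule forms_eqI[OF hf bf])
    fix x y assume xy: "x \<in> carrier U" "y \<in> carrier U"
    let ?a = "i1 (p1 x)" and ?d = "i2 (p2 x)" and ?a' = "i1 (p1 y)" and ?d' = "i2 (p2 y)"
    have "b (x, y) = b (?a \<oplus>\<^bsub>U\<^esub> ?d, ?a' \<oplus>\<^bsub>U\<^esub> ?d')" using xy by (simp add: i1p1_i2p2)
    also have "\<dots> = (b (?a, ?a') + b (?a, ?d') + (b (?d, ?a') + b (?d, ?d'))) mod int p"
     using xy by (simp add: forms_add1[OF bf] forms_add2[OF bf] mod_add_eq add_ac)
    also have "\<dots> = (b (?a, ?a') + b (?a, ?d') + b (?d, ?d') - b (?a', ?d) + (b (?d, ?a') + b (?a', ?d))) mod int p"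
     by (simp add: algebra_simps)
    also have "\<dots> = (b (?a, ?a') + b (?a, ?d') + b (?d, ?d') - b (?a', ?d) + (b (?d, ?a') + b (?a', ?d)) mod int p) mod int p"
     by (simp only: mod_add_right_eq)
    also have "(b (?d, ?a') + b (?a', ?d)) mod int p = 0" by (rule alt_antisym[OF b _ _ U.arep_axioms]) (use xy in auto)
    finally have "b (x, y) = (b (?a, ?a') + b (?d, ?d') + b (?a, ?d') - b (?a', ?d)) mod int p" by (simp add: add_ac)
    moreover have "p1 x \<in> carrier A" "p1 y \<in> carrier A" "p2 x \<in> carrier B" "p2 y \<in> carrier B"
     using xy ahom_closed[OF p1] ahom_closed[OF p2] by blast+
    ultimately show "?H (?F b) (x, y) = b (x, y)"
     using xy by (simp only: prod.case restrict_apply mem_Times_iff fst_conv snd_conv simp_thms if_True)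
   qed
  qed
  show "\<forall>w\<in>alt_forms G p A \<times> alt_forms G p B \<times> forms G p A B. ?F (?H w) = w"
  proof
   fix w assume "w \<in> alt_forms G p A \<times> alt_forms G p B \<times> forms G p A B"
   then obtain s t c where w: "w = (s, t, c)" and s: "s \<in> alt_forms G p A" and t: "t \<in> alt_forms G p B" and c: "c \<in> forms G p A B"
    by blast
   have sf: "s \<in> forms G p A A" and tf: "t \<in> forms G p B B" using s t by (auto simp: alt_forms_def)
   define W where "W = ?F (?H w)"
   have "W \<in> alt_forms G p A \<times> alt_forms G p B \<times> forms G p A B"
    using F[OF H[OF s t c]] unfolding W_def w .
   moreover obtain s' t' c' where w': "W = (s', t', c')" by (cases W)
   ultimately have f': "s' \<in> forms G p A A" "t' \<in> forms G p B B" "c' \<in> forms G p A B"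
    by (simp_all add: alt_forms_def)
   have e: "s' = fst (?F (?H w))" "t' = fst (snd (?F (?H w)))" "c' = snd (snd (?F (?H w)))"
    unfolding W_def[symmetric] w' by simp_all
   note zz = forms_zero[OF sf A.arep_axioms A.arep_axioms] forms_zero[OF tf B.arep_axioms B.arep_axioms]
    forms_zero[OF c A.arep_axioms B.arep_axioms]
   note rr = forms_range[OF sf] forms_range[OF tf] forms_range[OF c]
   have "s' = s" by (rule forms_eqI[OF f'(1) sf]) (use zz rr in \<open>simp add: e(1) w\<close>)
   moreover have "t' = t" by (rule forms_eqI[OF f'(2) tf]) (use zz rr in \<open>simp add: e(2) w\<close>)
   moreover have "c' = c" by (rule forms_eqI[OF f'(3) c]) (use zz rr in \<open>simp add: e(3) w\<close>)
   ultimately have "W = w" unfolding w' w by simp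
   thus "?F (?H w) = w" unfolding W_def .
  qed
  show "?F ` alt_forms G p U \<subseteq> alt_forms G p A \<times> alt_forms G p B \<times> forms G p A B" using F by blast
  show "?H ` (alt_forms G p A \<times> alt_forms G p B \<times> forms G p A B) \<subseteq> alt_forms G p U" using H by blast
 qed
 thus ?thesis by (simp add: bij_betw_same_card card_cartesian_product)
qed

lemma aiso_card_alt_forms_le:
 assumes U: "arep G p U" and V: "arep G p V" and i: "aiso G U V"
 shows "card (alt_forms G p V) \<le> card (alt_forms G p U)"
proof -
 interpret U: arep G p U by fact
 interpret V: arep G p V by fact
 obtain f where f: "f \<in> ahom G U V" "f ` carrier U = carrier V" using i by (auto simp: aiso_def bij_betw_def)
 let ?F = "\<lambda>b. \<lambda>(x, y)\<in>carrier U \<times> carrier U. b (f x, f y)"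
 have "?F b \<in> alt_forms G p U" if b: "b \<in> alt_forms G p V" for b
 proof -
  note bf = alt_forms_forms[OF b]
  have "?F b \<in> forms G p U U"
   by (rule formsI) (auto simp: forms_range[OF bf] forms_add1[OF bf] forms_add2[OF bf] forms_act[OF bf]
    ahom_add[OF f(1)] ahom_act[OF f(1)] ahom_closed[OF f(1)])
  thus ?thesis using b ahom_closed[OF f(1)] by (simp add: alt_forms_def)
 qed
 moreover have "inj_on ?F (alt_forms G p V)"
 proof (rule inj_onI)
  fix b c assume bc: "b \<in> alt_forms G p V" "c \<in> alt_forms G p V" "?F b = ?F c"
  show "b = c"
  proof (rule forms_eqI[OF bc(1,2)[THEN alt_forms_forms]])
   fix x y assume "x \<in> carrier V" "y \<in> carrier V"
   then obtain u v where "u \<in> carrier U" "v \<in> carrier U" "x = f u" "y = f v" using f(2) by blast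
   thus "b (x, y) = c (x, y)" using fun_cong[OF bc(3), of "(u, v)"] by simp
  qed
 qed
 moreover have "finite (alt_forms G p U)"
  using forms_finite[OF U U] by (rule finite_subset[rotated]) (auto simp: alt_forms_def)
 ultimately show ?thesis by (intro card_inj_on_le[of ?F]) auto
qed

lemma aiso_card_alt_forms:
 assumes U: "arep G p U" and V: "arep G p V" and i: "aiso G U V"
 shows "card (alt_forms G p U) = card (alt_forms G p V)"
 by (rule antisym[OF aiso_card_alt_forms_le[OF V U aiso_sym[OF U V i]] aiso_card_alt_forms_le[OF U V i]])

section \<open>Tensor and exterior squares\<close>

text \<open>Used to see that the tensor square, a quotient of an infinite free group, is finite.\<close>

lemma (in comm_group) finite_generate_torsion:
 assumes "finite S" "S \<subseteq> carrier G" "n > 0" "\<And>x. x \<in> carrier G \<Longrightarrow> x [^] (n::nat) = \<one>"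
 shows "finite (generate G S)"
 using assms(1,2)
proof (induct S)
 case empty
 thus ?case by (simp add: generate_empty)
next
 case (insert x S)
 have x: "x \<in> carrier G" and S: "S \<subseteq> carrier G" using insert by auto
 interpret H: subgroup "generate G S" G by (rule generate_is_subgroup[OF S])
 have pm: "x [^] k = x [^] (k mod n)" for k :: nat
 proof -
  have "x [^] k = x [^] (n * (k div n) + k mod n)" by simp
  also have "\<dots> = (x [^] n) [^] (k div n) \<otimes> x [^] (k mod n)" using x by (simp only: nat_pow_mult nat_pow_pow nat_pow_closed)
  finally show ?thesis using x assms(4) by simp
 qed
 define T where "T = (\<lambda>(k::nat, s). x [^] k \<otimes> s) ` ({..<n} \<times> generate G S)"
 have TI: "x [^] (k::nat) \<otimes> s \<in> T" if "s \<in> generate G S" for k s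
  unfolding T_def using that assms(3) pm[of k] by (auto intro!: image_eqI[of _ _ "(k mod n, s)"])
 have "generate G (insert x S) \<subseteq> T"
 proof
  fix y assume "y \<in> generate G (insert x S)"
  thus "y \<in> T"
  proof induct
   case one show ?case using TI[OF H.one_closed, of 0] by simp
  next
   case (incl h)
   show ?case
   proof (cases "h = x")
    case True thus ?thesis using TI[OF H.one_closed, of 1] x by simp
   next
    case False
    hence "h \<in> generate G S" using incl by (auto intro: generate.incl)
    thus ?thesis using TI[of h 0] H.mem_carrier by simp
   qed
  next
   case (inv h)
   show ?case
   proof (cases "h = x")
    case True
    have "x [^] (n - 1) \<otimes> x = \<one>" using assms(3) assms(4)[of x] x by (metis Suc_diff_1 nat_pow_Suc)
    hence "inv x = x [^] (n - 1)" using x by (intro inv_equality) auto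
    thus ?thesis using True TI[OF H.one_closed, of "n - 1"] x by simp
   next
    case False
    hence "inv h \<in> generate G S" using inv by (auto intro: generate.inv)
    thus ?thesis using TI[of "inv h" 0] H.mem_carrier by simp
   qed
  next
   case (eng h1 h2)
   then obtain k s l t where *: "h1 = x [^] (k::nat) \<otimes> s" "h2 = x [^] (l::nat) \<otimes> t" "s \<in> generate G S" "t \<in> generate G S"
    by (auto simp: T_def)
   have st: "s \<in> carrier G" "t \<in> carrier G" using * H.mem_carrier by auto
   have "h1 \<otimes> h2 = (x [^] k \<otimes> x [^] l) \<otimes> (s \<otimes> t)" using * st x by (simp add: m_ac)
   hence "h1 \<otimes> h2 = x [^] (k + l) \<otimes> (s \<otimes> t)" using x by (simp add: nat_pow_mult)
   thus ?case using TI[of "s \<otimes> t" "k + l"] H.m_closed * by simp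
  qed
 qed
 moreover have "finite T" unfolding T_def using insert S by simp
 ultimately show ?case by (rule finite_subset)
qed

text \<open>The squares are taken over an arbitrary commutative ring \<open>A\<close> acting on \<open>M\<close>, because both the prime field and the
endomorphism field are needed. Elements of the tensor square are cosets \<open>Q c\<close> of elements \<open>c\<close> of the
free group, and \<open>fe f h\<close> is the map that \<open>f\<close> and \<open>h\<close> induce on that group.\<close>

locale tens = arep G p M + A: cring A
 for G :: "('g, 'm) monoid_scheme" and p :: nat and A :: "('a, 'y) ring_scheme" and M :: "('a, 'b, 'g) rep" (structure) +
 assumes sm_closed [simp]: "a \<in> carrier A \<Longrightarrow> x \<in> carrier M \<Longrightarrow> a \<odot> x \<in> carrier M"
  and sm_add: "a \<in> carrier A \<Longrightarrow> x \<in> carrier M \<Longrightarrow> y \<in> carrier M \<Longrightarrow> a \<odot> (x \<oplus> y) = a \<odot> x \<oplus> a \<odot> y"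
  and sm_assoc: "a \<in> carrier A \<Longrightarrow> b \<in> carrier A \<Longrightarrow> x \<in> carrier M \<Longrightarrow> (a \<otimes>\<^bsub>A\<^esub> b) \<odot> x = a \<odot> (b \<odot> x)"
  and sm_one: "x \<in> carrier M \<Longrightarrow> \<one>\<^bsub>A\<^esub> \<odot> x = x"
  and sm_act: "a \<in> carrier A \<Longrightarrow> g \<in> carrier G \<Longrightarrow> x \<in> carrier M \<Longrightarrow> act M g (a \<odot> x) = a \<odot> act M g x"
begin

abbreviation "F \<equiv> free_on_pairs M"
abbreviation "K \<equiv> tensor_kernel A M"
abbreviation "T \<equiv> tensor_square A M"
definition Q :: "('b \<times> 'b \<Rightarrow>\<^sub>0 int) \<Rightarrow> ('b \<times> 'b \<Rightarrow>\<^sub>0 int) set" where "Q c = r_coset F K c"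
definition fe :: "('b \<Rightarrow> 'b) \<Rightarrow> ('b \<Rightarrow> 'b) \<Rightarrow> ('b \<times> 'b \<Rightarrow>\<^sub>0 int) \<Rightarrow> ('b \<times> 'b \<Rightarrow>\<^sub>0 int)"
 where "fe f h = frag_extend (\<lambda>(x, y). frag_of (f x, h y))"

sublocale F: comm_group F by (rule abelian_free_Abelian_group)

lemma relators_in: "tensor_relators A M \<subseteq> carrier F"
proof -
 have 1: "frag_of z \<in> carrier F" if "z \<in> carrier M \<times> carrier M" for z using that by (simp add: keys_frag_of)
 have 2: "a - b \<in> carrier F" if "a \<in> carrier F" "b \<in> carrier F" for a b
  using that keys_diff[of a b] by auto
 show ?thesis unfolding tensor_relators_def
  by (intro Un_least subsetI; clarsimp simp del: carrier_free_Abelian_group_iff; intro 1 2; simp)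
qed

lemma K_subgroup: "subgroup K F" unfolding tensor_kernel_def by (rule F.generate_is_subgroup[OF relators_in])

sublocale K: normal K F by (rule F.subgroup_imp_normal[OF K_subgroup])

lemma Q_eq: "c \<in> carrier F \<Longrightarrow> d \<in> carrier F \<Longrightarrow> Q c = Q d \<longleftrightarrow> c - d \<in> K"
proof
 assume cd: "c \<in> carrier F" "d \<in> carrier F" "Q c = Q d"
 hence "c \<in> K #>\<^bsub>F\<^esub> d" using F.rcos_self[OF cd(1) K_subgroup] by (simp add: Q_def)
 then obtain k where "k \<in> K" "c = k + d" by (auto simp: r_coset_def)
 thus "c - d \<in> K" by simp
next
 assume cd: "c \<in> carrier F" "d \<in> carrier F" "c - d \<in> K"
 hence "c \<in> K #>\<^bsub>F\<^esub> d" by (auto simp: r_coset_def intro!: bexI[of _ "c - d"])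
 thus "Q c = Q d" unfolding Q_def using F.repr_independence[OF _ cd(2) K_subgroup] by simp
qed

lemmas Q_eqI = Q_eq[THEN iffD2]

lemma Q_add: "c \<in> carrier F \<Longrightarrow> d \<in> carrier F \<Longrightarrow> Q c \<oplus>\<^bsub>T\<^esub> Q d = Q (c + d)"
 using K.rcos_sum[of c d] by (simp add: tensor_square_def Let_def Q_def FactGroup_def)

lemma T_carrier: "carrier T = Q ` carrier F"
 by (auto simp: tensor_square_def Let_def Q_def FactGroup_def RCOSETS_def)

lemma T_zero: "\<zero>\<^bsub>T\<^esub> = Q 0"
 using F.coset_join2[OF _ K_subgroup subgroup.one_closed[OF K_subgroup]]
 by (simp add: tensor_square_def Let_def Q_def FactGroup_def)

lemma T_ab: "abelian_group T"
proof -
 have "comm_group (F Mod K)" by (rule F.abelian_FactGroup[OF K_subgroup])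
 then interpret Q: comm_group "F Mod K" .
 have e: "carrier T = carrier (F Mod K)" "\<zero>\<^bsub>T\<^esub> = \<one>\<^bsub>F Mod K\<^esub>"
   "\<And>x y. x \<oplus>\<^bsub>T\<^esub> y = x \<otimes>\<^bsub>F Mod K\<^esub> y"
  by (simp_all add: tensor_square_def Let_def)
 show ?thesis
 proof (rule abelian_groupI, unfold e)
  fix x assume "x \<in> carrier (F Mod K)"
  thus "\<exists>y\<in>carrier (F Mod K). y \<otimes>\<^bsub>F Mod K\<^esub> x = \<one>\<^bsub>F Mod K\<^esub>" using Q.l_inv_ex by blast
 qed ((rule Q.m_closed Q.m_assoc Q.m_comm Q.l_one; assumption) | rule Q.one_closed)+
qed

lemma fe_of [simp]: "fe f h (frag_of (x, y)) = frag_of (f x, h y)" by (simp add: fe_def)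
lemma fe_add: "fe f h (c + d) = fe f h c + fe f h d" by (simp add: fe_def frag_extend_add)
lemma fe_diff: "fe f h (c - d) = fe f h c - fe f h d" by (simp add: fe_def frag_extend_diff)
lemma fe_0 [simp]: "fe f h 0 = 0" by (simp add: fe_def)
lemma fe_minus: "fe f h (- c) = - fe f h c" by (simp add: fe_def frag_extend_minus)

lemma fe_closed:
 assumes "\<And>x. x \<in> carrier M \<Longrightarrow> f x \<in> carrier M" "\<And>x. x \<in> carrier M \<Longrightarrow> h x \<in> carrier M" "c \<in> carrier F"
 shows "fe f h c \<in> carrier F"
proof -
 have "Poly_Mapping.keys c \<subseteq> carrier M \<times> carrier M" using assms(3) by simp
 thus ?thesis
 proof (induct rule: frag_induction)
  case (diff a b) thus ?case using keys_diff[of "fe f h a" "fe f h b"] by (auto simp: fe_diff)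
 next
  case (one z) thus ?case using assms by (cases z) (simp add: keys_frag_of)
 qed simp
qed

text \<open>A map on pairs that preserves the relators acts on cosets.\<close>

lemma tensor_map_Q:
 assumes cl: "\<And>x. x \<in> carrier M \<Longrightarrow> f x \<in> carrier M" "\<And>x. x \<in> carrier M \<Longrightarrow> h x \<in> carrier M"
  and R: "fe f h ` tensor_relators A M \<subseteq> K" and c: "c \<in> carrier F"
 shows "tensor_map A M f h (Q c) = Q (fe f h c)"
proof -
 have fK: "fe f h k \<in> K" if "k \<in> K" for k
  using that unfolding tensor_kernel_def
 proof induct
  case one show ?case using generate.one[of F] by simp
 next
  case (incl r) thus ?case using R by (auto simp: tensor_kernel_def)
 next
  case (inv r)
  have "fe f h r \<in> K" using inv R by auto
  hence "inv\<^bsub>F\<^esub> (fe f h r) \<in> K" by (rule subgroup.m_inv_closed[OF K_subgroup])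
  moreover have "r \<in> carrier F" using inv relators_in by blast
  ultimately show ?case using fe_closed[where f = f and h = h and c = r, OF cl] by (simp add: tensor_kernel_def fe_minus)
 next
  case (eng a b) thus ?case using generate.eng[of _ F] by (simp add: fe_add)
 qed
 have KF: "K \<subseteq> carrier F" using subgroup.subset[OF K_subgroup] .
 have K0: "0 \<in> K" using subgroup.one_closed[OF K_subgroup] by simp
 have Ka: "\<And>k l. k \<in> K \<Longrightarrow> l \<in> K \<Longrightarrow> k + l \<in> K" using subgroup.m_closed[OF K_subgroup] by simp
 have "tensor_map A M f h (Q c) = {k + fe f h (l + c) | k l. k \<in> K \<and> l \<in> K}"
  unfolding tensor_map_def fe_def[symmetric] Q_def set_mult_def r_coset_def by auto
 also have "\<dots> = {k + fe f h c | k. k \<in> K}"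
 proof (intro equalityI subsetI)
  fix z assume "z \<in> {k + fe f h (l + c) | k l. k \<in> K \<and> l \<in> K}"
  then obtain k l where "k \<in> K" "l \<in> K" "z = (k + fe f h l) + fe f h c" by (auto simp: fe_add add.assoc)
  thus "z \<in> {k + fe f h c | k. k \<in> K}" using Ka fK by blast
 next
  fix z assume "z \<in> {k + fe f h c | k. k \<in> K}"
  then obtain k where "k \<in> K" "z = k + fe f h (0 + c)" by auto
  thus "z \<in> {k + fe f h (l + c) | k l. k \<in> K \<and> l \<in> K}" using K0 by blast
 qed
 also have "\<dots> = Q (fe f h c)" unfolding Q_def r_coset_def by auto
 finally show ?thesis .
qed

lemma relator_in_K: "r \<in> tensor_relators A M \<Longrightarrow> r \<in> K"
 unfolding tensor_kernel_def by (rule generate.incl)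

lemma relI1: "x \<in> carrier M \<Longrightarrow> y \<in> carrier M \<Longrightarrow> z \<in> carrier M \<Longrightarrow>
  frag_of (x \<oplus> y, z) - frag_of (x, z) - frag_of (y, z) \<in> K"
 and relI2: "x \<in> carrier M \<Longrightarrow> y \<in> carrier M \<Longrightarrow> z \<in> carrier M \<Longrightarrow>
  frag_of (x, y \<oplus> z) - frag_of (x, y) - frag_of (x, z) \<in> K"
 and relI3: "a \<in> carrier A \<Longrightarrow> x \<in> carrier M \<Longrightarrow> y \<in> carrier M \<Longrightarrow>
  frag_of (a \<odot> x, y) - frag_of (x, a \<odot> y) \<in> K"
 by (rule relator_in_K, unfold tensor_relators_def, blast)+

lemma rel_act: "g \<in> carrier G \<Longrightarrow> fe (act M g) (act M g) ` tensor_relators A M \<subseteq> K"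
proof (rule image_subsetI)
 fix r assume g: "g \<in> carrier G" and "r \<in> tensor_relators A M"
 thus "fe (act M g) (act M g) r \<in> K"
  unfolding tensor_relators_def
 proof (elim UnE CollectE exE conjE)
  fix x y z assume *: "x \<in> carrier M" "y \<in> carrier M" "z \<in> carrier M"
  show "fe (act M g) (act M g) r \<in> K" if "r = frag_of (x \<oplus> y, z) - frag_of (x, z) - frag_of (y, z)"
   using relI1[of "act M g x" "act M g y" "act M g z"] that g * by (simp add: fe_diff)
  show "fe (act M g) (act M g) r \<in> K" if "r = frag_of (x, y \<oplus> z) - frag_of (x, y) - frag_of (x, z)"
   using relI2[of "act M g x" "act M g y" "act M g z"] that g * by (simp add: fe_diff)
 next
  fix a x y assume *: "a \<in> carrier A" "x \<in> carrier M" "y \<in> carrier M" "r = frag_of (a \<odot> x, y) - frag_of (x, a \<odot> y)"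
  show "fe (act M g) (act M g) r \<in> K"
   using relI3[of a "act M g x" "act M g y"] g * by (simp add: fe_diff sm_act)
 qed
qed

lemma rel_smult: "a \<in> carrier A \<Longrightarrow> fe (\<lambda>x. a \<odot> x) (\<lambda>y. y) ` tensor_relators A M \<subseteq> K"
proof (rule image_subsetI)
 fix r assume a: "a \<in> carrier A" and r: "r \<in> tensor_relators A M"
 have c: "a \<odot> (b \<odot> x) = b \<odot> (a \<odot> x)" if "b \<in> carrier A" "x \<in> carrier M" for b x
  using a that by (metis A.m_comm sm_assoc)
 show "fe (\<lambda>x. a \<odot> x) (\<lambda>y. y) r \<in> K"
  using r unfolding tensor_relators_def
 proof (elim UnE CollectE exE conjE)
  fix x y z assume *: "x \<in> carrier M" "y \<in> carrier M" "z \<in> carrier M"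
  show "fe (\<lambda>x. a \<odot> x) (\<lambda>y. y) r \<in> K" if "r = frag_of (x \<oplus> y, z) - frag_of (x, z) - frag_of (y, z)"
   using relI1[of "a \<odot> x" "a \<odot> y" z] that a * by (simp add: fe_diff sm_add)
  show "fe (\<lambda>x. a \<odot> x) (\<lambda>y. y) r \<in> K" if "r = frag_of (x, y \<oplus> z) - frag_of (x, y) - frag_of (x, z)"
   using relI2[of "a \<odot> x" y z] that a * by (simp add: fe_diff)
 next
  fix b x y assume *: "b \<in> carrier A" "x \<in> carrier M" "y \<in> carrier M" "r = frag_of (b \<odot> x, y) - frag_of (x, b \<odot> y)"
  show "fe (\<lambda>x. a \<odot> x) (\<lambda>y. y) r \<in> K"
   using relI3[of b "a \<odot> x" y] a * by (simp add: fe_diff c)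
 qed
qed

lemma T_act: "g \<in> carrier G \<Longrightarrow> c \<in> carrier F \<Longrightarrow> act T g (Q c) = Q (fe (act M g) (act M g) c)"
 using tensor_map_Q[OF _ _ rel_act] T_carrier by (simp add: tensor_square_def Let_def)

lemma T_smult: "a \<in> carrier A \<Longrightarrow> c \<in> carrier F \<Longrightarrow> a \<odot>\<^bsub>T\<^esub> Q c = Q (fe (\<lambda>x. a \<odot> x) (\<lambda>y. y) c)"
 using tensor_map_Q[OF _ _ rel_smult] by (simp add: tensor_square_def Let_def)

lemma F_add: "c \<in> carrier F \<Longrightarrow> d \<in> carrier F \<Longrightarrow> c + d \<in> carrier F"
 using F.m_closed[of c d] by simp

lemma F_diff: "c \<in> carrier F \<Longrightarrow> d \<in> carrier F \<Longrightarrow> c - d \<in> carrier F"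
 using keys_diff[of c d] by auto

lemma F_0: "0 \<in> carrier F" by simp
lemma F_of: "x \<in> carrier M \<Longrightarrow> y \<in> carrier M \<Longrightarrow> frag_of (x, y) \<in> carrier F" by (simp add: keys_frag_of)

lemma F_induct [consumes 1, case_names zero diff one]:
 assumes "c \<in> carrier F" "P 0" "\<And>c d. c \<in> carrier F \<Longrightarrow> d \<in> carrier F \<Longrightarrow> P c \<Longrightarrow> P d \<Longrightarrow> P (c - d)"
  "\<And>x y. x \<in> carrier M \<Longrightarrow> y \<in> carrier M \<Longrightarrow> P (frag_of (x, y))"
 shows "P c"
proof -
 have "Poly_Mapping.keys c \<subseteq> carrier M \<times> carrier M" using assms(1) by simp
 thus ?thesis by (induct rule: free_Abelian_group_induct) (use assms in auto)
qed

lemmas F_act = fe_closed[of "act M g" "act M g" for g]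
lemmas F_sm = fe_closed[of "\<lambda>x. a \<odot> x" "\<lambda>y. y" for a]

lemma arep_T: "arep G p T"
proof -
 interpret T: abelian_group T by (rule T_ab)
 have Qc: "Q c \<in> carrier T" if "c \<in> carrier F" for c using that T_carrier by auto
 have Qneg: "\<ominus>\<^bsub>T\<^esub> Q d = Q (- d)" if d: "d \<in> carrier F" for d
 proof -
  have m: "- d \<in> carrier F" using d by simp
  have "Q (- d) \<oplus>\<^bsub>T\<^esub> Q d = \<zero>\<^bsub>T\<^esub>" using d m by (simp only: Q_add T_zero) simp
  thus ?thesis using Qc[OF d] Qc[OF m] by (simp add: T.minus_equality)
 qed
 have pw: "add_pow T (n::nat) (Q (frag_of (x, y))) = Q (frag_of (add_pow M n x, y))" if xy: "x \<in> carrier M" "y \<in> carrier M" for n x y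
 proof (induct n)
  case 0
  have "frag_of (\<zero> \<oplus> \<zero>, y) - frag_of (\<zero>, y) - frag_of (\<zero>, y) \<in> K" using relI1 xy by blast
  hence "inv\<^bsub>F\<^esub> (- frag_of (\<zero>, y)) \<in> K" using xy by (intro subgroup.m_inv_closed[OF K_subgroup]) simp
  hence "frag_of (\<zero>, y) - 0 \<in> K" using xy by (simp add: keys_frag_of)
  hence "Q (frag_of (\<zero>, y)) = Q 0" using xy F_of F_0 by (intro Q_eqI) auto
  thus ?case by (simp add: add_pow_zero T_zero)
 next
  case (Suc n)
  have "add_pow T (Suc n) (Q (frag_of (x, y))) = Q (frag_of (add_pow M n x, y) + frag_of (x, y))"
   using Suc xy by (simp add: add_pow_Suc Q_add F_of)
  also have "\<dots> = Q (frag_of (add_pow M n x \<oplus> x, y))"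
  proof -
   have "frag_of (add_pow M n x \<oplus> x, y) - (frag_of (add_pow M n x, y) + frag_of (x, y)) \<in> K"
    using relI1[of "add_pow M n x" x y] xy by (simp add: diff_diff_add)
   thus ?thesis using xy F_of F_add by (intro Q_eqI[symmetric]) (auto simp del: carrier_free_Abelian_group_iff)
  qed
  finally show ?case by (simp add: add_pow_Suc)
 qed
 have tors: "add_pow T p (Q c) = \<zero>\<^bsub>T\<^esub>" if "c \<in> carrier F" for c
  using that
 proof (induct rule: F_induct)
  case zero show ?case using T.add.nat_pow_one[of p] by (simp add: T_zero)
 next
  case (diff c d)
  have md: "- d \<in> carrier F" using diff by simp
  have "Q (c - d) = Q c \<oplus>\<^bsub>T\<^esub> \<ominus>\<^bsub>T\<^esub> Q d" using Q_add[OF diff(1) md] Qneg[OF diff(2)] by simp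
  also have "add_pow T p \<dots> = add_pow T p (Q c) \<oplus>\<^bsub>T\<^esub> add_pow T p (\<ominus>\<^bsub>T\<^esub> Q d)"
   using Qc diff by (intro T.add.nat_pow_distrib) auto
  also have "add_pow T p (\<ominus>\<^bsub>T\<^esub> Q d) = \<ominus>\<^bsub>T\<^esub> add_pow T p (Q d)"
   using T.add.nat_pow_inv[of "Q d" p] Qc diff by simp
  finally show ?case using diff by simp
 next
  case (one x y)
  have "add_pow T p (Q (frag_of (x, y))) = Q (frag_of (add_pow M (0::nat) x, y))"
   using pw[OF one] torsion[OF one(1)] by (simp add: add_pow_zero)
  thus ?case using pw[OF one, of 0] by (simp add: add_pow_zero)
 qed
 have "carrier T \<subseteq> generate (add_monoid T) ((\<lambda>z. Q (frag_of z)) ` (carrier M \<times> carrier M))"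
 proof
  let ?S = "(\<lambda>z. Q (frag_of z)) ` (carrier M \<times> carrier M)"
  have S: "?S \<subseteq> carrier T" using Qc F_of by auto
  have sg: "subgroup (generate (add_monoid T) ?S) (add_monoid T)" by (rule T.add.generate_is_subgroup[OF S])
  fix t assume "t \<in> carrier T"
  then obtain c where "c \<in> carrier F" "t = Q c" using T_carrier by auto
  moreover have "Q c \<in> generate (add_monoid T) ?S" if "c \<in> carrier F" for c
   using that
  proof (induct rule: F_induct)
   case zero show ?case using generate.one[of "add_monoid T"] by (simp add: T_zero)
  next
   case (diff c d)
   have md: "- d \<in> carrier F" using diff by simp
   have "Q (c - d) = Q c \<oplus>\<^bsub>T\<^esub> \<ominus>\<^bsub>T\<^esub> Q d" using Q_add[OF diff(1) md] Qneg[OF diff(2)] by simp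
   thus ?case using subgroup.m_closed[OF sg diff(3) subgroup.m_inv_closed[OF sg diff(4)]] by (simp add: a_inv_def)
  next
   case (one x y) thus ?case by (intro generate.incl) auto
  qed
  ultimately show "t \<in> generate (add_monoid T) ?S" by simp
 qed
 moreover have "finite (generate (add_monoid T) ((\<lambda>z. Q (frag_of z)) ` (carrier M \<times> carrier M)))"
 proof (rule T.add.finite_generate_torsion[where n = p])
  show "p > 0" using prime_p prime_gt_0_nat by blast
  show "add_pow T p x = \<zero>\<^bsub>T\<^esub>" if "x \<in> carrier T" for x
   using that tors T_carrier by auto
 qed (use Qc F_of in auto)
 ultimately have fin: "finite (carrier T)" by (rule finite_subset)
 show ?thesis
 proof (intro arep.intro arep_axioms.intro G.group_axioms T_ab prime_p fin)
  fix x assume "x \<in> carrier T"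
  then obtain c where c: "c \<in> carrier F" "x = Q c" using T_carrier by auto
  show "add_pow T p x = \<zero>\<^bsub>T\<^esub>" using tors c by simp
  have "fe (act M \<one>\<^bsub>G\<^esub>) (act M \<one>\<^bsub>G\<^esub>) c = c"
   using c(1) by (induct rule: F_induct) (auto simp: fe_diff)
  thus "act T \<one>\<^bsub>G\<^esub> x = x" using c T_act[of "\<one>\<^bsub>G\<^esub>" c] by simp
  fix g assume g: "g \<in> carrier G"
  have gc: "fe (act M g) (act M g) c \<in> carrier F" using F_act g c by simp
  show "act T g x \<in> carrier T" using T_act[OF g c(1)] c Qc[OF gc] by simp
  show "act T g (x \<oplus>\<^bsub>T\<^esub> y) = act T g x \<oplus>\<^bsub>T\<^esub> act T g y" if y: "y \<in> carrier T" for y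
  proof -
   obtain d where d: "d \<in> carrier F" "y = Q d" using y T_carrier by auto
   have gd: "fe (act M g) (act M g) d \<in> carrier F" using F_act g d by simp
   show ?thesis using c d g gc gd F_add[OF c(1) d(1)] by (simp only: Q_add T_act fe_add)
  qed
  fix h assume h: "h \<in> carrier G"
  have hc: "fe (act M h) (act M h) c \<in> carrier F" using F_act h c by simp
  have "fe (act M (g \<otimes>\<^bsub>G\<^esub> h)) (act M (g \<otimes>\<^bsub>G\<^esub> h)) c = fe (act M g) (act M g) (fe (act M h) (act M h) c)"
   using c(1) by (induct rule: F_induct) (use g h in \<open>auto simp: fe_diff act_mult\<close>)
  thus "act T (g \<otimes>\<^bsub>G\<^esub> h) x = act T g (act T h x)" using c g h hc by (simp only: T_act G.m_closed)
 qed
qed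

sublocale T: arep G p T by (rule arep_T)

abbreviation pt :: "'b \<Rightarrow> 'b \<Rightarrow> ('b \<times> 'b \<Rightarrow>\<^sub>0 int) set" where "pt x y \<equiv> Q (frag_of (x, y))"

lemma T_induct [consumes 1, case_names zero diff one]:
 assumes "t \<in> carrier T" "P \<zero>\<^bsub>T\<^esub>"
  "\<And>s t. s \<in> carrier T \<Longrightarrow> t \<in> carrier T \<Longrightarrow> P s \<Longrightarrow> P t \<Longrightarrow> P (s \<ominus>\<^bsub>T\<^esub> t)"
  "\<And>x y. x \<in> carrier M \<Longrightarrow> y \<in> carrier M \<Longrightarrow> P (pt x y)"
 shows "P t"
proof -
 obtain c where c: "c \<in> carrier F" "t = Q c" using assms(1) T_carrier by auto
 have "P (Q c)" using c(1)
 proof (induct rule: F_induct)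
  case zero show ?case using assms(2) by (simp add: T_zero)
 next
  case (diff c d)
  have QQ: "Q c \<in> carrier T" "Q d \<in> carrier T" "Q (c - d) \<in> carrier T" using diff F_diff T_carrier by blast+
  have "Q (c - d) \<oplus>\<^bsub>T\<^esub> Q d = Q c" using Q_add[OF F_diff[OF diff(1,2)] diff(2)] by simp
  hence "Q c \<ominus>\<^bsub>T\<^esub> Q d = Q (c - d)" using QQ by (metis T.V.add.inv_solve_right a_minus_def)
  thus ?case using assms(3)[OF QQ(1,2) diff(3,4)] by simp
 next
  case (one x y) thus ?case by (rule assms(4))
 qed
 thus ?thesis using c by simp
qed

lemma pt_closed [simp]: "x \<in> carrier M \<Longrightarrow> y \<in> carrier M \<Longrightarrow> pt x y \<in> carrier T"
 using T_carrier F_of by auto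

lemma pt_add1: "x \<in> carrier M \<Longrightarrow> x' \<in> carrier M \<Longrightarrow> y \<in> carrier M \<Longrightarrow> pt (x \<oplus> x') y = pt x y \<oplus>\<^bsub>T\<^esub> pt x' y"
 using relI1[of x x' y] Q_eq[of "frag_of (x \<oplus> x', y)" "frag_of (x, y) + frag_of (x', y)"]
 by (simp add: Q_add F_of F_add diff_diff_add del: carrier_free_Abelian_group_iff)

lemma pt_add2: "x \<in> carrier M \<Longrightarrow> y \<in> carrier M \<Longrightarrow> y' \<in> carrier M \<Longrightarrow> pt x (y \<oplus> y') = pt x y \<oplus>\<^bsub>T\<^esub> pt x y'"
 using relI2[of x y y'] Q_eq[of "frag_of (x, y \<oplus> y')" "frag_of (x, y) + frag_of (x, y')"]
 by (simp add: Q_add F_of F_add diff_diff_add del: carrier_free_Abelian_group_iff)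

lemma pt_bal: "a \<in> carrier A \<Longrightarrow> x \<in> carrier M \<Longrightarrow> y \<in> carrier M \<Longrightarrow> pt (a \<odot> x) y = pt x (a \<odot> y)"
 using relI3[of a x y] Q_eq[of "frag_of (a \<odot> x, y)" "frag_of (x, a \<odot> y)"]
 by (simp add: F_of del: carrier_free_Abelian_group_iff)

lemma pt_act: "g \<in> carrier G \<Longrightarrow> x \<in> carrier M \<Longrightarrow> y \<in> carrier M \<Longrightarrow> act T g (pt x y) = pt (act M g x) (act M g y)"
 by (simp add: T_act F_of del: carrier_free_Abelian_group_iff)

lemma pt_smult: "a \<in> carrier A \<Longrightarrow> x \<in> carrier M \<Longrightarrow> y \<in> carrier M \<Longrightarrow> a \<odot>\<^bsub>T\<^esub> pt x y = pt (a \<odot> x) y"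
 by (simp add: T_smult F_of del: carrier_free_Abelian_group_iff)

definition bal :: "('b \<times> 'b \<Rightarrow> int) set" where
 "bal = {b \<in> forms G p M M. \<forall>a\<in>carrier A. \<forall>x\<in>carrier M. \<forall>y\<in>carrier M. b (a \<odot> x, y) = b (x, a \<odot> y)}"

text \<open>The universal property of the tensor square: functionals correspond to forms that are balanced over \<open>A\<close>.\<close>

lemma functionals_T:
 "bij_betw (\<lambda>f. \<lambda>(x, y)\<in>carrier M \<times> carrier M. f (pt x y)) (ahom G T (fp p)) bal"
 (is "bij_betw ?\<Phi> _ _")
proof (rule bij_betwI')
 have Fp: "arep G p (fp p)" by (rule arep_fp[OF G.group_axioms prime_p])
 fix f h assume f: "f \<in> ahom G T (fp p)" and h: "h \<in> ahom G T (fp p)"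
 have "f = h" if e: "?\<Phi> f = ?\<Phi> h"
 proof (rule ahom_eqI[OF f h])
  fix t assume "t \<in> carrier T"
  thus "f t = h t"
  proof (induct rule: T_induct)
   case zero show ?case using ahom_zero[OF arep_T Fp f] ahom_zero[OF arep_T Fp h] by simp
  next
   case (diff s t)
   thus ?case using ahom_diff[OF arep_T Fp f] ahom_diff[OF arep_T Fp h] by simp
  next
   case (one x y) thus ?case using fun_cong[OF e, of "(x, y)"] by simp
  qed
 qed
 thus "(?\<Phi> f = ?\<Phi> h) = (f = h)" by blast
next
 fix f assume f: "f \<in> ahom G T (fp p)"
 have "?\<Phi> f \<in> forms G p M M"
  by (rule formsI) (use ahom_closed[OF f] ahom_add[OF f] ahom_act[OF f] in
   \<open>auto simp: pt_add1 pt_add2 pt_act[symmetric]\<close>)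
 thus "?\<Phi> f \<in> bal" by (auto simp: bal_def pt_bal)
next
 fix b assume "b \<in> bal"
 hence b: "b \<in> forms G p M M" and bb: "\<And>a x y. a \<in> carrier A \<Longrightarrow> x \<in> carrier M \<Longrightarrow> y \<in> carrier M \<Longrightarrow> b (a \<odot> x, y) = b (x, a \<odot> y)"
  by (auto simp: bal_def)
 have Fp: "arep G p (fp p)" by (rule arep_fp[OF G.group_axioms prime_p])
 then interpret Z: arep G p "fp p :: (int, int, 'g) rep" .
 let ?H = "add_monoid (fp p :: (int, int, 'g) rep)"
 have bc: "b ` (carrier M \<times> carrier M) \<subseteq> carrier (fp p :: (int, int, 'g) rep)" using forms_range[OF b] by auto
 obtain h where h: "h \<in> hom F ?H" and hb': "\<forall>z\<in>carrier M \<times> carrier M. h (frag_of z) = b z"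
  using Z.V.add.free_Abelian_group_universal[OF bc] by metis
 have hb: "\<And>z. z \<in> carrier M \<times> carrier M \<Longrightarrow> h (frag_of z) = b z" using hb' by blast
 interpret h: group_hom F ?H h by (intro group_hom.intro F.group_axioms Z.V.a_group group_hom_axioms.intro h)
 have hadd: "h (c + d) = (h c + h d) mod int p" if "c \<in> carrier F" "d \<in> carrier F" for c d
  using h.hom_mult[OF that] by simp
 have hrng: "0 \<le> h c \<and> h c < int p" if "c \<in> carrier F" for c using h.hom_closed[OF that] by simp
 have hK: "h r = 0" if r: "r \<in> K" for r
 proof -
  have "tensor_relators A M \<subseteq> kernel F ?H h"
  proof
   fix r assume r: "r \<in> tensor_relators A M"
   have sub: "h c = h d" if "c \<in> carrier F" "d \<in> carrier F" "h (c - d) = 0" for c d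
   proof -
    have "h c = (h (c - d) + h d) mod int p" using hadd[OF F_diff[OF that(1,2)] that(2)] by simp
    thus ?thesis using that hrng[OF that(2)] by simp
   qed
   have sub': "h (c - d) = 0" if cd: "c \<in> carrier F" "d \<in> carrier F" "h c = h d" for c d
   proof -
    have "h c = (h (c - d) + h d) mod int p" using hadd[OF F_diff[OF cd(1,2)] cd(2)] by simp
    hence "[h (c - d) + h d = 0 + h d] (mod int p)" using cd hrng[OF cd(2)] by (simp add: cong_def)
    hence "h (c - d) mod int p = 0 mod int p" by (simp only: cong_add_rcancel) (simp add: cong_def)
    thus ?thesis using hrng[OF F_diff[OF cd(1,2)]] by simp
   qed
   have "h r = 0" using r unfolding tensor_relators_def
   proof (elim UnE CollectE exE conjE)
    fix x y z assume *: "x \<in> carrier M" "y \<in> carrier M" "z \<in> carrier M" "r = frag_of (x \<oplus> y, z) - frag_of (x, z) - frag_of (y, z)"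
    have "h (frag_of (x \<oplus> y, z) - (frag_of (x, z) + frag_of (y, z))) = 0"
     by (rule sub'[OF F_of F_add[OF F_of F_of]]) (use * hb forms_add1[OF b] in \<open>auto simp: hadd F_of simp del: carrier_free_Abelian_group_iff\<close>)
    thus "h r = 0" using *(4) by (simp add: diff_diff_add)
   next
    fix x y z assume *: "x \<in> carrier M" "y \<in> carrier M" "z \<in> carrier M" "r = frag_of (x, y \<oplus> z) - frag_of (x, y) - frag_of (x, z)"
    have "h (frag_of (x, y \<oplus> z) - (frag_of (x, y) + frag_of (x, z))) = 0"
     by (rule sub'[OF F_of F_add[OF F_of F_of]]) (use * hb forms_add2[OF b] in \<open>auto simp: hadd F_of simp del: carrier_free_Abelian_group_iff\<close>)
    thus "h r = 0" using *(4) by (simp add: diff_diff_add)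
   next
    fix a x y assume *: "a \<in> carrier A" "x \<in> carrier M" "y \<in> carrier M" "r = frag_of (a \<odot> x, y) - frag_of (x, a \<odot> y)"
    show "h r = 0" unfolding *(4) by (rule sub'[OF F_of F_of]) (use * hb bb in auto)
   qed
   thus "r \<in> kernel F ?H h" using subsetD[OF relators_in r]
    unfolding kernel_def by (simp del: carrier_free_Abelian_group_iff)
  qed
  hence "K \<subseteq> kernel F ?H h" unfolding tensor_kernel_def
   by (rule F.generate_subgroup_incl) (rule h.subgroup_kernel)
  thus ?thesis using r by (auto simp: kernel_def)
 qed
 obtain f0 where f0: "\<And>c. c \<in> carrier F \<Longrightarrow> f0 (Q c) = h c"
 proof -
  have "h c = h d" if cd: "c \<in> carrier F" "d \<in> carrier F" "Q c = Q d" for c d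
  proof -
   have "h (c - d) = 0" using hK Q_eq[OF cd(1,2)] cd(3) by simp
   moreover have "h c = (h (c - d) + h d) mod int p" using hadd[OF F_diff[OF cd(1,2)] cd(2)] by simp
   ultimately show ?thesis using hrng[OF cd(2)] by simp
  qed
  hence "\<exists>f0. \<forall>c. c \<in> carrier F \<longrightarrow> h c = f0 (Q c)"
   using function_factors_left_gen[of "\<lambda>c. c \<in> carrier F" Q h] by metis
  thus ?thesis using that by metis
 qed
 define f where "f = restrict f0 (carrier T)"
 have fQ: "f (Q c) = h c" if "c \<in> carrier F" for c using that f0 T_carrier by (simp add: f_def)
 have h_act: "h (fe (act M g) (act M g) c) = h c" if "g \<in> carrier G" "c \<in> carrier F" for g c
  using that(2)
 proof (induct rule: F_induct)
  case zero show ?case by simp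
 next
  case (diff c d)
  have *: "h (x - y) = (h x - h y) mod int p" if "x \<in> carrier F" "y \<in> carrier F" for x y
  proof -
   have "h x = (h (x - y) + h y) mod int p" using hadd[OF F_diff[OF that] that(2)] by simp
   hence "(h x - h y) mod int p = (h (x - y) + h y - h y) mod int p" by (metis mod_diff_left_eq)
   thus ?thesis using hrng[OF F_diff[OF that]] by simp
  qed
  have cl: "fe (act M g) (act M g) c \<in> carrier F" "fe (act M g) (act M g) d \<in> carrier F"
   using F_act[of g] \<open>g \<in> carrier G\<close> diff by auto
  show ?case unfolding fe_diff *[OF cl] *[OF diff(1,2)] diff(3,4) ..
 next
  case (one x y) thus ?case using \<open>g \<in> carrier G\<close> hb forms_act[OF b] by simp
 qed
 have "f \<in> ahom G T (fp p)"
 proof (rule ahomI)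
  fix s t assume "s \<in> carrier T" "t \<in> carrier T"
  then obtain c d where cd: "c \<in> carrier F" "d \<in> carrier F" "s = Q c" "t = Q d" using T_carrier by auto
  show "f (s \<oplus>\<^bsub>T\<^esub> t) = f s \<oplus>\<^bsub>fp p :: (int, int, 'g) rep\<^esub> f t"
   unfolding cd(3,4) Q_add[OF cd(1,2)] fQ[OF F_add[OF cd(1,2)]] fQ[OF cd(1)] fQ[OF cd(2)] hadd[OF cd(1,2)] by simp
 next
  fix g t assume g: "g \<in> carrier G" and "t \<in> carrier T"
  then obtain c where c: "c \<in> carrier F" "t = Q c" using T_carrier by auto
  have cl: "fe (act M g) (act M g) c \<in> carrier F" using F_act[of g] g c by auto
  show "f (act T g t) = act (fp p :: (int, int, 'g) rep) g (f t)"
   unfolding c(2) T_act[OF g c(1)] fQ[OF cl] fQ[OF c(1)] h_act[OF g c(1)] by simp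
 next
  fix t assume "t \<in> carrier T"
  then obtain c where c: "c \<in> carrier F" "t = Q c" using T_carrier by auto
  show "f t \<in> carrier (fp p :: (int, int, 'g) rep)" using fQ[OF c(1)] hrng[OF c(1)] c(2) by simp
 qed (simp add: f_def)
 moreover have "b = ?\<Phi> f"
 proof (rule extensionalityI[OF forms_ext[OF b]])
  fix z assume "z \<in> carrier M \<times> carrier M"
  thus "b z = ?\<Phi> f z" using fQ[OF F_of] hb by auto
 qed simp
 ultimately show "\<exists>f\<in>ahom G T (fp p). b = ?\<Phi> f" by blast
qed

end

context tens
begin

subsection \<open>The exterior square\<close>

lemma T_obtain: "t \<in> carrier T \<Longrightarrow> (\<And>c. c \<in> carrier F \<Longrightarrow> t = Q c \<Longrightarrow> thesis) \<Longrightarrow> thesis"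
 using T_carrier by blast

lemma sT_closed [simp]:
 assumes "a \<in> carrier A" "t \<in> carrier T" shows "a \<odot>\<^bsub>T\<^esub> t \<in> carrier T"
proof -
 obtain c where c: "c \<in> carrier F" "t = Q c" using assms T_obtain by blast
 have "fe (\<lambda>x. a \<odot> x) (\<lambda>y. y) c \<in> carrier F"
  by (rule fe_closed[where f = "\<lambda>x. a \<odot> x" and h = "\<lambda>y. y" and c = c, OF _ _ c(1)]) (use assms in auto)
 thus ?thesis using T_smult[OF assms(1) c(1)] c(2) T_carrier by auto
qed

lemma sT_add:
 assumes "a \<in> carrier A" "s \<in> carrier T" "t \<in> carrier T"
 shows "a \<odot>\<^bsub>T\<^esub> (s \<oplus>\<^bsub>T\<^esub> t) = a \<odot>\<^bsub>T\<^esub> s \<oplus>\<^bsub>T\<^esub> a \<odot>\<^bsub>T\<^esub> t"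
proof -
 obtain c where c: "c \<in> carrier F" "s = Q c" using assms(2) T_obtain by blast
 obtain d where d: "d \<in> carrier F" "t = Q d" using assms(3) T_obtain by blast
 have cl: "fe (\<lambda>x. a \<odot> x) (\<lambda>y. y) e \<in> carrier F" if "e \<in> carrier F" for e
  by (rule fe_closed[where f = "\<lambda>x. a \<odot> x" and h = "\<lambda>y. y" and c = e, OF _ _ that]) (use assms in auto)
 show ?thesis unfolding c(2) d(2)
  using cl[OF c(1)] cl[OF d(1)] F_add[OF c(1) d(1)] c(1) d(1) assms(1)
  by (simp only: Q_add T_smult fe_add)
qed

lemma sT_zero: "a \<in> carrier A \<Longrightarrow> a \<odot>\<^bsub>T\<^esub> \<zero>\<^bsub>T\<^esub> = \<zero>\<^bsub>T\<^esub>"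
 using T_smult[OF _ F_0] by (simp add: T_zero)

lemma sT_diff:
 assumes "a \<in> carrier A" "s \<in> carrier T" "t \<in> carrier T"
 shows "a \<odot>\<^bsub>T\<^esub> (s \<ominus>\<^bsub>T\<^esub> t) = a \<odot>\<^bsub>T\<^esub> s \<ominus>\<^bsub>T\<^esub> a \<odot>\<^bsub>T\<^esub> t"
proof -
 have "a \<odot>\<^bsub>T\<^esub> (s \<ominus>\<^bsub>T\<^esub> t) \<oplus>\<^bsub>T\<^esub> a \<odot>\<^bsub>T\<^esub> t = a \<odot>\<^bsub>T\<^esub> ((s \<ominus>\<^bsub>T\<^esub> t) \<oplus>\<^bsub>T\<^esub> t)"
  using assms by (simp add: sT_add)
 also have "(s \<ominus>\<^bsub>T\<^esub> t) \<oplus>\<^bsub>T\<^esub> t = s" using assms by (simp add: a_minus_def T.V.a_assoc T.V.l_neg)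
 finally show ?thesis using assms
  by (metis T.V.add.inv_solve_right T.V.minus_closed a_minus_def sT_closed)
qed

lemma sT_assoc:
 assumes "a \<in> carrier A" "b \<in> carrier A" "t \<in> carrier T"
 shows "(a \<otimes>\<^bsub>A\<^esub> b) \<odot>\<^bsub>T\<^esub> t = a \<odot>\<^bsub>T\<^esub> (b \<odot>\<^bsub>T\<^esub> t)"
 using assms(3)
proof (induct rule: T_induct)
 case (diff s t) thus ?case using assms by (simp add: sT_diff)
next
 case (one x y) thus ?case using assms by (simp add: pt_smult sm_assoc)
qed (use assms in \<open>simp add: sT_zero\<close>)

lemma sT_one: assumes "t \<in> carrier T" shows "\<one>\<^bsub>A\<^esub> \<odot>\<^bsub>T\<^esub> t = t"
 using assms
proof (induct rule: T_induct)
 case (diff s t) thus ?case by (simp add: sT_diff)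
next
 case (one x y) thus ?case by (simp add: pt_smult sm_one)
qed (simp add: sT_zero)

lemma T_act_diff:
 assumes "g \<in> carrier G" "s \<in> carrier T" "t \<in> carrier T"
 shows "act T g (s \<ominus>\<^bsub>T\<^esub> t) = act T g s \<ominus>\<^bsub>T\<^esub> act T g t"
proof -
 have "act T g (s \<ominus>\<^bsub>T\<^esub> t) \<oplus>\<^bsub>T\<^esub> act T g t = act T g ((s \<ominus>\<^bsub>T\<^esub> t) \<oplus>\<^bsub>T\<^esub> t)"
  using assms by simp
 also have "(s \<ominus>\<^bsub>T\<^esub> t) \<oplus>\<^bsub>T\<^esub> t = s" using assms by (simp add: a_minus_def T.V.a_assoc T.V.l_neg)
 finally show ?thesis using assms
  by (metis T.V.add.inv_solve_right T.V.minus_closed a_minus_def T.act_closed)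
qed

lemma sT_act:
 assumes "a \<in> carrier A" "g \<in> carrier G" "t \<in> carrier T"
 shows "act T g (a \<odot>\<^bsub>T\<^esub> t) = a \<odot>\<^bsub>T\<^esub> act T g t"
 using assms(3)
proof (induct rule: T_induct)
 case (diff s t) thus ?case using assms by (simp add: sT_diff T_act_diff)
next
 case (one x y) thus ?case using assms by (simp add: pt_smult pt_act sm_act)
qed (use assms in \<open>simp add: sT_zero\<close>)

lemma T_submoduleI:
 assumes "H \<subseteq> carrier T" "\<zero>\<^bsub>T\<^esub> \<in> H" "\<And>s t. s \<in> H \<Longrightarrow> t \<in> H \<Longrightarrow> s \<oplus>\<^bsub>T\<^esub> t \<in> H"
  "\<And>a t. a \<in> carrier A \<Longrightarrow> t \<in> H \<Longrightarrow> a \<odot>\<^bsub>T\<^esub> t \<in> H"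
 shows "Module.submodule H A T"
proof -
 have "asub (G\<lparr>carrier := {}\<rparr>) T H" using assms by (auto simp: asub_def)
 from T.asub_neg[OF this] have "subgroup H (add_monoid T)"
  using assms by (intro subgroup.intro) (auto simp: a_inv_def)
 thus ?thesis using assms(4) by (intro Module.submodule.intro submodule_axioms.intro)
qed

abbreviation "N \<equiv> alternating_submodule A M"
abbreviation "E \<equiv> exterior_square A M"

lemma N_least: "Module.submodule H A T \<Longrightarrow> (\<And>x. x \<in> carrier M \<Longrightarrow> pt x x \<in> H) \<Longrightarrow> N \<subseteq> H"
 unfolding alternating_submodule_def pure_tensor_def Q_def by blast

lemma N_squares: "x \<in> carrier M \<Longrightarrow> pt x x \<in> N"
 unfolding alternating_submodule_def pure_tensor_def Q_def by blast

lemma submodule_facts: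
 assumes "Module.submodule H A T"
 shows "\<zero>\<^bsub>T\<^esub> \<in> H" "s \<in> H \<Longrightarrow> t \<in> H \<Longrightarrow> s \<oplus>\<^bsub>T\<^esub> t \<in> H" "a \<in> carrier A \<Longrightarrow> t \<in> H \<Longrightarrow> a \<odot>\<^bsub>T\<^esub> t \<in> H"
proof -
 have sg: "subgroup H (add_monoid T)" using assms by (simp add: Module.submodule_def)
 show "\<zero>\<^bsub>T\<^esub> \<in> H" using subgroup.one_closed[OF sg] by simp
 show "s \<in> H \<Longrightarrow> t \<in> H \<Longrightarrow> s \<oplus>\<^bsub>T\<^esub> t \<in> H" using subgroup.m_closed[OF sg] by simp
 show "a \<in> carrier A \<Longrightarrow> t \<in> H \<Longrightarrow> a \<odot>\<^bsub>T\<^esub> t \<in> H" using assms by (rule Module.submodule.smult_closed)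
qed

lemma N_carrier: "N \<subseteq> carrier T"
 by (rule N_least[OF T_submoduleI]) auto

lemma N_submodule: "Module.submodule N A T"
proof (rule T_submoduleI[OF N_carrier])
 show "\<zero>\<^bsub>T\<^esub> \<in> N" unfolding alternating_submodule_def using submodule_facts(1) by blast
 show "s \<oplus>\<^bsub>T\<^esub> t \<in> N" if "s \<in> N" "t \<in> N" for s t
  using that submodule_facts(2)[of _ s t] unfolding alternating_submodule_def by blast
 show "a \<odot>\<^bsub>T\<^esub> t \<in> N" if "a \<in> carrier A" "t \<in> N" for a t
  using that submodule_facts(3)[of _ a t] unfolding alternating_submodule_def by blast
qed

text \<open>The preimage of \<open>N\<close> under the action of \<open>g\<close> is again a submodule that contains all squares.\<close>

lemma N_act: assumes "g \<in> carrier G" "t \<in> N" shows "act T g t \<in> N"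
proof -
 have "N \<subseteq> {t \<in> carrier T. act T g t \<in> N}"
  by (rule N_least[OF T_submoduleI])
   (use assms(1) submodule_facts[OF N_submodule] N_squares in \<open>auto simp: sT_act pt_act\<close>)
 thus ?thesis using assms(2) by blast
qed

lemma N_subgroup: "subgroup N (add_monoid T)"
 using N_submodule by (simp add: Module.submodule_def)

sublocale N: normal N "add_monoid T"
 by (rule T.V.add.subgroup_imp_normal[OF N_subgroup])

definition Q2 where "Q2 t = r_coset (add_monoid T) N t"

lemma Q2_eq: "s \<in> carrier T \<Longrightarrow> t \<in> carrier T \<Longrightarrow> Q2 s = Q2 t \<longleftrightarrow> s \<ominus>\<^bsub>T\<^esub> t \<in> N"
proof
 assume st: "s \<in> carrier T" "t \<in> carrier T" "Q2 s = Q2 t"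
 hence "s \<in> r_coset (add_monoid T) N t" using T.V.add.rcos_self[OF _ N_subgroup, of s] by (simp add: Q2_def)
 then obtain k where k: "k \<in> N" "s = k \<oplus>\<^bsub>T\<^esub> t" by (auto simp: r_coset_def)
 hence "k \<in> carrier T" using N_carrier by auto
 hence "s \<ominus>\<^bsub>T\<^esub> t = k" using k st by (simp add: a_minus_def T.V.a_assoc T.V.r_neg)
 thus "s \<ominus>\<^bsub>T\<^esub> t \<in> N" using k by simp
next
 assume st: "s \<in> carrier T" "t \<in> carrier T" "s \<ominus>\<^bsub>T\<^esub> t \<in> N"
 have "s = (s \<ominus>\<^bsub>T\<^esub> t) \<oplus>\<^bsub>T\<^esub> t" using st by (simp add: a_minus_def T.V.a_assoc T.V.l_neg)
 hence "s \<in> r_coset (add_monoid T) N t" using st(3) by (auto simp: r_coset_def)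
 thus "Q2 s = Q2 t" unfolding Q2_def using T.V.add.repr_independence[of s N t] st N_subgroup by simp
qed

lemma Q2_add: "s \<in> carrier T \<Longrightarrow> t \<in> carrier T \<Longrightarrow> Q2 s \<oplus>\<^bsub>E\<^esub> Q2 t = Q2 (s \<oplus>\<^bsub>T\<^esub> t)"
 using N.rcos_sum[of s t] by (simp add: exterior_square_def Let_def Q2_def A_FactGroup_def FactGroup_def)

lemma E_carrier: "carrier E = Q2 ` carrier T"
 by (auto simp: exterior_square_def Let_def Q2_def A_FactGroup_def FactGroup_def RCOSETS_def)

lemma E_zero: "\<zero>\<^bsub>E\<^esub> = Q2 \<zero>\<^bsub>T\<^esub>"
 using T.V.add.coset_join2[OF _ N_subgroup subgroup.one_closed[OF N_subgroup]]
 by (simp add: exterior_square_def Let_def Q2_def A_FactGroup_def FactGroup_def)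

lemma E_act:
 assumes g: "g \<in> carrier G" and t: "t \<in> carrier T"
 shows "act E g (Q2 t) = Q2 (act T g t)"
proof -
 have Nc: "\<And>k. k \<in> N \<Longrightarrow> k \<in> carrier T" using N_carrier by auto
 have "act E g (Q2 t) = set_mult (add_monoid T) N (act T g ` Q2 t)"
  using t E_carrier by (auto simp: exterior_square_def Let_def set_add_def)
 also have "\<dots> = {k \<oplus>\<^bsub>T\<^esub> act T g (l \<oplus>\<^bsub>T\<^esub> t) | k l. k \<in> N \<and> l \<in> N}"
  unfolding set_mult_def Q2_def r_coset_def by auto
 also have "\<dots> = {k \<oplus>\<^bsub>T\<^esub> act T g t | k. k \<in> N}"
 proof (intro equalityI subsetI)
  fix z assume "z \<in> {k \<oplus>\<^bsub>T\<^esub> act T g (l \<oplus>\<^bsub>T\<^esub> t) | k l. k \<in> N \<and> l \<in> N}"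
  then obtain k l where kl: "k \<in> N" "l \<in> N" "z = k \<oplus>\<^bsub>T\<^esub> act T g (l \<oplus>\<^bsub>T\<^esub> t)" by blast
  hence "z = (k \<oplus>\<^bsub>T\<^esub> act T g l) \<oplus>\<^bsub>T\<^esub> act T g t" using Nc g t by (simp add: T.V.a_assoc)
  thus "z \<in> {k \<oplus>\<^bsub>T\<^esub> act T g t | k. k \<in> N}"
   using submodule_facts(2)[OF N_submodule kl(1) N_act[OF g kl(2)]] by blast
 next
  fix z assume "z \<in> {k \<oplus>\<^bsub>T\<^esub> act T g t | k. k \<in> N}"
  then obtain k where "k \<in> N" "z = k \<oplus>\<^bsub>T\<^esub> act T g (\<zero>\<^bsub>T\<^esub> \<oplus>\<^bsub>T\<^esub> t)" using t by auto
  thus "z \<in> {k \<oplus>\<^bsub>T\<^esub> act T g (l \<oplus>\<^bsub>T\<^esub> t) | k l. k \<in> N \<and> l \<in> N}"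
   using submodule_facts(1)[OF N_submodule] by blast
 qed
 also have "\<dots> = Q2 (act T g t)" unfolding Q2_def r_coset_def by auto
 finally show ?thesis .
qed

lemma arep_E: "arep G p E"
proof -
 have "comm_group (add_monoid T Mod N)" by (rule T.V.add.abelian_FactGroup[OF N_subgroup])
 then interpret Q: comm_group "add_monoid T Mod N" .
 have e: "carrier E = carrier (add_monoid T Mod N)" "\<zero>\<^bsub>E\<^esub> = \<one>\<^bsub>add_monoid T Mod N\<^esub>"
   "\<And>x y. x \<oplus>\<^bsub>E\<^esub> y = x \<otimes>\<^bsub>add_monoid T Mod N\<^esub> y"
  by (simp_all add: exterior_square_def Let_def A_FactGroup_def)
 have ab: "abelian_group E"
 proof (rule abelian_groupI, unfold e)
  fix x assume "x \<in> carrier (add_monoid T Mod N)"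
  thus "\<exists>y\<in>carrier (add_monoid T Mod N). y \<otimes>\<^bsub>add_monoid T Mod N\<^esub> x = \<one>\<^bsub>add_monoid T Mod N\<^esub>" using Q.l_inv_ex by blast
 qed ((rule Q.m_closed Q.m_assoc Q.m_comm Q.l_one; assumption) | rule Q.one_closed)+
 have pw: "add_pow E (n::nat) (Q2 t) = Q2 (add_pow T n t)" if "t \<in> carrier T" for n t
  by (induct n) (use that in \<open>simp_all add: add_pow_zero add_pow_Suc E_zero Q2_add\<close>)
 have cl: "Q2 t \<in> carrier E" if "t \<in> carrier T" for t using that E_carrier by auto
 show ?thesis
 proof (intro arep.intro arep_axioms.intro G.group_axioms ab prime_p)
  show "finite (carrier E)" using E_carrier T.finite_carrier by simp
  fix x assume "x \<in> carrier E"
  then obtain s where s: "s \<in> carrier T" "x = Q2 s" using E_carrier by auto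
  show "add_pow E p x = \<zero>\<^bsub>E\<^esub>" using s by (simp add: pw T.torsion E_zero)
  show "act E \<one>\<^bsub>G\<^esub> x = x" using s by (simp add: E_act)
  fix g assume g: "g \<in> carrier G"
  show "act E g x \<in> carrier E" using s g by (simp add: E_act cl)
  show "act E g (x \<oplus>\<^bsub>E\<^esub> y) = act E g x \<oplus>\<^bsub>E\<^esub> act E g y" if y: "y \<in> carrier E" for y
  proof -
   obtain t where t: "t \<in> carrier T" "y = Q2 t" using y E_carrier by auto
   show ?thesis using s t g by (simp add: E_act Q2_add)
  qed
  fix h assume "h \<in> carrier G"
  thus "act E (g \<otimes>\<^bsub>G\<^esub> h) x = act E g (act E h x)" using s g by (simp add: E_act T.act_mult)
 qed
qed

text \<open>The scalar \<open>a\<close> occurs because the squares are factored out together with their multiples.\<close>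

definition ext_bal :: "('b \<times> 'b \<Rightarrow> int) set" where
 "ext_bal = {b \<in> bal. \<forall>a\<in>carrier A. \<forall>x\<in>carrier M. b (a \<odot> x, x) = 0}"

text \<open>Functionals on the quotient are functionals on the tensor square that vanish on the alternating
submodule, which holds as soon as they vanish on all multiples of squares.\<close>

lemma card_functionals_E: "card (ahom G E (fp p)) = card ext_bal"
proof -
 have Fp: "arep G p (fp p)" by (rule arep_fp[OF G.group_axioms prime_p])
 define S where "S = {f \<in> ahom G T (fp p). \<forall>t\<in>N. f t = 0}"
 let ?\<Phi> = "\<lambda>f. \<lambda>(x, y)\<in>carrier M \<times> carrier M. f (pt x y)"
 have cl: "Q2 t \<in> carrier E" if "t \<in> carrier T" for t using that E_carrier by auto
 have "bij_betw (\<lambda>f. \<lambda>t\<in>carrier T. f (Q2 t)) (ahom G E (fp p)) S"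
 proof (rule bij_betwI')
  fix f h assume f: "f \<in> ahom G E (fp p)" and h: "h \<in> ahom G E (fp p)"
  have "f = h" if e: "(\<lambda>t\<in>carrier T. f (Q2 t)) = (\<lambda>t\<in>carrier T. h (Q2 t))"
  proof (rule ahom_eqI[OF f h])
   fix x assume "x \<in> carrier E"
   then obtain t where t: "t \<in> carrier T" "x = Q2 t" using E_carrier by auto
   show "f x = h x" using fun_cong[OF e, of t] t by simp
  qed
  thus "((\<lambda>t\<in>carrier T. f (Q2 t)) = (\<lambda>t\<in>carrier T. h (Q2 t))) = (f = h)" by blast
 next
  fix f assume f: "f \<in> ahom G E (fp p)"
  have "(\<lambda>t\<in>carrier T. f (Q2 t)) \<in> ahom G T (fp p)"
   by (rule ahomI) (use cl ahom_closed[OF f] ahom_add[OF f] ahom_act[OF f] in \<open>auto simp: Q2_add[symmetric] E_act[symmetric]\<close>)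
  moreover have "f (Q2 t) = 0" if t: "t \<in> N" for t
  proof -
   have tc: "t \<in> carrier T" using t N_carrier by auto
   have z: "\<ominus>\<^bsub>T\<^esub> \<zero>\<^bsub>T\<^esub> = \<zero>\<^bsub>T\<^esub>" by (rule T.V.minus_equality) auto
   have "t \<ominus>\<^bsub>T\<^esub> \<zero>\<^bsub>T\<^esub> = t" unfolding a_minus_def z using tc by simp
   hence "Q2 t = Q2 \<zero>\<^bsub>T\<^esub>" using Q2_eq[OF tc T.V.zero_closed] t by simp
   thus ?thesis using ahom_zero[OF arep_E Fp f] by (simp add: E_zero)
  qed
  ultimately show "(\<lambda>t\<in>carrier T. f (Q2 t)) \<in> S" using N_carrier by (auto simp: S_def)
 next
  fix h assume "h \<in> S"
  hence h: "h \<in> ahom G T (fp p)" and hN: "\<And>t. t \<in> N \<Longrightarrow> h t = 0" by (auto simp: S_def)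
  have "h s = h t" if "s \<in> carrier T" "t \<in> carrier T" "Q2 s = Q2 t" for s t
   using hN[of "s \<ominus>\<^bsub>T\<^esub> t"] Q2_eq[OF that(1,2)] that(3) ahom_diff_zero[OF arep_T Fp h that(1,2)] by simp
  hence "\<exists>f0. \<forall>t. t \<in> carrier T \<longrightarrow> h t = f0 (Q2 t)"
   using function_factors_left_gen[of "\<lambda>t. t \<in> carrier T" Q2 h] by metis
  then obtain f0 where f0: "\<And>t. t \<in> carrier T \<Longrightarrow> h t = f0 (Q2 t)" by blast
  define f where "f = restrict f0 (carrier E)"
  have fQ: "f (Q2 t) = h t" if "t \<in> carrier T" for t using f0[OF that] cl[OF that] by (simp add: f_def)
  have "f \<in> ahom G E (fp p)"
  proof (rule ahomI)
   fix x y assume "x \<in> carrier E" "y \<in> carrier E"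
   then obtain s t where "s \<in> carrier T" "t \<in> carrier T" "x = Q2 s" "y = Q2 t" using E_carrier by auto
   thus "f (x \<oplus>\<^bsub>E\<^esub> y) = f x \<oplus>\<^bsub>fp p :: (int, int, 'g) rep\<^esub> f y"
    using ahom_add[OF h, of s t] by (simp add: Q2_add fQ)
  next
   fix g x assume g: "g \<in> carrier G" and "x \<in> carrier E"
   then obtain s where "s \<in> carrier T" "x = Q2 s" using E_carrier by auto
   thus "f (act E g x) = act (fp p :: (int, int, 'g) rep) g (f x)"
    using ahom_act[OF h g, of s] g by (simp add: E_act fQ)
  next
   fix x assume "x \<in> carrier E"
   then obtain s where "s \<in> carrier T" "x = Q2 s" using E_carrier by auto
   thus "f x \<in> carrier (fp p :: (int, int, 'g) rep)" using ahom_closed[OF h, of s] by (simp add: fQ)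
  qed (simp add: f_def)
  moreover have "h = (\<lambda>t\<in>carrier T. f (Q2 t))"
   by (rule extensionalityI[OF ahom_ext[OF h]]) (auto simp: fQ)
  ultimately show "\<exists>f\<in>ahom G E (fp p). h = (\<lambda>t\<in>carrier T. f (Q2 t))" by blast
 qed
 hence 1: "card (ahom G E (fp p)) = card S" by (rule bij_betw_same_card)
 have iff: "f \<in> S \<longleftrightarrow> ?\<Phi> f \<in> ext_bal" if f: "f \<in> ahom G T (fp p)" for f
 proof
  assume "f \<in> S"
  hence fN: "\<And>t. t \<in> N \<Longrightarrow> f t = 0" by (simp add: S_def)
  have "?\<Phi> f \<in> bal" using functionals_T f by (rule bij_betw_apply)
  moreover have "f (pt (a \<odot> x) x) = 0" if "a \<in> carrier A" "x \<in> carrier M" for a x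
   using fN submodule_facts(3)[OF N_submodule that(1) N_squares[OF that(2)]] that by (simp add: pt_smult)
  ultimately show "?\<Phi> f \<in> ext_bal" by (simp add: ext_bal_def)
 next
  assume "?\<Phi> f \<in> ext_bal"
  hence z: "f (pt (a \<odot> x) x) = 0" if "a \<in> carrier A" "x \<in> carrier M" for a x
   using that by (auto simp: ext_bal_def)
  let ?N0 = "{t \<in> carrier T. \<forall>a\<in>carrier A. f (a \<odot>\<^bsub>T\<^esub> t) = 0}"
  have "N \<subseteq> ?N0"
  proof (rule N_least[OF T_submoduleI])
   show "\<zero>\<^bsub>T\<^esub> \<in> ?N0"
    using ahom_zero[OF arep_T Fp f] by (simp add: sT_zero)
   show "s \<oplus>\<^bsub>T\<^esub> t \<in> ?N0"
    if "s \<in> ?N0" "t \<in> ?N0" for s t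
    using that by (simp add: sT_add ahom_add[OF f])
   show "a \<odot>\<^bsub>T\<^esub> t \<in> ?N0"
    if "a \<in> carrier A" "t \<in> ?N0" for a t
    using that by (simp add: sT_assoc[symmetric])
  qed (use z in \<open>auto simp: pt_smult\<close>)
  hence f1: "f (\<one>\<^bsub>A\<^esub> \<odot>\<^bsub>T\<^esub> t) = 0" if "t \<in> N" for t using that A.one_closed by blast
  have "f t = 0" if t: "t \<in> N" for t using f1[OF t] unfolding sT_one[OF subsetD[OF N_carrier t]] .
  thus "f \<in> S" using f by (simp add: S_def)
 qed
 have "?\<Phi> ` S = ext_bal"
 proof
  show "?\<Phi> ` S \<subseteq> ext_bal"
  proof (rule image_subsetI)
   fix f assume "f \<in> S"
   moreover from this have "f \<in> ahom G T (fp p)" by (simp add: S_def)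
   ultimately show "?\<Phi> f \<in> ext_bal" using iff by blast
  qed
  show "ext_bal \<subseteq> ?\<Phi> ` S"
  proof
   fix b assume b: "b \<in> ext_bal"
   hence "b \<in> ?\<Phi> ` ahom G T (fp p)" using functionals_T by (simp add: ext_bal_def bij_betw_def)
   then obtain f where f: "f \<in> ahom G T (fp p)" "b = ?\<Phi> f" by (rule imageE)
   hence "f \<in> S" using iff[OF f(1)] b by simp
   thus "b \<in> ?\<Phi> ` S" unfolding f(2) by (rule imageI)
  qed
 qed
 moreover have "card (?\<Phi> ` S) = card S"
  by (rule card_image, rule inj_on_subset[OF bij_betw_imp_inj_on[OF functionals_T]]) (auto simp: S_def)
 ultimately show ?thesis using 1 by (simp only:)
qed

lemma card_invariants_T:
 assumes "finite (carrier G)" "\<not> p dvd card (carrier G)"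
 shows "card (rep_invariants G T) = card bal"
 using card_invariants_eq_functionals[OF arep_T assms] bij_betw_same_card[OF functionals_T] by simp

lemma card_invariants_E:
 assumes "finite (carrier G)" "\<not> p dvd card (carrier G)"
 shows "card (rep_invariants G E) = card ext_bal"
 using card_invariants_eq_functionals[OF arep_E assms] card_functionals_E by simp

end

lemma invariants_nontrivial:
 assumes "arep G p V"
 shows "rep_invariants G V \<noteq> {\<zero>\<^bsub>V\<^esub>} \<longleftrightarrow> card (rep_invariants G V) \<noteq> 1"
proof -
 interpret V: arep G p V by fact
 have "\<zero>\<^bsub>V\<^esub> \<in> rep_invariants G V" by (auto simp: rep_invariants_def)
 thus ?thesis by (metis card_1_singletonE is_singletonI is_singleton_altdef singletonD)
qed

text \<open>Over the prime field balance is automatic and the submodule generated by the squares is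
 detected by alternating forms.\<close>

lemma card_invariants_exterior_square:
 assumes V: "arep G p V" and sm: "smult_ok p V" and G: "finite (carrier G)" "\<not> p dvd card (carrier G)"
 shows "card (rep_invariants G (exterior_square (Fp p) V)) = card (alt_forms G p V)"
proof -
 interpret V: arep G p V by fact
 have p1: "int p > 1" using V.prime_p prime_gt_1_nat by auto
 have s: "a \<odot>\<^bsub>V\<^esub> x = add_pow V (nat a) x" if "0 \<le> a" "a < int p" "x \<in> carrier V" for a x
  using sm that by (auto simp: smult_ok_def)
 have pw1: "b (add_pow V (n::nat) x, y) = (int n * b (x, y)) mod int p"
  if b: "b \<in> forms G p V V" "x \<in> carrier V" "y \<in> carrier V" for b n x y
 proof (induct n)
  case 0 show ?case using forms_zero(1)[OF b(1) V V b(3)] by (simp add: add_pow_zero)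
 next
  case (Suc n) thus ?case using b by (simp add: add_pow_Suc forms_add1[OF b(1)] mod_simps algebra_simps)
 qed
 have pw2: "b (y, add_pow V (n::nat) x) = (int n * b (y, x)) mod int p"
  if b: "b \<in> forms G p V V" "x \<in> carrier V" "y \<in> carrier V" for b n x y
 proof (induct n)
  case 0 show ?case using forms_zero(2)[OF b(1) V V b(3)] by (simp add: add_pow_zero)
 next
  case (Suc n) thus ?case using b by (simp add: add_pow_Suc forms_add2[OF b(1)] mod_simps algebra_simps)
 qed
 interpret tens G p "Fp p" V
 proof (intro tens.intro V tens_axioms.intro)
  show "cring (Fp p)" by (rule residues.cring) (use p1 in \<open>simp add: residues_def\<close>)
  fix a b x assume "a \<in> carrier (Fp p)" "b \<in> carrier (Fp p)" "x \<in> carrier V"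
  hence ab: "0 \<le> a" "a < int p" "0 \<le> b" "b < int p" and x: "x \<in> carrier V" by auto
  have "nat ((a * b) mod int p) = (nat a * nat b) mod p" using ab p1 by (simp add: nat_mod_distrib nat_mult_distrib)
  thus "(a \<otimes>\<^bsub>Fp p\<^esub> b) \<odot>\<^bsub>V\<^esub> x = a \<odot>\<^bsub>V\<^esub> (b \<odot>\<^bsub>V\<^esub> x)"
   using ab x p1 by (simp add: s V.pow_mod V.pow_pow mult.commute)
 qed (use s p1 in \<open>auto simp: V.pow_distrib V.act_pow add_pow_Suc add_pow_zero\<close>)
 have "ext_bal = alt_forms G p V"
 proof (intro equalityI subsetI)
  fix b assume b: "b \<in> ext_bal"
  have "b (x, x) = 0" if "x \<in> carrier V" for x
  proof -
   have "b (1 \<odot>\<^bsub>V\<^esub> x, x) = 0" using b that p1 by (auto simp: ext_bal_def)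
   thus ?thesis using sm_one[OF that] by simp
  qed
  thus "b \<in> alt_forms G p V" using b by (simp add: ext_bal_def bal_def alt_forms_def)
 next
  fix b assume "b \<in> alt_forms G p V"
  hence b: "b \<in> forms G p V V" "\<And>x. x \<in> carrier V \<Longrightarrow> b (x, x) = 0" by (auto simp: alt_forms_def)
  thus "b \<in> ext_bal" by (auto simp: ext_bal_def bal_def s pw1[OF b(1)] pw2[OF b(1)])
 qed
 thus ?thesis using card_invariants_E[OF G] by simp
qed

section \<open>The endomorphism field and the sign\<close>

lemma End_rep_simps [simp]:
 "monoid.mult (End_rep G R V) f h = compose (carrier V) f h"
 "\<one>\<^bsub>End_rep G R V\<^esub> = (\<lambda>v\<in>carrier V. v)"
 "\<zero>\<^bsub>End_rep G R V\<^esub> = (\<lambda>v\<in>carrier V. \<zero>\<^bsub>V\<^esub>)"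
 "f \<oplus>\<^bsub>End_rep G R V\<^esub> h = (\<lambda>v\<in>carrier V. f v \<oplus>\<^bsub>V\<^esub> h v)"
 by (simp_all add: End_rep_def)

lemma rep_over_End_simps [simp]:
 "carrier (rep_over_End V) = carrier V" "\<zero>\<^bsub>rep_over_End V\<^esub> = \<zero>\<^bsub>V\<^esub>"
 "ring.add (rep_over_End V) = ring.add V" "f \<odot>\<^bsub>rep_over_End V\<^esub> v = f v"
 "act (rep_over_End V) = act V"
 by (simp_all add: rep_over_End_def)

lemma End_rep_carrier:
 "arep G p V \<Longrightarrow> smult_ok p V \<Longrightarrow> carrier (End_rep G (Fp p) V) = ahom G V V"
 by (simp add: End_rep_def rep_hom_eq_ahom)

lemma ahom_sum:
 assumes "arep G p U" "arep G p V" "f \<in> ahom G U V" "h \<in> ahom G U V"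
 shows "(\<lambda>v\<in>carrier U. f v \<oplus>\<^bsub>V\<^esub> h v) \<in> ahom G U V"
proof -
 interpret U: arep G p U by fact
 interpret V: arep G p V by fact
 show ?thesis
  by (intro ahomI) (auto simp: ahom_closed[OF assms(3)] ahom_closed[OF assms(4)] ahom_add[OF assms(3)]
   ahom_add[OF assms(4)] ahom_act[OF assms(3)] ahom_act[OF assms(4)] V.V.a_ac)
qed

lemma ahom_minus:
 assumes "arep G p U" "arep G p V" "f \<in> ahom G U V"
 shows "(\<lambda>v\<in>carrier U. \<ominus>\<^bsub>V\<^esub> f v) \<in> ahom G U V"
proof -
 interpret U: arep G p U by fact
 interpret V: arep G p V by fact
 have n: "\<ominus>\<^bsub>V\<^esub> act V g y = act V g (\<ominus>\<^bsub>V\<^esub> y)" if "g \<in> carrier G" "y \<in> carrier V" for g y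
  by (rule V.V.minus_equality) (use that V.act_add[of g "\<ominus>\<^bsub>V\<^esub> y" y, symmetric] in \<open>auto simp: V.V.l_neg\<close>)
 show ?thesis
  by (intro ahomI) (auto simp: ahom_closed[OF assms(3)] ahom_add[OF assms(3)] ahom_act[OF assms(3)]
   V.V.minus_add n)
qed

text \<open>Schur's lemma.\<close>

lemma End_division_ring:
 assumes V: "airr G p V" and sm: "smult_ok p V"
 shows "finite_division_ring (End_rep G (Fp p) V)"
proof -
 interpret V: arep G p V using V by (simp add: airr_def)
 note A = V.arep_axioms
 let ?E = "End_rep G (Fp p) V"
 note C = End_rep_carrier[OF A sm]
 have ag: "abelian_group ?E"
 proof (rule abelian_groupI, unfold C)
  fix f assume f: "f \<in> ahom G V V"
  show "\<exists>h\<in>ahom G V V. h \<oplus>\<^bsub>?E\<^esub> f = \<zero>\<^bsub>?E\<^esub>"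
   by (rule bexI[OF _ ahom_minus[OF A A f]]) (auto simp: V.V.l_neg ahom_closed[OF f])
  show "\<zero>\<^bsub>?E\<^esub> \<oplus>\<^bsub>?E\<^esub> f = f"
   using ahom_ext[OF f] by (auto simp: ahom_closed[OF f] fun_eq_iff restrict_def extensional_def)
 qed (auto simp: ahom_sum[OF A A] ahom_zero_map[OF A A] ahom_closed V.V.a_ac intro!: restrict_ext)
 have mo: "monoid ?E"
 proof (rule monoidI, unfold C)
  fix f assume f: "f \<in> ahom G V V"
  show "\<one>\<^bsub>?E\<^esub> \<otimes>\<^bsub>?E\<^esub> f = f" "f \<otimes>\<^bsub>?E\<^esub> \<one>\<^bsub>?E\<^esub> = f"
   using ahom_ext[OF f] by (auto simp: ahom_closed[OF f] fun_eq_iff compose_def restrict_def extensional_def)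
  fix h assume h: "h \<in> ahom G V V"
  show "f \<otimes>\<^bsub>?E\<^esub> h \<in> ahom G V V" using ahom_compose[OF A h f] by simp
 qed (auto simp: ahom_id[OF A] compose_def ahom_closed intro!: restrict_ext)
 interpret ring ?E
  by (rule ringI[OF ag mo], unfold C)
   (auto simp: compose_def ahom_closed ahom_add intro!: restrict_ext)
 show ?thesis
 proof unfold_locales
  show "finite (carrier ?E)" unfolding C by (rule ahom_finite[OF A A])
  obtain x where "x \<in> carrier V" "x \<noteq> \<zero>\<^bsub>V\<^esub>" using V V.V.zero_closed unfolding airr_def by blast
  thus "\<one>\<^bsub>?E\<^esub> \<noteq> \<zero>\<^bsub>?E\<^esub>" by (auto simp: restrict_def fun_eq_iff)
  fix f assume "f \<in> carrier ?E" "f \<noteq> \<zero>\<^bsub>?E\<^esub>"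
  hence f: "f \<in> ahom G V V" "f \<noteq> (\<lambda>v\<in>carrier V. \<zero>\<^bsub>V\<^esub>)" by (auto simp: C)
  note bij = schur_bij[OF V V f]
  let ?h = "\<lambda>y\<in>carrier V. inv_into (carrier V) f y"
  have "?h \<in> ahom G V V" by (rule ahom_inverse[OF A A f(1) bij])
  moreover have "?h \<otimes>\<^bsub>?E\<^esub> f = \<one>\<^bsub>?E\<^esub>" "f \<otimes>\<^bsub>?E\<^esub> ?h = \<one>\<^bsub>?E\<^esub>"
   using bij ahom_closed[OF f(1)]
   by (auto simp: compose_def bij_betw_inv_into_left bij_betw_inv_into_right inv_into_into bij_betw_def intro!: restrict_ext)
  ultimately show "\<exists>y\<in>carrier ?E. y \<otimes>\<^bsub>?E\<^esub> f = \<one>\<^bsub>?E\<^esub> \<and> f \<otimes>\<^bsub>?E\<^esub> y = \<one>\<^bsub>?E\<^esub>"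
   unfolding C by blast
 qed
qed

lemma End_field: "airr G p V \<Longrightarrow> smult_ok p V \<Longrightarrow> field (End_rep G (Fp p) V)"
 by (rule finite_division_ring.wedderburn[OF End_division_ring])

lemma ahom_commute:
 assumes "airr G p V" "smult_ok p V" "f \<in> ahom G V V" "h \<in> ahom G V V" "x \<in> carrier V"
 shows "f (h x) = h (f x)"
proof -
 interpret field "End_rep G (Fp p) V" by (rule End_field[OF assms(1,2)])
 have C: "carrier (End_rep G (Fp p) V) = ahom G V V"
  using assms(1,2) by (simp add: End_rep_carrier airr_def)
 have "compose (carrier V) f h = compose (carrier V) h f"
  using m_comm[of f h] assms(3,4) by (simp add: C)
 from fun_cong[OF this, of x] show ?thesis using assms(5) by (simp add: compose_def)
qed

lemma
 assumes V: "airr G p V" and sm: "smult_ok p V"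
 shows tens_End: "tens G p (End_rep G (Fp p) V) (rep_over_End V)"
  and vectorspace_End: "vectorspace (End_rep G (Fp p) V) (rep_over_End V)"
proof -
 interpret V: arep G p V using V by (simp add: airr_def)
 note A = V.arep_axioms
 interpret F: field "End_rep G (Fp p) V" by (rule End_field[OF assms])
 note C = End_rep_carrier[OF A sm]
 let ?W = "rep_over_End V"
 have ag: "abelian_group ?W"
  by (rule abelian_groupI) (auto simp: V.V.a_ac intro: bexI[of _ "\<ominus>\<^bsub>V\<^esub> _"] V.V.l_neg V.V.a_inv_closed)
 have pw: "add_pow ?W (n::nat) x = add_pow V n x" for n x
  by (induct n) (auto simp: add_pow_def)
 have "arep G p ?W"
  by (intro arep.intro V.G.group_axioms ag arep_axioms.intro)
   (auto simp: V.prime_p V.torsion V.act_mult pw)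
 thus "tens G p (End_rep G (Fp p) V) ?W"
  by (intro tens.intro tens_axioms.intro F.cring_axioms)
   (auto simp: C compose_def ahom_closed ahom_add ahom_act)
 have "Module.module (End_rep G (Fp p) V) ?W"
  by (rule moduleI) (auto simp: F.cring_axioms ag C compose_def ahom_closed ahom_add)
 thus "vectorspace (End_rep G (Fp p) V) ?W"
  by (intro vectorspace.intro F.field_axioms)
qed

text \<open>Coordinates with respect to a basis.\<close>

lemma card_End_dim:
 assumes V: "airr G p V" and sm: "smult_ok p V"
 shows "card (carrier V) = card (ahom G V V) ^ vectorspace.dim (End_rep G (Fp p) V) (rep_over_End V)"
proof -
 interpret V: arep G p V using V by (simp add: airr_def)
 note C = End_rep_carrier[OF V.arep_axioms sm]
 interpret W: vectorspace "End_rep G (Fp p) V" "rep_over_End V" by (rule vectorspace_End[OF assms])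
 have "W.gen_set (carrier V)"
  using W.in_own_span[of "carrier V"] W.span_is_subset2[of "carrier V"] by auto
 hence fd: "W.fin_dim" unfolding W.fin_dim_def
  by (intro exI[of _ "carrier V"]) auto
 then obtain B where B: "finite B" "W.basis B" using W.finite_basis_exists by blast
 have BV: "B \<subseteq> carrier V" using B(2) by (simp add: W.basis_def)
 have uniq: "\<forall>v\<in>carrier V. \<exists>!a. a \<in> B \<rightarrow>\<^sub>E ahom G V V \<and> W.lincomb a B = v"
  using W.basis_criterion[OF B(1)] B(2) BV by (simp add: C)
 have cl: "W.lincomb a B \<in> carrier V" if "a \<in> B \<rightarrow>\<^sub>E ahom G V V" for a
  using W.lincomb_closed[of B a] BV that by (auto simp: C PiE_def)
 have "bij_betw (\<lambda>a. W.lincomb a B) (B \<rightarrow>\<^sub>E ahom G V V) (carrier V)"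
 proof (rule bij_betw_imageI)
  show "inj_on (\<lambda>a. W.lincomb a B) (B \<rightarrow>\<^sub>E ahom G V V)"
  proof (rule inj_onI)
   fix a a' assume a: "a \<in> B \<rightarrow>\<^sub>E ahom G V V" "a' \<in> B \<rightarrow>\<^sub>E ahom G V V" "W.lincomb a B = W.lincomb a' B"
   with bspec[OF uniq cl[OF a(1)]] show "a = a'" by (elim ex1E) metis
  qed
  show "(\<lambda>a. W.lincomb a B) ` (B \<rightarrow>\<^sub>E ahom G V V) = carrier V"
  proof (intro equalityI subsetI)
   fix v assume "v \<in> carrier V"
   with uniq obtain a where "a \<in> B \<rightarrow>\<^sub>E ahom G V V" "W.lincomb a B = v" by (meson ex1E)
   thus "v \<in> (\<lambda>a. W.lincomb a B) ` (B \<rightarrow>\<^sub>E ahom G V V)" by blast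
  qed (use cl in auto)
 qed
 hence "card (carrier V) = card (B \<rightarrow>\<^sub>E ahom G V V)" by (simp add: bij_betw_same_card)
 also have "\<dots> = card (ahom G V V) ^ card B" using B(1) by (simp add: card_funcsetE)
 also have "card B = W.dim" using W.dim_basis[OF B] by simp
 finally show ?thesis .
qed

subsection \<open>Forms on a nontrivial irreducible representation\<close>

definition twist :: "('a, 'b, 'g) rep \<Rightarrow> ('b \<Rightarrow> 'b) \<Rightarrow> ('b \<times> 'b \<Rightarrow> int) \<Rightarrow> ('b \<times> 'b \<Rightarrow> int)" where
 "twist V d b = (\<lambda>(x, y)\<in>carrier V \<times> carrier V. b (d x, y))"

definition flip :: "('a, 'b, 'g) rep \<Rightarrow> ('b \<times> 'b \<Rightarrow> int) \<Rightarrow> ('b \<times> 'b \<Rightarrow> int)" where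
 "flip V b = (\<lambda>(x, y)\<in>carrier V \<times> carrier V. b (y, x))"

definition addf :: "('a, 'b, 'g) rep \<Rightarrow> nat \<Rightarrow> ('b \<times> 'b \<Rightarrow> int) \<Rightarrow> ('b \<times> 'b \<Rightarrow> int) \<Rightarrow> ('b \<times> 'b \<Rightarrow> int)" where
 "addf V p b c = (\<lambda>(x, y)\<in>carrier V \<times> carrier V. (b (x, y) + c (x, y)) mod int p)"

locale irr_forms =
 fixes G :: "('g, 'm) monoid_scheme" and p :: nat and V :: "(int, 'b, 'g) rep"
 assumes irr: "airr G p V" and sm: "smult_ok p V" and nontriv: "\<not> trivial_action G V"
begin

abbreviation "B \<equiv> forms G p V V"
abbreviation "E \<equiv> ahom G V V"

sublocale V: arep G p V using irr by (simp add: airr_def)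

lemma twist_form:
 assumes "d \<in> E" "b \<in> B" shows "twist V d b \<in> B"
 by (rule formsI) (use assms in \<open>auto simp: twist_def ahom_closed[OF assms(1)] forms_range ahom_add forms_add1[OF assms(2)]
  forms_add2[OF assms(2)] ahom_act forms_act\<close>)

lemma flip_form:
 assumes "b \<in> B" shows "flip V b \<in> B"
 by (rule formsI) (use assms in \<open>auto simp: flip_def forms_range forms_add1[OF assms]
  forms_add2[OF assms] forms_act\<close>)

lemma mod4: "((i + j) mod m + (k + l) mod m) mod m = ((i + k) mod m + (j + l) mod m) mod m" for i j k l m :: int
 by (simp only: mod_simps) (simp only: ac_simps)

lemma addf_form:
 assumes "b \<in> B" "c \<in> B" shows "addf V p b c \<in> B"
proof (rule formsI)
 have "int p > 0" using V.prime_p prime_gt_0_nat by auto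
 thus "0 \<le> addf V p b c (x, y) \<and> addf V p b c (x, y) < int p" if "x \<in> carrier V" "y \<in> carrier V" for x y
  using that by (simp add: addf_def)
qed (auto simp: addf_def forms_add1[OF assms(1)] forms_add1[OF assms(2)] forms_add2[OF assms(1)]
  forms_add2[OF assms(2)] forms_act[OF assms(1)] forms_act[OF assms(2)] mod4)

abbreviation "z \<equiv> (\<lambda>_\<in>carrier V \<times> carrier V. 0 :: int)"

lemma form_nonzero:
 assumes "b \<in> B" "b \<noteq> z" obtains x y where "x \<in> carrier V" "y \<in> carrier V" "b (x, y) \<noteq> 0"
 using forms_eqI[OF assms(1) zero_form[OF V.arep_axioms V.arep_axioms]] assms(2) by force

lemma zero_endo: "(\<lambda>v\<in>carrier V. \<zero>\<^bsub>V\<^esub>) \<in> E"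
 by (rule ahom_zero_map[OF V.arep_axioms V.arep_axioms])

lemma form_left_nondegenerate:
 assumes b: "b \<in> B" "b \<noteq> z" and d: "d \<in> E"
  and v: "\<And>x y. x \<in> carrier V \<Longrightarrow> y \<in> carrier V \<Longrightarrow> b (d x, y) = 0"
 shows "d = (\<lambda>v\<in>carrier V. \<zero>\<^bsub>V\<^esub>)"
proof (rule ccontr)
 assume "d \<noteq> (\<lambda>v\<in>carrier V. \<zero>\<^bsub>V\<^esub>)"
 hence "d ` carrier V = carrier V" by (rule schur_surj[OF V.arep_axioms irr d])
 moreover obtain x y where xy: "x \<in> carrier V" "y \<in> carrier V" "b (x, y) \<noteq> 0" using form_nonzero[OF b] .
 ultimately obtain x' where "x' \<in> carrier V" "x = d x'" by blast
 thus False using v xy by auto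
qed

lemma form_diff1:
 assumes "b \<in> B" "x \<in> carrier V" "x' \<in> carrier V" "y \<in> carrier V"
 shows "b (x \<ominus>\<^bsub>V\<^esub> x', y) = (b (x, y) - b (x', y)) mod int p"
proof -
 have "b (x, y) = (b (x \<ominus>\<^bsub>V\<^esub> x', y) + b (x', y)) mod int p"
  using forms_add1[OF assms(1), of "x \<ominus>\<^bsub>V\<^esub> x'" x' y] assms
  by (simp add: a_minus_def V.V.a_assoc V.V.l_neg)
 hence "(b (x, y) - b (x', y)) mod int p = b (x \<ominus>\<^bsub>V\<^esub> x', y) mod int p"
  by (simp add: mod_simps)
 also have "\<dots> = b (x \<ominus>\<^bsub>V\<^esub> x', y)"
  using forms_range[OF assms(1), of "x \<ominus>\<^bsub>V\<^esub> x'" y] assms by (simp add: V.V.minus_closed)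
 finally show ?thesis by simp
qed

lemma twist_inj:
 assumes b: "b \<in> B" "b \<noteq> z" shows "inj_on (\<lambda>d. twist V d b) E"
proof (rule inj_onI)
 fix d e assume de: "d \<in> E" "e \<in> E" "twist V d b = twist V e b"
 let ?h = "\<lambda>v\<in>carrier V. d v \<oplus>\<^bsub>V\<^esub> (\<lambda>v\<in>carrier V. \<ominus>\<^bsub>V\<^esub> e v) v"
 have "?h \<in> E" by (intro ahom_sum[OF V.arep_axioms V.arep_axioms] ahom_minus[OF V.arep_axioms V.arep_axioms] de)
 moreover have h: "?h x = d x \<ominus>\<^bsub>V\<^esub> e x" if "x \<in> carrier V" for x using that by (simp add: a_minus_def)
 moreover have "b (?h x, y) = 0" if xy: "x \<in> carrier V" "y \<in> carrier V" for x y
 proof -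
  have "b (d x, y) = b (e x, y)" using fun_cong[OF de(3), of "(x, y)"] xy by (simp add: twist_def)
  thus ?thesis using xy de by (simp only: h) (simp add: form_diff1[OF b(1)] ahom_closed)
 qed
 ultimately have h0: "?h = (\<lambda>v\<in>carrier V. \<zero>\<^bsub>V\<^esub>)" by (intro form_left_nondegenerate[OF b]) auto
 show "d = e"
 proof (rule ahom_eqI[OF de(1,2)])
  fix x assume x: "x \<in> carrier V"
  hence "d x \<ominus>\<^bsub>V\<^esub> e x = \<zero>\<^bsub>V\<^esub>" using h[OF x] unfolding h0 by simp
  thus "d x = e x" using x de by (subst (asm) V.diff_zero_iff) (auto simp: ahom_closed)
 qed
qed

text \<open>Antisymmetric forms are alternating even in characteristic two, since \<open>x \<mapsto> b (x, x)\<close> is then an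
 invariant functional.\<close>

lemma alternating_iff:
 assumes b: "b \<in> B"
 shows "b \<in> alt_forms G p V \<longleftrightarrow> (\<forall>x\<in>carrier V. \<forall>y\<in>carrier V. (b (x, y) + b (y, x)) mod int p = 0)"
proof
 assume *: "\<forall>x\<in>carrier V. \<forall>y\<in>carrier V. (b (x, y) + b (y, x)) mod int p = 0"
 have "(\<lambda>x\<in>carrier V. b (x, x)) \<in> ahom G V (fp p)"
 proof (rule ahomI)
  fix x y assume xy: "x \<in> carrier V" "y \<in> carrier V"
  have "b (x \<oplus>\<^bsub>V\<^esub> y, x \<oplus>\<^bsub>V\<^esub> y) = (b (x, x) + b (y, y) + (b (x, y) + b (y, x))) mod int p"
   using xy by (simp add: forms_add1[OF b] forms_add2[OF b] mod_simps) (simp add: algebra_simps)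
  also have "\<dots> = (b (x, x) + b (y, y) + (b (x, y) + b (y, x)) mod int p) mod int p" by (simp only: mod_simps)
  finally show "(\<lambda>x\<in>carrier V. b (x, x)) (x \<oplus>\<^bsub>V\<^esub> y)
    = (\<lambda>x\<in>carrier V. b (x, x)) x \<oplus>\<^bsub>fp p\<^esub> (\<lambda>x\<in>carrier V. b (x, x)) y"
   using * xy by (simp add: fp_def)
 qed (use forms_range[OF b] forms_act[OF b] in \<open>auto simp: fp_def\<close>)
 hence "(\<lambda>x\<in>carrier V. b (x, x)) = (\<lambda>x\<in>carrier V. 0)"
  unfolding functionals_nontrivial_irreducible[OF irr nontriv] by simp
 hence "b (x, x) = 0" if "x \<in> carrier V" for x
  using that by (auto dest: fun_cong[where x = x])
 thus "b \<in> alt_forms G p V" using b by (simp add: alt_forms_def)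
qed (auto intro: alt_antisym[OF _ _ _ V.arep_axioms])

end

text \<open>The assumption says that the dual is isomorphic to \<open>V\<close>, in the form in which it is used: it makes the injective
map from endomorphisms to forms in \<open>forms_are_twists\<close> a bijection.\<close>

locale self_dual_irr = irr_forms +
 assumes card_B: "card B = card E"
begin

lemma forms_are_twists:
 assumes b: "b \<in> B" "b \<noteq> z" and c: "c \<in> B" obtains d where "d \<in> E" "c = twist V d b"
proof -
 have "(\<lambda>d. twist V d b) ` E = B"
 proof (rule card_subset_eq)
  show "card ((\<lambda>d. twist V d b) ` E) = card B" by (simp add: card_image[OF twist_inj[OF b]] card_B)
 qed (use twist_form b forms_finite[OF V.arep_axioms V.arep_axioms] in auto)
 thus ?thesis using c that by blast
qed

text \<open>One form has an adjoint of \<open>a\<close> because transposing, twisting by \<open>a\<close> and transposing back yields a twist of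
that form. It serves all other forms as well, since these are twists and endomorphisms commute.\<close>

lemma adjoint_exists:
 assumes a: "a \<in> E"
 obtains s where "s \<in> E" "\<And>b x y. b \<in> B \<Longrightarrow> x \<in> carrier V \<Longrightarrow> y \<in> carrier V \<Longrightarrow> b (x, a y) = b (s x, y)"
proof (cases "B \<subseteq> {z}")
 case True
 show ?thesis
 proof (rule that[OF a])
  fix b x y assume "b \<in> B" "x \<in> carrier V" "y \<in> carrier V"
  hence "b = z" using True by blast
  thus "b (x, a y) = b (a x, y)" using \<open>x \<in> carrier V\<close> \<open>y \<in> carrier V\<close> a by (simp add: ahom_closed)
 qed
next
 case False
 then obtain b0 where b0: "b0 \<in> B" "b0 \<noteq> z" by blast
 \<comment> \<open>This is the form \<open>(x, y) \<mapsto> b0 (x, a y)\<close>.\<close>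
 let ?c = "flip V (twist V a (flip V b0))"
 have "?c \<in> B" using a b0 by (intro flip_form twist_form)
 then obtain s where s: "s \<in> E" "?c = twist V s b0" by (rule forms_are_twists[OF b0])
 have s': "b0 (x, a y) = b0 (s x, y)" if "x \<in> carrier V" "y \<in> carrier V" for x y
  using fun_cong[OF s(2), of "(x, y)"] that a by (simp add: flip_def twist_def ahom_closed)
 show ?thesis
 proof (rule that[OF s(1)])
  fix b x y assume b: "b \<in> B" "x \<in> carrier V" "y \<in> carrier V"
  obtain d where d: "d \<in> E" "b = twist V d b0" using forms_are_twists[OF b0 b(1)] .
  show "b (x, a y) = b (s x, y)"
   using b s' d a s(1) ahom_commute[OF irr sm d(1) s(1)] by (simp add: twist_def ahom_closed)
 qed
qed

lemma eq_of_dvd: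
 assumes "b \<in> B" "c \<in> B" "x \<in> carrier V" "y \<in> carrier V" "int p dvd b (x, y) - c (x, y)"
 shows "b (x, y) = c (x, y)"
 using forms_range[OF assms(1,3,4)] forms_range[OF assms(2-4)] assms(5)
 by (metis mod_eq_dvd_iff mod_pos_pos_trivial)

text \<open>If some form is not balanced with respect to \<open>a\<close>, then \<open>t\<close>, the difference of \<open>a\<close> and its adjoint \<open>s\<close>, is
invertible and its own negative adjoint. Twisting by \<open>t\<close> exchanges symmetric and antisymmetric forms.\<close>

lemma adjoint_difference:
 assumes a: "a \<in> E" and ne: "b0 \<in> B" "x0 \<in> carrier V" "y0 \<in> carrier V" "b0 (a x0, y0) \<noteq> b0 (x0, a y0)"
 shows "\<exists>s\<in>E. \<exists>t\<in>E. t ` carrier V = carrier V \<and> (\<forall>b\<in>B. \<forall>x\<in>carrier V. \<forall>y\<in>carrier V.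
  b (x, a y) = b (s x, y) \<and> int p dvd b (t x, y) - (b (a x, y) - b (s x, y)) \<and> int p dvd b (x, t y) + b (t x, y))"
proof -
 obtain s where s: "s \<in> E" "\<And>b x y. b \<in> B \<Longrightarrow> x \<in> carrier V \<Longrightarrow> y \<in> carrier V \<Longrightarrow> b (x, a y) = b (s x, y)"
  using adjoint_exists[OF a] by blast
 have sa: "b (x, s y) = b (a x, y)" if "b \<in> B" "x \<in> carrier V" "y \<in> carrier V" for b x y
  using s(2)[OF flip_form[OF that(1)] that(3,2)] that a s(1) by (simp add: flip_def ahom_closed)
 define t where "t = (\<lambda>v\<in>carrier V. a v \<oplus>\<^bsub>V\<^esub> (\<lambda>v\<in>carrier V. \<ominus>\<^bsub>V\<^esub> s v) v)"
 have tE: "t \<in> E" unfolding t_def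
  by (intro ahom_sum[OF V.arep_axioms V.arep_axioms] ahom_minus[OF V.arep_axioms V.arep_axioms] a s(1))
 have t: "t x = a x \<ominus>\<^bsub>V\<^esub> s x" if "x \<in> carrier V" for x using that by (simp add: t_def a_minus_def)
 have d1: "int p dvd b (t x, y) - (b (a x, y) - b (s x, y))" if "b \<in> B" "x \<in> carrier V" "y \<in> carrier V" for b x y
  using that a s(1) by (simp add: t form_diff1 ahom_closed mod_eq_dvd_iff[symmetric])
 have d2: "int p dvd b (x, t y) + b (t x, y)" if b: "b \<in> B" "x \<in> carrier V" "y \<in> carrier V" for b x y
 proof -
  have f: "flip V b (v, w) = b (w, v)" if "v \<in> carrier V" "w \<in> carrier V" for v w using that by (simp add: flip_def)
  have "int p dvd b (x, t y) - (b (x, a y) - b (x, s y))"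
   using d1[OF flip_form[OF b(1)] b(3,2)] b a s(1) tE by (simp add: f ahom_closed)
  from dvd_add[OF this d1[OF b]] show ?thesis using s(2)[OF b] sa[OF b] by (simp add: algebra_simps)
 qed
 have "t \<noteq> (\<lambda>v\<in>carrier V. \<zero>\<^bsub>V\<^esub>)"
 proof
  assume "t = (\<lambda>v\<in>carrier V. \<zero>\<^bsub>V\<^esub>)"
  hence "a x0 = s x0" using t[OF ne(2)] ne(2) a s(1) V.diff_zero_iff[of "a x0" "s x0"] by (simp add: ahom_closed)
  thus False using ne s(2)[OF ne(1-3)] by simp
 qed
 hence tt: "t ` carrier V = carrier V" by (rule schur_surj[OF V.arep_axioms irr tE])
 show ?thesis
  by (rule bexI[OF _ s(1)], rule bexI[OF _ tE], intro conjI ballI, rule tt, rule s(2), assumption+,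
   rule d1, assumption+, rule d2, assumption+)
qed

text \<open>The alternating forms make up half of all forms, measured by dimension. Twisting by \<open>t\<close> shows that there
are as many symmetric as alternating forms. A form is then recovered from two symmetric forms: injections in
both directions between forms and pairs of symmetric forms show that the number of pairs is right. They use
that 1 and \<open>a\<close> span the field over the fixed field of the adjunction, which for \<open>p = 2\<close> replaces
the decomposition into symmetric and antisymmetric parts.\<close>

lemma card_alt_unitary:
 assumes a: "a \<in> E" and ne: "b0 \<in> B" "x0 \<in> carrier V" "y0 \<in> carrier V" "b0 (a x0, y0) \<noteq> b0 (x0, a y0)"
 shows "card (alt_forms G p V) ^ 2 = card E"
proof -
 obtain s t where st: "s \<in> E" "t \<in> E" "t ` carrier V = carrier V"
  and st': "\<forall>b\<in>B. \<forall>x\<in>carrier V. \<forall>y\<in>carrier V.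
  b (x, a y) = b (s x, y) \<and> int p dvd b (t x, y) - (b (a x, y) - b (s x, y)) \<and> int p dvd b (x, t y) + b (t x, y)"
  using adjoint_difference[OF assms] by blast
 have adj: "b (x, a y) = b (s x, y)" and d1: "int p dvd b (t x, y) - (b (a x, y) - b (s x, y))"
  and d2: "int p dvd b (x, t y) + b (t x, y)" if "b \<in> B" "x \<in> carrier V" "y \<in> carrier V" for b x y
  using st' that by blast+
 define S where "S = {b \<in> B. \<forall>x\<in>carrier V. \<forall>y\<in>carrier V. b (x, y) = b (y, x)}"
 let ?A = "alt_forms G p V"
 have finB: "finite B" by (rule forms_finite[OF V.arep_axioms V.arep_axioms])
 have A: "?A \<subseteq> B" by (auto simp: alt_forms_def)
 have S: "S \<subseteq> B" "b (x, y) = b (y, x)" if "b \<in> S" "x \<in> carrier V" "y \<in> carrier V" for b x y using that by (auto simp: S_def)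
 have SB: "S \<subseteq> B" by (auto simp: S_def)
 have fin: "finite S" "finite ?A" using finB SB A by (auto intro: finite_subset)
 have Ai: "b \<in> ?A \<longleftrightarrow> (\<forall>x\<in>carrier V. \<forall>y\<in>carrier V. int p dvd b (x, y) + b (y, x))" if "b \<in> B" for b
  unfolding alternating_iff[OF that] by (simp add: dvd_eq_mod_eq_0)
 have twt: "twist V t b \<in> B" "twist V t b (x, y) = b (t x, y)" if "b \<in> B" "x \<in> carrier V" "y \<in> carrier V" for b x y
  using that twist_form[OF st(2)] by (auto simp: twist_def)
 have cl: "t x \<in> carrier V" "a x \<in> carrier V" "s x \<in> carrier V" if "x \<in> carrier V" for x
  using that a st by (auto simp: ahom_closed)
 have onto: "b = c" if bc: "b \<in> B" "c \<in> B" and h: "\<And>x y. x \<in> carrier V \<Longrightarrow> y \<in> carrier V \<Longrightarrow> int p dvd b (t x, y) - c (t x, y)" for b c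
 proof (rule forms_eqI[OF bc])
  fix x y assume xy: "x \<in> carrier V" "y \<in> carrier V"
  then obtain x' where "x' \<in> carrier V" "x = t x'" using st(3) by blast
  thus "b (x, y) = c (x, y)" using eq_of_dvd[OF bc xy] h[of x' y] xy by simp
 qed
 have inj: "inj_on (twist V t) B"
 proof (rule inj_onI, rule onto)
  fix b c x y assume bc: "b \<in> B" "c \<in> B" "twist V t b = twist V t c" and xy: "x \<in> carrier V" "y \<in> carrier V"
  have "b (t x, y) = c (t x, y)" using fun_cong[OF bc(3), of "(x, y)"] xy by (simp add: twist_def)
  thus "int p dvd b (t x, y) - c (t x, y)" by simp
 qed
 have "card S \<le> card ?A"
 proof (rule card_inj_on_le[OF inj_on_subset[OF inj SB] _ fin(2)], rule image_subsetI)
  fix b assume b: "b \<in> S"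
  hence bB: "b \<in> B" using SB by blast
  show "twist V t b \<in> ?A" unfolding Ai[OF twist_form[OF st(2) bB]]
  proof (intro ballI)
   fix x y assume xy: "x \<in> carrier V" "y \<in> carrier V"
   show "int p dvd twist V t b (x, y) + twist V t b (y, x)"
    using d2[OF bB xy] S(2)[OF b xy(1) cl(1)[OF xy(2)]] xy by (simp add: twist_def add.commute)
  qed
 qed
 moreover have "card ?A \<le> card S"
 proof (rule card_inj_on_le[OF inj_on_subset[OF inj A] _ fin(1)], rule image_subsetI)
  fix b assume b: "b \<in> ?A"
  hence bB: "b \<in> B" using A by blast
  have "twist V t b (x, y) = twist V t b (y, x)" if xy: "x \<in> carrier V" "y \<in> carrier V" for x y
  proof -
   have "int p dvd b (x, t y) + b (t y, x)" using b xy cl unfolding Ai[OF bB] by blast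
   from dvd_diff[OF d2[OF bB xy] this] have "int p dvd b (t x, y) - b (t y, x)" by (simp add: algebra_simps)
   hence "int p dvd twist V t b (x, y) - flip V (twist V t b) (x, y)" using xy by (simp add: twist_def flip_def)
   hence "twist V t b (x, y) = flip V (twist V t b) (x, y)"
    using xy st(2) bB by (intro eq_of_dvd twist_form flip_form)
   thus ?thesis using xy by (simp add: flip_def)
  qed
  thus "twist V t b \<in> S" unfolding S_def using twist_form[OF st(2) bB] by blast
 qed
 moreover have "card (S \<times> S) \<le> card B"
 proof (rule card_inj_on_le[OF _ _ finB])
  show "(\<lambda>(b, c). addf V p b (twist V a c)) ` (S \<times> S) \<subseteq> B"
   using SB by (auto intro!: addf_form twist_form a)
  show "inj_on (\<lambda>(b, c). addf V p b (twist V a c)) (S \<times> S)"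
  proof (rule inj_onI, clarify)
   fix b c b' c' assume S4: "b \<in> S" "c \<in> S" "b' \<in> S" "c' \<in> S"
    and eq: "addf V p b (twist V a c) = addf V p b' (twist V a c')"
   have B4: "b \<in> B" "c \<in> B" "b' \<in> B" "c' \<in> B" using S4 SB by auto
   have e: "int p dvd (b (x, y) + c (a x, y)) - (b' (x, y) + c' (a x, y))" if "x \<in> carrier V" "y \<in> carrier V" for x y
    using fun_cong[OF eq, of "(x, y)"] that by (simp add: addf_def twist_def mod_eq_dvd_iff)
   have "c = c'"
   proof (rule onto[OF B4(2,4)])
    fix x y assume xy: "x \<in> carrier V" "y \<in> carrier V"
    have 1: "c (a y, x) = c (s x, y)" "c' (a y, x) = c' (s x, y)"
     using adj[OF B4(2) xy] adj[OF B4(4) xy] S(2)[OF S4(2) xy(1) cl(2)[OF xy(2)]] S(2)[OF S4(4) xy(1) cl(2)[OF xy(2)]] by simp_all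
    have 2: "b (y, x) = b (x, y)" "b' (y, x) = b' (x, y)" using S(2) S4 xy by blast+
    have "int p dvd (c (a x, y) - c (s x, y)) - (c' (a x, y) - c' (s x, y))"
     using dvd_diff[OF e[OF xy] e[OF xy(2,1)]] unfolding 1 2 by (simp add: algebra_simps)
    from dvd_diff[OF dvd_add[OF d1[OF B4(2) xy] this] d1[OF B4(4) xy]]
    show "int p dvd c (t x, y) - c' (t x, y)" by (simp add: algebra_simps)
   qed
   moreover have "b = b'"
    by (rule forms_eqI[OF B4(1,3)], rule eq_of_dvd[OF B4(1,3)]) (use e \<open>c = c'\<close> in auto)
   ultimately show "b = b' \<and> c = c'" by simp
  qed
 qed
 moreover have "card B \<le> card (S \<times> S)"
 proof (rule card_inj_on_le)
  \<comment> \<open>Symmetrization loses the antisymmetric part, which symmetrizing the twist by \<open>a\<close> recovers.\<close>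
  let ?sy = "\<lambda>b. addf V p b (flip V b)"
  have sy: "?sy b \<in> S" if "b \<in> B" for b
   using addf_form[OF that flip_form[OF that]] by (auto simp: S_def addf_def flip_def add.commute)
  thus "(\<lambda>b. (?sy b, ?sy (twist V a b))) ` B \<subseteq> S \<times> S" using twist_form[OF a] by blast
  show "finite (S \<times> S)" using fin by simp
  show "inj_on (\<lambda>b. (?sy b, ?sy (twist V a b))) B"
  proof (rule inj_onI, rule onto)
   fix b c x y assume bc: "b \<in> B" "c \<in> B" and eq: "(?sy b, ?sy (twist V a b)) = (?sy c, ?sy (twist V a c))"
    and xy: "x \<in> carrier V" "y \<in> carrier V"
   have e1: "int p dvd (b (v, w) + b (w, v)) - (c (v, w) + c (w, v))" if "v \<in> carrier V" "w \<in> carrier V" for v w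
   proof -
    have "?sy b (v, w) = ?sy c (v, w)" using eq by simp
    thus ?thesis using that by (simp add: addf_def flip_def mod_eq_dvd_iff)
   qed
   have e2: "int p dvd (b (a x, y) + b (a y, x)) - (c (a x, y) + c (a y, x))"
   proof -
    have "?sy (twist V a b) (x, y) = ?sy (twist V a c) (x, y)" using eq by simp
    thus ?thesis using xy by (simp add: addf_def flip_def twist_def mod_eq_dvd_iff)
   qed
   have "int p dvd (b (a x, y) - b (s x, y)) - (c (a x, y) - c (s x, y))"
    using dvd_diff[OF e2 e1[OF xy(1) cl(2)[OF xy(2)]]] unfolding adj[OF bc(1) xy] adj[OF bc(2) xy]
    by (simp add: algebra_simps)
   from dvd_diff[OF dvd_add[OF d1[OF bc(1) xy] this] d1[OF bc(2) xy]]
   show "int p dvd b (t x, y) - c (t x, y)" by (simp add: algebra_simps)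
  qed auto
 qed
 ultimately show ?thesis using card_B by (simp add: card_cartesian_product power2_eq_square)
qed

text \<open>If a nonzero balanced form exists, all forms are balanced, being twists of it. A nonzero alternating
one among them makes all forms alternating, and this is the case \<open>\<epsilon> = - 1\<close>. Without nonzero
balanced forms \<open>card_alt_unitary\<close> applies.\<close>

theorem card_alternating_sign:
 assumes fin: "finite (carrier G)" and cop: "\<not> p dvd card (carrier G)"
 shows "real (card (alt_forms G p V)) = real (card E) powr ((1 - real_of_int (rep_sign G (Fp p) V)) / 2)"
proof -
 let ?k = "End_rep G (Fp p) V" and ?W = "rep_over_End V"
 interpret T: tens G p ?k ?W by (rule tens_End[OF irr sm])
 note C = End_rep_carrier[OF V.arep_axioms sm]
 have fW: "forms G p ?W ?W = B" by (simp add: forms_def)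
 have bal: "T.bal = {b \<in> B. \<forall>a\<in>E. \<forall>x\<in>carrier V. \<forall>y\<in>carrier V. b (a x, y) = b (x, a y)}"
  unfolding T.bal_def fW C by simp
 have ext: "T.ext_bal = {b \<in> T.bal. \<forall>a\<in>E. \<forall>x\<in>carrier V. b (a x, x) = 0}"
  unfolding T.ext_bal_def C by simp
 have sign: "rep_sign G (Fp p) V = (if card T.ext_bal \<noteq> 1 then - 1 else if card T.bal \<noteq> 1 then 1 else 0)"
  unfolding rep_sign_def Let_def invariants_nontrivial[OF T.arep_T] invariants_nontrivial[OF T.arep_E]
   T.card_invariants_T[OF fin cop] T.card_invariants_E[OF fin cop] by simp
 have zB: "z \<in> B" by (rule zero_form[OF V.arep_axioms V.arep_axioms])
 have "z \<in> T.bal" unfolding bal using zB by (auto simp: ahom_closed)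
 hence zz: "z \<in> T.bal" "z \<in> T.ext_bal" unfolding ext by (auto simp: ahom_closed)
 have one: "card M \<noteq> 1 \<longleftrightarrow> (\<exists>b\<in>M. b \<noteq> z)" if "z \<in> M" for M
  using that by (auto simp: card_1_singleton_iff)
 have id: "(\<lambda>x\<in>carrier V. x) \<in> E" by (rule ahom_id[OF V.arep_axioms])
 have zA: "z \<in> alt_forms G p V" using zB by (simp add: alt_forms_def)
 have ne0: "\<zero>\<^bsub>?k\<^esub> \<noteq> \<one>\<^bsub>?k\<^esub>" using finite_division_ring.nontrivial[OF End_division_ring[OF irr sm]] by simp
 have q0: "card E > 0" using id ahom_finite[OF V.arep_axioms V.arep_axioms] by (auto simp: card_gt_0_iff)
 show ?thesis
 proof (cases "\<exists>b\<in>T.bal. b \<noteq> z")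
  case True
  then obtain b0 where b0: "b0 \<in> B" "b0 \<noteq> z"
   and bb: "\<And>a x y. a \<in> E \<Longrightarrow> x \<in> carrier V \<Longrightarrow> y \<in> carrier V \<Longrightarrow> b0 (a x, y) = b0 (x, a y)"
   unfolding bal by blast
  have allbal: "b \<in> T.bal" if bB: "b \<in> B" for b
  proof -
   obtain d where d: "d \<in> E" "b = twist V d b0" using forms_are_twists[OF b0 bB] .
   have "b (a x, y) = b (x, a y)" if "a \<in> E" "x \<in> carrier V" "y \<in> carrier V" for a x y
    using that d bb[of a "d x" y] ahom_commute[OF irr sm d(1) that(1,2)] by (simp add: twist_def ahom_closed)
   thus ?thesis using bB unfolding bal by blast
  qed
  show ?thesis
  proof (cases "\<exists>b\<in>alt_forms G p V. b \<noteq> z")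
   case True
   then obtain b where b: "b \<in> B" "b \<noteq> z" "b \<in> alt_forms G p V" using alt_forms_forms by blast
   have tw: "twist V d b \<in> alt_forms G p V" if d: "d \<in> E" for d
   proof -
    have "(b (d x, y) + b (d y, x)) mod int p = 0" if xy: "x \<in> carrier V" "y \<in> carrier V" for x y
    proof -
     have "b (d y, x) = b (y, d x)" using allbal[OF b(1)] d xy unfolding bal by blast
     thus ?thesis using b(3) xy d unfolding alternating_iff[OF b(1)] by (simp add: ahom_closed)
    qed
    thus ?thesis unfolding alternating_iff[OF twist_form[OF d b(1)]] by (simp add: twist_def)
   qed
   have "alt_forms G p V = B"
   proof (intro equalityI subsetI)
    fix c assume "c \<in> B"
    then obtain d where "d \<in> E" "c = twist V d b" by (rule forms_are_twists[OF b(1,2)])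
    thus "c \<in> alt_forms G p V" using tw by simp
   qed (rule alt_forms_forms)
   moreover have "b (d x, x) = 0" if "d \<in> E" "x \<in> carrier V" for d x
    using tw[OF that(1)] that(2) by (simp add: alt_forms_def twist_def)
   hence "b \<in> T.ext_bal" unfolding ext using allbal[OF b(1)] by blast
   hence "card T.ext_bal \<noteq> 1" using one[OF zz(2)] b(2) by blast
   ultimately show ?thesis unfolding sign using q0 card_B by simp
  next
   case False
   hence "alt_forms G p V = {z}" using zA by blast
   moreover have "T.ext_bal \<subseteq> alt_forms G p V"
   proof
    fix b assume b: "b \<in> T.ext_bal"
    have "b (x, x) = 0" if "x \<in> carrier V" for x
    proof -
     have "b ((\<lambda>x\<in>carrier V. x) x, x) = 0" using b id that unfolding ext by blast
     thus ?thesis using that by simp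
    qed
    thus "b \<in> alt_forms G p V" using b by (simp add: alt_forms_def ext bal)
   qed
   ultimately have "card T.ext_bal = 1" using one[OF zz(2)] by blast
   moreover have "card T.bal \<noteq> 1" using one[OF zz(1)] True by blast
   ultimately show ?thesis unfolding sign using q0 \<open>alt_forms G p V = {z}\<close> by simp
  qed
 next
  case False
  hence "card T.bal = 1" "card T.ext_bal = 1" using one[OF zz(1)] one[OF zz(2)] by (auto simp: ext)
  hence s0: "rep_sign G (Fp p) V = 0" unfolding sign by simp
  have "\<not> B \<subseteq> {z}"
  proof
   assume "B \<subseteq> {z}"
   hence "B = {z}" using zB by blast
   hence "card E = 1" using card_B by simp
   then obtain e where "E = {e}" by (rule card_1_singletonE)
   hence "(\<lambda>v\<in>carrier V. \<zero>\<^bsub>V\<^esub>) = (\<lambda>x\<in>carrier V. x)" using id zero_endo by simp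
   thus False using ne0 by simp
  qed
  then obtain b where "b \<in> B" "b \<notin> T.bal" using False by blast
  then obtain a x y where "a \<in> E" "b \<in> B" "x \<in> carrier V" "y \<in> carrier V" "b (a x, y) \<noteq> b (x, a y)"
   unfolding bal by blast
  hence "card (alt_forms G p V) ^ 2 = card E" by (rule card_alt_unitary)
  hence "real (card E) = real (card (alt_forms G p V)) ^ 2" by (metis of_nat_power)
  thus ?thesis unfolding s0 by (simp add: powr_half_sqrt)
 qed
qed

end

section \<open>Finiteness\<close>

lemma field_Fp: "Factorial_Ring.prime p \<Longrightarrow> field (Fp p)"
 by (rule residues_prime.is_field) (simp add: residues_prime_def)

lemma finite_span_Fp:
 assumes "Module.module (Fp p) M" "finite S" "S \<subseteq> carrier M"
 shows "finite (module.span (Fp p) M S)"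
proof -
 interpret module "Fp p" M by fact
 have "span S \<subseteq> (\<lambda>a. lincomb a S) ` (S \<rightarrow>\<^sub>E carrier (Fp p))"
 proof
  fix x assume "x \<in> span S"
  then obtain a where a: "a \<in> S \<rightarrow> carrier (Fp p)" "x = lincomb a S"
   unfolding finite_span[OF assms(2,3)] by blast
  have "lincomb (restrict a S) S = lincomb a S"
   unfolding lincomb_def using a assms(3) by (intro finsum_cong') (auto intro!: smult_closed)
  thus "x \<in> (\<lambda>a. lincomb a S) ` (S \<rightarrow>\<^sub>E carrier (Fp p))"
   using a by (intro image_eqI[of _ _ "restrict a S"]) auto
 qed
 moreover have "finite (S \<rightarrow>\<^sub>E carrier (Fp p))" using assms(2) by (intro finite_PiE) auto
 ultimately show ?thesis by (meson finite_imageI finite_subset)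
qed

lemma fin_dim_iff_finite:
 assumes "representation G (Fp p) V" "Factorial_Ring.prime p"
 shows "vectorspace.fin_dim (Fp p) V \<longleftrightarrow> finite (carrier V)"
proof -
 have m: "Module.module (Fp p) V" using assms by (simp add: representation_def)
 interpret vectorspace "Fp p" V by (rule vectorspace.intro[OF m field_Fp[OF assms(2)]])
 have "gen_set (carrier V)"
  using in_own_span[of "carrier V"] span_is_subset2[of "carrier V"] by auto
 thus ?thesis unfolding fin_dim_def using finite_span_Fp[OF m] by (metis order_refl)
qed

text \<open>The span of an orbit is a finite nonzero subrepresentation.\<close>

lemma irreducible_finite:
 assumes irr: "irreducible_rep G (Fp p) V" and fin: "finite (carrier G)" and p: "Factorial_Ring.prime p"
 shows "finite (carrier V)"
proof -
 have rep: "representation G (Fp p) V" using irr by (simp add: irreducible_rep_def)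
 have m: "Module.module (Fp p) V" using rep by (simp add: representation_def)
 interpret module "Fp p" V by (rule m)
 interpret GA: group_action G "carrier V" "act V" using rep by (simp add: representation_def)
 interpret G: group G by (rule group_hom.axioms(1)[OF GA.group_hom])
 have mh: "act V g \<in> module_hom (Fp p) V V" if "g \<in> carrier G" for g using rep that by (simp add: representation_def)
 obtain v where v: "v \<in> carrier V" "v \<noteq> \<zero>\<^bsub>V\<^esub>" using irr M.zero_closed unfolding irreducible_rep_def by blast
 define S where "S = (\<lambda>g. act V g v) ` carrier G"
 have S: "finite S" "S \<subseteq> carrier V" unfolding S_def using fin v(1) GA.element_image by auto
 note sub = span_is_submodule[OF S(2)]
 have sm: "Module.submodule (span S) (Fp p) V"
 proof (rule submoduleI)
  show "\<ominus>\<^bsub>V\<^esub> a \<in> span S" if "a \<in> span S" for a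
  proof -
   have "a \<in> carrier V" using that span_is_subset2[OF S(2)] by blast
   hence "\<ominus>\<^bsub>V\<^esub> a = (\<ominus>\<^bsub>Fp p\<^esub> \<one>\<^bsub>Fp p\<^esub>) \<odot>\<^bsub>V\<^esub> a" by (simp only: smult_l_minus R.one_closed smult_one)
   thus ?thesis using LinearCombinations.submodule.smult_closed[OF sub _ that] R.a_inv_closed[OF R.one_closed] by simp
  qed
 qed (use span_is_subset2[OF S(2)] LinearCombinations.submodule.zero_closed[OF sub]
   LinearCombinations.submodule.m_closed[OF sub] LinearCombinations.submodule.smult_closed[OF sub] in auto)
 have "act V g ` span S \<subseteq> span S" if g: "g \<in> carrier G" for g
 proof -
  let ?N = "{x \<in> carrier V. act V g x \<in> span S}"
  have "S \<subseteq> ?N"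
  proof
   fix x assume "x \<in> S"
   then obtain h where h: "h \<in> carrier G" "x = act V h v" by (auto simp: S_def)
   hence "act V g x = act V (g \<otimes>\<^bsub>G\<^esub> h) v" using GA.composition_rule[OF v(1) g h(1)] by simp
   hence "act V g x \<in> S" using g h by (auto simp: S_def)
   thus "x \<in> ?N" using in_own_span[OF S(2)] S(2) \<open>x \<in> S\<close> by blast
  qed
  moreover have "LinearCombinations.submodule (Fp p) ?N V"
  proof (unfold_locales, goal_cases)
   case 3
   have "act V g \<zero>\<^bsub>V\<^esub> = act V g (\<zero>\<^bsub>Fp p\<^esub> \<odot>\<^bsub>V\<^esub> \<zero>\<^bsub>V\<^esub>)" by (simp only: smult_l_null M.zero_closed)
   also have "\<dots> = \<zero>\<^bsub>Fp p\<^esub> \<odot>\<^bsub>V\<^esub> act V g \<zero>\<^bsub>V\<^esub>"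
    using mh[OF g] R.zero_closed M.zero_closed unfolding module_hom_def by blast
   also have "\<dots> = \<zero>\<^bsub>V\<^esub>" using mh[OF g] by (intro smult_l_null) (auto simp: module_hom_def)
   finally show ?case using LinearCombinations.submodule.zero_closed[OF sub] by simp
  qed (use mh[OF g] LinearCombinations.submodule.m_closed[OF sub] LinearCombinations.submodule.smult_closed[OF sub]
    in \<open>auto simp: module_hom_def\<close>)
  ultimately show ?thesis using span_is_subset[of S ?N] by blast
 qed
 hence "span S = {\<zero>\<^bsub>V\<^esub>} \<or> span S = carrier V" using irr sm unfolding irreducible_rep_def by blast
 moreover have "v \<in> span S"
 proof -
  have "act V \<one>\<^bsub>G\<^esub> v = v" using fun_cong[OF GA.id_eq_one, of v] v(1) by simp
  thus ?thesis using in_own_span[OF S(2)] by (force simp: S_def)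
 qed
 ultimately have "carrier V = span S" using v by auto
 thus ?thesis using finite_span_Fp[OF m S] by simp
qed

section \<open>Classification\<close>

lemma biprod_swap:
 assumes "biprod_rep G p U A B i1 i2 p1 p2" shows "biprod_rep G p U B A i2 i1 p2 p1"
proof -
 interpret biprod_rep G p U A B i1 i2 p1 p2 by fact
 have "i2 (p2 u) \<oplus>\<^bsub>U\<^esub> i1 (p1 u) = u" if "u \<in> carrier U" for u
  using i1p1_i2p2[OF that] ahom_closed[OF i1 ahom_closed[OF p1 that]] ahom_closed[OF i2 ahom_closed[OF p2 that]]
  by (simp add: U.V.a_comm)
 thus ?thesis
  by (intro biprod_rep.intro biprod_rep_axioms.intro U.arep_axioms A.arep_axioms B.arep_axioms)
   (simp add: biprod_def i1 i2 p1 p2)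
qed

text \<open>Irreducible representations are indexed by natural numbers, whose order singles out a first element in
each pair of dual representations.\<close>

locale irreducibles =
 fixes G :: "('g, 'm) monoid_scheme" and p :: nat and I :: "nat set" and V :: "nat \<Rightarrow> (int, nat, 'g) rep"
 assumes finite_I: "finite I" and group_G: "group G" and finite_G: "finite (carrier G)"
  and prime_p: "Factorial_Ring.prime p" and coprime_G: "\<not> p dvd card (carrier G)"
  and irred: "\<And>i. i \<in> I \<Longrightarrow> irreducible_rep G (Fp p) (V i)"
  and nontriv: "\<And>i. i \<in> I \<Longrightarrow> \<not> trivial_action G (V i)"
  and non_iso: "\<And>i j. i \<in> I \<Longrightarrow> j \<in> I \<Longrightarrow> i \<noteq> j \<Longrightarrow> \<not> rep_iso G (Fp p) (V i) (V j)"
  and complete: "\<And>W :: (int, nat, 'g) rep. irreducible_rep G (Fp p) W \<Longrightarrow> \<not> trivial_action G W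
    \<Longrightarrow> \<exists>i\<in>I. rep_iso G (Fp p) W (V i)"
begin

definition q where "q i = card (ahom G (V i) (V i))"
definition W where "W f = rep_prod {(i, k). i \<in> I \<and> k < f i} (\<lambda>(i, k :: nat). V i)"

lemma irr: "i \<in> I \<Longrightarrow> airr G p (V i)" and sm: "i \<in> I \<Longrightarrow> smult_ok p (V i)" and rep: "i \<in> I \<Longrightarrow> arep G p (V i)"
proof -
 assume i: "i \<in> I"
 have f: "finite (carrier (V i))" by (rule irreducible_finite[OF irred[OF i] finite_G prime_p])
 show "airr G p (V i)" by (rule irreducible_rep_airr[OF irred[OF i] f prime_p])
 thus "arep G p (V i)" by (simp add: airr_def)
 show "smult_ok p (V i)"
  by (rule representation_arep(2)[where G = G, OF _ f prime_p]) (use irred[OF i] in \<open>simp add: irreducible_rep_def\<close>)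
qed

lemma hom_irr: "i \<in> I \<Longrightarrow> j \<in> I \<Longrightarrow> card (ahom G (V i) (V j)) = (if i = j then q i else 1)"
 using card_hom_noniso[OF irr irr, of i j] non_iso[of i j] rep_iso_eq_aiso[OF rep rep sm sm, of i j]
 by (auto simp: q_def)

lemma irr_forms: "i \<in> I \<Longrightarrow> irr_forms G p (V i)"
 by (simp add: irr_forms_def irr sm nontriv)

lemma q_gt_1: assumes i: "i \<in> I" shows "q i > 1"
proof -
 let ?z = "\<lambda>v\<in>carrier (V i). \<zero>\<^bsub>V i\<^esub>" and ?o = "\<lambda>v\<in>carrier (V i). v"
 interpret arep G p "V i" by (rule rep[OF i])
 have "?z \<in> ahom G (V i) (V i)" "?o \<in> ahom G (V i) (V i)"
  using ahom_zero_map[OF rep rep] ahom_id[OF rep] i by auto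
 moreover have "?z \<noteq> ?o"
 proof -
  obtain v where "v \<in> carrier (V i)" "v \<noteq> \<zero>\<^bsub>V i\<^esub>" using irr[OF i] V.zero_closed unfolding airr_def by blast
  thus ?thesis by (auto dest: fun_cong[of _ _ v])
 qed
 ultimately have "card {?z, ?o} \<le> q i" unfolding q_def
  by (intro card_mono ahom_finite[OF rep rep, OF i i]) auto
 thus ?thesis using \<open>?z \<noteq> ?o\<close> by simp
qed

lemma finite_index: "finite {(i, k). i \<in> I \<and> k < (f :: nat \<Rightarrow> nat) i}"
proof -
 have "{(i, k). i \<in> I \<and> k < f i} = Sigma I (\<lambda>i. {..<f i})" by auto
 thus ?thesis by (simp add: finite_I)
qed

lemma W_cong: "(\<And>i. i \<in> I \<Longrightarrow> e i = f i) \<Longrightarrow> W e = W f"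
 unfolding W_def by (rule arg_cong2[of _ _ _ _ rep_prod]) auto

lemma W_rep: "arep G p (W f)" unfolding W_def
 by (rule arep_prod[OF finite_index _ group_G prime_p]) (auto intro: rep)

lemma W_sm: "smult_ok p (W f)" unfolding W_def by (rule smult_ok_prod) (auto intro: sm)

lemma W_zero: assumes "\<And>i. i \<in> I \<Longrightarrow> f i = 0" shows "carrier (W f) = {\<zero>\<^bsub>W f\<^esub>}"
proof -
 have e: "{(i, k). i \<in> I \<and> k < f i} = {}" using assms by auto
 show ?thesis unfolding W_def e by (simp add: restrict_def)
qed

lemma W_Suc:
 assumes i: "i \<in> I"
 obtains i1 i2 p1 p2 where "biprod_rep G p (W (f(i := Suc (f i)))) (W f) (V i) i1 i2 p1 p2"
proof -
 have J: "{(j, k). j \<in> I \<and> k < (f(i := Suc (f i))) j} = insert (i, f i) {(j, k). j \<in> I \<and> k < f j}"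
  using i by (auto simp: less_Suc_eq split: if_splits)
 have r: "arep G p (case x of (i, k) \<Rightarrow> V i)" if "x \<in> insert (i, f i) {(j, k). j \<in> I \<and> k < f j}" for x
  using that i rep by auto
 obtain i1 i2 p1 p2 where "biprod_rep G p (W (f(i := Suc (f i)))) (W f) (case (i, f i) of (i, k) \<Rightarrow> V i) i1 i2 p1 p2"
  unfolding W_def J by (rule rep_prod_biprod[OF finite_index _ r group_G prime_p]) auto
 thus ?thesis using that by simp
qed

text \<open>Adding one irreducible factor at a time, which by \<open>W_Suc\<close> is a biproduct.\<close>

lemma W_induct [case_names zero Suc]:
 assumes "\<And>f. (\<And>i. i \<in> I \<Longrightarrow> f i = 0) \<Longrightarrow> P f" "\<And>f i. i \<in> I \<Longrightarrow> P f \<Longrightarrow> P (f(i := Suc (f i)))"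
 shows "P f"
proof (induction "\<Sum>i\<in>I. f i" arbitrary: f)
 case 0
 thus ?case using finite_I by (intro assms(1)) auto
next
 case (Suc n)
 then obtain i where i: "i \<in> I" "f i \<noteq> 0" by (metis sum.neutral nat.distinct(1))
 let ?g = "f(i := f i - 1)"
 have "(\<Sum>j\<in>I. f j) = f i + (\<Sum>j\<in>I - {i}. f j)" "(\<Sum>j\<in>I. ?g j) = (f i - 1) + (\<Sum>j\<in>I - {i}. f j)"
  using i by (simp_all add: sum.remove finite_I)
 hence "n = (\<Sum>j\<in>I. ?g j)" using Suc.hyps(2) i(2) by linarith
 moreover have "?g(i := Suc (?g i)) = f" using i(2) by auto
 ultimately show ?case using assms(2)[OF i(1) Suc.hyps(1)] by metis
qed

lemma prod_Suc:
 assumes "i \<in> I" "h (Suc (f i)) i = h (f i) i * m"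
 shows "(\<Prod>j\<in>I. h ((f(i := Suc (f i))) j) j) = (\<Prod>j\<in>I. h (f j) j) * (m :: 'z :: comm_semiring_1)"
proof -
 have "(\<Prod>j\<in>I. h ((f(i := Suc (f i))) j) j) = (h (f i) i * m) * (\<Prod>j\<in>I - {i}. h (f j) j)"
  using assms finite_I by (subst prod.remove[of _ i]) (auto intro!: prod.cong)
 also have "\<dots> = (\<Prod>j\<in>I. h (f j) j) * m" using assms(1) finite_I by (subst (2) prod.remove[of _ i]) (auto simp: mult_ac)
 finally show ?thesis .
qed

lemma card_W: "card (carrier (W f)) = (\<Prod>i\<in>I. card (carrier (V i)) ^ f i)"
proof (induction f rule: W_induct)
 case (zero f) thus ?case using W_zero[of f] by simp
next
 case (Suc f i)
 obtain i1 i2 p1 p2 where "biprod_rep G p (W (f(i := Suc (f i)))) (W f) (V i) i1 i2 p1 p2" using W_Suc[OF Suc(1)] .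
 then interpret biprod_rep G p "W (f(i := Suc (f i)))" "W f" "V i" i1 i2 p1 p2 .
 show ?case unfolding card_biprod Suc.IH by (rule prod_Suc[symmetric, OF Suc(1)]) simp
qed

lemma card_hom_W_from:
 assumes Z: "arep G p Z"
 shows "card (ahom G (W f) Z) = (\<Prod>i\<in>I. card (ahom G (V i) Z) ^ f i)"
proof (induction f rule: W_induct)
 case (zero f) thus ?case using card_hom_from_zero[OF W_rep Z W_zero, of f] by simp
next
 case (Suc f i)
 obtain i1 i2 p1 p2 where "biprod_rep G p (W (f(i := Suc (f i)))) (W f) (V i) i1 i2 p1 p2" using W_Suc[OF Suc(1)] .
 then interpret biprod_rep G p "W (f(i := Suc (f i)))" "W f" "V i" i1 i2 p1 p2 .
 show ?case unfolding card_hom_from[OF Z] Suc.IH by (rule prod_Suc[symmetric, OF Suc(1)]) simp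
qed

lemma card_hom_W: "j \<in> I \<Longrightarrow> card (ahom G (W f) (V j)) = q j ^ f j"
proof -
 assume j: "j \<in> I"
 have "card (ahom G (W f) (V j)) = (\<Prod>i\<in>I. if i = j then q j ^ f j else 1)"
  unfolding card_hom_W_from[OF rep[OF j]] by (intro prod.cong) (auto simp: hom_irr j)
 thus ?thesis using j finite_I by simp
qed

lemma q_real: "i \<in> I \<Longrightarrow> real (q i) > 1" using q_gt_1 by force

lemma qs: "i \<in> I \<Longrightarrow> qseries (real (q i)) (1 / real (q i))"
 using q_real by unfold_locales auto

abbreviation "ic i \<equiv> qseries.inj_count (real (q i))"

lemma card_sur_W: "real (card (asur G (W e) (W f))) = (\<Prod>i\<in>I. ic i (e i) (f i))"
proof (induction f rule: W_induct)
 case (zero f)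
 have "asur G (W e) (W f) = ahom G (W e) (W f)"
 proof -
  interpret arep G p "W e" by (rule W_rep)
  have "h ` carrier (W e) = carrier (W f)" if h: "h \<in> ahom G (W e) (W f)" for h
  proof -
   have "h x = \<zero>\<^bsub>W f\<^esub>" if "x \<in> carrier (W e)" for x
    using ahom_closed[OF h that] W_zero[of f, OF zero] by simp
   thus ?thesis using V.zero_closed W_zero[of f, OF zero] by (auto simp: image_iff)
  qed
  thus ?thesis by (auto simp: asur_def)
 qed
 thus ?case using card_hom_to_zero[OF W_rep W_rep W_zero[OF zero]] zero
  by (simp add: qseries.inj_count_def[OF qs])
next
 case (Suc f i)
 note i = Suc(1)
 obtain i1 i2 p1 p2 where "biprod_rep G p (W (f(i := Suc (f i)))) (W f) (V i) i1 i2 p1 p2" using W_Suc[OF i] .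
 then interpret biprod_rep G p "W (f(i := Suc (f i)))" "W f" "V i" i1 i2 p1 p2 .
 have "real (card (asur G (W e) (W (f(i := Suc (f i)))))) = (\<Prod>i\<in>I. ic i (e i) (f i)) * real (q i ^ e i - q i ^ f i)"
  unfolding card_sur_to[OF W_rep irr[OF i]] card_hom_W[OF i] by (simp add: Suc.IH)
 also have "\<dots> = (\<Prod>i\<in>I. ic i (e i) (f i)) * (real (q i) ^ e i - real (q i) ^ f i)"
 proof (cases "f i \<le> e i")
  case True
  hence "q i ^ f i \<le> q i ^ e i" using q_gt_1[OF i] by (intro power_increasing) auto
  thus ?thesis by (simp add: of_nat_diff)
 next
  case False
  hence "ic i (e i) (f i) = 0" by (simp add: qseries.inj_count_less[OF qs[OF i]])
  hence "(\<Prod>i\<in>I. ic i (e i) (f i)) = 0" using i finite_I by (intro prod_zero) auto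
  thus ?thesis by simp
 qed
 also have "\<dots> = (\<Prod>j\<in>I. ic j (e j) ((f(i := Suc (f i))) j))"
  by (rule prod_Suc[symmetric, OF i]) (simp add: qseries.inj_count_def[OF qs[OF i]])
 finally show ?case .
qed

lemma rep_Aut_W: "rep_Aut G (Fp p) (W f) = asur G (W f) (W f)"
proof -
 interpret arep G p "W f" by (rule W_rep)
 show ?thesis unfolding rep_Aut_def asur_def rep_hom_eq_ahom[OF W_rep W_rep W_sm W_sm] bij_betw_def
  using finite_carrier by (auto intro: eq_card_imp_inj_on)
qed

lemma invariants_V: assumes i: "i \<in> I" shows "card (rep_invariants G (V i)) = 1"
proof -
 interpret arep G p "V i" by (rule rep[OF i])
 have "asub G (V i) (rep_invariants G (V i))"
  by (auto simp: asub_def rep_invariants_def)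
 moreover have "rep_invariants G (V i) \<noteq> carrier (V i)"
  using nontriv[OF i] by (auto simp: rep_invariants_def trivial_action_def)
 ultimately have "rep_invariants G (V i) = {\<zero>\<^bsub>V i\<^esub>}" using irr[OF i] by (auto simp: airr_def)
 thus ?thesis by simp
qed

lemma invariants_W: "rep_invariants G (W f) = {\<zero>\<^bsub>W f\<^esub>}"
proof -
 have "card (rep_invariants G (W f)) = 1"
 proof (induction f rule: W_induct)
  case (zero f)
  interpret arep G p "W f" by (rule W_rep)
  have "rep_invariants G (W f) = {\<zero>\<^bsub>W f\<^esub>}" using W_zero[OF zero] by (auto simp: rep_invariants_def)
  thus ?case by simp
 next
  case (Suc f i)
  obtain i1 i2 p1 p2 where "biprod_rep G p (W (f(i := Suc (f i)))) (W f) (V i) i1 i2 p1 p2" using W_Suc[OF Suc(1)] .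
  then interpret biprod_rep G p "W (f(i := Suc (f i)))" "W f" "V i" i1 i2 p1 p2 .
  have F: "arep G p (fp p :: (int, int, 'g) rep)" by (rule arep_fp[OF group_G prime_p])
  show ?case using card_hom_to[OF F] invariants_V[OF Suc(1)] Suc.IH
   unfolding card_hom_fp[OF W_rep] card_hom_fp[OF rep[OF Suc(1)]] by (simp only: mult_1)
 qed
 thus ?thesis using invariants_nontrivial[OF W_rep] by blast
qed

lemma irr_iso_V:
 assumes N: "airr G p N" "\<not> trivial_action G N"
 shows "\<exists>i\<in>I. aiso G N (V i)"
proof -
 have aN: "arep G p N" using N by (simp add: airr_def)
 obtain U :: "(int, nat, 'g) rep" where U: "arep G p U" "smult_ok p U" "representation G (Fp p) U" "aiso G U N"
  using nat_copy_exists[OF aN] .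
 have "irreducible_rep G (Fp p) U" by (rule airr_irreducible_rep[OF airr_aiso[OF N(1) U(1,4)] U(3)])
 moreover have NU: "aiso G N U" by (rule aiso_sym[OF U(1) aN U(4)])
 hence "\<not> trivial_action G U" using aiso_trivial_action[OF aN U(1) NU] N(2) by blast
 ultimately obtain i where i: "i \<in> I" "rep_iso G (Fp p) U (V i)" using complete by blast
 hence "aiso G U (V i)" by (simp add: rep_iso_eq_aiso[OF U(1) rep U(2) sm])
 thus ?thesis using aiso_trans[OF aN NU] i(1) by blast
qed

theorem classification:
 assumes "arep G p U" "card (rep_invariants G U) = 1"
 shows "\<exists>f. aiso G U (W f)"
 using assms
proof (induction "card (carrier U)" arbitrary: U rule: less_induct)
 case less
 note U = less.prems(1)
 interpret U: arep G p U by fact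
 have F: "arep G p (fp p :: (int, int, 'g) rep)" by (rule arep_fp[OF group_G prime_p])
 show ?case
 proof (cases "carrier U = {\<zero>\<^bsub>U\<^esub>}")
  case True
  interpret W: arep G p "W (\<lambda>_. 0)" by (rule W_rep)
  have "(\<lambda>x\<in>carrier U. \<zero>\<^bsub>W (\<lambda>_. 0)\<^esub>) \<in> ahom G U (W (\<lambda>_. 0))" by (rule ahom_zero_map[OF U W_rep])
  moreover have "bij_betw (\<lambda>x\<in>carrier U. \<zero>\<^bsub>W (\<lambda>_. 0)\<^esub>) (carrier U) (carrier (W (\<lambda>_. 0)))"
   using True W_zero[of "\<lambda>_. 0"] by (simp add: bij_betw_def)
  ultimately show ?thesis unfolding aiso_def by blast
 next
  case False
  obtain N K i1 i2 p1 p2 where N: "asub G U N" "asub G U K" "airr G p (U\<lparr>carrier := N\<rparr>)"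
   and b: "biprod_rep G p U (U\<lparr>carrier := N\<rparr>) (U\<lparr>carrier := K\<rparr>) i1 i2 p1 p2" and K: "card K < card (carrier U)"
   using split_irreducible[OF U finite_G coprime_G False] .
  interpret biprod_rep G p U "U\<lparr>carrier := N\<rparr>" "U\<lparr>carrier := K\<rparr>" i1 i2 p1 p2 by (rule b)
  note aN = arep_sub[OF U N(1)] and aK = arep_sub[OF U N(2)]
  have inv: "card (rep_invariants G (U\<lparr>carrier := N\<rparr>)) = 1" "card (rep_invariants G (U\<lparr>carrier := K\<rparr>)) = 1"
   using card_hom_to[OF F] less.prems(2)
   unfolding card_hom_fp[OF U] card_hom_fp[OF aN] card_hom_fp[OF aK] by simp_all
  have "\<not> trivial_action G (U\<lparr>carrier := N\<rparr>)"
  proof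
   assume t: "trivial_action G (U\<lparr>carrier := N\<rparr>)"
   have "rep_invariants G (U\<lparr>carrier := N\<rparr>) = N" using t by (auto simp: rep_invariants_def trivial_action_def)
   hence "card N = 1" using inv(1) by simp
   thus False using N(1,3) by (auto simp: airr_def asub_def card_1_singleton_iff)
  qed
  then obtain i where i: "i \<in> I" "aiso G (U\<lparr>carrier := N\<rparr>) (V i)" using irr_iso_V[OF N(3)] by blast
  obtain f where f: "aiso G (U\<lparr>carrier := K\<rparr>) (W f)" using less.hyps[OF _ aK inv(2)] K by auto
  obtain j1 j2 r1 r2 where j: "biprod_rep G p (W (f(i := Suc (f i)))) (W f) (V i) j1 j2 r1 r2" using W_Suc[OF i(1)] .
  have "aiso G U (W (f(i := Suc (f i))))"
   by (rule biprod_iso[OF biprod_swap[OF b] j f i(2)])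
  thus ?thesis by blast
 qed
qed

text \<open>The multiplicities are read off from the sizes of the spaces of homomorphisms to the \<open>V i\<close>.\<close>

lemma W_iso_eq: assumes "aiso G (W e) (W f)" "i \<in> I" shows "e i = f i"
proof -
 have "q i ^ e i = q i ^ f i"
  using aiso_card_hom[OF W_rep W_rep rep[OF assms(2)] rep[OF assms(2)] assms(1) aiso_refl[OF rep[OF assms(2)]]] assms(2) by (simp add: card_hom_W)
 thus ?thesis using q_gt_1[OF assms(2)] by (simp add: power_inject_exp)
qed

section \<open>Duality\<close>

definition paired where "paired i j \<longleftrightarrow> card (forms G p (V i) (V j)) \<noteq> 1"

lemma rep_iso_dual: "i \<in> I \<Longrightarrow> j \<in> I \<Longrightarrow> rep_iso G (Fp p) (V i) (rep_dual G (Fp p) (V j)) \<longleftrightarrow> paired i j"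
 unfolding paired_def rep_iso_eq_aiso[OF rep arep_dual[OF rep sm] sm smult_ok_dual[OF rep sm]]
 by (rule iso_dual_iff[OF irr sm irr sm])

lemma aiso_dual: "i \<in> I \<Longrightarrow> j \<in> I \<Longrightarrow> aiso G (V i) (rep_dual G (Fp p) (V j)) \<longleftrightarrow> paired i j"
 unfolding paired_def by (rule iso_dual_iff[OF irr sm irr sm])

lemma paired_sym: "i \<in> I \<Longrightarrow> j \<in> I \<Longrightarrow> paired i j \<longleftrightarrow> paired j i"
 unfolding paired_def using card_forms_swap[OF rep rep, of i j] by simp

lemma paired_unique:
 assumes "i \<in> I" "j \<in> I" "k \<in> I" "paired i j" "paired i k" shows "j = k"
proof (rule ccontr)
 assume "j \<noteq> k"
 have "aiso G (V j) (rep_dual G (Fp p) (V i))" "aiso G (V k) (rep_dual G (Fp p) (V i))"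
  using assms by (auto simp: aiso_dual paired_sym[of _ i])
 hence "aiso G (V j) (V k)"
  using aiso_trans[OF rep[OF assms(2)]] aiso_sym[OF rep[OF assms(3)] arep_dual[OF rep sm, OF assms(1,1)]] by blast
 thus False using non_iso[OF assms(2,3) \<open>j \<noteq> k\<close>] by (simp add: rep_iso_eq_aiso[OF rep rep sm sm] assms)
qed

text \<open>An irreducible subrepresentation of the dual of \<open>V i\<close> is isomorphic to some \<open>V j\<close>. It is not trivial, as it would
consist of invariant functionals on \<open>V i\<close>.\<close>

lemma paired_exists:
 assumes i: "i \<in> I" shows "\<exists>j\<in>I. paired i j"
proof -
 let ?D = "rep_dual G (Fp p) (V i)"
 have D: "arep G p ?D" by (rule arep_dual[OF rep sm, OF i i])
 interpret D: arep G p ?D by (rule D)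
 interpret Vi: arep G p "V i" by (rule rep[OF i])
 have "card (carrier (V i)) \<noteq> 1"
 proof
  assume "card (carrier (V i)) = 1"
  then obtain x where x: "carrier (V i) = {x}" by (rule card_1_singletonE)
  hence "x = \<zero>\<^bsub>V i\<^esub>" using Vi.V.zero_closed by simp
  thus False using irr[OF i] x by (simp add: airr_def)
 qed
 hence "carrier ?D \<noteq> {\<zero>\<^bsub>?D\<^esub>}" using card_dual[OF rep sm, OF i i] by auto
 then obtain N where N: "asub G ?D N" "airr G p (?D\<lparr>carrier := N\<rparr>)" by (rule D.exists_irreducible_sub)
 let ?N = "?D\<lparr>carrier := N\<rparr>"
 have aN: "arep G p ?N" using N(2) by (simp add: airr_def)
 have incl: "(\<lambda>x\<in>N. x) \<in> ahom G ?N ?D" using N(1) by (intro ahomI) (auto simp: asub_def)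
 obtain n where n: "n \<in> N" "n \<noteq> \<zero>\<^bsub>?D\<^esub>" using N unfolding airr_def asub_def by auto
 have "\<not> trivial_action G ?N"
 proof
  assume t: "trivial_action G ?N"
  have nD: "n \<in> carrier ?D" using n(1) N(1) by (auto simp: asub_def)
  hence nT: "n \<in> ahom (triv_grp G) (V i) (fp p)" unfolding rep_dual_carrier[OF rep sm, OF i i] .
  have fix_n: "n (act (V i) (inv\<^bsub>G\<^esub> g) v) = n v" if g: "g \<in> carrier G" "v \<in> carrier (V i)" for g v
  proof -
   have "act ?D g n = n" using t g(1) n(1) by (simp add: trivial_action_def)
   hence "(\<lambda>v\<in>carrier (V i). n (act (V i) (inv\<^bsub>G\<^esub> g) v)) = n" using nD by (simp add: rep_dual_simps)
   from fun_cong[OF this, of v] show ?thesis using g(2) by simp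
  qed
  have "n \<in> ahom G (V i) (fp p)"
  proof (rule ahomI)
   fix g v assume g: "g \<in> carrier G" "v \<in> carrier (V i)"
   have "n (act (V i) (inv\<^bsub>G\<^esub> (inv\<^bsub>G\<^esub> g)) v) = n v" using fix_n[of "inv\<^bsub>G\<^esub> g" v] g D.G.inv_closed by blast
   thus "n (act (V i) g v) = act (fp p) g (n v)" using g ahom_closed[OF nT g(2)] by (simp add: fp_def)
  qed (use ahom_ext[OF nT] ahom_closed[OF nT] ahom_add[OF nT] in auto)
  hence "n = \<zero>\<^bsub>?D\<^esub>" unfolding functionals_nontrivial_irreducible[OF irr[OF i] nontriv[OF i]] by (simp add: rep_dual_simps)
  thus False using n(2) by simp
 qed
 then obtain j where j: "j \<in> I" "aiso G ?N (V j)" using irr_iso_V[OF N(2)] by blast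
 have "card (ahom G (V j) ?D) = card (ahom G ?N ?D)"
  using aiso_card_hom[OF aN rep[OF j(1)] D D j(2) aiso_refl[OF D]] by simp
 also have "\<dots> \<noteq> 1"
 proof
  assume "card (ahom G ?N ?D) = 1"
  then obtain h where "ahom G ?N ?D = {h}" by (rule card_1_singletonE)
  hence "(\<lambda>x\<in>N. x) = (\<lambda>x\<in>N. \<zero>\<^bsub>?D\<^esub>)" using incl ahom_zero_map[OF aN D] by simp
  from fun_cong[OF this, of n] show False using n by simp
 qed
 finally have "paired j i" unfolding paired_def card_forms[OF rep rep sm, OF j(1) i i] .
 thus ?thesis using j(1) paired_sym[OF i j(1)] by blast
qed

definition st where "st i = (THE j. j \<in> I \<and> paired i j)"

lemma st: assumes "i \<in> I" shows "st i \<in> I" "paired i (st i)" "j \<in> I \<Longrightarrow> paired i j \<longleftrightarrow> j = st i"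
proof -
 have "\<exists>!j. j \<in> I \<and> paired i j" using paired_exists paired_unique assms by blast
 from theI'[OF this] show "st i \<in> I" "paired i (st i)" by (auto simp: st_def)
 thus "j \<in> I \<Longrightarrow> paired i j \<longleftrightarrow> j = st i" using paired_unique[OF assms] by blast
qed

lemma st_st: "i \<in> I \<Longrightarrow> st (st i) = i"
 using st(1,2)[of i] st(3)[of "st i" i] paired_sym[of i "st i"] by simp

lemma card_forms_V:
 assumes "i \<in> I" "j \<in> I" shows "card (forms G p (V i) (V j)) = (if j = st i then q i else 1)"
proof (cases "j = st i")
 case True
 hence "aiso G (V i) (rep_dual G (Fp p) (V j))" using aiso_dual[OF assms] st(2)[OF assms(1)] by simp
 from aiso_card_hom[OF rep[OF assms(1)] rep[OF assms(1)] rep[OF assms(1)] arep_dual[OF rep sm, OF assms(2,2)]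
   aiso_refl[OF rep[OF assms(1)]] this]
 show ?thesis unfolding card_forms[OF rep rep sm, OF assms assms(2)] using True by (simp add: q_def)
next
 case False
 thus ?thesis using st(3)[OF assms] by (simp add: paired_def)
qed

lemma q_st: assumes i: "i \<in> I" shows "q (st i) = q i"
 using card_forms_swap[OF rep rep, OF i st(1)[OF i]] i st(1)[OF i] by (simp add: card_forms_V st_st)

lemma card_V_st: assumes i: "i \<in> I" shows "card (carrier (V (st i))) = card (carrier (V i))"
proof -
 have "aiso G (V i) (rep_dual G (Fp p) (V (st i)))" using aiso_dual[OF i st(1)[OF i]] st(2)[OF i] by simp
 from aiso_card[OF this] show ?thesis by (simp add: card_dual[OF rep sm, OF st(1)[OF i] st(1)[OF i]])
qed

text \<open>The blocks: self-dual representations and pairs of dual ones, represented by their first element.\<close>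

definition S where "S = {i \<in> I. st i = i}"
definition P where "P = {i \<in> I. i < st i}"

lemma SP: "finite S" "finite P" "S \<subseteq> I" "P \<subseteq> I" "S \<union> P \<union> st ` P = I" "S \<inter> P = {}" "S \<inter> st ` P = {}" "P \<inter> st ` P = {}"
 "inj_on st P"
proof -
 show "finite S" "finite P" "S \<subseteq> I" "P \<subseteq> I" using finite_I by (auto simp: S_def P_def)
 show "S \<union> P \<union> st ` P = I"
 proof (intro equalityI subsetI)
  fix i assume i: "i \<in> I"
  show "i \<in> S \<union> P \<union> st ` P"
  proof (cases "st i < i")
   case True
   hence "st i \<in> P" using i st(1) st_st by (simp add: P_def)
   thus ?thesis using st_st[OF i] by (metis UnI2 imageI)
  qed (use i in \<open>auto simp: S_def P_def\<close>)
 qed (use st(1) in \<open>auto simp: S_def P_def\<close>)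
 show "S \<inter> P = {}" "S \<inter> st ` P = {}" "P \<inter> st ` P = {}"
  using st_st by (fastforce simp: S_def P_def)+
 show "inj_on st P" by (rule inj_onI) (metis (no_types, lifting) P_def mem_Collect_eq st_st)
qed

lemma prod_I: "(\<Prod>i\<in>I. h i) = (\<Prod>i\<in>S. h i) * (\<Prod>i\<in>P. h i * h (st i))" for h :: "nat \<Rightarrow> 'z :: comm_monoid_mult"
proof -
 have "(\<Prod>i\<in>I. h i) = (\<Prod>i\<in>S \<union> P. h i) * (\<Prod>i\<in>st ` P. h i)"
  using SP by (subst SP(5)[symmetric]) (intro prod.union_disjoint, auto)
 thus ?thesis using SP by (simp add: prod.union_disjoint prod.reindex prod.distrib mult.assoc)
qed

definition alt_c where "alt_c i = card (alt_forms G p (V i))"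

lemma alt_c: "i \<in> I \<Longrightarrow> st i \<noteq> i \<Longrightarrow> alt_c i = 1"
proof -
 assume i: "i \<in> I" "st i \<noteq> i"
 hence "card (forms G p (V i) (V i)) = 1" by (simp add: card_forms_V)
 moreover have "alt_forms G p (V i) \<subseteq> forms G p (V i) (V i)" by (auto simp: alt_forms_def)
 moreover have "(\<lambda>_\<in>carrier (V i) \<times> carrier (V i). 0) \<in> alt_forms G p (V i)"
  using zero_form[OF rep rep, OF i(1) i(1)] by (simp add: alt_forms_def)
 ultimately have "alt_forms G p (V i) = forms G p (V i) (V i)" by (auto simp: card_1_singleton_iff)
 thus ?thesis using \<open>card (forms G p (V i) (V i)) = 1\<close> by (simp add: alt_c_def)
qed

text \<open>Adding a copy of \<open>V i\<close> multiplies the number of alternating forms by those on \<open>V i\<close> and by the forms between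
\<open>W f\<close> and \<open>V i\<close>, which only involve the factors dual to \<open>V i\<close>.\<close>

lemma card_alt_W:
 "card (alt_forms G p (W f)) = (\<Prod>i\<in>S. q i ^ (f i choose 2) * alt_c i ^ f i) * (\<Prod>i\<in>P. q i ^ (f i * f (st i)))"
proof (induction f rule: W_induct)
 case (zero f)
 interpret W: arep G p "W f" by (rule W_rep)
 have "forms G p (W f) (W f) \<subseteq> {\<lambda>_\<in>carrier (W f) \<times> carrier (W f). 0}"
 proof
  fix b assume b: "b \<in> forms G p (W f) (W f)"
  have "b = (\<lambda>_\<in>carrier (W f) \<times> carrier (W f). 0)"
   by (rule forms_eqI[OF b zero_form[OF W_rep W_rep]])
    (use forms_zero(1)[OF b W_rep W_rep] W_zero[of f, OF zero] in auto)
  thus "b \<in> {\<lambda>_\<in>carrier (W f) \<times> carrier (W f). 0}" by simp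
 qed
 hence "alt_forms G p (W f) = {\<lambda>_\<in>carrier (W f) \<times> carrier (W f). 0}"
  using zero_form[OF W_rep W_rep, of f f] by (auto simp: alt_forms_def)
 moreover have "f i = 0" if "i \<in> S \<or> i \<in> P" for i using zero SP(3,4) that by auto
 ultimately show ?case by (simp add: numeral_2_eq_2)
next
 case (Suc f i)
 note i = Suc(1)
 let ?f = "f(i := Suc (f i))"
 let ?A = "\<lambda>f. (\<Prod>i\<in>S. q i ^ (f i choose 2) * alt_c i ^ f i)" and ?B = "\<lambda>f. (\<Prod>i\<in>P. q i ^ (f i * f (st i)))"
 obtain i1 i2 p1 p2 where "biprod_rep G p (W ?f) (W f) (V i) i1 i2 p1 p2" using W_Suc[OF i] .
 then interpret biprod_rep G p "W ?f" "W f" "V i" i1 i2 p1 p2 .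
 have "card (forms G p (W f) (V i)) = (\<Prod>j\<in>I. card (ahom G (V j) (rep_dual G (Fp p) (V i))) ^ f j)"
  unfolding card_forms[OF W_rep rep[OF i] sm[OF i]] by (rule card_hom_W_from[OF arep_dual[OF rep sm, OF i i]])
 also have "\<dots> = (\<Prod>j\<in>I. if j = st i then q i ^ f j else 1)"
 proof (rule prod.cong[OF refl])
  fix j assume j: "j \<in> I"
  have "card (ahom G (V j) (rep_dual G (Fp p) (V i))) = (if i = st j then q j else 1)"
   using card_forms_V[OF j i] by (simp add: card_forms[OF rep rep sm, OF j i i])
  moreover have "i = st j \<longleftrightarrow> j = st i" using st_st i j by auto
  ultimately show "card (ahom G (V j) (rep_dual G (Fp p) (V i))) ^ f j = (if j = st i then q i ^ f j else 1)"
   using q_st[OF i] by auto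
 qed
 also have "\<dots> = q i ^ f (st i)" using finite_I st(1)[OF i] by simp
 finally have forms: "card (forms G p (W f) (V i)) = q i ^ f (st i)" .
 have "card (alt_forms G p (W ?f)) = ?A f * ?B f * (alt_c i * q i ^ f (st i))"
  unfolding card_alt_forms forms Suc.IH alt_c_def by (simp add: mult_ac)
 also have "\<dots> = ?A ?f * ?B ?f"
 proof -
  consider "i \<in> S" | "i \<in> P" | "i \<in> st ` P" using i SP(5) by blast
  thus ?thesis
  proof cases
   case 1
   hence "st i = i" by (simp add: S_def)
   have "?B ?f = ?B f"
   proof (rule prod.cong[OF refl])
    fix x assume "x \<in> P"
    hence "x \<noteq> i" "st x \<noteq> i" using 1 SP(6,7) by blast+
    thus "q x ^ (?f x * ?f (st x)) = q x ^ (f x * f (st x))" by simp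
   qed
   moreover have "?A ?f = ?A f * (alt_c i * q i ^ f i)"
   proof -
    have "?A ?f = (q i ^ (Suc (f i) choose 2) * alt_c i ^ Suc (f i)) * (\<Prod>i\<in>S - {i}. q i ^ (f i choose 2) * alt_c i ^ f i)"
     using 1 SP(1) by (subst prod.remove[of _ i]) (auto intro!: prod.cong)
    also have "\<dots> = (alt_c i * q i ^ f i) * ((q i ^ (f i choose 2) * alt_c i ^ f i) * (\<Prod>i\<in>S - {i}. q i ^ (f i choose 2) * alt_c i ^ f i))"
     by (simp add: numeral_2_eq_2 power_add mult_ac)
    also have "\<dots> = (alt_c i * q i ^ f i) * ?A f"
     unfolding prod.remove[OF SP(1) 1, of "\<lambda>i. q i ^ (f i choose 2) * alt_c i ^ f i"] ..
    finally show ?thesis by (simp only: mult.commute)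
   qed
   ultimately show ?thesis using \<open>st i = i\<close> by (simp only: mult_ac)
  next
   case 2
   have ne: "st i \<noteq> i" using 2 by (simp add: P_def)
   have "?A ?f = ?A f" using 2 SP(6) by (intro prod.cong) auto
   moreover have "?B ?f = ?B f * q i ^ f (st i)"
   proof -
    have "?B ?f = q i ^ (Suc (f i) * f (st i)) * (\<Prod>j\<in>P - {i}. q j ^ (f j * f (st j)))"
    proof -
     have "q x ^ (?f x * ?f (st x)) = q x ^ (f x * f (st x))" if "x \<in> P - {i}" for x
     proof -
      have "x \<noteq> i" "st x \<noteq> i" using that 2 SP(8) by blast+
      thus ?thesis by simp
     qed
     hence "(\<Prod>j\<in>P - {i}. q j ^ (?f j * ?f (st j))) = (\<Prod>j\<in>P - {i}. q j ^ (f j * f (st j)))" by (rule prod.cong[OF refl])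
     thus ?thesis using 2 SP(2) ne by (subst prod.remove[of _ i]) auto
    qed
    also have "\<dots> = q i ^ f (st i) * (q i ^ (f i * f (st i)) * (\<Prod>j\<in>P - {i}. q j ^ (f j * f (st j))))"
     by (simp add: power_add mult_ac)
    also have "\<dots> = q i ^ f (st i) * ?B f"
     unfolding prod.remove[OF SP(2) 2, of "\<lambda>j. q j ^ (f j * f (st j))"] ..
    finally show ?thesis by (simp only: mult.commute)
   qed
   ultimately show ?thesis using alt_c[OF i ne] by (simp only: mult_1 mult_ac)
  next
   case 3
   then obtain j where j: "j \<in> P" "i = st j" by blast
   hence sj: "st i = j" "j \<noteq> i" "st i \<noteq> i" using SP(4) st_st by (auto simp: P_def)
   have "?A ?f = ?A f" using 3 SP(7) by (intro prod.cong) auto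
   moreover have "?B ?f = ?B f * q i ^ f j"
   proof -
    have "?B ?f = q j ^ (f j * Suc (f i)) * (\<Prod>j\<in>P - {j}. q j ^ (f j * f (st j)))"
    proof -
     have "q x ^ (?f x * ?f (st x)) = q x ^ (f x * f (st x))" if "x \<in> P - {j}" for x
     proof -
      have "x \<noteq> i" using that 3 SP(8) by blast
      moreover have "st x \<noteq> i" using that j SP(9) by (auto dest: inj_onD)
      ultimately show ?thesis by simp
     qed
     hence "(\<Prod>j\<in>P - {j}. q j ^ (?f j * ?f (st j))) = (\<Prod>j\<in>P - {j}. q j ^ (f j * f (st j)))" by (rule prod.cong[OF refl])
     thus ?thesis using j SP(2) sj by (subst prod.remove[of _ j]) auto
    qed
    also have "\<dots> = q i ^ f j * (q j ^ (f j * f (st j)) * (\<Prod>j\<in>P - {j}. q j ^ (f j * f (st j))))"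
     using q_st[of j] j SP(4) by (auto simp add: power_add mult_ac)
    also have "\<dots> = q i ^ f j * ?B f"
     unfolding prod.remove[OF SP(2) j(1), of "\<lambda>j. q j ^ (f j * f (st j))"] ..
    finally show ?thesis by (simp only: mult.commute)
   qed
   ultimately show ?thesis using alt_c[OF i sj(3)] sj(1) by (simp only: mult_1 mult_ac)
  qed
 qed
 finally show ?case .
qed

end

section \<open>Measures on isomorphism classes\<close>

context irreducibles
begin

definition cls where "cls f = iso_class G p (W f)"

definition sur_prod where "sur_prod e f = (\<Prod>i\<in>I. ic i (e i) (f i))"

lemma W_restrict: "W (restrict f I) = W f"
 by (rule W_cong) simp

text \<open>Members of a class are finite because they are isomorphic to a finite representation.\<close>

lemma iso_class_member:
 assumes "U \<in> iso_class G p V'" "arep G p V'" "smult_ok p V'"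
 shows "arep G p U" "smult_ok p U" "aiso G U V'"
proof -
 interpret arep G p V' by fact
 have U: "representation G (Fp p) U" "rep_iso G (Fp p) U V'" using assms(1) by (auto simp: iso_class_def)
 hence "finite (carrier U)" using finite_carrier bij_betw_finite unfolding rep_iso_def by blast
 thus *: "arep G p U" "smult_ok p U" using representation_arep[OF U(1) _ prime_p] by auto
 thus "aiso G U V'" using U(2) assms by (simp add: rep_iso_eq_aiso)
qed

lemma iso_class_eq:
 assumes "arep G p U" "smult_ok p U" "arep G p V'" "smult_ok p V'" "aiso G U V'"
 shows "iso_class G p U = iso_class G p V'"
proof -
 have "rep_iso G (Fp p) Z U \<longleftrightarrow> rep_iso G (Fp p) Z V'" if "representation G (Fp p) Z" for Z :: "(int, nat, 'g) rep"
 proof -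
  have *: "rep_iso G (Fp p) Z B" if A: "rep_iso G (Fp p) Z A" "arep G p A" "smult_ok p A" "arep G p B" "smult_ok p B" "aiso G A B"
   for A :: "(int, 'x, 'g) rep" and B :: "(int, 'y, 'g) rep"
  proof -
   have "Z \<in> iso_class G p A" using A(1) \<open>representation G (Fp p) Z\<close> by (simp add: iso_class_def)
   note Z = iso_class_member[OF this A(2,3)]
   show ?thesis unfolding rep_iso_eq_aiso[OF Z(1) A(4) Z(2) A(5)] by (rule aiso_trans[OF Z(1,3) A(6)])
  qed
  show ?thesis using *[of U V'] *[of V' U] assms aiso_sym[OF assms(1,3,5)] by blast
 qed
 thus ?thesis by (auto simp: iso_class_def)
qed

lemma reps_arep:
 assumes "U \<in> reps_no_invariants G p"
 shows "arep G p U" "smult_ok p U" "\<exists>f\<in>multi I. aiso G U (W f)"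
proof -
 have U: "representation G (Fp p) U" "vectorspace.fin_dim (Fp p) U" "rep_invariants G U = {\<zero>\<^bsub>U\<^esub>}"
  using assms by (auto simp: reps_no_invariants_def)
 hence "finite (carrier U)" using fin_dim_iff_finite[OF U(1) prime_p] by simp
 thus a: "arep G p U" "smult_ok p U" using representation_arep[OF U(1) _ prime_p] by auto
 obtain f where "aiso G U (W f)" using classification[OF a(1)] U(3) by auto
 thus "\<exists>f\<in>multi I. aiso G U (W f)" using W_restrict[of f] by (intro bexI[of _ "restrict f I"]) auto
qed

lemma reps_copy:
 obtains U where "U \<in> reps_no_invariants G p" "aiso G U (W f)"
proof -
 obtain U :: "(int, nat, 'g) rep" where U: "arep G p U" "smult_ok p U" "representation G (Fp p) U" "aiso G U (W f)"
  using nat_copy_exists[OF W_rep] .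
 interpret arep G p U by (rule U(1))
 have "card (rep_invariants G U) = card (rep_invariants G (W f))"
  using aiso_card_hom[OF arep_fp[OF group_G prime_p] arep_fp[OF group_G prime_p] U(1) W_rep aiso_refl[OF arep_fp[OF group_G prime_p]] U(4)]
  by (simp add: card_hom_fp[OF U(1)] card_hom_fp[OF W_rep])
 hence "rep_invariants G U = {\<zero>\<^bsub>U\<^esub>}" using invariants_nontrivial[OF U(1)] invariants_W[of f] by simp
 hence "U \<in> reps_no_invariants G p"
  using U(3) finite_carrier by (simp add: reps_no_invariants_def fin_dim_iff_finite[OF U(3) prime_p])
 thus ?thesis using that U(4) by blast
qed

lemma cls_bij: "bij_betw cls (multi I) (R_classes G p)"
proof (rule bij_betw_imageI)
 show "inj_on cls (multi I)"
 proof (rule inj_onI)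
  fix e f assume ef: "e \<in> multi I" "f \<in> multi I" "cls e = cls f"
  obtain U :: "(int, nat, 'g) rep" where U: "arep G p U" "smult_ok p U" "representation G (Fp p) U" "aiso G U (W e)"
   using nat_copy_exists[OF W_rep] .
  have "U \<in> cls e" using U by (simp add: cls_def iso_class_def rep_iso_eq_aiso[OF U(1) W_rep U(2) W_sm])
  hence "aiso G U (W f)" using ef(3) unfolding cls_def by (simp add: iso_class_member(3)[OF _ W_rep W_sm])
  hence "aiso G (W e) (W f)" using aiso_trans[OF W_rep aiso_sym[OF U(1) W_rep U(4)]] by blast
  thus "e = f" using W_iso_eq ef by (intro PiE_ext[of e I _ f]) auto
 qed
 show "cls ` multi I = R_classes G p"
 proof (intro equalityI subsetI)
  fix C assume "C \<in> cls ` multi I"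
  then obtain f where f: "C = cls f" by blast
  obtain U where U: "U \<in> reps_no_invariants G p" "aiso G U (W f)" using reps_copy .
  have "C = iso_class G p U" unfolding f cls_def
   by (rule iso_class_eq[symmetric, OF reps_arep(1,2)[OF U(1)] W_rep W_sm U(2)])
  thus "C \<in> R_classes G p" using U(1) by (simp add: R_classes_def)
 next
  fix C assume "C \<in> R_classes G p"
  then obtain U where U: "U \<in> reps_no_invariants G p" "C = iso_class G p U" by (auto simp: R_classes_def)
  obtain f where "f \<in> multi I" "aiso G U (W f)" using reps_arep(3)[OF U(1)] by blast
  thus "C \<in> cls ` multi I"
   using iso_class_eq[OF reps_arep(1,2)[OF U(1)] W_rep W_sm] unfolding U(2) cls_def by blast
 qed
qed

lemma countable_classes: "countable (R_classes G p)"
 using countable_multi[OF finite_I] bij_betw_imp_surj_on[OF cls_bij] countable_image by metis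

lemma Sur_count_cls:
 assumes "arep G p U" "smult_ok p U" "aiso G U (W f)"
 shows "real (Sur_count G p (cls e) U) = sur_prod e f"
proof -
 obtain Z where Z: "Z \<in> cls e"
 proof -
  obtain Z :: "(int, nat, 'g) rep" where Z: "arep G p Z" "smult_ok p Z" "representation G (Fp p) Z" "aiso G Z (W e)"
   using nat_copy_exists[OF W_rep] .
  hence "Z \<in> cls e" by (simp add: cls_def iso_class_def rep_iso_eq_aiso[OF Z(1) W_rep Z(2) W_sm])
  thus ?thesis using that by blast
 qed
 hence "(SOME Z. Z \<in> cls e) \<in> iso_class G p (W e)" unfolding cls_def by (rule someI)
 note S = iso_class_member[OF this W_rep W_sm]
 have "Sur_count G p (cls e) U = card (asur G (SOME Z. Z \<in> cls e) U)"
  unfolding Sur_count_def rep_Sur_def asur_def using S assms by (simp add: rep_hom_eq_ahom cls_def)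
 also have "\<dots> = card (asur G (W e) (W f))"
  using aiso_card_sur[OF S(1) W_rep assms(1) W_rep S(3) assms(3)] by (simp add: cls_def)
 finally show ?thesis by (simp add: card_sur_W sur_prod_def)
qed

definition moment where "moment u f = real (card (alt_forms G p (W f))) / real (card (carrier (W f))) ^ u"

text \<open>There are countably many classes, so a measure on all subsets is given by its point masses.\<close>

lemma nn_integral_classes:
 assumes "space \<nu> = R_classes G p" "sets \<nu> = Pow (R_classes G p)"
 shows "(\<integral>\<^sup>+ C. g C \<partial>\<nu>) = (\<integral>\<^sup>+ e. emeasure \<nu> {cls e} * g (cls e) \<partial>count_space (multi I))"
proof -
 let ?R = "R_classes G p"
 have "\<nu> = density (count_space ?R) (\<lambda>C. emeasure \<nu> {C})"
  by (rule measure_eqI_countable[of _ ?R]) (auto simp: assms countable_classes emeasure_density)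
 hence "(\<integral>\<^sup>+ C. g C \<partial>\<nu>) = (\<integral>\<^sup>+ C. g C \<partial>density (count_space ?R) (\<lambda>C. emeasure \<nu> {C}))" by simp
 also have "\<dots> = (\<integral>\<^sup>+ C. emeasure \<nu> {C} * g C \<partial>count_space ?R)" by (rule nn_integral_density) auto
 also have "\<dots> = (\<integral>\<^sup>+ e. emeasure \<nu> {cls e} * g (cls e) \<partial>count_space (multi I))"
  by (rule nn_integral_bij_count_space[OF cls_bij, symmetric])
 finally show ?thesis .
qed

abbreviation mass_moment where
 "mass_moment \<nu> f \<equiv> \<integral>\<^sup>+ e. emeasure \<nu> {cls e} * ennreal (sur_prod e f) \<partial>count_space (multi I)"

text \<open>The problem in coordinates: a linear system for the masses of the classes of the \<open>W e\<close>.\<close>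

lemma has_moments_iff:
 "has_moments G p u \<nu> \<longleftrightarrow> space \<nu> = R_classes G p \<and> sets \<nu> = Pow (R_classes G p) \<and>
  (\<forall>f\<in>multi I. mass_moment \<nu> f = ennreal (moment u f))"
proof (cases "space \<nu> = R_classes G p \<and> sets \<nu> = Pow (R_classes G p)")
 case True
 have key: "(\<integral>\<^sup>+ C. of_nat (Sur_count G p C U) \<partial>\<nu>) = ennreal (real (card (rep_invariants G (exterior_square (Fp p) U)))
    / real (card (carrier U)) ^ u)
   \<longleftrightarrow> mass_moment \<nu> f = ennreal (moment u f)"
  if U: "U \<in> reps_no_invariants G p" and f: "aiso G U (W f)" for U f
 proof -
  note a = reps_arep(1,2)[OF U]
  have "(\<integral>\<^sup>+ C. of_nat (Sur_count G p C U) \<partial>\<nu>)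
    = (\<integral>\<^sup>+ e. emeasure \<nu> {cls e} * of_nat (Sur_count G p (cls e) U) \<partial>count_space (multi I))"
   using True by (intro nn_integral_classes) auto
  also have "\<dots> = mass_moment \<nu> f"
   unfolding Sur_count_cls[OF a f, symmetric] by (simp add: ennreal_of_nat_eq_real_of_nat)
  finally have "(\<integral>\<^sup>+ C. of_nat (Sur_count G p C U) \<partial>\<nu>)
    = mass_moment \<nu> f" .
  moreover have "card (rep_invariants G (exterior_square (Fp p) U)) = card (alt_forms G p (W f))"
   using card_invariants_exterior_square[OF a finite_G coprime_G] aiso_card_alt_forms[OF a(1) W_rep f] by simp
  ultimately show ?thesis by (simp add: moment_def aiso_card[OF f])
 qed
 show ?thesis
 proof
  assume h: "has_moments G p u \<nu>"
  have "mass_moment \<nu> f = ennreal (moment u f)" for f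
  proof -
   obtain U where U: "U \<in> reps_no_invariants G p" "aiso G U (W f)" using reps_copy .
   thus ?thesis using key[OF U] h unfolding has_moments_def by blast
  qed
  thus "space \<nu> = R_classes G p \<and> sets \<nu> = Pow (R_classes G p) \<and>
   (\<forall>f\<in>multi I. mass_moment \<nu> f = ennreal (moment u f))"
   using True by blast
 next
  assume h: "space \<nu> = R_classes G p \<and> sets \<nu> = Pow (R_classes G p) \<and>
   (\<forall>f\<in>multi I. mass_moment \<nu> f = ennreal (moment u f))"
  show "has_moments G p u \<nu>" unfolding has_moments_def
  proof (intro conjI ballI)
   fix U assume U: "U \<in> reps_no_invariants G p"
   obtain f where "f \<in> multi I" "aiso G U (W f)" using reps_arep(3)[OF U] by blast
   thus "(\<integral>\<^sup>+ C. of_nat (Sur_count G p C U) \<partial>\<nu>) = ennreal (real (card (rep_invariants G (exterior_square (Fp p) U)))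
    / real (card (carrier U)) ^ u)" using key[OF U] h by blast
  qed (use True in auto)
 qed
qed (auto simp: has_moments_def)

end

section \<open>The measure\<close>

text \<open>\<open>N i\<close> below is \<open>u n_i\<close>, so that \<open>q_i^(N i f_i)\<close> is the contribution of \<open>V i\<close> to the \<open>u\<close>-th power of the size of
\<open>W f\<close>; \<open>m1\<close> and \<open>m2\<close> are the factors that a block contributes to the moment.\<close>

locale moment_problem = irreducibles G p I V for G :: "('g, 'm) monoid_scheme" and p I V +
 fixes u :: nat and n :: "nat \<Rightarrow> nat" and \<epsilon> :: "nat \<Rightarrow> int"
 assumes u: "u > 0" and card_V: "\<And>i. i \<in> I \<Longrightarrow> card (carrier (V i)) = q i ^ n i"
  and sign: "\<And>i. i \<in> I \<Longrightarrow> \<epsilon> i = rep_sign G (Fp p) (V i)"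
begin

definition N where "N i = u * n i"
definition x where "x i = 1 / real (q i)"

lemma qx: "i \<in> I \<Longrightarrow> qseries (real (q i)) (x i)" unfolding x_def by (rule qs)

lemma N_pos: assumes i: "i \<in> I" shows "N i \<ge> 1"
proof -
 interpret arep G p "V i" by (rule rep[OF i])
 have "card (carrier (V i)) \<noteq> 1"
 proof
  assume "card (carrier (V i)) = 1"
  then obtain y where y: "carrier (V i) = {y}" by (rule card_1_singletonE)
  hence "y = \<zero>\<^bsub>V i\<^esub>" using V.zero_closed by simp
  thus False using irr[OF i] y by (simp add: airr_def)
 qed
 hence "n i \<noteq> 0" using card_V[OF i] by (cases "n i") auto
 thus ?thesis using u by (simp add: N_def Suc_le_eq)
qed

lemma n_st: assumes i: "i \<in> I" shows "n (st i) = n i"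
proof -
 have "q i ^ n (st i) = q i ^ n i"
  using card_V_st[OF i] card_V[OF i] card_V[OF st(1)[OF i]] q_st[OF i] by simp
 thus ?thesis using q_gt_1[OF i] by simp
qed

lemma N_st: "i \<in> I \<Longrightarrow> N (st i) = N i" by (simp add: N_def n_st)
lemma x_st: "i \<in> I \<Longrightarrow> x (st i) = x i" by (simp add: x_def q_st)

definition m1 where "m1 i k = real (q i) ^ (k choose 2) * real (alt_c i) ^ k * x i ^ (N i * k)"
definition m2 where "m2 i k l = real (q i) ^ (k * l) * x i ^ (N i * (k + l))"

lemma alt_c_powr:
 assumes "i \<in> S" shows "real (alt_c i) = real (q i) powr ((1 - real_of_int (\<epsilon> i)) / 2)"
proof -
 have i: "i \<in> I" "st i = i" using assms by (auto simp: S_def)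
 interpret irr_forms G p "V i" by (rule irr_forms[OF i(1)])
 have "card (forms G p (V i) (V i)) = card (ahom G (V i) (V i))" using card_forms_V[OF i(1) i(1)] i(2) by (simp add: q_def)
 then interpret self_dual_irr G p "V i" by unfold_locales
 show ?thesis using card_alternating_sign[OF finite_G coprime_G] i(1) by (simp add: alt_c_def q_def sign)
qed

lemma sign_range: "\<epsilon> i \<in> {- 1, 0, 1}" if "i \<in> I"
 using sign[OF that] by (simp add: rep_sign_def Let_def)

lemma alt_c_bounds: assumes "i \<in> S" shows "0 < real (alt_c i)" "real (alt_c i) \<le> real (q i)"
proof -
 have i: "i \<in> I" using assms by (simp add: S_def)
 note q = q_real[OF i]
 show "0 < real (alt_c i)" unfolding alt_c_powr[OF assms] using q by simp
 have "real (q i) powr ((1 - real_of_int (\<epsilon> i)) / 2) \<le> real (q i) powr 1"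
  using q sign_range[OF i] by (intro powr_mono) auto
 thus "real (alt_c i) \<le> real (q i)" unfolding alt_c_powr[OF assms] using q by simp
qed

lemma moment_eq: "moment u f = (\<Prod>i\<in>S. m1 i (f i)) * (\<Prod>i\<in>P. m2 i (f i) (f (st i)))"
proof -
 have W: "real (card (carrier (W f))) ^ u = (\<Prod>i\<in>I. real (q i) ^ (N i * f i))"
  unfolding card_W of_nat_prod prod_power_distrib
  by (intro prod.cong) (simp_all add: card_V N_def power_mult[symmetric] mult_ac)
 have "(\<Prod>i\<in>I. real (q i) ^ (N i * f i)) * (\<Prod>i\<in>I. x i ^ (N i * f i)) = 1"
  unfolding prod.distrib[symmetric] by (intro prod.neutral ballI qseries.qx_cancel(1)[OF qx])
 hence "1 / real (card (carrier (W f))) ^ u = (\<Prod>i\<in>I. x i ^ (N i * f i))"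
  unfolding W by (auto simp: divide_eq_eq mult.commute)
 also have "\<dots> = (\<Prod>i\<in>S. x i ^ (N i * f i)) * (\<Prod>i\<in>P. x i ^ (N i * (f i + f (st i))))"
  unfolding prod_I using SP(4) by (auto intro!: arg_cong2[of _ _ _ _ "(*)"] prod.cong simp: N_st x_st distrib_left power_add)
 finally have 1: "1 / real (card (carrier (W f))) ^ u = (\<Prod>i\<in>S. x i ^ (N i * f i)) * (\<Prod>i\<in>P. x i ^ (N i * (f i + f (st i))))" .
 have "moment u f = real (card (alt_forms G p (W f))) * (1 / real (card (carrier (W f))) ^ u)"
  by (simp add: moment_def)
 thus ?thesis unfolding 1 card_alt_W by (simp add: m1_def m2_def prod.distrib mult_ac)
qed

lemma moment_nonneg: "moment u f \<ge> 0" by (simp add: moment_def)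

text \<open>A pair of dual representations contributes \<open>q^(f g)\<close>, and \<open>f g\<close> is at most the sum of \<open>Suc f choose 2\<close> and
\<open>Suc g choose 2\<close>; so for the purpose of convergence the indices may be treated independently.\<close>

lemma moment_bound:
 "moment u f \<le> (\<Prod>i\<in>I. real (q i) ^ (Suc (f i) choose 2) * (1 / real (q i)) ^ (N i * f i))"
 unfolding moment_eq prod_I
proof (intro mult_mono prod_mono conjI prod_nonneg)
 have x0: "x i \<ge> 0" for i by (simp add: x_def)
 have c2: "Suc k choose 2 = (k choose 2) + k" for k by (simp add: numeral_2_eq_2)
 show "m1 i (f i) \<ge> 0" for i by (simp add: m1_def x0)
 show "m2 i (f i) (f (st i)) \<ge> 0" if "i \<in> P" for i by (simp add: m2_def x0)
 show "m2 i (f i) (f (st i)) \<ge> 0" if "i \<in> P" for i by (simp add: m2_def x0)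
 show "m1 i (f i) \<le> real (q i) ^ (Suc (f i) choose 2) * (1 / real (q i)) ^ (N i * f i)" if "i \<in> S" for i
  unfolding m1_def x_def c2 power_add using alt_c_bounds[OF that]
  by (intro mult_right_mono mult_left_mono power_mono) auto
 show "m2 i (f i) (f (st i)) \<le> real (q i) ^ (Suc (f i) choose 2) * (1 / real (q i)) ^ (N i * f i)
   * (real (q (st i)) ^ (Suc (f (st i)) choose 2) * (1 / real (q (st i))) ^ (N (st i) * f (st i)))" if i: "i \<in> P" for i
 proof -
  have iI: "i \<in> I" using i SP(4) by blast
  have "f i * f (st i) \<le> (Suc (f i) choose 2) + (Suc (f (st i)) choose 2)"
  proof -
   have "2 * (k * l) \<le> k * k + l * l" for k l :: nat
   proof -
    have "int (2 * (k * l)) \<le> int (k * k + l * l)"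
     using zero_le_power2[of "int k - int l"] by (simp add: power2_eq_square algebra_simps)
    thus ?thesis by (simp only: of_nat_le_iff)
   qed
   from this[of "f i" "f (st i)"] show ?thesis unfolding c2 using qseries.choose_two(2)[OF qx[OF iI], of "f i"]
     qseries.choose_two(2)[OF qx[OF iI], of "f (st i)"] by linarith
  qed
  hence "real (q i) ^ (f i * f (st i)) \<le> real (q i) ^ ((Suc (f i) choose 2) + (Suc (f (st i)) choose 2))"
   using q_real[OF iI] by (intro power_increasing) auto
  hence "m2 i (f i) (f (st i)) \<le> real (q i) ^ ((Suc (f i) choose 2) + (Suc (f (st i)) choose 2)) * x i ^ (N i * (f i + f (st i)))"
   unfolding m2_def using x0 by (intro mult_right_mono) auto
  thus ?thesis using iI by (simp add: q_st N_st x_def power_add distrib_left mult_ac)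
 qed
qed auto

theorem unique_masses:
 assumes "has_moments G p u \<nu>" "has_moments G p u \<nu>'" "f \<in> multi I"
 shows "emeasure \<nu> {cls f} = emeasure \<nu>' {cls f}"
proof (rule moments_unique[of I "\<lambda>i. real (q i)" N "moment u" "\<lambda>e. emeasure \<nu> {cls e}" "\<lambda>e. emeasure \<nu>' {cls e}", OF finite_I q_real N_pos
   moment_nonneg moment_bound _ _ assms(3)])
qed (use assms(1,2) in \<open>auto simp: has_moments_iff sur_prod_def\<close>)

text \<open>The normalizing product of a self-dual block. It has the stated form because \<open>alt_c i\<close> is
\<open>q_i^((1 - \<epsilon> i)/2)\<close>.\<close>

definition P1 where "P1 i = prodinf (\<lambda>l. 1 + (real (alt_c i) * x i ^ (N i + 1)) * x i ^ l)"
abbreviation "qr i \<equiv> qseries.rp (x i)"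

definition w1 where "w1 i k = m1 i k / ic i k k / P1 i"
definition w2 where "w2 i k l = m2 i k l * qr i (int (N i) - (int k - int l)) * qr i (int (N i) + (int k - int l))
  / (ic i k k * ic i l l) * (qseries.qinf (x i) / qr i (2 * int (N i)))"
definition mass where "mass e = (\<Prod>i\<in>S. w1 i (e i)) * (\<Prod>i\<in>P. w2 i (e i) (e (st i)))"

lemma P1_pos: assumes "i \<in> S" shows "P1 i > 0"
proof -
 have i: "i \<in> I" using assms by (simp add: S_def)
 interpret qseries "real (q i)" "x i" by (rule qx[OF i])
 have t: "real (alt_c i) * x i ^ (N i + 1) \<ge> 0" using x_bounds by simp
 have "(\<lambda>n. \<Prod>l<n. 1 + (real (alt_c i) * x i ^ (N i + 1)) * x i ^ l) \<longlonglongrightarrow> P1 i" unfolding P1_def by (rule prod_LIMSEQ)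
 moreover have "1 \<le> (\<Prod>l<n. 1 + (real (alt_c i) * x i ^ (N i + 1)) * x i ^ l)" for n
  using t x_bounds by (intro prod_ge_1) simp
 ultimately have "1 \<le> P1 i" by (intro LIMSEQ_le_const) auto
 thus ?thesis by simp
qed

lemma w1_sum:
 assumes "i \<in> S" shows "(\<integral>\<^sup>+k. ennreal (w1 i k * ic i k f) \<partial>count_space UNIV) = ennreal (m1 i f)"
proof -
 have i: "i \<in> I" using assms by (simp add: S_def)
 interpret qseries "real (q i)" "x i" by (rule qx[OF i])
 have "(\<lambda>k. 1 / P1 i * (real (q i) ^ (k choose 2) * real (alt_c i) ^ k * x i ^ (N i * k) / ic i k k * ic i k f)) sums
   (1 / P1 i * (real (q i) ^ (f choose 2) * real (alt_c i) ^ f * x i ^ (N i * f) * P1 i))"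
  unfolding P1_def by (intro sums_mult single_block alt_c_bounds(1)[OF assms])
 hence "(\<lambda>k. w1 i k * ic i k f) sums m1 i f"
  using P1_pos[OF assms] by (simp add: w1_def m1_def field_simps)
 moreover have "w1 i k * ic i k f \<ge> 0" for k
  using P1_pos[OF assms] x_bounds inj_count_nonneg by (auto simp: w1_def m1_def intro!: mult_nonneg_nonneg divide_nonneg_nonneg)
 ultimately show ?thesis by (intro nn_integral_sums)
qed

lemma w2_nonneg: assumes i: "i \<in> I" shows "w2 i k l \<ge> 0"
proof -
 interpret qseries "real (q i)" "x i" by (rule qx[OF i])
 show ?thesis using x_bounds inj_count_nonneg rp_nonneg qinf_pos
  by (auto simp: w2_def m2_def intro!: mult_nonneg_nonneg divide_nonneg_nonneg)
qed

lemma w2_sum: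
 assumes "i \<in> P"
 shows "(\<integral>\<^sup>+l. \<integral>\<^sup>+k. ennreal (w2 i k l * (ic i k f * ic i l g)) \<partial>count_space UNIV \<partial>count_space UNIV) = ennreal (m2 i f g)"
proof -
 have i: "i \<in> I" using assms by (simp add: P_def)
 interpret qseries "real (q i)" "x i" by (rule qx[OF i])
 define C where "C = qinf / rp (2 * int (N i))"
 have C: "C > 0" unfolding C_def using qinf_pos qp_pos[of "2 * N i"] by (simp add: rp_def nat_mult_distrib)
 let ?w = "\<lambda>k l. real (q i) ^ (k * l) * x i ^ (N i * (k + l)) * rp (int (N i) - (int k - int l)) * rp (int (N i) + (int k - int l))
    / (ic i k k * ic i l l) * (ic i k f * ic i l g)"
 obtain v where v: "\<And>l. (\<lambda>k. ?w k l) sums v l" "v sums (real (q i) ^ (f * g) * x i ^ (N i * (f + g)) * (rp (2 * int (N i)) / qinf))"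
  using pair_block[of "N i" f g] by blast
 have w: "w2 i k l * (ic i k f * ic i l g) = C * ?w k l" for k l by (simp add: w2_def m2_def C_def mult_ac)
 have nn: "w2 i k l * (ic i k f * ic i l g) \<ge> 0" for k l
  using w2_nonneg[OF i] inj_count_nonneg by (intro mult_nonneg_nonneg) auto
 have v0: "v l \<ge> 0" for l
 proof -
  have "?w k l \<ge> 0" for k
  proof -
   have "C * 0 \<le> C * ?w k l" using nn[of k l] unfolding w by (simp only: mult_zero_right)
   thus ?thesis by (rule mult_le_cancel_left_pos[OF C, THEN iffD1])
  qed
  thus ?thesis by (rule sums_le[OF _ sums_zero v(1)])
 qed
 have "(\<integral>\<^sup>+k. ennreal (w2 i k l * (ic i k f * ic i l g)) \<partial>count_space UNIV) = ennreal (C * v l)" for l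
  by (rule nn_integral_sums[OF nn]) (unfold w, intro sums_mult v)
 hence "(\<integral>\<^sup>+l. \<integral>\<^sup>+k. ennreal (w2 i k l * (ic i k f * ic i l g)) \<partial>count_space UNIV \<partial>count_space UNIV)
   = (\<integral>\<^sup>+l. ennreal (C * v l) \<partial>count_space UNIV)" by simp
 also have "\<dots> = ennreal (C * (real (q i) ^ (f * g) * x i ^ (N i * (f + g)) * (rp (2 * int (N i)) / qinf)))"
  using C v0 by (intro nn_integral_sums sums_mult v) auto
 also have "C * (real (q i) ^ (f * g) * x i ^ (N i * (f + g)) * (rp (2 * int (N i)) / qinf)) = m2 i f g"
 proof -
  have "C * (rp (2 * int (N i)) / qinf) = 1" using C qinf_pos unfolding C_def by (auto simp: field_simps)
  moreover have "C * (m2 i f g * Z) = m2 i f g * (C * Z)" for Z by (simp only: mult_ac)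
  ultimately show ?thesis unfolding m2_def by (simp only: mult_1_right)
 qed
 finally show ?thesis .
qed

lemma mass_moments:
 "(\<integral>\<^sup>+ e. ennreal (mass e) * ennreal (sur_prod e f) \<partial>count_space (multi I)) = ennreal (moment u f)"
proof -
 have nn: "w1 i k * ic i k l \<ge> 0" "w1 i k \<ge> 0" "ic i k l \<ge> 0" if "i \<in> S" for i k l
 proof -
  have i: "i \<in> I" using that by (simp add: S_def)
  interpret qseries "real (q i)" "x i" by (rule qx[OF i])
  show "w1 i k \<ge> 0" using P1_pos[OF that] x_bounds inj_count_nonneg by (auto simp: w1_def m1_def)
  thus "w1 i k * ic i k l \<ge> 0" "ic i k l \<ge> 0" using inj_count_nonneg by (auto intro: mult_nonneg_nonneg)
 qed
 have nn2: "w2 i k l \<ge> 0" "ic i k l \<ge> 0" if "i \<in> P" for i k l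
  using that SP(4) w2_nonneg qseries.inj_count_nonneg[OF qx] by auto
 have "ennreal (mass e) * ennreal (sur_prod e f) = (\<Prod>i\<in>S. ennreal (w1 i (e i) * ic i (e i) (f i)))
   * (\<Prod>i\<in>P. ennreal (w2 i (e i) (e (st i)) * (ic i (e i) (f i) * ic i (e (st i)) (f (st i)))))" for e
 proof -
  have "sur_prod e f = (\<Prod>i\<in>S. ic i (e i) (f i)) * (\<Prod>i\<in>P. ic i (e i) (f i) * ic i (e (st i)) (f (st i)))"
   unfolding sur_prod_def prod_I using SP(4) by (auto intro!: arg_cong2[of _ _ _ _ "(*)"] prod.cong simp: q_st)
  hence "mass e * sur_prod e f = (\<Prod>i\<in>S. w1 i (e i) * ic i (e i) (f i))
   * (\<Prod>i\<in>P. w2 i (e i) (e (st i)) * (ic i (e i) (f i) * ic i (e (st i)) (f (st i))))"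
   by (simp add: mass_def prod.distrib mult_ac)
  moreover have "mass e \<ge> 0" unfolding mass_def using nn nn2 by (intro mult_nonneg_nonneg prod_nonneg) auto
  moreover have "(\<Prod>i\<in>S. w1 i (e i) * ic i (e i) (f i)) \<ge> 0" using nn by (intro prod_nonneg) auto
  ultimately show ?thesis using nn nn2
   by (simp add: ennreal_mult'[symmetric] prod_ennreal ennreal_mult''[symmetric] prod_nonneg)
 qed
 hence "(\<integral>\<^sup>+ e. ennreal (mass e) * ennreal (sur_prod e f) \<partial>count_space (multi I))
   = (\<Prod>i\<in>S. ennreal (m1 i (f i))) * (\<Prod>i\<in>P. ennreal (m2 i (f i) (f (st i))))"
  using nn_integral_blocks[OF SP(2,1,9,6,7,8), of "\<lambda>i k. ennreal (w1 i k * ic i k (f i))"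
    "\<lambda>i k l. ennreal (w2 i k l * (ic i k (f i) * ic i l (f (st i))))"]
  by (simp add: w1_sum w2_sum SP(5))
 also have "\<dots> = ennreal (moment u f)"
  unfolding moment_eq by (subst (1 2) prod_ennreal) (auto simp: m1_def m2_def x_def ennreal_mult prod_nonneg)
 finally show ?thesis .
qed

definition \<nu>0 where "\<nu>0 = density (count_space (R_classes G p)) (\<lambda>C. ennreal (mass (the_inv_into (multi I) cls C)))"

lemma \<nu>0_mass: "f \<in> multi I \<Longrightarrow> emeasure \<nu>0 {cls f} = ennreal (mass f)"
 using bij_betw_apply[OF cls_bij, of f] the_inv_into_f_f[OF bij_betw_imp_inj_on[OF cls_bij], of f]
 by (simp add: \<nu>0_def emeasure_density)

theorem \<nu>0_moments: "has_moments G p u \<nu>0"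
 unfolding has_moments_iff
proof (intro conjI ballI)
 fix f :: "nat \<Rightarrow> nat"
 have "(\<integral>\<^sup>+ e. emeasure \<nu>0 {cls e} * ennreal (sur_prod e f) \<partial>count_space (multi I))
   = (\<integral>\<^sup>+ e. ennreal (mass e) * ennreal (sur_prod e f) \<partial>count_space (multi I))"
  by (intro nn_integral_cong) (simp add: \<nu>0_mass)
 thus "(\<integral>\<^sup>+ e. emeasure \<nu>0 {cls e} * ennreal (sur_prod e f) \<partial>count_space (multi I)) = ennreal (moment u f)"
  by (simp add: mass_moments)
qed (simp_all add: \<nu>0_def)

theorem unique_measure: "\<exists>!\<nu>. has_moments G p u \<nu>"
proof (rule ex1I[of _ \<nu>0], rule \<nu>0_moments)
 fix \<nu> assume \<nu>: "has_moments G p u \<nu>"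
 show "\<nu> = \<nu>0"
 proof (rule measure_eqI_countable[of _ "R_classes G p"])
  fix C assume "C \<in> R_classes G p"
  then obtain f where "f \<in> multi I" "C = cls f" using bij_betw_imp_surj_on[OF cls_bij] by blast
  thus "emeasure \<nu> {C} = emeasure \<nu>0 {C}" using unique_masses[OF \<nu> \<nu>0_moments] by simp
 qed (use \<nu> \<nu>0_moments in \<open>auto simp: has_moments_def countable_classes\<close>)
qed

lemma x_powr: "i \<in> I \<Longrightarrow> x i ^ m = real (q i) powr (- real m)"
 using q_real[of i] by (simp add: x_def powr_minus powr_realpow power_one_over inverse_eq_divide)

lemma qp_eq: "i \<in> I \<Longrightarrow> qseries.qp (x i) m = (\<Prod>l = 1..m. 1 - real (q i) powr (- real l))"
 by (simp add: qseries.qp_def[OF qx] x_powr[symmetric] prod.atLeast1_atMost_eq)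

lemma w1_eq:
 assumes "i \<in> S"
 shows "w1 i k = m1 i k / ic i k k
  * prodinf (\<lambda>l. inverse (1 + real (q i) powr (- real (u * n i) - (real_of_int (\<epsilon> i) + 1) / 2 - real l)))"
proof -
 have i: "i \<in> I" using assms by (simp add: S_def)
 interpret qseries "real (q i)" "x i" by (rule qx[OF i])
 have "real (q i) powr (- real (u * n i) - (real_of_int (\<epsilon> i) + 1) / 2 - real l) = (real (alt_c i) * x i ^ (N i + 1)) * x i ^ l" for l
  unfolding alt_c_powr[OF assms] x_powr[OF i] powr_add[symmetric]
  by (rule arg_cong[of _ _ "\<lambda>t. _ powr t"]) (simp add: N_def add_divide_distrib diff_divide_distrib)
 thus ?thesis unfolding w1_def P1_def by (simp only: prodinf_inverse[OF conv_prod] divide_inverse)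
qed

lemma w2_eq:
 assumes "i \<in> P" "\<bar>int k - int l\<bar> \<le> int (N i)"
 shows "w2 i k l = m2 i k l / (ic i k k * ic i l l) *
  (prodinf (\<lambda>l. 1 - real (q i) powr (- real (Suc l))) * (\<Prod>l = 1..2 * u * n i. 1 - real (q i) powr (- real l))
   / ((\<Prod>l = 1..u * n i + l - k. 1 - real (q i) powr (- real l)) * (\<Prod>l = 1..u * n i + k - l. 1 - real (q i) powr (- real l))))"
proof -
 have i: "i \<in> I" using assms by (simp add: P_def)
 interpret qseries "real (q i)" "x i" by (rule qx[OF i])
 have g: "int M - (int k - int l) = int (M + l - k)" "int M + (int k - int l) = int (M + k - l)"
  if "\<bar>int k - int l\<bar> \<le> int M" for M using that by auto
 note e = g[OF assms(2)]
 have e2: "2 * int (N i) = int (2 * u * n i)" by (simp add: N_def)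
 show ?thesis unfolding N_def[symmetric] w2_def e e2 rp_nat qp_eq[OF i] qinf_def x_powr[OF i] by (simp add: field_simps)
qed

text \<open>Outside the admissible range one of the two reciprocal Pochhammer symbols has a negative index.\<close>

lemma w2_zero:
 assumes "i \<in> P" "\<bar>int k - int l\<bar> > int (N i)"
 shows "w2 i k l = 0"
proof -
 have i: "i \<in> I" using assms by (simp add: P_def)
 have "int (N i) - (int k - int l) < 0 \<or> int (N i) + (int k - int l) < 0" using assms(2) by auto
 thus ?thesis by (auto simp: w2_def qseries.rp_neg[OF qx[OF i]])
qed

lemma dual_pair_iff: "i \<in> I \<Longrightarrow> j \<in> I \<Longrightarrow> dual_pair G (Fp p) (V i) (V j) \<longleftrightarrow> j = st i"
 unfolding dual_pair_def rep_iso_dual using st(3) paired_sym by auto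

lemma self_dual_S: "{i. i \<in> I \<and> self_dual G (Fp p) (V i)} = S"
 unfolding self_dual_def S_def using rep_iso_dual st(3) by auto

lemma prod_dual_pairs:
 "(\<Prod>(i, j) | i \<in> I \<and> j \<in> I \<and> i < j \<and> dual_pair G (Fp p) (V i) (V j). h i j) = (\<Prod>i\<in>P. h i (st i))"
proof -
 have "{(i, j). i \<in> I \<and> j \<in> I \<and> i < j \<and> dual_pair G (Fp p) (V i) (V j)} = (\<lambda>i. (i, st i)) ` P"
  using dual_pair_iff st(1) by (auto simp: P_def)
 thus ?thesis by (simp add: prod.reindex inj_on_def)
qed

lemma dual_pair_bound:
 "(\<forall>i\<in>I. \<forall>j\<in>I. dual_pair G (Fp p) (V i) (V j) \<longrightarrow> \<bar>int (f i) - int (f j)\<bar> \<le> int (u * n i))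
  \<longleftrightarrow> (\<forall>i\<in>P. \<bar>int (f i) - int (f (st i))\<bar> \<le> int (N i))" (is "?L \<longleftrightarrow> ?R")
proof
 assume ?L thus ?R using dual_pair_iff st(1) by (auto simp: P_def N_def)
next
 assume R: ?R
 show ?L
 proof (intro ballI impI)
  fix i j assume ij: "i \<in> I" "j \<in> I" "dual_pair G (Fp p) (V i) (V j)"
  hence j: "j = st i" using dual_pair_iff by blast
  have "i \<in> S \<or> i \<in> P \<or> st i \<in> P"
   using ij(1) st(1)[OF ij(1)] st_st[OF ij(1)] by (cases i "st i" rule: linorder_cases) (auto simp: S_def P_def)
  then consider "i \<in> S" | "i \<in> P" | "st i \<in> P" by blast
  thus "\<bar>int (f i) - int (f j)\<bar> \<le> int (u * n i)"
  proof cases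
   case 1 thus ?thesis by (simp add: j S_def)
  next
   case 2 thus ?thesis using R by (simp add: j N_def)
  next
   case 3
   hence "\<bar>int (f (st i)) - int (f (st (st i)))\<bar> \<le> int (N (st i))" using R by blast
   thus ?thesis using ij(1) by (simp add: j N_def n_st st_st abs_minus_commute)
  qed
 qed
qed

theorem mass_formula:
 assumes "has_moments G p u \<nu>"
 shows "emeasure \<nu> {iso_class G p (W f)} =
  (if \<forall>i\<in>I. \<forall>j\<in>I. dual_pair G (Fp p) (V i) (V j) \<longrightarrow> \<bar>int (f i) - int (f j)\<bar> \<le> int (u * n i)
   then ennreal (
    real (card (rep_invariants G (exterior_square (Fp p) (W f))))
     / (real (card (carrier (W f))) ^ u * real (card (rep_Aut G (Fp p) (W f))))
    * (\<Prod>i | i \<in> I \<and> self_dual G (Fp p) (V i).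
      prodinf (\<lambda>l. inverse (1 + real (q i) powr (- real (u * n i) - (real_of_int (\<epsilon> i) + 1) / 2 - real l))))
    * (\<Prod>(i, j) | i \<in> I \<and> j \<in> I \<and> i < j \<and> dual_pair G (Fp p) (V i) (V j).
      prodinf (\<lambda>l. 1 - real (q i) powr (- real (Suc l)))
       * (\<Prod>l = 1..2 * u * n i. 1 - real (q i) powr (- real l))
      / ((\<Prod>l = 1..u * n i + f j - f i. 1 - real (q i) powr (- real l))
        * (\<Prod>l = 1..u * n i + f i - f j. 1 - real (q i) powr (- real l)))))
   else 0)"
proof -
 have "emeasure \<nu> {iso_class G p (W f)} = emeasure \<nu> {cls (restrict f I)}"
  by (simp add: cls_def W_restrict)
 also have "\<dots> = ennreal (mass (restrict f I))"
  using unique_masses[OF assms \<nu>0_moments, of "restrict f I"] \<nu>0_mass[of "restrict f I"] by simp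
 also have "mass (restrict f I) = mass f"
  unfolding mass_def using SP(3,4) st(1) by (intro arg_cong2[of _ _ _ _ "(*)"] prod.cong) auto
 finally have e: "emeasure \<nu> {iso_class G p (W f)} = ennreal (mass f)" .
 show ?thesis
 proof (cases "\<forall>i\<in>P. \<bar>int (f i) - int (f (st i))\<bar> \<le> int (N i)")
  case True
  have "real (card (rep_Aut G (Fp p) (W f))) = (\<Prod>i\<in>S. ic i (f i) (f i)) * (\<Prod>i\<in>P. ic i (f i) (f i) * ic i (f (st i)) (f (st i)))"
   unfolding rep_Aut_W card_sur_W prod_I using SP(4) by (auto intro!: arg_cong2[of _ _ _ _ "(*)"] prod.cong simp: q_st)
  hence A: "real (card (rep_invariants G (exterior_square (Fp p) (W f)))) / (real (card (carrier (W f))) ^ u * real (card (rep_Aut G (Fp p) (W f))))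
   = (\<Prod>i\<in>S. m1 i (f i) / ic i (f i) (f i)) * (\<Prod>i\<in>P. m2 i (f i) (f (st i)) / (ic i (f i) (f i) * ic i (f (st i)) (f (st i))))"
   using moment_eq[of f] by (simp add: moment_def card_invariants_exterior_square[OF W_rep W_sm finite_G coprime_G] prod_dividef
    divide_divide_eq_left[symmetric] del: divide_divide_eq_left) (simp add: prod.distrib)
  show ?thesis unfolding e dual_pair_bound prod_dual_pairs self_dual_S A mass_def
   using True by (simp add: w1_eq w2_eq prod.distrib mult_ac del: times_divide_eq_right times_divide_eq_left)
 next
  case False
  then obtain i where "i \<in> P" "w2 i (f i) (f (st i)) = 0" using w2_zero by (meson not_le)
  hence m: "mass f = 0" unfolding mass_def using SP(2) by auto
  show ?thesis unfolding e dual_pair_bound by (simp only: False if_False m ennreal_0)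
 qed
qed

end

theorem theorem1p2:
  fixes G :: "('g, 'm) monoid_scheme"
    and p c u :: nat
    and V :: "nat \<Rightarrow> (int, nat, 'g) rep"
    and \<kappa> :: "nat \<Rightarrow> (nat \<Rightarrow> nat) ring"
    and q n :: "nat \<Rightarrow> nat"
    and \<epsilon> :: "nat \<Rightarrow> int"
  assumes "group G" and "finite (carrier G)"
    and "Factorial_Ring.prime p" and "\<not> p dvd order G"
    and "\<forall>i\<in>{1..c}. irreducible_rep G (Fp p) (V i) \<and> \<not> trivial_action G (V i)"
    and "\<forall>i\<in>{1..c}. \<forall>j\<in>{1..c}. i \<noteq> j \<longrightarrow> \<not> rep_iso G (Fp p) (V i) (V j)"
    and "\<forall>W :: (int, nat, 'g) rep. irreducible_rep G (Fp p) W \<and> \<not> trivial_action G W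
           \<longrightarrow> (\<exists>i\<in>{1..c}. rep_iso G (Fp p) W (V i))"
    and "\<forall>i\<in>{1..c}. \<kappa> i = End_rep G (Fp p) (V i)"
    and "\<forall>i\<in>{1..c}. q i = card (carrier (\<kappa> i))"
    and "\<forall>i\<in>{1..c}. n i = vectorspace.dim (\<kappa> i) (rep_over_End (V i))"
    and "\<forall>i\<in>{1..c}. \<epsilon> i = rep_sign G (Fp p) (V i)"
    and "u > 0"
  shows "(\<exists>!\<nu>. has_moments G p u \<nu>) \<and>
    (\<forall>\<nu>. has_moments G p u \<nu> \<longrightarrow>
      (\<forall>f :: nat \<Rightarrow> nat.
        let W = rep_prod {(i, k). i \<in> {1..c} \<and> k < f i} (\<lambda>(i, k). V i) in
        emeasure \<nu> {iso_class G p W} =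
        (if \<forall>i\<in>{1..c}. \<forall>j\<in>{1..c}. dual_pair G (Fp p) (V i) (V j) \<longrightarrow>
              \<bar>int (f i) - int (f j)\<bar> \<le> int (u * n i)
         then ennreal (
           real (card (rep_invariants G (exterior_square (Fp p) W)))
             / (real (card (carrier W)) ^ u * real (card (rep_Aut G (Fp p) W)))
           * (\<Prod>i | i \<in> {1..c} \<and> self_dual G (Fp p) (V i).
                prodinf (\<lambda>l. inverse (1 + real (q i) powr
                     (- real (u * n i) - (real_of_int (\<epsilon> i) + 1) / 2 - real l))))
           * (\<Prod>(i, j) | i \<in> {1..c} \<and> j \<in> {1..c} \<and> i < j \<and> dual_pair G (Fp p) (V i) (V j).
                prodinf (\<lambda>l. 1 - real (q i) powr (- real (Suc l)))
                  * (\<Prod>l = 1..2 * u * n i. 1 - real (q i) powr (- real l))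
                / ((\<Prod>l = 1..u * n i + f j - f i. 1 - real (q i) powr (- real l))
                   * (\<Prod>l = 1..u * n i + f i - f j. 1 - real (q i) powr (- real l)))))
         else 0)))"
proof -
 interpret R: irreducibles G p "{1..c}" V
  using assms(1-7) by (intro irreducibles.intro) (auto simp: order_def)
 have q: "q i = R.q i" if "i \<in> {1..c}" for i
  using that assms(8,9) by (simp add: End_rep_carrier[OF R.rep R.sm] R.q_def)
 interpret R: moment_problem G p "{1..c}" V u n \<epsilon>
 proof unfold_locales
  fix i assume i: "i \<in> {1..c}"
  show "card (carrier (V i)) = R.q i ^ n i"
   using card_End_dim[OF R.irr R.sm, OF i i] assms(8,10) i by (simp add: R.q_def)
 qed (use assms(11,12) in auto)
 show ?thesis
 proof (intro conjI allI impI)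
  show "\<exists>!\<nu>. has_moments G p u \<nu>" by (rule R.unique_measure)
 qed (unfold Let_def R.W_def[symmetric], subst R.mass_formula, assumption,
  intro if_cong refl arg_cong[of _ _ ennreal] arg_cong2[of _ _ _ _ "(*)"] prod.cong; clarify?; simp only: q)
qed

end
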